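(* Let $N\ge2$, let $b^-<b^+$ be real constants, let $\Omega=\{x\in\mathbb{R}^N : b^-<x_N<b^+\}$ and $\Gamma^\pm=\{x\in\mathbb{R}^N : x_N=b^\pm\}$. Let $a>0$, $1<p<\infty$, $g\in L^{p'}(\Omega;\mathbb{R}^N)$ (with $1/p+1/p'=1$), and $f^\pm\in L^1_{\mathrm{loc}}(\mathbb{R}^{N-1})$. Then the Dirichlet problem $$\begin{cases}-\operatorname{div}(|\nabla u|^{p-2}\nabla u)=\operatorname{div}g&\text{in }\Omega,\\ u=f^\pm&\text{on }\Gamma^\pm\end{cases}$$ admits a solution in $\dot{W}^{1,p}(\Omega)$ if and only if $$\int_{\mathbb{R}^{N-1}}|f^+(x')-f^-(x')|^p\,dx'<\infty,\qquad|f^-|_{\tilde{W}^{1-1/p,p}_{(a)}(\mathbb{R}^{N-1})}<\infty,\qquad|f^+|_{\tilde{W}^{1-1/p,p}_{(a)}(\mathbb{R}^{N-1})}<\infty.$$ In either case, there exists a constant $c=c(a,N,p)>0$ such that $$\int_\Omega|\nabla u(x)|^p\,dx\le c\int_\Omega|g(x)|^{p'}\,dx+c\int_{\mathbb{R}^{N-1}}|f^+(x')-f^-(x')|^p\,dx'+c|f^-|^p_{\tilde{W}^{1-1/p,p}_{(a)}(\mathbb{R}^{N-1})}+c|f^+|^p_{\tilde{W}^{1-1/p,p}_{(a)}(\mathbb{R}^{N-1})}.$$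
   Context: Points are written $x=(x',x_N)\in\mathbb{R}^{N-1}\times\mathbb{R}$. $\dot{W}^{1,p}(\Omega)$ is the space of real-valued $u\in L^1_{\mathrm{loc}}(\Omega)$ whose first-order weak derivatives all belong to $L^p(\Omega)$. $\operatorname{Tr}:\dot{W}^{1,p}(\Omega)\to L^p_{\mathrm{loc}}(\partial\Omega)$ is the usual Sobolev boundary trace ($u\in W^{1,p}$ on bounded Lipschitz subdomains of $\Omega$). Functions on $\Gamma^\pm$ are identified with functions of $x'\in\mathbb{R}^{N-1}$. Solutions are understood in the weak sense: a solution of the Dirichlet problem in $\dot W^{1,p}(\Omega)$ is a $u\in\dot{W}^{1,p}(\Omega)$ with $\operatorname{Tr}(u)=f^\pm$ on $\Gamma^\pm$ and $\int_\Omega(|\nabla u|^{p-2}\nabla u+g)\cdot\nabla v\,dx=0$ for every $v\in\dot{W}^{1,p}(\Omega)$ with $\operatorname{Tr}(v)=0$ on $\Gamma^\pm$. For a constant $a>0$ and $f\in L^1_{\mathrm{loc}}(\mathbb{R}^{N-1})$, with $B'(0,a)$ the open ball in $\mathbb{R}^{N-1}$ with center $0$ and radius $a$, $$|f|_{\tilde{W}^{1-1/p,p}_{(a)}(\mathbb{R}^{N-1})}:=\left(\int_{\mathbb{R}^{N-1}}\int_{B'(0,a)}\frac{|f(x'+h')-f(x')|^p}{|h'|^{p+N-2}}\,dh'\,dx'\right)^{1/p}.$$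
   Formalization: The constant c may depend on b^- and b^+ as well as on a, N, p; a c(a,N,p) uniform in the width is impossible: with g=0, f^-=0, f^+=φ≠0 smooth compactly supported, the left side is at least (b^+-b^-)^{1-p}∫|φ|^p, unbounded as the width tends to 0. *)

theory Defs
  imports "HOL-Analysis.Analysis"
begin

text \<open>
  A point \<open>x = (x', x\<^sub>N)\<close> of \<open>\<real>\<^sup>N\<close> is an element of \<open>(real^'n) \<times> real\<close>, which carries the Euclidean
  norm and Lebesgue measure of \<open>\<real>\<^sup>N\<close>, with \<open>N = CARD('n) + 1 \<ge> 2\<close>. Functions on a set are total
  functions of which only the values on that set (up to null sets) are used.
\<close>

definition strip :: "real \<Rightarrow> real \<Rightarrow> ((real^'n) \<times> real) set" where
  "strip bm bp = {x. bm < snd x \<and> snd x < bp}"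

definition L1loc_on :: "'a::euclidean_space set \<Rightarrow> ('a \<Rightarrow> real) \<Rightarrow> bool" where
  "L1loc_on S u \<longleftrightarrow> (\<forall>K. compact K \<and> K \<subseteq> S \<longrightarrow> u absolutely_integrable_on K)"

definition Lp_on :: "real \<Rightarrow> 'a::euclidean_space set \<Rightarrow> ('a \<Rightarrow> 'b::euclidean_space) \<Rightarrow> bool" where
  "Lp_on p S u \<longleftrightarrow> u \<in> borel_measurable (lebesgue_on S) \<and>
     (\<integral>\<^sup>+x\<in>S. ennreal (norm (u x) powr p) \<partial>lebesgue) < \<infinity>"

definition partial_deriv :: "'a::euclidean_space \<Rightarrow> ('a \<Rightarrow> real) \<Rightarrow> 'a \<Rightarrow> real" where
  "partial_deriv i f x = frechet_derivative f (at x) i"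

definition grad :: "('a::euclidean_space \<Rightarrow> real) \<Rightarrow> 'a \<Rightarrow> 'a" where
  "grad f x = (\<Sum>i\<in>Basis. partial_deriv i f x *\<^sub>R i)"

primrec Ck :: "nat \<Rightarrow> ('a::euclidean_space \<Rightarrow> real) \<Rightarrow> bool" where
  "Ck 0 f \<longleftrightarrow> continuous_on UNIV f"
| "Ck (Suc k) f \<longleftrightarrow> (\<forall>x. f differentiable (at x)) \<and> (\<forall>i\<in>Basis. Ck k (partial_deriv i f))"

definition Cinf :: "('a::euclidean_space \<Rightarrow> real) \<Rightarrow> bool" where
  "Cinf f \<longleftrightarrow> (\<forall>k. Ck k f)"

definition test_function :: "'a::euclidean_space set \<Rightarrow> ('a \<Rightarrow> real) \<Rightarrow> bool" where
  "test_function S \<phi> \<longleftrightarrow> Cinf \<phi> \<and> compact (closure {x. \<phi> x \<noteq> 0}) \<and> closure {x. \<phi> x \<noteq> 0} \<subseteq> S"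

definition has_weak_partial ::
    "'a::euclidean_space set \<Rightarrow> 'a \<Rightarrow> ('a \<Rightarrow> real) \<Rightarrow> ('a \<Rightarrow> real) \<Rightarrow> bool" where
  "has_weak_partial S i u w \<longleftrightarrow> L1loc_on S u \<and> L1loc_on S w \<and>
     (\<forall>\<phi>. test_function S \<phi> \<longrightarrow>
        (LINT x:S|lebesgue. u x * partial_deriv i \<phi> x) = - (LINT x:S|lebesgue. w x * \<phi> x))"

text \<open>The weak derivatives of \<open>u\<close> on an open set are unique up to null sets; a representative is chosen.\<close>

definition weak_partial :: "'a::euclidean_space set \<Rightarrow> 'a \<Rightarrow> ('a \<Rightarrow> real) \<Rightarrow> 'a \<Rightarrow> real" where
  "weak_partial S i u = (SOME w. has_weak_partial S i u w)"

definition weak_grad :: "'a::euclidean_space set \<Rightarrow> ('a \<Rightarrow> real) \<Rightarrow> 'a \<Rightarrow> 'a" where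
  "weak_grad S u x = (\<Sum>i\<in>Basis. weak_partial S i u x *\<^sub>R i)"

definition hom_sobolev :: "real \<Rightarrow> 'a::euclidean_space set \<Rightarrow> ('a \<Rightarrow> real) set" where
  "hom_sobolev p S =
     {u. L1loc_on S u \<and> (\<forall>i\<in>Basis. \<exists>w. has_weak_partial S i u w \<and> Lp_on p S w)}"

text \<open>
  \<open>has_trace p bm bp t u f\<close>, for \<open>t \<in> {bm, bp}\<close>: the trace of \<open>u\<close> on the hyperplane \<open>x\<^sub>N = t\<close> is \<open>f\<close>.
  On each bounded Lipschitz cylinder \<open>Q = B'(0,R) \<times> (bm,bp)\<close>, the trace is the continuous extension
  of the restriction of smooth functions: \<open>f\<close> is the \<open>L\<^sup>p\<close>-limit on \<open>B'(0,R) \<times> {t}\<close> of functions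
  in \<open>C\<^sup>\<infinity>(closure Q)\<close> that converge to \<open>u\<close> in \<open>W\<^sup>1\<^sup>,\<^sup>p(Q)\<close>.
\<close>

definition has_trace ::
    "real \<Rightarrow> real \<Rightarrow> real \<Rightarrow> real \<Rightarrow> ((real^'n) \<times> real \<Rightarrow> real) \<Rightarrow> (real^'n \<Rightarrow> real) \<Rightarrow> bool" where
  "has_trace p bm bp t u f \<longleftrightarrow>
     (\<forall>R>0. Lp_on p (ball 0 R) f \<and>
       (\<exists>\<phi> :: nat \<Rightarrow> (real^'n) \<times> real \<Rightarrow> real. (\<forall>n. Cinf (\<phi> n)) \<and>
          (\<lambda>n. \<integral>\<^sup>+x\<in>ball 0 R \<times> {bm<..<bp}. ennreal (\<bar>\<phi> n x - u x\<bar> powr p) \<partial>lebesgue)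
            \<longlonglongrightarrow> 0 \<and>
          (\<lambda>n. \<integral>\<^sup>+x\<in>ball 0 R \<times> {bm<..<bp}.
                 ennreal (norm (grad (\<phi> n) x - weak_grad (strip bm bp) u x) powr p) \<partial>lebesgue)
            \<longlonglongrightarrow> 0 \<and>
          (\<lambda>n. \<integral>\<^sup>+y\<in>ball 0 R. ennreal (\<bar>\<phi> n (y, t) - f y\<bar> powr p) \<partial>lebesgue) \<longlonglongrightarrow> 0))"

text \<open>Since \<open>0 powr r = 0\<close> for every \<open>r\<close>, the value at \<open>z = 0\<close> is \<open>0\<close> for all \<open>p > 1\<close>, as usual.\<close>

definition p_flux :: "real \<Rightarrow> 'a::euclidean_space \<Rightarrow> 'a" where
  "p_flux p z = (norm z powr (p - 2)) *\<^sub>R z"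

definition dirichlet_solution ::
    "real \<Rightarrow> real \<Rightarrow> real \<Rightarrow> ((real^'n) \<times> real \<Rightarrow> (real^'n) \<times> real) \<Rightarrow>
     (real^'n \<Rightarrow> real) \<Rightarrow> (real^'n \<Rightarrow> real) \<Rightarrow> ((real^'n) \<times> real \<Rightarrow> real) \<Rightarrow> bool" where
  "dirichlet_solution p bm bp g fm fp u \<longleftrightarrow>
     u \<in> hom_sobolev p (strip bm bp) \<and>
     has_trace p bm bp bm u fm \<and> has_trace p bm bp bp u fp \<and>
     (\<forall>v \<in> hom_sobolev p (strip bm bp).
        has_trace p bm bp bm v (\<lambda>_. 0) \<and> has_trace p bm bp bp v (\<lambda>_. 0) \<longrightarrow>
        (LINT x:strip bm bp|lebesgue.
           (p_flux p (weak_grad (strip bm bp) u x) + g x) \<bullet> weak_grad (strip bm bp) v x) = 0)"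

text \<open>Real powers, for positive exponents, of extended nonnegative reals.\<close>

definition ennreal_powr :: "ennreal \<Rightarrow> real \<Rightarrow> ennreal" where
  "ennreal_powr x r = (if x = \<infinity> then \<infinity> else ennreal (enn2real x powr r))"

definition tilde_seminorm :: "real \<Rightarrow> real \<Rightarrow> (real^'n \<Rightarrow> real) \<Rightarrow> ennreal" where
  "tilde_seminorm a p f = ennreal_powr
     (\<integral>\<^sup>+x. (\<integral>\<^sup>+h\<in>ball 0 a. ennreal (\<bar>f (x + h) - f x\<bar> powr p /
              norm h powr (p + real DIM((real^'n) \<times> real) - 2)) \<partial>lebesgue) \<partial>lebesgue)
     (1 / p)"

end

theory Submission
 imports Defs
begin

text \<open>
 By uniform convexity, a minimising sequence of \<open>\<integral> \<bar>\<nabla>u\<bar>\<^sup>p / p + g \<bullet> \<nabla>u\<close> among the functions with traces \<open>f\<^sup>-\<close> and \<open>f\<^sup>+\<close>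
 has gradients that are Cauchy in \<open>L\<^sup>p\<close>, and the Poincare inequality on the strip keeps the limit in the class.
 So the problem is solvable as soon as some \<open>w\<close> has these traces, and testing with \<open>u - w\<close> bounds \<open>\<nabla>u\<close> by \<open>g\<close> and \<open>\<nabla>w\<close>.
 Such a \<open>w\<close> interpolates linearly in \<open>x\<^sub>N\<close> between smooth averages of \<open>f\<^sup>-\<close> and \<open>f\<^sup>+\<close>, taken over balls of radius
 proportional to the distance from the respective face; the strip has finite width, hence only radii below \<open>a\<close> occur,
 and the slope of the interpolation is controlled by \<open>f\<^sup>+ - f\<^sup>-\<close>. Conversely, \<open>f\<^sup>+ - f\<^sup>-\<close> is bounded by integrating
 \<open>\<nabla>u\<close> along vertical segments, and \<open>f(x' + h') - f(x')\<close> by integrating it along two segments that meet at a height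
 proportional to \<open>\<bar>h'\<bar>\<close>.
\<close>

subsection \<open>Calculus of \<open>C\<^sup>k\<close> functions\<close>

text \<open>Three obstacles shape the proof. Traces are limits of functions smooth on the whole
  space, so an extension of the data must be approximated up to the boundary. This is done by
  shifting the averages inwards, and they are therefore controlled up to height
  \<open>2 * L\<close>, although the strip has height \<open>L = bp - bm\<close>; the choice
  \<open>\<kappa> = a / (3 * L)\<close> keeps all averaging radii used there below \<open>a\<close>.
  Next, a function of the homogeneous space need not lie in \<open>L\<^sup>p\<close> of the strip,
  so limits are taken only among functions with zero trace, to which the Poincare inequality
  applies, and the data enter through one fixed function \<open>w\<close>. Last, the data are only
  Lebesgue measurable, whereas product measures and changes of variables are handled for Borel
  functions; the data are replaced by Borel versions, and the result is carried back by equality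
  almost everywhere. Norms appear only through their p-th powers in \<open>ennreal\<close>, so that
  inequalities can be stated before finiteness is known; the triangle inequality then costs a factor
  \<open>2 powr p\<close>.\<close>

lemma sum_inner_Basis_mult:
 fixes g :: "'a::euclidean_space => real"
 assumes "i \<in> Basis" shows "(\<Sum>j\<in>Basis. (i \<bullet> j) * g j) = g i"
proof -
 have "(\<Sum>j\<in>Basis. (i \<bullet> j) * g j) = (\<Sum>j\<in>Basis. if j = i then g i else 0)" using assms by (intro sum.cong) (auto simp: inner_Basis)
 then show ?thesis using assms by simp
qed

lemma partial_deriv_eq:
 "(f has_derivative f') (at x) ==> partial_deriv i f x = f' i"
 unfolding partial_deriv_def by (simp add: frechet_derivative_at[symmetric])

lemma has_derivative_partial:
 assumes "f differentiable (at x)"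
 shows "(f has_derivative (%h. \<Sum>i\<in>Basis. (h \<bullet> i) * partial_deriv i f x)) (at x)"
proof -
 have d: "(f has_derivative frechet_derivative f (at x)) (at x)" using assms frechet_derivative_works by blast
 then have l: "linear (frechet_derivative f (at x))" by (rule has_derivative_linear)
 have "frechet_derivative f (at x) h = (\<Sum>i\<in>Basis. (h \<bullet> i) * partial_deriv i f x)" for h
 proof -
  have "frechet_derivative f (at x) (\<Sum>i\<in>Basis. (h \<bullet> i) *\<^sub>R i)
    = (\<Sum>i\<in>Basis. (h \<bullet> i) * frechet_derivative f (at x) i)" using l by (simp add: linear_sum linear_cmul o_def)
  then show ?thesis by (simp add: euclidean_representation partial_deriv_def)
 qed
 then have "frechet_derivative f (at x) = (%h. \<Sum>i\<in>Basis. (h \<bullet> i) * partial_deriv i f x)" by (rule ext)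
 then show ?thesis using d by simp
qed

lemma has_derivative_grad:
 assumes "f differentiable (at x)"
 shows "(f has_derivative (%h. grad f x \<bullet> h)) (at x)"
proof -
 have "(%h. \<Sum>i\<in>Basis. (h \<bullet> i) * partial_deriv i f x) = (%h. grad f x \<bullet> h)"
  unfolding grad_def by (auto simp add: inner_sum_right inner_commute mult.commute)
 then show ?thesis using has_derivative_partial[OF assms] by simp
qed

lemma grad_inner_Basis: "i \<in> Basis ==> grad f x \<bullet> i = partial_deriv i f x" unfolding grad_def by (simp add: inner_sum_left_Basis)

lemma Ck_SucD: "Ck (Suc k) f ==> Ck k f"
proof (induction k arbitrary: f)
 case 0
 then show ?case by (auto intro!: continuous_at_imp_continuous_on differentiable_imp_continuous_within)
qed auto

lemma Ck_continuous: "Ck k f ==> continuous_on UNIV f" by (induction k) (use Ck_SucD in "auto simp del: Ck.simps(2)")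

text \<open>A derivative known in any form is enough: only its values on the basis have to be of
  class \<open>Ck k\<close>. The closure rules below thus never unfold
  \<open>frechet_derivative\<close>.\<close>

lemma Ck_SucI:
 assumes "\<And>x. (f has_derivative f' x) (at x)" "\<And>i. i \<in> Basis ==> Ck k (%x. f' x i)"
 shows "Ck (Suc k) f"
proof -
 have "partial_deriv i f = (%x. f' x i)" for i using assms(1) partial_deriv_eq by blast
 then show ?thesis using assms by (auto simp: differentiable_def)
qed

lemma Ck_SucE:
 assumes "Ck (Suc k) f"
 shows "(f has_derivative (%h. \<Sum>i\<in>Basis. (h \<bullet> i) * partial_deriv i f x)) (at x)"
  "i \<in> Basis ==> Ck k (partial_deriv i f)" using assms has_derivative_partial[of f x] by auto

lemma Ck_const [intro]: "Ck k (%_. c)"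
proof (induction k arbitrary: c)
 case (Suc k)
 show ?case by (rule Ck_SucI[where f' = "%_ _. 0"]) (auto intro: Suc)
qed auto

lemma Ck_bounded_linear:
 assumes "bounded_linear f" shows "Ck k f"
proof (cases k)
 case 0
 then show ?thesis using assms by (simp add: linear_continuous_on)
next
 case (Suc j)
 show ?thesis unfolding Suc by (rule Ck_SucI[where f' = "%_. f"]) (auto intro: assms bounded_linear_imp_has_derivative)
qed

lemma Ck_add [intro]: "Ck k f ==> Ck k g ==> Ck k (%x. f x + g x)"
proof (induction k arbitrary: f g)
 case 0 then show ?case by (auto intro: continuous_on_add)
next
 case (Suc k)
 note d = Ck_SucE(1)[OF Suc.prems(1)] Ck_SucE(1)[OF Suc.prems(2)]
 show ?case by (rule Ck_SucI, rule has_derivative_add[OF d])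
   (use Suc.IH Suc.prems in "auto simp: sum_inner_Basis_mult")
qed

lemma Ck_mult [intro]: "Ck k f ==> Ck k g ==> Ck k (%x. f x * g x)"
proof (induction k arbitrary: f g)
 case 0 then show ?case by (auto intro: continuous_on_mult)
next
 case (Suc k)
 note d = Ck_SucE(1)[OF Suc.prems(1)] Ck_SucE(1)[OF Suc.prems(2)]
 show ?case
 proof (rule Ck_SucI, rule has_derivative_mult[OF d])
  fix i :: 'a assume i: "i \<in> Basis"
  have "Ck k f" "Ck k g" using Suc.prems Ck_SucD by auto
  then show "Ck k (%x. f x * (\<Sum>j\<in>Basis. i \<bullet> j * partial_deriv j g x)
    + (\<Sum>j\<in>Basis. i \<bullet> j * partial_deriv j f x) * g x)" using Suc.prems i
   by (intro Ck_add Suc.IH) (auto simp: sum_inner_Basis_mult)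
 qed
qed

lemma Ck_cmult [intro]: "Ck k f ==> Ck k (%x. c * f x)" by (rule Ck_mult) auto

lemma Ck_uminus [intro]: "Ck k f ==> Ck k (%x. - f x)" using Ck_cmult[of k f "-1"] by simp

lemma Ck_diff [intro]: "Ck k f ==> Ck k g ==> Ck k (%x. f x - g x)" using Ck_add[OF _ Ck_uminus, of k f g] by simp

lemma Ck_sum [intro]: "(\<And>i. i \<in> I ==> Ck k (f i)) ==> Ck k (%x. \<Sum>i\<in>I. f i x)" by (induction I rule: infinite_finite_induct) auto

lemma Ck_prod [intro]: "(\<And>i. i \<in> I ==> Ck k (f i)) ==> Ck k (%x. \<Prod>i\<in>I. f i x)" by (induction I rule: infinite_finite_induct) auto

lemma Ck_power [intro]: "Ck k f ==> Ck k (%x. f x ^ m)" by (induction m) auto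

text \<open>Only \<open>f\<close> is generalised in the induction: the chain rule yields partial
  derivatives of \<open>f\<close> composed with the same \<open>G\<close>. Smoothness of
  \<open>G\<close> is expressed by its components because \<open>Ck\<close> speaks of real-valued
  functions.\<close>

lemma Ck_compose:
 assumes "Ck k f" "\<And>j. j \<in> Basis ==> Ck k (%x. G x \<bullet> j)"
 shows "Ck k (%x. f (G x))" using assms
proof (induction k arbitrary: f)
 case 0
 have "continuous_on UNIV G" using 0(2) by (subst continuous_on_componentwise) simp
 then show ?case using continuous_on_compose2[OF 0(1)[unfolded Ck.simps(1)], of UNIV G] by simp
next
 case (Suc k)
 let ?G' = "%x h. \<Sum>j\<in>Basis. (\<Sum>i\<in>Basis. (h \<bullet> i) * partial_deriv i (%x. G x \<bullet> j) x) *\<^sub>R j"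
 have "((%x. \<Sum>j\<in>Basis. (G x \<bullet> j) *\<^sub>R j) has_derivative ?G' x) (at x)" for x
  by (rule has_derivative_sum, rule has_derivative_scaleR_left, rule Ck_SucE(1)[OF Suc.prems(2)])
 then have G: "(G has_derivative ?G' x) (at x)" for x by (simp add: euclidean_representation)
 note d = diff_chain_at[OF G Ck_SucE(1)[OF Suc.prems(1)]]
 have 1: "Ck k (%x. partial_deriv j f (G x))" if "j \<in> Basis" for j
 proof (rule Suc.IH)
  show "Ck k (partial_deriv j f)" using Suc.prems(1) that by simp
 qed (rule Ck_SucD, rule Suc.prems(2))
 have 2: "Ck k (partial_deriv i (%x. G x \<bullet> j))" if "i \<in> Basis" "j \<in> Basis" for i j using Suc.prems(2) that by auto
 show ?case
 proof (rule Ck_SucI[OF d[unfolded o_def]])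
  fix i :: 'b assume i: "i \<in> Basis"
  show "Ck k (%x. \<Sum>ia\<in>Basis. ?G' x i \<bullet> ia * partial_deriv ia f (G x))" using i by (intro Ck_sum Ck_mult 1)
    (simp_all only: inner_sum_left_Basis sum_inner_Basis_mult 2)
 qed
qed

text \<open>The derivative of \<open>1 / f\<close> is a product of \<open>1 / f\<close>, twice, with
  a derivative of \<open>f\<close>; one degree lower, \<open>1 / f\<close> is covered by the
  induction hypothesis.\<close>

lemma Ck_inverse:
 assumes "Ck k f" "\<And>x. f x \<noteq> 0"
 shows "Ck k (%x. inverse (f x))" using assms
proof (induction k)
 case 0 then show ?case by (auto intro: continuous_on_inverse)
next
 case (Suc k)
 show ?case
 proof (rule Ck_SucI, rule Deriv.has_derivative_inverse[OF Suc.prems(2) Ck_SucE(1)[OF Suc.prems(1)]])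
  fix i :: 'a assume i: "i \<in> Basis"
  have "Ck k (%x. inverse (f x))" using Suc Ck_SucD by auto
  then show "Ck k (%x. - (inverse (f x) * (\<Sum>ia\<in>Basis. i \<bullet> ia * partial_deriv ia f x) * inverse (f x)))" using i Suc.prems
   by (intro Ck_uminus Ck_mult Ck_sum) (auto)
 qed
qed

lemma Cinf_continuous: "Cinf f ==> continuous_on UNIV f" unfolding Cinf_def using Ck_continuous by blast

lemma Cinf_differentiable: "Cinf f ==> f differentiable (at x)" unfolding Cinf_def using Ck.simps(2) by blast

lemma Cinf_partial: "Cinf f ==> i \<in> Basis ==> Cinf (partial_deriv i f)" unfolding Cinf_def using Ck.simps(2) by blast

lemma Cinf_const [intro]: "Cinf (%_. c)"
 and Cinf_add [intro]: "Cinf f ==> Cinf g ==> Cinf (%x. f x + g x)"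
 and Cinf_diff [intro]: "Cinf f ==> Cinf g ==> Cinf (%x. f x - g x)"
 and Cinf_mult [intro]: "Cinf f ==> Cinf g ==> Cinf (%x. f x * g x)"
 and Cinf_power [intro]: "Cinf f ==> Cinf (%x. f x ^ m)"
 and Cinf_sum [intro]: "(\<And>i. i \<in> I ==> Cinf (F i)) ==> Cinf (%x. \<Sum>i\<in>I. F i x)"
 and Cinf_prod [intro]: "(\<And>i. i \<in> I ==> Cinf (F i)) ==> Cinf (%x. \<Prod>i\<in>I. F i x)"
 and Cinf_inverse: "Cinf f ==> (\<And>x. f x \<noteq> 0) ==> Cinf (%x. inverse (f x))"
 and Cinf_bounded_linear: "bounded_linear f ==> Cinf f"
 for f g :: "'a::euclidean_space => real" and F :: "'b => 'a => real"
 unfolding Cinf_def by (auto intro: Ck_inverse Ck_bounded_linear)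

lemma Cinf_compose:
 "Cinf f ==> (\<And>j. j \<in> Basis ==> Cinf (%x. G x \<bullet> j)) ==> Cinf (%x. f (G x))" unfolding Cinf_def by (auto intro: Ck_compose)

lemma Cinf_compose_real: "Cinf f ==> Cinf G ==> Cinf (%x. f (G x :: real))" by (rule Cinf_compose) auto

lemma Cinf_inner [intro]: "Cinf (%x. x \<bullet> i)" by (rule Cinf_bounded_linear) (rule bounded_linear_inner_left)

text \<open>\<open>partial_deriv\<close> accepts any direction, not only basis vectors, so as a
  function of the direction it is the whole derivative.\<close>

lemma Cinf_has_derivative:
 "Cinf f ==> (f has_derivative (%h. partial_deriv h f x)) (at x)"
 unfolding partial_deriv_def using Cinf_differentiable frechet_derivative_works by blast

lemma partial_deriv_add:
 assumes "Cinf f" "Cinf g"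
 shows "partial_deriv i (%x. f x + g x) x = partial_deriv i f x + partial_deriv i g x"
 by (rule partial_deriv_eq[OF has_derivative_add]) (intro Cinf_has_derivative assms)+

lemma partial_deriv_mult:
 assumes "Cinf f" "Cinf g"
 shows "partial_deriv i (%x. f x * g x) x = f x * partial_deriv i g x + partial_deriv i f x * g x"
 by (rule partial_deriv_eq[OF has_derivative_mult]) (intro Cinf_has_derivative assms)+

lemma partial_deriv_cmult: "Cinf f ==> partial_deriv i (%x. c * f x) x = c * partial_deriv i f x"
 using partial_deriv_mult[OF Cinf_const, of f i c x] by (simp add: partial_deriv_eq[OF has_derivative_const])

lemma grad_add: "Cinf f ==> Cinf g ==> grad (%x. f x + g x) x = grad f x + grad g x"
 unfolding grad_def by (simp add: partial_deriv_add scaleR_left_distrib sum.distrib)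

lemma grad_cmult: "Cinf f ==> grad (%x. c * f x) x = c *\<^sub>R grad f x"
 unfolding grad_def by (simp add: partial_deriv_cmult scaleR_sum_right)

lemma continuous_grad: "Cinf f ==> continuous_on UNIV (grad f)"
 unfolding grad_def by (intro continuous_on_sum continuous_on_scaleR continuous_on_const)
  (auto intro: Cinf_continuous Cinf_partial)

subsection \<open>Smooth step and bump functions\<close>

text \<open>The classical flat function exp(-1/s), divided by powers of s so that the family is
  closed under differentiation up to linear combinations.\<close>

definition flat_fun :: "nat => real => real" where
 "flat_fun m s = (if s > 0 then exp (- (1 / s)) / s ^ m else 0)"

text \<open>A single term of the series of exp(1/s), the one of index \<open>Suc m\<close>, gives
  the linear bound; the one power of s to spare forces the limit 0 at the origin.\<close>

lemma flat_fun_bounds: "0 \<le> flat_fun m s" "flat_fun m s \<le> fact (Suc m) * \<bar>s\<bar>"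
proof -
 show "0 \<le> flat_fun m s" by (auto simp: flat_fun_def)
 have "exp (- (1 / s)) / s ^ m \<le> fact (Suc m) * s" if s: "s > 0"
 proof -
  have "(\<Sum>n\<in>{Suc m}. inverse (fact n) *\<^sub>R (1 / s) ^ n) \<le> (\<Sum>n. inverse (fact n) *\<^sub>R (1 / s) ^ n)"
   by (rule sum_le_suminf) (use s summable_exp_generic[of "1 / s"] in auto)
  then have "(1 / s) ^ Suc m / fact (Suc m) \<le> exp (1 / s)" by (simp add: exp_def divide_inverse mult.commute)
  then have "(1 / s) ^ Suc m \<le> exp (1 / s) * fact (Suc m)" by (subst (asm) pos_divide_le_eq) simp_all
  then show ?thesis using s by (simp add: exp_minus field_simps power_divide)
 qed
 moreover have "0 \<le> fact (Suc m) * \<bar>s\<bar>" by simp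
 ultimately show "flat_fun m s \<le> fact (Suc m) * \<bar>s\<bar>"
  unfolding flat_fun_def by (cases "s > 0") (simp_all only: if_True if_False abs_of_pos)
qed

lemma flat_fun_deriv:
 "(flat_fun m has_real_derivative flat_fun (m + 2) s - m * flat_fun (Suc m) s) (at s)"
proof -
 consider "s > 0" | "s < 0" | "s = 0" by linarith
 then show ?thesis
 proof cases
  case 1
  have "((%s. exp (- (1 / s)) / s ^ m) has_real_derivative
    flat_fun (m + 2) s - m * flat_fun (Suc m) s) (at s)"
  proof -
   have p: "((%s. s ^ m) has_real_derivative m * s ^ m / s) (at s)" using DERIV_pow[of m s] 1 by (cases m) simp_all
   have "((%s. exp (- (1 / s))) has_real_derivative exp (- (1 / s)) / s\<^sup>2) (at s)"
    using 1 by (auto intro!: derivative_eq_intros simp: field_simps power2_eq_square)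
   from DERIV_divide[OF this p] show ?thesis
    by (rule DERIV_cong) (use 1 in "simp_all add: flat_fun_def field_simps power2_eq_square")
  qed
  then show ?thesis by (rule has_field_derivative_transform_within_open[where S = "{0<..}"])
    (use 1 in "auto simp: flat_fun_def")
 next
  case 2
  have "((%s. 0) has_real_derivative flat_fun (m + 2) s - m * flat_fun (Suc m) s) (at s)" using 2 by (auto simp: flat_fun_def)
  then show ?thesis by (rule has_field_derivative_transform_within_open[where S = "{..<0}"])
    (use 2 in "auto simp: flat_fun_def")
 next
  case 3
  \<comment> \<open>At 0 the difference quotient is the next member of the family, which tends to 0
    by the linear bound.\<close>
  have "((%h. flat_fun (Suc m) h) \<longlongrightarrow> 0) (at 0)"
  proof (rule Lim_null_comparison)
   show "\<forall>\<^sub>F h in at 0. norm (flat_fun (Suc m) h) \<le> fact (Suc (Suc m)) * \<bar>h\<bar>"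
    using flat_fun_bounds[of "Suc m"] by (intro always_eventually) auto
   show "((%h::real. fact (Suc (Suc m)) * \<bar>h\<bar>) \<longlongrightarrow> 0) (at 0)" by (auto intro!: tendsto_eq_intros)
  qed
  moreover have "(flat_fun m h - flat_fun m 0) / h = flat_fun (Suc m) h" for h by (simp add: flat_fun_def)
  ultimately show ?thesis unfolding 3 DERIV_def by (simp add: flat_fun_def)
 qed
qed

lemma Cinf_flat_fun: "Cinf (flat_fun m)"
proof -
 have "Ck k (flat_fun m)" for k
 proof (induction k arbitrary: m)
  case 0
  show ?case unfolding Ck.simps by (rule continuous_at_imp_continuous_on) (blast intro: DERIV_isCont flat_fun_deriv)
 next
  case (Suc k)
  show ?case by (rule Ck_SucI[OF flat_fun_deriv[unfolded has_field_derivative_def]])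
    (simp, intro Ck_diff Ck_cmult Suc)
 qed
 then show ?thesis by (simp add: Cinf_def)
qed

definition smooth_step :: "real => real" where
 "smooth_step s = flat_fun 0 s * inverse (flat_fun 0 s + flat_fun 0 (1 - s))"

lemma flat_fun_pos: "s > 0 ==> flat_fun m s > 0"
 and flat_fun_zero: "s \<le> 0 ==> flat_fun m s = 0" by (auto simp: flat_fun_def)

text \<open>One of \<open>s\<close> and \<open>1 - s\<close> is positive, so the two summands never
  vanish together.\<close>

lemma smooth_step_denom: "flat_fun 0 s + flat_fun 0 (1 - s) > 0"
 using flat_fun_pos[of s 0] flat_fun_pos[of "1 - s" 0] flat_fun_bounds(1)[of 0 s] flat_fun_bounds(1)[of 0 "1 - s"]
 by (cases "s > 0") linarith+

lemma Cinf_smooth_step: "Cinf smooth_step" unfolding smooth_step_def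
proof (intro Cinf_mult Cinf_inverse Cinf_add Cinf_flat_fun)
 show "Cinf (%s. flat_fun 0 (1 - s))"
  by (rule Cinf_compose_real[OF Cinf_flat_fun Cinf_diff[OF Cinf_const Cinf_bounded_linear[OF bounded_linear_ident]]])
 show "flat_fun 0 s + flat_fun 0 (1 - s) \<noteq> 0" for s using smooth_step_denom[of s] by simp
qed

lemma smooth_step_0: "s \<le> 0 ==> smooth_step s = 0"
 and smooth_step_1: "s \<ge> 1 ==> smooth_step s = 1"
 and smooth_step_bounds: "0 \<le> smooth_step s" "smooth_step s \<le> 1"
 using smooth_step_denom[of s] flat_fun_bounds(1)[of 0 s] flat_fun_bounds(1)[of 0 "1 - s"]
  flat_fun_pos[of s 0] by (auto simp: smooth_step_def flat_fun_zero field_simps)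

text \<open>The squared norm is used because it is a polynomial, hence smooth at the origin
  too.\<close>

definition bump :: "real => 'a::euclidean_space => real" where
 "bump r z = flat_fun 0 (r\<^sup>2 - z \<bullet> z)"

lemma Cinf_bump: "Cinf (bump r)"
proof -
 have "Cinf (%z::'a. r\<^sup>2 - (\<Sum>i\<in>Basis. (z \<bullet> i) * (z \<bullet> i)))" by (intro Cinf_diff Cinf_const Cinf_sum Cinf_mult Cinf_inner)
 then have "Cinf (%z::'a. r\<^sup>2 - z \<bullet> z)" by (simp add: euclidean_inner[symmetric])
 from Cinf_compose_real[OF Cinf_flat_fun this] show ?thesis by (simp add: bump_def[abs_def])
qed

lemma bump_nonneg: "bump r z \<ge> 0" by (simp add: bump_def flat_fun_bounds)

lemma bump_pos: "norm z < r ==> bump r z > 0" unfolding bump_def by (intro flat_fun_pos)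
  (simp add: dot_square_norm power_strict_mono)

lemma bump_zero: "norm z \<ge> r ==> r \<ge> 0 ==> bump r z = 0"
 unfolding bump_def by (intro flat_fun_zero) (simp add: dot_square_norm power_mono)

subsection \<open>Integrals of smooth functions depending on parameters\<close>

lemma integrable_mult_bounded_support:
 fixes f k :: "'a::euclidean_space => real"
 assumes f: "f absolutely_integrable_on cball 0 R" and k: "k \<in> borel_measurable lebesgue"
  and s: "\<And>y. norm y > R ==> k y = 0" and b: "\<And>y. \<bar>k y\<bar> \<le> B"
 shows "integrable lebesgue (%y. f y * k y)"
  and "\<bar>\<integral>y. f y * k y \<partial>lebesgue\<bar> \<le> B * (\<integral>y. \<bar>indicator (cball 0 R) y * f y\<bar> \<partial>lebesgue)"
proof -
 have fi: "integrable lebesgue (%y. indicator (cball 0 R) y * f y)" using f by (simp add: set_integrable_def)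
 have eq: "f y * k y = (indicator (cball 0 R) y * f y) * k y" for y using s[of y] by (auto simp: indicator_def)
 show i: "integrable lebesgue (%y. f y * k y)" unfolding eq
 proof (rule Bochner_Integration.integrable_bound[OF integrable_mult_right[OF fi, of B]])
  show "(%y. indicator (cball 0 R) y * f y * k y) \<in> borel_measurable lebesgue"
   using k borel_measurable_integrable[OF fi] by (rule borel_measurable_times[rotated])
  have "\<bar>k x\<bar> \<le> \<bar>B\<bar>" for x using b[of x] by linarith
  then show "AE x in lebesgue. norm (indicator (cball 0 R) x * f x * k x) \<le> norm (B * (indicator (cball 0 R) x * f x))"
   by (intro AE_I2) (auto simp: abs_mult mult.commute intro!: mult_right_mono)
 qed
 have "\<bar>\<integral>y. f y * k y \<partial>lebesgue\<bar> \<le> (\<integral>y. \<bar>f y * k y\<bar> \<partial>lebesgue)" by (rule integral_abs_bound)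
 also have "\<dots> \<le> (\<integral>y. B * \<bar>indicator (cball 0 R) y * f y\<bar> \<partial>lebesgue)"
 proof (rule integral_mono)
  show "\<bar>f y * k y\<bar> \<le> B * \<bar>indicator (cball 0 R) y * f y\<bar>" for y
   unfolding eq abs_mult[of _ "k y"] using b[of y] by (subst mult.commute) (rule mult_right_mono, auto)
 qed (use i fi in auto)
 finally show "\<bar>\<integral>y. f y * k y \<partial>lebesgue\<bar> \<le> B * (\<integral>y. \<bar>indicator (cball 0 R) y * f y\<bar> \<partial>lebesgue)" by simp
qed

lemma L1loc_UNIV_cball: "L1loc_on UNIV f ==> f absolutely_integrable_on cball 0 R" unfolding L1loc_on_def by simp

lemma Ck_slice_measurable:
 assumes "continuous_on UNIV (K :: ('a::euclidean_space \<times> 'b::euclidean_space) => real)"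
 shows "(%y. K (X, y)) \<in> borel_measurable lebesgue"
proof -
 have "continuous_on UNIV (%y. K (X, y))" by (rule continuous_on_compose2[OF assms]) (auto intro!: continuous_intros)
 then have "(%y. K (X, y)) \<in> borel_measurable lborel" using borel_measurable_continuous_onI by simp
 then show ?thesis by (rule measurable_completion)
qed

text \<open>Uniform continuity on a compact product makes the estimate uniform in \<open>y\<close>;
  the bound \<open>d \<le> 1\<close> keeps \<open>X\<close> in the compact factor
  \<open>cball X0 1\<close>.\<close>

lemma slice_uniform:
 fixes K :: "('a::euclidean_space \<times> 'b::euclidean_space) => real"
 assumes c: "continuous_on UNIV K" and e: "e > 0"
 obtains d where "d > 0" "d \<le> 1"
  "\<And>X y. norm (X - X0) < d ==> norm y \<le> R ==> \<bar>K (X, y) - K (X0, y)\<bar> < e"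
proof -
 have "compact (cball X0 1 \<times> cball (0::'b) R)" by (intro compact_Times) auto
 then have "uniformly_continuous_on (cball X0 1 \<times> cball (0::'b) R) K"
  by (intro compact_uniformly_continuous continuous_on_subset[OF c]) auto
 then obtain d where d: "d > 0" "\<And>x x'. x \<in> cball X0 1 \<times> cball (0::'b) R ==>
   x' \<in> cball X0 1 \<times> cball (0::'b) R ==> dist x' x < d ==> dist (K x') (K x) < e"
  unfolding uniformly_continuous_on_def using e by metis
 show ?thesis
 proof (rule that[of "min d 1"])
  fix X y assume "norm (X - X0) < min d 1" "norm (y::'b) \<le> R"
  then show "\<bar>K (X, y) - K (X0, y)\<bar> < e"
   using d(2)[of "(X0, y)" "(X, y)"] by (simp add: dist_Pair_Pair dist_norm norm_minus_commute)
 qed (use d in auto)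
qed

lemma partial_deriv_outside:
 assumes "open U" "x \<in> U" "\<And>y. y \<in> U ==> f y = 0"
 shows "partial_deriv i f x = 0"
proof -
 have "(f has_derivative (%_. 0)) (at x)"
  by (rule has_derivative_transform_within_open[OF has_derivative_const[of 0] assms(1,2)])
   (use assms(3) in auto)
 then show ?thesis by (rule partial_deriv_eq)
qed

text \<open>Differentiation under the integral sign with \<open>f\<close> merely locally integrable.
  The support condition confines \<open>y\<close> to a fixed ball while \<open>X\<close> ranges over
  a bounded set, so uniform continuity of the kernel and of its derivatives takes the place of an
  integrable majorant.\<close>

lemma
 fixes K :: "('a::euclidean_space \<times> 'b::euclidean_space) => real"
 assumes f: "L1loc_on UNIV f"
  and s: "\<And>R. \<exists>R'. \<forall>X y. norm X < R \<longrightarrow> norm y > R' \<longrightarrow> K (X, y) = 0"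
 shows has_derivative_param_integral: "Ck (Suc 0) K ==> ((%X. \<integral>y. f y * K (X, y) \<partial>lebesgue) has_derivative
   (%h. \<Sum>i\<in>Basis. (h \<bullet> i) * (\<integral>y. f y * partial_deriv (i, 0) K (X0, y) \<partial>lebesgue))) (at X0)"
  and continuous_param_integral: "continuous_on UNIV K ==>
   continuous_on UNIV (%X. \<integral>y. f y * K (X, y) \<partial>lebesgue)"
  and integrable_param: "continuous_on UNIV K ==> integrable lebesgue (%y. f y * K (X0, y))"
proof -
 \<comment> \<open>One radius \<open>R X0\<close> serves all \<open>X\<close> with
   \<open>norm X < norm X0 + 2\<close>, in particular a whole unit ball around
   \<open>X0\<close>.\<close>
 have "\<forall>X0::'a. \<exists>R'. \<forall>X y. norm X < norm X0 + 2 \<longrightarrow> norm y > R' \<longrightarrow> K (X, y) = 0" using s by blast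
 from choice[OF this] obtain R where "\<forall>(X0::'a) X y. norm X < norm X0 + 2 \<longrightarrow> norm y > R X0 \<longrightarrow> K (X, y) = 0" by auto
 then have R: "norm X < norm X0 + 2 ==> norm y > R X0 ==> K (X, y) = 0" for X0 :: 'a and X y by blast
 define A where "A X0 = (\<integral>y. \<bar>indicator (cball 0 (R X0)) y * f y\<bar> \<partial>lebesgue)" for X0
 have A: "A X \<ge> 0" for X unfolding A_def by (rule Bochner_Integration.integral_nonneg) simp
 have bd: "\<exists>B. \<forall>y. \<bar>L (X, y)\<bar> \<le> B"
  if L: "continuous_on UNIV L" and "\<And>y. norm y > R X0 ==> L (X, y) = 0"
  for X X0 and L :: "('a \<times> 'b) => real"
 proof -
  have "compact ((%y. L (X, y)) ` cball 0 (R X0))"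
   by (intro compact_continuous_image compact_cball continuous_on_compose2[OF L]) (auto intro!: continuous_intros)
  then obtain B where "\<forall>y\<in>cball 0 (R X0). \<bar>L (X, y)\<bar> \<le> B" by (auto simp: bounded_iff dest!: compact_imp_bounded)
  then have "\<And>y. norm y \<le> R X0 ==> \<bar>L (X, y)\<bar> \<le> B" by simp
  then have "\<forall>y. \<bar>L (X, y)\<bar> \<le> max B 0" using that(2)
   by (metis abs_zero linorder_not_le max.cobounded1 max.cobounded2 order_trans)
  then show ?thesis by blast
 qed
 have int: "integrable lebesgue (%y. f y * L (X, y))"
  if L: "continuous_on UNIV L" "\<And>y. norm y > R X0 ==> L (X, y) = 0"
  for X X0 and L :: "('a \<times> 'b) => real"
  using bd[OF L] integrable_mult_bounded_support(1)[OF L1loc_UNIV_cball[OF f] Ck_slice_measurable[OF L(1)], of "R X0" X] L(2)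
  by blast
 { assume c: "continuous_on UNIV K"
  show "continuous_on UNIV (%X. \<integral>y. f y * K (X, y) \<partial>lebesgue)"
  proof (rule continuous_at_imp_continuous_on, rule, unfold continuous_at_eps_delta, intro allI impI)
   fix X0 :: 'a and e :: real assume "e > 0"
   then have e: "e / (A X0 + 1) > 0" using A[of X0] by simp
   obtain d where d: "d > 0" "d \<le> 1"
    "\<And>X y. norm (X - X0) < d ==> norm y \<le> R X0 ==> \<bar>K (X, y) - K (X0, y)\<bar> < e / (A X0 + 1)" using slice_uniform[OF c e] by metis
   show "\<exists>d>0. \<forall>X. dist X X0 < d \<longrightarrow>
     dist (\<integral>y. f y * K (X, y) \<partial>lebesgue) (\<integral>y. f y * K (X0, y) \<partial>lebesgue) < e"
   proof (intro exI[of _ d] conjI allI impI d)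
    fix X assume X: "dist X X0 < d"
    then have nX: "norm X < norm X0 + 2" using d(2) by norm
    have K0: "norm y > R X0 ==> K (X, y) - K (X0, y) = 0" for y using R[of X X0] R[of X0 X0] nX by simp
    have "\<bar>\<integral>y. f y * (K (X, y) - K (X0, y)) \<partial>lebesgue\<bar> \<le> e / (A X0 + 1) * A X0" unfolding A_def[of X0]
    proof (rule integrable_mult_bounded_support(2)[OF L1loc_UNIV_cball[OF f] _ K0], goal_cases)
     case (3 y)
     then show ?case using d(3)[of X y] X K0[of y] e by (cases "norm y \<le> R X0") (auto simp: dist_norm A_def)
    qed (use Ck_slice_measurable[OF c] in auto)
    also have "\<dots> < e" using A[of X0] \<open>e > 0\<close> by (simp add: field_simps)
    finally show "dist (\<integral>y. f y * K (X, y) \<partial>lebesgue) (\<integral>y. f y * K (X0, y) \<partial>lebesgue) < e"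
     using int[OF c R[OF nX]] int[OF c R[of X0 X0]] by (simp add: dist_real_def right_diff_distrib)
   qed
  qed
 }
 { assume c: "continuous_on UNIV K"
  show "integrable lebesgue (%y. f y * K (X0, y))" by (rule int[OF c R[of X0 X0]]) simp_all }
 { assume C: "Ck (Suc 0) K"
  let ?D = "%i. partial_deriv (i::'a, 0::'b) K"
  have Dc: "continuous_on UNIV (?D i)" if "i \<in> Basis" for i using C that by (simp add: Basis_prod_def)
  have Kc: "continuous_on UNIV K" using C Ck_continuous by blast
  have D0: "?D i (X, y) = 0" if "norm X < norm X0 + 2" "norm y > R X0" for i X y
  proof (rule partial_deriv_outside[where U = "{X. norm X < norm X0 + 2} \<times> {y. norm y > R X0}"])
   show "open ({X. norm X < norm X0 + 2} \<times> {y::'b. norm y > R X0})" by (intro open_Times open_Collect_less continuous_intros)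
  qed (use that R in auto)
  have DK: "((%X. K (X, y)) has_derivative (%h. \<Sum>i\<in>Basis. (h \<bullet> i) * ?D i (X, y))) (at X)" for X y
  proof -
   have "((%X. (X, y)) has_derivative (%h. (h, 0))) (at X)" by (auto intro!: derivative_eq_intros)
   from diff_chain_at[OF this, of K] Ck_SucE(1)[OF C]
   have "((%X. K (X, y)) has_derivative (%h. \<Sum>i\<in>Basis. ((h, 0) \<bullet> i) * partial_deriv i K (X, y))) (at X)"
    by (fastforce simp: o_def)
   then show ?thesis by (simp add: Basis_prod_def sum.union_disjoint sum.reindex inj_on_def disjoint_iff image_iff)
  qed
  show "((%X. \<integral>y. f y * K (X, y) \<partial>lebesgue) has_derivative
   (%h. \<Sum>i\<in>Basis. (h \<bullet> i) * (\<integral>y. f y * ?D i (X0, y) \<partial>lebesgue))) (at X0)" unfolding has_derivative_at_alt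
  proof (intro conjI allI impI)
   show "bounded_linear (%h. \<Sum>i\<in>Basis. h \<bullet> i * (\<integral>y. f y * ?D i (X0, y) \<partial>lebesgue))"
    by (intro bounded_linear_sum bounded_linear_mult_const bounded_linear_inner_left)
   fix e :: real assume "e > 0"
   \<comment> \<open>The tolerance is shared between the mass \<open>A X0\<close> of
     \<open>f\<close> and the \<open>DIM('a)\<close> directions; adding 1 avoids a division by
     zero.\<close>
   define e' where "e' = e / (A X0 + 1) / DIM('a)"
   have e': "e' > 0" using A[of X0] \<open>e > 0\<close> by (simp add: e'_def)
   have "\<exists>d>0. d \<le> 1 \<and> (\<forall>X y. norm (X - X0) < d \<longrightarrow> norm y \<le> R X0 \<longrightarrow> \<bar>?D i (X, y) - ?D i (X0, y)\<bar> < e')"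
    if "i \<in> Basis" for i using slice_uniform[OF Dc[OF that] e'] by metis
   then obtain d where d: "\<And>i. i \<in> Basis ==> d i > 0" "\<And>i. i \<in> Basis ==> d i \<le> 1"
    "\<And>i X y. i \<in> Basis ==> norm (X - X0) < d i ==> norm y \<le> R X0 ==> \<bar>?D i (X, y) - ?D i (X0, y)\<bar> < e'" by metis
   define \<delta> where "\<delta> = Min (d ` Basis)"
   have \<delta>: "\<delta> > 0" "\<delta> \<le> 1" "\<And>i. i \<in> Basis ==> \<delta> \<le> d i" using d by (auto simp: \<delta>_def Min_le_iff) (meson nonempty_Basis ex_in_conv)
   show "\<exists>d>0. \<forall>X. norm (X - X0) < d \<longrightarrow>
     norm ((\<integral>y. f y * K (X, y) \<partial>lebesgue) - (\<integral>y. f y * K (X0, y) \<partial>lebesgue)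
      - (\<Sum>i\<in>Basis. (X - X0) \<bullet> i * (\<integral>y. f y * ?D i (X0, y) \<partial>lebesgue)))
     \<le> e * norm (X - X0)"
   proof (intro exI[of _ \<delta>] conjI allI impI \<delta>)
    fix X assume X: "norm (X - X0) < \<delta>"
    then have nX: "norm X < norm X0 + 2" using \<delta>(2) by norm
    \<comment> \<open>The first-order remainder of the kernel at \<open>X0\<close>. Its integral
      against \<open>f\<close> is the remainder to be estimated.\<close>
    define r where "r y = K (X, y) - K (X0, y) - (\<Sum>i\<in>Basis. (X - X0) \<bullet> i * ?D i (X0, y))" for y
    have r0: "r y = 0" if "norm y > R X0" for y using R[of X X0 y] R[of X0 X0 y] D0 that nX by (simp add: r_def)
    have rb: "\<bar>r y\<bar> \<le> e / (A X0 + 1) * norm (X - X0)" if y: "norm y \<le> R X0" for y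
    proof -
     \<comment> \<open>The linear part is subtracted before the mean value inequality is applied, so
       that only the variation of the derivative near \<open>X0\<close> enters.\<close>
     have "norm ((%X. K (X, y) - (\<Sum>i\<in>Basis. X \<bullet> i * ?D i (X0, y))) X
        - (%X. K (X, y) - (\<Sum>i\<in>Basis. X \<bullet> i * ?D i (X0, y))) X0) \<le> e / (A X0 + 1) * norm (X - X0)"
     proof (rule differentiable_bound[where S = "ball X0 \<delta>" and f' = "%X h. (\<Sum>i\<in>Basis. (h \<bullet> i) * ?D i (X, y)) - (\<Sum>i\<in>Basis. (h \<bullet> i) * ?D i (X0, y))"])
      fix Y assume Y: "Y \<in> ball X0 \<delta>"
      show "((%X. K (X, y) - (\<Sum>i\<in>Basis. X \<bullet> i * ?D i (X0, y))) has_derivative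
        (%h. (\<Sum>i\<in>Basis. (h \<bullet> i) * ?D i (Y, y)) - (\<Sum>i\<in>Basis. (h \<bullet> i) * ?D i (X0, y)))) (at Y within ball X0 \<delta>)"
       by (rule has_derivative_diff[OF has_derivative_at_withinI[OF DK] bounded_linear_imp_has_derivative])
        (intro bounded_linear_sum bounded_linear_mult_const bounded_linear_inner_left)
      show "onorm (%h. (\<Sum>i\<in>Basis. (h \<bullet> i) * ?D i (Y, y)) - (\<Sum>i\<in>Basis. (h \<bullet> i) * ?D i (X0, y))) \<le> e / (A X0 + 1)"
      proof (rule onorm_le)
       fix h :: 'a
       have "\<bar>\<Sum>i\<in>Basis. (h \<bullet> i) * (?D i (Y, y) - ?D i (X0, y))\<bar> \<le> (\<Sum>i\<in>(Basis::'a set). norm h * e')"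
       proof (rule order_trans[OF sum_abs sum_mono])
        fix i :: 'a assume i: "i \<in> Basis"
        have "\<bar>?D i (Y, y) - ?D i (X0, y)\<bar> \<le> e'"
         using d(3)[OF i _ y, of Y] Y \<delta>(3)[OF i] by (simp add: dist_norm norm_minus_commute)
        then show "\<bar>h \<bullet> i * (?D i (Y, y) - ?D i (X0, y))\<bar> \<le> norm h * e'"
         unfolding abs_mult by (intro mult_mono Basis_le_norm i) auto
       qed
       also have "\<dots> = e / (A X0 + 1) * norm h" by (simp add: e'_def)
       finally show "norm ((\<Sum>i\<in>Basis. (h \<bullet> i) * ?D i (Y, y)) - (\<Sum>i\<in>Basis. (h \<bullet> i) * ?D i (X0, y))) \<le> e / (A X0 + 1) * norm h"
        by (simp add: sum_subtractf right_diff_distrib)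
      qed
     qed (use X \<delta>(1) in "auto simp: dist_norm norm_minus_commute")
     then show ?thesis by (simp add: r_def inner_diff_left left_diff_distrib sum_subtractf algebra_simps)
    qed
    have Dm: "(%y. ?D i (X0, y)) \<in> borel_measurable lebesgue" if "i \<in> Basis" for i using Ck_slice_measurable[OF Dc[OF that]] .
    have rm: "r \<in> borel_measurable lebesgue"
     unfolding r_def using Ck_slice_measurable[OF Kc] Dm by (intro borel_measurable_diff borel_measurable_sum) auto
    have "\<bar>\<integral>y. f y * r y \<partial>lebesgue\<bar> \<le> (e / (A X0 + 1) * norm (X - X0)) * A X0" unfolding A_def[of X0]
    proof (rule integrable_mult_bounded_support(2)[OF L1loc_UNIV_cball[OF f] rm r0], goal_cases)
     case (2 y)
     then show ?case using rb[of y] r0[of y] A[of X0] \<open>e > 0\<close> by (cases "norm y \<le> R X0") (auto simp: A_def)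
    qed auto
    also have "\<dots> \<le> e * norm (X - X0)" using A[of X0] \<open>e > 0\<close> by (simp add: field_simps mult_right_mono)
    also have "(\<integral>y. f y * r y \<partial>lebesgue) = (\<integral>y. f y * K (X, y) \<partial>lebesgue) - (\<integral>y. f y * K (X0, y) \<partial>lebesgue)
      - (\<Sum>i\<in>Basis. (X - X0) \<bullet> i * (\<integral>y. f y * ?D i (X0, y) \<partial>lebesgue))"
    proof -
     have i1: "integrable lebesgue (%y. f y * K (X, y))" "integrable lebesgue (%y. f y * K (X0, y))"
      using int[OF Kc R[OF nX]] int[OF Kc R[of X0 X0]] by auto
     have i2: "integrable lebesgue (%y. f y * ?D i (X0, y))" if "i \<in> Basis" for i
      by (rule int[OF Dc[OF that]]) (auto intro: D0)
     have "f y * r y = f y * K (X, y) - f y * K (X0, y) - (\<Sum>i\<in>Basis. (X - X0) \<bullet> i * (f y * ?D i (X0, y)))" for y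
      by (simp add: r_def right_diff_distrib sum_distrib_left mult_ac)
     then show ?thesis using i1 i2 by simp
    qed
    finally show "norm ((\<integral>y. f y * K (X, y) \<partial>lebesgue) - (\<integral>y. f y * K (X0, y) \<partial>lebesgue)
      - (\<Sum>i\<in>Basis. (X - X0) \<bullet> i * (\<integral>y. f y * ?D i (X0, y) \<partial>lebesgue))) \<le> e * norm (X - X0)" by simp
   qed
  qed
 }
qed

text \<open>The derivative is again such an integral, with a partial derivative of the kernel, which
  inherits the support condition because the kernel vanishes on an open set.\<close>

lemma Ck_param_integral:
 fixes K :: "('a::euclidean_space \<times> 'b::euclidean_space) => real"
 assumes f: "L1loc_on UNIV f"
  and "\<And>R. \<exists>R'. \<forall>X y. norm X < R \<longrightarrow> norm y > R' \<longrightarrow> K (X, y) = 0" and "Ck k K"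
 shows "Ck k (%X. \<integral>y. f y * K (X, y) \<partial>lebesgue)" using assms(2,3)
proof (induction k arbitrary: K)
 case 0
 show ?case unfolding Ck.simps by (rule continuous_param_integral[OF f]) (use 0 in auto)
next
 case (Suc k)
 have "Ck (Suc 0) K" using Suc.prems(2) by (auto dest: Ck_continuous)
 note d = has_derivative_param_integral[OF f Suc.prems(1) this]
 show ?case
 proof (rule Ck_SucI[OF d])
  fix i :: 'a assume i: "i \<in> Basis"
  have "Ck k (%X. \<integral>y. f y * partial_deriv (i, 0) K (X, y) \<partial>lebesgue)"
  proof (rule Suc.IH)
   show "Ck k (partial_deriv (i, 0) K)" using Suc.prems(2) i by (simp add: Basis_prod_def)
   fix R
   obtain R' where R': "\<And>X y. norm X < R ==> norm y > R' ==> K (X, y) = 0" using Suc.prems(1) by metis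
   have "partial_deriv (i, 0) K (X, y) = 0" if "norm X < R" "norm y > R'" for X y
   proof (rule partial_deriv_outside[where U = "{X. norm X < R} \<times> {y. norm y > R'}"])
    show "open ({X::'a. norm X < R} \<times> {y::'b. norm y > R'})" by (intro open_Times open_Collect_less continuous_intros)
   qed (use that R' in auto)
   then show "\<exists>R'. \<forall>X y. norm X < R \<longrightarrow> norm y > R' \<longrightarrow> partial_deriv (i, 0) K (X, y) = 0" by blast
  qed
  then show "Ck k (%x. \<Sum>ia\<in>Basis. i \<bullet> ia * (\<integral>y. f y * partial_deriv (ia, 0) K (x, y) \<partial>lebesgue))"
   using i by (simp add: sum_inner_Basis_mult)
 qed
qed

subsection \<open>Weak derivatives\<close>

lemma test_function_bounded_support:
 assumes "test_function S \<phi>"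
 obtains R where "R > 0" "\<And>x. norm x > R ==> \<phi> x = 0"
proof -
 have "bounded {x. \<phi> x \<noteq> 0}" using assms compact_imp_bounded bounded_subset closure_subset unfolding test_function_def by metis
 then obtain R where "R > 0" "\<And>x. \<phi> x \<noteq> 0 ==> norm x \<le> R" unfolding bounded_pos by auto
 then show ?thesis using that by force
qed

lemma continuous_bounded_support:
 fixes f :: "'a::euclidean_space => real"
 assumes "continuous_on UNIV f" "\<And>x. norm x > R ==> f x = 0"
 shows "integrable lborel f" and "\<exists>B. \<forall>x. \<bar>f x\<bar> \<le> B"
proof -
 have "integrable lborel (%x. indicator (cball 0 R) x *\<^sub>R f x)"
  by (rule borel_integrable_compact) (auto intro: continuous_on_subset[OF assms(1)])
 moreover have "(%x. indicator (cball 0 R) x *\<^sub>R f x) = f" using assms(2) by (auto simp: indicator_def fun_eq_iff)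
 ultimately show "integrable lborel f" by simp
 have "compact (f ` cball 0 R)" by (intro compact_continuous_image compact_cball continuous_on_subset[OF assms(1)]) auto
 then obtain B where B: "\<forall>y\<in>cball 0 R. \<bar>f y\<bar> \<le> B" by (auto simp: bounded_iff dest!: compact_imp_bounded)
 have "\<bar>f x\<bar> \<le> max B 0" for x using B[rule_format, of x] assms(2)[of x] by (cases "norm x \<le> R") auto
 then show "\<exists>B. \<forall>x. \<bar>f x\<bar> \<le> B" by blast
qed

lemma partial_deriv_0_outside_cball:
 fixes f :: "'a::euclidean_space => real"
 assumes "\<And>x. norm x > R ==> f x = 0" "norm x > R"
 shows "partial_deriv i f x = 0"
proof (rule partial_deriv_outside[where U = "{x. norm x > R}"])
 show "open {x::'a. norm x > R}" by (intro open_Collect_less continuous_intros)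
qed (use assms in auto)

text \<open>By translation invariance the integral of every difference quotient is 0, and dominated
  convergence transfers this to the derivative. No iterated integrals are involved.\<close>

lemma integral_partial_deriv_0:
 fixes f :: "'a::euclidean_space => real"
 assumes f: "Cinf f" and s: "\<And>x. norm x > R ==> f x = 0" and i: "i \<in> Basis"
 shows "(\<integral>x. partial_deriv i f x \<partial>lborel) = 0"
proof -
 let ?D = "partial_deriv i f"
 have s': "\<And>x. norm x > R ==> ?D x = 0" by (rule partial_deriv_0_outside_cball[OF s])
 have Dc: "continuous_on UNIV ?D" using f i Cinf_partial Cinf_continuous by blast
 obtain B where B: "\<And>x. \<bar>?D x\<bar> \<le> B" using continuous_bounded_support(2)[OF Dc s'] by metis
 have B0: "B \<ge> 0" using B[of 0] by linarith
 have fint: "integrable lborel f" by (rule continuous_bounded_support(1)[OF Cinf_continuous[OF f] s])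
 have fc: "f \<in> borel_measurable borel" using borel_measurable_continuous_onI[OF Cinf_continuous[OF f]] .
 define g where "g n x = (f (x + (1 / real (Suc n)) *\<^sub>R i) - f x) / (1 / real (Suc n))" for n x
 have line: "((%t. f (x + t *\<^sub>R i)) has_real_derivative ?D (x + t *\<^sub>R i)) (at t)" for x t
 proof -
  have "((%t. x + t *\<^sub>R i) has_derivative (%t. t *\<^sub>R i)) (at t)" by (auto intro!: derivative_eq_intros)
  from diff_chain_at[OF this Cinf_has_derivative[OF f]]
  have "((%t. f (x + t *\<^sub>R i)) has_derivative (%h. partial_deriv (h *\<^sub>R i) f (x + t *\<^sub>R i))) (at t)" by (simp add: o_def)
  moreover have "partial_deriv (h *\<^sub>R i) f y = h * ?D y" for h y
   using linear_cmul[OF has_derivative_linear[OF Cinf_has_derivative[OF f, of y]], of h i] by simp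
  ultimately show ?thesis by (simp add: has_field_derivative_def mult.commute[of _ "?D _"])
 qed
 have transl: "integrable lborel (%x. f (x + c))" "(\<integral>x. f (x + c) \<partial>lborel) = (\<integral>x. f x \<partial>lborel)" for c
 proof -
  have "integrable (distr lborel borel ((+) c)) f" using fint by (subst lborel_distr_plus)
  then show "integrable lborel (%x. f (x + c))" using fc by (subst (asm) integrable_distr_eq) (auto simp: add.commute)
  have "(\<integral>x. f x \<partial>lborel) = (\<integral>x. f x \<partial>distr lborel borel ((+) c))" by (subst lborel_distr_plus) simp
  also have "\<dots> = (\<integral>x. f (x + c) \<partial>lborel)" using fc by (subst integral_distr) (auto simp: add.commute)
  finally show "(\<integral>x. f (x + c) \<partial>lborel) = (\<integral>x. f x \<partial>lborel)" by simp
 qed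
 have g0: "(\<integral>x. g n x \<partial>lborel) = 0" for n unfolding g_def using transl fint by simp
 \<comment> \<open>The quotients are values of the derivative by the mean value theorem, hence
   bounded by \<open>B\<close>; steps of length at most 1 keep them supported in the ball of radius
   \<open>R + 1\<close>.\<close>
 have gb: "\<bar>g n x\<bar> \<le> B * indicator (cball 0 (R + 1)) x" for n x
 proof -
  let ?h = "1 / real (Suc n)"
  have h: "?h > 0" "?h \<le> 1" by auto
  show ?thesis
  proof (cases "norm x \<le> R + 1")
   case True
   have "\<exists>z>0. z < ?h \<and> f (x + ?h *\<^sub>R i) - f (x + 0 *\<^sub>R i) = (?h - 0) * ?D (x + z *\<^sub>R i)" by (rule MVT2) (use h line in auto)
   then obtain z where "f (x + ?h *\<^sub>R i) - f x = ?h * ?D (x + z *\<^sub>R i)" by auto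
   then have "g n x = ?D (x + z *\<^sub>R i)" unfolding g_def using h by (simp add: field_simps)
   then show ?thesis using B True by simp
  next
   case False
   have "norm (x + ?h *\<^sub>R i) \<ge> norm x - norm (?h *\<^sub>R i)" by (rule norm_diff_ineq)
   moreover have "norm (?h *\<^sub>R i) \<le> 1" using h i by simp
   ultimately have "norm (x + ?h *\<^sub>R i) > R" "norm x > R" using False by linarith+
   then show ?thesis using s False by (simp add: g_def)
  qed
 qed
 have "(%n. \<integral>x. g n x \<partial>lborel) \<longlonglongrightarrow> (\<integral>x. ?D x \<partial>lborel)"
 proof (rule integral_dominated_convergence[where w = "%x. B * indicator (cball 0 (R + 1)) x"])
  show "?D \<in> borel_measurable lborel" using borel_measurable_continuous_onI[OF Dc] by simp
  show "g n \<in> borel_measurable lborel" for n unfolding g_def using borel_measurable_integrable[OF transl(1)] fc by measurable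
  show "integrable lborel (%x. B * indicator (cball 0 (R + 1)) (x::'a))"
   using borel_integrable_compact[of "cball 0 (R + 1)" "%_::'a. B"] by (simp add: mult.commute)
  show "AE x in lborel. (%n. g n x) \<longlonglongrightarrow> ?D x"
  proof (rule AE_I2)
   fix x
   have "((%h. (f (x + (0 + h) *\<^sub>R i) - f (x + 0 *\<^sub>R i)) / h) \<longlongrightarrow> ?D (x + 0 *\<^sub>R i)) (at 0)"
    using line[of x 0] unfolding DERIV_def .
   then have "((%h. (f (x + h *\<^sub>R i) - f x) / h) \<longlongrightarrow> ?D x) (at 0)" by simp
   moreover have "filterlim (%n. 1 / real (Suc n)) (at 0) sequentially"
    using LIMSEQ_Suc[OF lim_const_over_n[of 1]] by (auto simp: filterlim_at)
   ultimately show "(%n. g n x) \<longlonglongrightarrow> ?D x" unfolding g_def by (rule filterlim_compose)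
  qed
  show "AE x in lborel. norm (g n x) \<le> B * indicator (cball 0 (R + 1)) x" for n using gb by auto
 qed
 then have "(%n. 0::real) \<longlonglongrightarrow> (\<integral>x. ?D x \<partial>lborel)" by (simp add: g0)
 then show ?thesis using LIMSEQ_unique tendsto_const by blast
qed

lemma set_lebesgue_integral_support:
 fixes f :: "'a::euclidean_space => real"
 assumes "\<And>x. x \<notin> S ==> f x = 0" "f \<in> borel_measurable borel"
 shows "(LINT x:S|lebesgue. f x) = (\<integral>x. f x \<partial>lborel)"
proof -
 have "(%x. indicator S x *\<^sub>R f x) = f" using assms(1) by (auto simp: indicator_def fun_eq_iff)
 then show ?thesis using assms(2) by (simp add: set_lebesgue_integral_def integral_completion)
qed

lemma continuous_L1loc:
 assumes "continuous_on S f" shows "L1loc_on S (f :: 'a::euclidean_space => real)" unfolding L1loc_on_def set_integrable_def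
proof (intro allI impI, elim conjE)
 fix K assume K: "compact K" "K \<subseteq> S"
 have "integrable lborel (%x. indicator K x *\<^sub>R f x)"
  by (rule borel_integrable_compact[OF K(1) continuous_on_subset[OF assms K(2)]])
 then show "integrable lebesgue (%x. indicator K x *\<^sub>R f x)" by (simp add: integrable_completion borel_measurable_integrable)
qed

text \<open>On the support of a test function, \<open>u\<close> agrees with some \<open>u\<^sub>0\<close> that is smooth everywhere, so that
 the product with the test function is smooth everywhere.\<close>

lemma has_weak_partial_smooth:
 assumes S: "open S" and i: "i \<in> Basis"
  and loc: "\<And>K. compact K ==> K \<subseteq> S ==> \<exists>u0 U. Cinf u0 \<and> open U \<and> K \<subseteq> U \<and> (\<forall>x\<in>U. u0 x = u x)"
 shows "has_weak_partial S i u (partial_deriv i u)"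
proof -
 have eqd: "partial_deriv i u x = partial_deriv i u0 x"
  if "Cinf u0" "open U" "x \<in> U" "\<forall>x\<in>U. u0 x = u x" for u0 U x
 proof (rule partial_deriv_eq)
  show "(u has_derivative (%h. partial_deriv h u0 x)) (at x)"
   by (rule has_derivative_transform_within_open[OF Cinf_has_derivative[OF that(1)] that(2,3)])
    (use that(4) in auto)
 qed
 have L: "L1loc_on S u" "L1loc_on S (partial_deriv i u)"
 proof -
  have "continuous_on K u" "continuous_on K (partial_deriv i u)" if K: "compact K" "K \<subseteq> S" for K
  proof -
   obtain u0 U where u0: "Cinf u0" "open U" "K \<subseteq> U" "\<forall>x\<in>U. u0 x = u x" using loc[OF K] by (elim exE conjE)
   have "continuous_on K u0" "continuous_on K (partial_deriv i u0)"
    by (rule continuous_on_subset[OF Cinf_continuous], rule u0, simp)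
     (rule continuous_on_subset[OF Cinf_continuous], rule Cinf_partial[OF u0(1) i], simp)
   moreover have "u0 x = u x" "partial_deriv i u x = partial_deriv i u0 x" if "x \<in> K" for x using u0 that eqd by auto
   ultimately show "continuous_on K u" "continuous_on K (partial_deriv i u)" by (auto cong: continuous_on_cong)
  qed
  then show "L1loc_on S u" "L1loc_on S (partial_deriv i u)" using continuous_L1loc unfolding L1loc_on_def by blast+
 qed
 show ?thesis unfolding has_weak_partial_def
 proof (intro conjI allI impI L)
  fix \<phi> assume \<phi>: "test_function S \<phi>"
  let ?K = "closure {x. \<phi> x \<noteq> 0}"
  have K: "compact ?K" "?K \<subseteq> S" and c\<phi>: "Cinf \<phi>" using \<phi> by (auto simp: test_function_def)
  obtain u0 U where u0: "Cinf u0" "open U" "?K \<subseteq> U" "\<forall>x\<in>U. u0 x = u x" using loc[OF K] by (elim exE conjE)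
  have \<phi>0: "\<phi> x = 0" if "x \<notin> ?K" for x using that closure_subset[of "{x. \<phi> x \<noteq> 0}"] by auto
  have \<phi>1: "partial_deriv i \<phi> x = 0" if "x \<notin> ?K" for x
  proof (rule partial_deriv_outside[where U = "- ?K"])
   show "open (- ?K)" by (rule open_Compl[OF closed_closure])
   show "x \<in> - ?K" using that unfolding Compl_iff .
   show "\<phi> y = 0" if "y \<in> - ?K" for y using that unfolding Compl_iff by (rule \<phi>0)
  qed
  have e1: "u x * partial_deriv i \<phi> x = u0 x * partial_deriv i \<phi> x" for x
  proof (cases "x \<in> ?K")
   case True
   then have "u0 x = u x" using bspec[OF u0(4) subsetD[OF u0(3)]] by (simp only:)
   then show ?thesis by (simp only:)
  next
   case False
   then show ?thesis by (simp only: \<phi>1[OF False] mult_zero_right)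
  qed
  have e2: "partial_deriv i u x * \<phi> x = partial_deriv i u0 x * \<phi> x" for x
  proof (cases "x \<in> ?K")
   case True
   then show ?thesis using eqd[OF u0(1,2) subsetD[OF u0(3)] u0(4)] by (simp only:)
  next
   case False
   then show ?thesis by (simp only: \<phi>0[OF False] mult_zero_right)
  qed
  obtain R where R: "\<And>x. norm x > R ==> \<phi> x = 0" using test_function_bounded_support[OF \<phi>] by metis
  have c1: "continuous_on UNIV (%x. u0 x * partial_deriv i \<phi> x)" "continuous_on UNIV (%x. partial_deriv i u0 x * \<phi> x)"
   using u0(1) c\<phi> i by (auto intro!: continuous_on_mult intro: Cinf_continuous Cinf_partial)
  have i1: "integrable lborel (%x. u0 x * partial_deriv i \<phi> x)"
   by (rule continuous_bounded_support(1)[OF c1(1), of R]) (simp add: partial_deriv_0_outside_cball[OF R])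
  have i2: "integrable lborel (%x. partial_deriv i u0 x * \<phi> x)"
   by (rule continuous_bounded_support(1)[OF c1(2), of R]) (simp add: R)
  have "(\<integral>x. u0 x * partial_deriv i \<phi> x \<partial>lborel) + (\<integral>x. partial_deriv i u0 x * \<phi> x \<partial>lborel)
   = (\<integral>x. partial_deriv i (%x. u0 x * \<phi> x) x \<partial>lborel)" using i1 i2 by (simp add: partial_deriv_mult[OF u0(1) c\<phi>])
  also have "\<dots> = 0" by (rule integral_partial_deriv_0[OF Cinf_mult[OF u0(1) c\<phi>], of R]) (use R i in auto)
  finally have "(\<integral>x. u0 x * partial_deriv i \<phi> x \<partial>lborel) = - (\<integral>x. partial_deriv i u0 x * \<phi> x \<partial>lborel)" by linarith
  moreover have "(LINT x:S|lebesgue. u0 x * partial_deriv i \<phi> x) = (\<integral>x. u0 x * partial_deriv i \<phi> x \<partial>lborel)"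
   by (rule set_lebesgue_integral_support[OF _ borel_measurable_continuous_onI[OF c1(1)]])
    (drule contra_subsetD[OF K(2)], simp only: \<phi>1 mult_zero_right not_False_eq_True)
  moreover have "(LINT x:S|lebesgue. partial_deriv i u0 x * \<phi> x) = (\<integral>x. partial_deriv i u0 x * \<phi> x \<partial>lborel)"
   by (rule set_lebesgue_integral_support[OF _ borel_measurable_continuous_onI[OF c1(2)]])
    (drule contra_subsetD[OF K(2)], simp only: \<phi>0 mult_zero_right not_False_eq_True)
  ultimately show "(LINT x:S|lebesgue. u x * partial_deriv i \<phi> x) = - (LINT x:S|lebesgue. partial_deriv i u x * \<phi> x)"
   by (simp add: e1 e2)
 qed
qed

section \<open>The fundamental lemma of the calculus of variations\<close>

lemma box_test_functions:
 fixes c d :: "'a::euclidean_space"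
 assumes "cbox c d \<subseteq> S"
 obtains \<psi> where "\<And>k. test_function S (\<psi> k)" "\<And>k x. \<bar>\<psi> k x\<bar> \<le> indicator (cbox c d) x"
  "\<And>x. (%k. \<psi> k x) \<longlonglongrightarrow> indicator (box c d) x"
proof -
 \<comment> \<open>Each factor is 1 as soon as \<open>k\<close> times the distance of
   \<open>x\<close> to the corresponding face is at least 1, and 0 beyond the face; hence the limit
   is the indicator of the open box.\<close>
 define \<psi> where "\<psi> k x = (\<Prod>i\<in>Basis. smooth_step (real k * (x \<bullet> i - c \<bullet> i)) * smooth_step (real k * (d \<bullet> i - x \<bullet> i)))" for k :: nat and x :: 'a
 have C: "Cinf (\<psi> k)" for k unfolding \<psi>_def
  by (intro Cinf_prod Cinf_mult Cinf_compose_real[OF Cinf_smooth_step] Cinf_const Cinf_diff Cinf_inner)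
 have z: "\<psi> k x = 0" if "x \<notin> box c d" for k x
 proof -
  have "\<exists>i\<in>Basis. x \<bullet> i \<le> c \<bullet> i \<or> d \<bullet> i \<le> x \<bullet> i" using that unfolding mem_box by (meson not_less)
  then obtain i where i: "i \<in> Basis" "x \<bullet> i \<le> c \<bullet> i \<or> d \<bullet> i \<le> x \<bullet> i" by (rule bexE)
  then have "smooth_step (real k * (x \<bullet> i - c \<bullet> i)) * smooth_step (real k * (d \<bullet> i - x \<bullet> i)) = 0"
   using smooth_step_0 by (auto simp: mult_nonneg_nonpos)
  then show ?thesis unfolding \<psi>_def using i(1) by (auto simp: prod_zero_iff)
 qed
 have b: "0 \<le> \<psi> k x" "\<psi> k x \<le> 1" for k x unfolding \<psi>_def using smooth_step_bounds
  by (auto intro!: prod_nonneg prod_le_1 mult_nonneg_nonneg mult_le_one)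
 have "closure {x. \<psi> k x \<noteq> 0} \<subseteq> cbox c d" for k
  by (rule closure_minimal) (use z box_subset_cbox[of c d] in "auto simp: closed_cbox")
 then have t: "test_function S (\<psi> k)" for k unfolding test_function_def using C assms
  by (meson bounded_cbox bounded_subset closed_closure compact_eq_bounded_closed dual_order.trans)
 show ?thesis
 proof (rule that[OF t])
  show "\<bar>\<psi> k x\<bar> \<le> indicator (cbox c d) x" for k x
   using b[of k x] z[of x k] box_subset_cbox[of c d] by (auto simp: indicator_def)
  fix x show "(%k. \<psi> k x) \<longlonglongrightarrow> indicator (box c d) x"
  proof (cases "x \<in> box c d")
   case True
   have "\<forall>\<^sub>F k in sequentially. \<forall>i\<in>Basis. real k * (x \<bullet> i - c \<bullet> i) \<ge> 1 \<and> real k * (d \<bullet> i - x \<bullet> i) \<ge> 1"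
   proof (rule eventually_ball_finite, simp, intro ballI eventually_conj)
    fix i :: 'a assume "i \<in> Basis"
    then have p: "x \<bullet> i - c \<bullet> i > 0" "d \<bullet> i - x \<bullet> i > 0" using True by (auto simp: mem_box)
    have "filterlim (%k. real k * e) at_top sequentially" if "e > 0" for e :: real
     using filterlim_tendsto_pos_mult_at_top[OF tendsto_const that filterlim_real_sequentially] by (simp add: mult.commute)
    then show "\<forall>\<^sub>F k in sequentially. real k * (x \<bullet> i - c \<bullet> i) \<ge> 1"
     "\<forall>\<^sub>F k in sequentially. real k * (d \<bullet> i - x \<bullet> i) \<ge> 1" using p by (auto simp: filterlim_at_top)
   qed
   then have "\<forall>\<^sub>F k in sequentially. \<psi> k x = 1" by eventually_elim (auto simp: \<psi>_def smooth_step_1 intro!: prod.neutral)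
   then show ?thesis using True by (auto intro: tendsto_eventually)
  qed (simp add: z)
 qed
qed

lemma indicator_box_lebesgue: "indicator (box c d) \<in> borel_measurable lebesgue" by (rule borel_measurable_indicator) simp

text \<open>The positive and the negative part of \<open>w\<close> are densities of two measures
  that agree on all boxes. Boxes generate the Borel sets and are stable under intersection, so the
  measures agree, and then so do the densities.\<close>

lemma AE_eq_0_box_integrals:
 fixes w :: "'a::euclidean_space => real"
 assumes w: "w absolutely_integrable_on cbox a b"
  and z: "\<And>c d. cbox c d \<subseteq> cbox a b ==> (LINT x:box c d|lebesgue. w x) = 0"
 shows "AE x in lebesgue. x \<in> box a b \<longrightarrow> w x = 0"
proof -
 have wi: "integrable lebesgue (%x. indicator (box a b) x * w x)"
  using set_integrable_subset[OF w, of "box a b"] box_subset_cbox[of a b] by (simp add: set_integrable_def)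
 \<comment> \<open>Uniqueness of measures and densities is applied on Borel sets; \<open>w\<close>
   is therefore cut off to the box and replaced by a Borel function.\<close>
 obtain w' where w': "w' \<in> borel_measurable lborel" "AE x in lborel. indicator (box a b) x * w x = w' x"
  using completion_ex_borel_measurable_real[OF borel_measurable_integrable[OF wi]] by auto
 have wi': "integrable lborel w'"
 proof -
  have "integrable lebesgue w'" using wi by (rule Bochner_Integration.integrable_cong_AE_imp)
    (use w' in "auto intro: measurable_completion AE_completion")
  then show ?thesis using w'(1) by (simp add: integrable_completion)
 qed
 \<comment> \<open>\<open>ennreal\<close> sends negative numbers to 0, so these are the positive and
   the negative part.\<close>
 define f g where "f x = ennreal (w' x)" and "g x = ennreal (- w' x)" for x
 have fg: "f \<in> borel_measurable lborel" "g \<in> borel_measurable lborel" using w'(1) unfolding f_def g_def by measurable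
 have fin: "(\<integral>\<^sup>+x. f x \<partial>lborel) < \<infinity>" "(\<integral>\<^sup>+x. g x \<partial>lborel) < \<infinity>"
  using real_integrable_def wi' by (auto simp: f_def g_def less_top[symmetric])
 have box_eq: "emeasure (density lborel f) (box c d) = emeasure (density lborel g) (box c d)" for c d
 proof -
  let ?w = "%x. indicator (box c d) x * w' x"
  obtain c' d' where cd: "box c d \<inter> box a b = box c' d'" by (rule that[OF box_Int_box])
  \<comment> \<open>An empty intersection may be presented with corners anywhere, hence the second
    alternative.\<close>
  have "cbox c' d' \<subseteq> cbox a b \<or> box c' d' = {}"
   using cd by (metis box_subset_cbox closure_box closure_minimal closed_cbox inf_le2 subset_trans)
  then have "(LINT x:box c' d'|lebesgue. w x) = 0" using z[of c' d'] by (auto simp: set_lebesgue_integral_def)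
  also have "(LINT x:box c' d'|lebesgue. w x) = (\<integral>x. ?w x \<partial>lebesgue)"
   unfolding set_lebesgue_integral_def
  proof (rule integral_cong_AE)
   have "AE x in lebesgue. indicator (box a b) x * w x = w' x" using w'(2) by (rule AE_completion)
   then show "AE x in lebesgue. indicator (box c' d') x *\<^sub>R w x = ?w x"
   proof eventually_elim
    case (elim x)
    have "indicator (box c' d') x = indicator (box c d) x * (indicator (box a b) x :: real)"
     unfolding cd[symmetric] by (simp add: indicator_inter_arith)
    then show ?case using elim by simp
   qed
   have "(%x. indicator (box c' d') x *\<^sub>R w x) = (%x. indicator (box c d) x * (indicator (box a b) x * w x))"
    unfolding cd[symmetric] by (simp add: indicator_inter_arith fun_eq_iff)
   then show "(%x. indicator (box c' d') x *\<^sub>R w x) \<in> borel_measurable lebesgue"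
    using borel_measurable_integrable[OF wi] indicator_box_lebesgue by (simp only:) (rule borel_measurable_times)
   show "?w \<in> borel_measurable lebesgue"
    using w'(1) by (intro borel_measurable_times measurable_completion) auto
  qed
  also have "\<dots> = (\<integral>x. ?w x \<partial>lborel)" using w'(1) by (intro integral_completion) auto
  finally have 0: "(\<integral>x. ?w x \<partial>lborel) = 0" by simp
  have ib: "integrable lborel ?w"
   using integrable_mult_indicator[OF _ wi', of "box c d"] by simp
  have "enn2real (\<integral>\<^sup>+x. ennreal (?w x) \<partial>lborel)
    = enn2real (\<integral>\<^sup>+x. ennreal (- (?w x)) \<partial>lborel)" using 0 real_lebesgue_integral_def[OF ib] by simp
  moreover have "(\<integral>\<^sup>+x. ennreal (?w x) \<partial>lborel) < \<infinity>"
    "(\<integral>\<^sup>+x. ennreal (- (?w x)) \<partial>lborel) < \<infinity>"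
   using ib unfolding real_integrable_def by (auto simp: less_top[symmetric])
  ultimately have "(\<integral>\<^sup>+x. ennreal (?w x) \<partial>lborel)
    = (\<integral>\<^sup>+x. ennreal (- (?w x)) \<partial>lborel)" by (metis ennreal_enn2real infinity_ennreal_def)
  moreover have "ennreal (?w x) = f x * indicator (box c d) x"
   "ennreal (- (?w x)) = g x * indicator (box c d) x" for x by (auto simp: f_def g_def indicator_def)
  ultimately show ?thesis using fg by (simp add: emeasure_density)
 qed
 have gen: "sets (borel :: 'a measure) = sigma_sets UNIV (range (%(c, d). box c d))"
  by (subst borel_eq_box) (rule sets_measure_of, simp)
 have "density lborel f = density lborel g"
 proof (rule measure_eqI_generator_eq[where E = "range (%(c, d). box c d)" and \<Omega> = UNIV and A = "%n::nat. box (- real n *\<^sub>R One) (real n *\<^sub>R One)"])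
  show "Int_stable (range (%(c, d). box c d :: 'a set))" unfolding Int_stable_def by (auto simp: image_iff box_Int_box)
  show "sets (density lborel f) = sigma_sets UNIV (range (%(c, d). box c d))"
   "sets (density lborel g) = sigma_sets UNIV (range (%(c, d). box c d))" using gen by simp_all
  show "(\<Union>n. box (- real n *\<^sub>R One) (real n *\<^sub>R One)) = (UNIV :: 'a set)" using UN_box_eq_UNIV by simp
  show "emeasure (density lborel f) (box (- real n *\<^sub>R One) (real n *\<^sub>R One)) \<noteq> \<infinity>" for n
  proof -
   have "(\<integral>\<^sup>+x. f x * indicator (box (- real n *\<^sub>R One) (real n *\<^sub>R One)) x \<partial>lborel) \<le> (\<integral>\<^sup>+x. f x \<partial>lborel)"
    by (intro nn_integral_mono) (auto simp: indicator_def)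
   then show ?thesis using fg(1) fin(1) by (simp add: emeasure_density top_unique)
  qed
 qed (use box_eq in auto)
 then have "AE x in lborel. f x = g x"
  using sigma_finite_measure.density_unique[OF lborel.sigma_finite_measure_axioms fg] by simp
 then have "AE x in lborel. w' x = 0"
 proof eventually_elim
  case (elim x)
  then show ?case by (cases "w' x" "0::real" rule: linorder_cases) (auto simp: f_def g_def ennreal_neg ennreal_eq_0_iff)
 qed
 with w'(2) have "AE x in lborel. indicator (box a b) x * w x = 0" by eventually_elim simp
 then have "AE x in lebesgue. indicator (box a b) x * w x = 0" by (rule AE_completion)
 then show ?thesis by eventually_elim (auto simp: indicator_def split: if_splits)
qed

text \<open>Dominated convergence along the functions of \<open>box_test_functions\<close> shows
  that \<open>w\<close> has integral 0 over every open box with closure in \<open>S\<close>.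
  Countably many boxes exhaust \<open>S\<close>, and their boundaries are null sets.\<close>

lemma AE_eq_0_test_functions:
 fixes w :: "'a::euclidean_space => real"
 assumes S: "open S" and w: "L1loc_on S w"
  and z: "\<And>\<phi>. test_function S \<phi> ==> (LINT x:S|lebesgue. w x * \<phi> x) = 0"
 shows "AE x in lebesgue. x \<in> S \<longrightarrow> w x = 0"
proof -
 obtain \<D> where \<D>: "countable \<D>" "\<And>X. X \<in> \<D> ==> X \<subseteq> S" "\<And>X. X \<in> \<D> ==> \<exists>a b. X = cbox a b" "\<Union>\<D> = S"
  by (rule open_countable_Union_open_cbox[OF S]) blast
 have "AE x in lebesgue. x \<in> X \<longrightarrow> w x = 0" if X: "X \<in> \<D>" for X
 proof -
  obtain a b where ab: "X = cbox a b" using \<D>(3)[OF X] by blast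
  have wX: "w absolutely_integrable_on cbox a b" using w \<D>(2)[OF X] ab unfolding L1loc_on_def by auto
  have "AE x in lebesgue. x \<in> box a b \<longrightarrow> w x = 0"
  proof (rule AE_eq_0_box_integrals[OF wX])
   fix c d assume cd: "cbox c d \<subseteq> cbox a b"
   then have cdS: "cbox c d \<subseteq> S" using \<D>(2)[OF X] ab by auto
   let ?v = "%x. indicator (cbox c d) x * w x" and ?b = "%x. indicator (box c d) x * w x"
   obtain \<psi> where \<psi>: "\<And>k. test_function S (\<psi> k)" "\<And>k x. \<bar>\<psi> k x\<bar> \<le> indicator (cbox c d) x"
    "\<And>x. (%k. \<psi> k x) \<longlonglongrightarrow> indicator (box c d) x" using box_test_functions[OF cdS] by metis
   have wi: "integrable lebesgue ?v"
    using set_integrable_subset[OF wX, of "cbox c d"] cd by (simp add: set_integrable_def)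
   have eq: "indicator S x *\<^sub>R (w x * \<psi> k x) = ?v x * \<psi> k x" for k x
    using \<psi>(2)[of k x] cdS by (auto simp: indicator_def)
   have \<psi>m: "\<psi> k \<in> borel_measurable lebesgue" for k using \<psi>(1)[of k] Cinf_continuous[of "\<psi> k"] unfolding test_function_def
    by (intro measurable_completion) (simp add: borel_measurable_continuous_onI)
   have "(%k. \<integral>x. ?v x * \<psi> k x \<partial>lebesgue)
     \<longlonglongrightarrow> (\<integral>x. ?b x \<partial>lebesgue)"
   proof (rule integral_dominated_convergence[where w = "%x. \<bar>?v x\<bar>"])
    have "?b = (%x. indicator (box c d) x * ?v x)"
     using box_subset_cbox[of c d] by (auto simp: indicator_def fun_eq_iff)
    then show "?b \<in> borel_measurable lebesgue"
     using borel_measurable_integrable[OF wi] indicator_box_lebesgue by (simp only:) (rule borel_measurable_times)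
    show "(%x. ?v x * \<psi> k x) \<in> borel_measurable lebesgue" for k
     using borel_measurable_integrable[OF wi] \<psi>m by (rule borel_measurable_times)
    show "AE x in lebesgue. (%k. ?v x * \<psi> k x) \<longlonglongrightarrow> ?b x"
    proof (rule AE_I2)
     fix x
     have "(%k. ?v x * \<psi> k x) \<longlonglongrightarrow> ?v x * indicator (box c d) x"
      by (intro tendsto_mult_left \<psi>(3))
     moreover have "?v x * indicator (box c d) x = ?b x"
      using box_subset_cbox[of c d] by (auto simp: indicator_def)
     ultimately show "(%k. ?v x * \<psi> k x) \<longlonglongrightarrow> ?b x" by simp
    qed
    show "AE x in lebesgue. norm (?v x * \<psi> k x) \<le> \<bar>?v x\<bar>" for k
    proof (rule AE_I2)
     fix x
     have "\<bar>\<psi> k x\<bar> \<le> 1" using \<psi>(2)[of k x] by (cases "x \<in> cbox c d") auto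
     then show "norm (?v x * \<psi> k x) \<le> \<bar>?v x\<bar>"
      unfolding real_norm_def abs_mult[of _ "\<psi> k x"] by (rule mult_left_le) simp
    qed
   qed (use wi in auto)
   moreover have "(\<integral>x. ?v x * \<psi> k x \<partial>lebesgue) = 0" for k
    using z[OF \<psi>(1)[of k]] unfolding set_lebesgue_integral_def eq by simp
   ultimately have "(\<integral>x. ?b x \<partial>lebesgue) = 0" using LIMSEQ_unique[of "%_. 0::real"] by auto
   then show "(LINT x:box c d|lebesgue. w x) = 0" by (simp add: set_lebesgue_integral_def)
  qed
  moreover have "AE x in lebesgue. x \<notin> cbox a b - box a b"
  proof -
   have "cbox a b - box a b \<in> null_sets lebesgue"
    using negligible_frontier_interval[of a b] by (simp add: negligible_iff_null_sets)
   then show ?thesis by (rule AE_not_in)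
  qed
  ultimately show ?thesis by eventually_elim (auto simp: ab)
 qed
 then have "AE x in lebesgue. \<forall>X\<in>\<D>. x \<in> X \<longrightarrow> w x = 0" by (subst AE_ball_countable[OF \<D>(1)]) simp
 then show ?thesis by eventually_elim (use \<D>(4) in auto)
qed

section \<open>Products with test functions; uniqueness and linearity of weak derivatives\<close>

lemma L1loc_mult_test:
 fixes w :: "'a::euclidean_space => real"
 assumes w: "L1loc_on S w" and c: "continuous_on UNIV \<psi>" and K: "compact K" "K \<subseteq> S" "\<And>x. x \<notin> K ==> \<psi> x = 0"
 shows "set_integrable lebesgue S (%x. w x * \<psi> x)"
proof -
 have wi: "integrable lebesgue (%x. indicator K x * w x)" using w K unfolding L1loc_on_def by (auto simp: set_integrable_def)
 obtain R where R: "K \<subseteq> cball 0 R" using compact_imp_bounded[OF K(1)] unfolding bounded_pos by (auto simp: subset_iff)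
 have wR: "(%x. indicator K x * w x) absolutely_integrable_on cball 0 R"
  unfolding set_integrable_def using integrable_mult_indicator[OF _ wi, of "cball 0 R"] by simp
 obtain B where B: "\<And>x. \<bar>\<psi> x\<bar> \<le> B"
  using continuous_bounded_support(2)[OF c, of R] K(3) R by (metis linorder_not_le mem_cball_0 subsetD)
 have "integrable lebesgue (%x. (indicator K x * w x) * \<psi> x)"
 proof (rule integrable_mult_bounded_support(1)[OF wR _ _ B])
  show "\<psi> \<in> borel_measurable lebesgue" using c by (intro measurable_completion) (simp add: borel_measurable_continuous_onI)
  show "\<psi> y = 0" if "norm y > R" for y using that K(3) R by force
 qed
 moreover have "(%x. (indicator K x * w x) * \<psi> x) = (%x. indicator S x *\<^sub>R (w x * \<psi> x))"
  using K(2,3) by (auto simp: indicator_def fun_eq_iff)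
 ultimately show ?thesis by (simp add: set_integrable_def)
qed

lemma test_function_integrable:
 assumes "test_function S \<phi>" "L1loc_on S w"
 shows "set_integrable lebesgue S (%x. w x * \<phi> x)"
  and "i \<in> Basis ==> set_integrable lebesgue S (%x. w x * partial_deriv i \<phi> x)"
proof -
 let ?K = "closure {x. \<phi> x \<noteq> 0}"
 have K: "compact ?K" "?K \<subseteq> S" "Cinf \<phi>" using assms(1) by (auto simp: test_function_def)
 have 0: "\<phi> x = 0" if "x \<notin> ?K" for x using that closure_subset[of "{x. \<phi> x \<noteq> 0}"] by auto
 have 1: "partial_deriv i \<phi> x = 0" if "x \<notin> ?K" for x i
 proof (rule partial_deriv_outside[where U = "- ?K"])
  show "open (- ?K)" by (rule open_Compl[OF closed_closure])
  show "x \<in> - ?K" using that unfolding Compl_iff .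
  show "\<phi> y = 0" if "y \<in> - ?K" for y using that unfolding Compl_iff by (rule 0)
 qed
 show "set_integrable lebesgue S (%x. w x * \<phi> x)" by (rule L1loc_mult_test[OF assms(2) Cinf_continuous[OF K(3)] K(1,2) 0])
 show "set_integrable lebesgue S (%x. w x * partial_deriv i \<phi> x)" if "i \<in> Basis"
  by (rule L1loc_mult_test[OF assms(2) Cinf_continuous[OF Cinf_partial[OF K(3) that]] K(1,2) 1])
qed

lemma L1loc_diff: "L1loc_on S u ==> L1loc_on S v ==> L1loc_on S (%x. u x - v x)"
 and L1loc_add: "L1loc_on S u ==> L1loc_on S v ==> L1loc_on S (%x. u x + v x)"
 and L1loc_cmult: "L1loc_on S u ==> L1loc_on S (%x. c * u x)"
 unfolding L1loc_on_def by (auto intro: set_integral_diff(1) set_integral_add(1))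

lemma has_weak_partial_unique:
 assumes "open S" "has_weak_partial S i u w" "has_weak_partial S i u w'"
 shows "AE x in lebesgue. x \<in> S \<longrightarrow> w x = w' x"
proof -
 have "AE x in lebesgue. x \<in> S \<longrightarrow> w x - w' x = 0"
 proof (rule AE_eq_0_test_functions[OF assms(1)])
  show "L1loc_on S (%x. w x - w' x)" using assms(2,3) L1loc_diff by (auto simp: has_weak_partial_def)
  fix \<phi> assume \<phi>: "test_function S \<phi>"
  have "(LINT x:S|lebesgue. w x * \<phi> x) = (LINT x:S|lebesgue. w' x * \<phi> x)"
   using assms(2,3) \<phi> unfolding has_weak_partial_def by (metis add.inverse_inverse)
  then show "(LINT x:S|lebesgue. (w x - w' x) * \<phi> x) = 0"
   using test_function_integrable(1)[OF \<phi>] assms(2,3) by (simp add: left_diff_distrib has_weak_partial_def)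
 qed
 then show ?thesis by eventually_elim auto
qed

lemma has_weak_partial_lincomb:
 assumes "i \<in> Basis" "has_weak_partial S i u w" "has_weak_partial S i v z"
 shows "has_weak_partial S i (%x. u x + c * v x) (%x. w x + c * z x)" unfolding has_weak_partial_def
proof (intro conjI allI impI)
 show "L1loc_on S (%x. u x + c * v x)" "L1loc_on S (%x. w x + c * z x)"
  using assms(2,3) by (auto simp: has_weak_partial_def intro!: L1loc_add L1loc_cmult)
 fix \<phi> assume \<phi>: "test_function S \<phi>"
 note I = test_function_integrable[OF \<phi>]
 have L: "L1loc_on S u" "L1loc_on S v" "L1loc_on S w" "L1loc_on S z" using assms(2,3) by (auto simp: has_weak_partial_def)
 have "(LINT x:S|lebesgue. (u x + c * v x) * partial_deriv i \<phi> x) =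
  (LINT x:S|lebesgue. u x * partial_deriv i \<phi> x) + c * (LINT x:S|lebesgue. v x * partial_deriv i \<phi> x)"
  using I(2)[OF L(1) assms(1)] I(2)[OF L(2) assms(1)] by (simp add: distrib_right mult.assoc set_integral_add)
 also have "\<dots> = - ((LINT x:S|lebesgue. w x * \<phi> x) + c * (LINT x:S|lebesgue. z x * \<phi> x))"
  using assms(2,3) \<phi> by (simp add: has_weak_partial_def)
 also have "(LINT x:S|lebesgue. w x * \<phi> x) + c * (LINT x:S|lebesgue. z x * \<phi> x) = (LINT x:S|lebesgue. (w x + c * z x) * \<phi> x)"
  using I(1)[OF L(3)] I(1)[OF L(4)] by (simp add: distrib_right mult.assoc set_integral_add)
 finally show "(LINT x:S|lebesgue. (u x + c * v x) * partial_deriv i \<phi> x) = - (LINT x:S|lebesgue. (w x + c * z x) * \<phi> x)" .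
qed

subsection \<open>Powers of \<open>L\<^sup>p\<close> norms\<close>

definition Lpow :: "'a measure => real => ('a => 'b::euclidean_space) => ennreal" where
 "Lpow M p f = (\<integral>\<^sup>+x. ennreal (norm (f x) powr p) \<partial>M)"

text \<open>Bounding a sum by twice the larger term avoids convexity, so the inequality holds for
  all positive \<open>p\<close>, with \<open>2 powr p\<close> in place of a sharp constant.\<close>

lemma powr_add_le:
 fixes a b :: "'b::real_normed_vector"
 assumes "p > 0"
 shows "norm (a + b) powr p \<le> 2 powr p * (norm a powr p + norm b powr p)"
proof -
 have "norm (a + b) \<le> 2 * max (norm a) (norm b)" using norm_triangle_ineq[of a b] by linarith
 then have "norm (a + b) powr p \<le> (2 * max (norm a) (norm b)) powr p" using assms by (intro powr_mono2) auto
 also have "\<dots> = 2 powr p * max (norm a) (norm b) powr p" by (rule powr_mult)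
 also have "\<dots> \<le> 2 powr p * (norm a powr p + norm b powr p)" by (intro mult_left_mono) (auto simp: max_def)
 finally show ?thesis .
qed

lemma powr_diff_le:
 fixes a b :: "'b::real_normed_vector"
 assumes "p > 0"
 shows "norm (a - b) powr p \<le> 2 powr p * (norm a powr p + norm b powr p)" using powr_add_le[OF assms, of a "- b"] by simp

lemma Lpow_cong_AE: "AE x in M. f x = g x ==> Lpow M p f = Lpow M p g" unfolding Lpow_def by (intro nn_integral_cong_AE) auto

lemma Lpow_mono: "(\<And>x. x \<in> space M ==> norm (f x) \<le> norm (g x)) ==> p > 0 ==> Lpow M p f \<le> Lpow M p g"
 unfolding Lpow_def by (intro nn_integral_mono ennreal_leI powr_mono2) auto

lemma Lpow_add_le:
 assumes "p > 0" "f \<in> borel_measurable M" "g \<in> borel_measurable M"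
 shows "Lpow M p (%x. f x + g x) \<le> ennreal (2 powr p) * (Lpow M p f + Lpow M p g)"
proof -
 have "Lpow M p (%x. f x + g x)
   \<le> (\<integral>\<^sup>+x. ennreal (2 powr p) * (ennreal (norm (f x) powr p) + ennreal (norm (g x) powr p)) \<partial>M)" unfolding Lpow_def
  by (intro nn_integral_mono)
   (use powr_add_le[OF assms(1)] in "simp add: ennreal_plus[symmetric] ennreal_mult[symmetric] del: ennreal_plus")
 also have "\<dots> = ennreal (2 powr p) * (Lpow M p f + Lpow M p g)"
  unfolding Lpow_def using assms by (simp add: nn_integral_cmult nn_integral_add)
 finally show ?thesis .
qed

lemma Lpow_uminus [simp]: "Lpow M p (%x. - f x) = Lpow M p f" by (simp add: Lpow_def)

lemma Lpow_diff_le: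
 assumes "p > 0" "f \<in> borel_measurable M" "g \<in> borel_measurable M"
 shows "Lpow M p (%x. f x - g x) \<le> ennreal (2 powr p) * (Lpow M p f + Lpow M p g)"
 using Lpow_add_le[of p f M "%x. - g x"] assms by simp

lemma Lpow_scaleR:
 assumes "f \<in> borel_measurable M"
 shows "Lpow M p (%x. c *\<^sub>R f x) = ennreal (\<bar>c\<bar> powr p) * Lpow M p f" unfolding Lpow_def using assms
 by (subst nn_integral_cmult[symmetric]) (auto simp: powr_mult ennreal_mult intro!: nn_integral_cong)

lemma Lpow_add_fin:
 assumes "p > 0" "f \<in> borel_measurable M" "g \<in> borel_measurable M" "Lpow M p f < \<infinity>" "Lpow M p g < \<infinity>"
 shows "Lpow M p (%x. f x + g x) < \<infinity>"
 by (rule le_less_trans[OF Lpow_add_le[OF assms(1-3)]]) (use assms(4,5) in "simp add: ennreal_mult_less_top")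

lemma Lpow_diff_fin:
 assumes "p > 0" "f \<in> borel_measurable M" "g \<in> borel_measurable M" "Lpow M p f < \<infinity>" "Lpow M p g < \<infinity>"
 shows "Lpow M p (%x. f x - g x) < \<infinity>"
 by (rule le_less_trans[OF Lpow_diff_le[OF assms(1-3)]]) (use assms(4,5) in "simp add: ennreal_mult_less_top")

lemma Lpow_scaleR_fin:
 assumes "f \<in> borel_measurable M" "Lpow M p f < \<infinity>"
 shows "Lpow M p (%x. c *\<^sub>R f x) < \<infinity>" using assms by (simp add: Lpow_scaleR ennreal_mult_less_top)

lemma tendsto_zero_ennreal_le:
 fixes f g :: "'a => ennreal"
 assumes "(g \<longlongrightarrow> 0) F" "\<And>x. f x \<le> g x" shows "(f \<longlongrightarrow> 0) F" by (rule tendsto_sandwich[of "%_. 0"]) (use assms in auto)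

lemma tendsto_cmult_zero_ennreal:
 fixes f :: "'a => ennreal"
 assumes "(f \<longlongrightarrow> 0) F" "c < \<infinity>" shows "((%x. c * f x) \<longlongrightarrow> 0) F" using ennreal_tendsto_cmult[of c f 0 F] assms by simp

lemma tendsto_add_zero_ennreal:
 fixes f g :: "'a => ennreal"
 assumes "(f \<longlongrightarrow> 0) F" "(g \<longlongrightarrow> 0) F" shows "((%x. f x + g x) \<longlongrightarrow> 0) F" using tendsto_add[OF assms] by simp

lemma Lpow_tendsto_add:
 assumes "p > 0" "\<And>n. f n \<in> borel_measurable M" "\<And>n. g n \<in> borel_measurable M"
  and "(%n. Lpow M p (f n)) \<longlonglongrightarrow> 0" "(%n. Lpow M p (g n)) \<longlonglongrightarrow> 0"
 shows "(%n. Lpow M p (%x. f n x + g n x)) \<longlonglongrightarrow> 0"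
 by (rule tendsto_zero_ennreal_le[OF tendsto_cmult_zero_ennreal[OF tendsto_add_zero_ennreal[OF assms(4,5)], of "ennreal (2 powr p)"]])
  (use assms in "auto intro: Lpow_add_le")

lemma Lpow_tendsto_scaleR:
 assumes "\<And>n. f n \<in> borel_measurable M" "(%n. Lpow M p (f n)) \<longlonglongrightarrow> 0"
 shows "(%n. Lpow M p (%x. c *\<^sub>R f n x)) \<longlonglongrightarrow> 0" using tendsto_cmult_zero_ennreal[OF assms(2), of "ennreal (\<bar>c\<bar> powr p)"] assms(1)
 by (simp add: Lpow_scaleR)

lemma tendsto_0_ennreal_eps:
 fixes a :: "nat => ennreal"
 assumes "\<And>e. e > 0 ==> \<exists>N. \<forall>n\<ge>N. a n \<le> ennreal e"
 shows "a \<longlonglongrightarrow> 0"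
proof (rule order_tendstoI)
 fix y :: ennreal assume "0 < y"
 then obtain e where e: "0 < ennreal e" "ennreal e < y" "e > 0"
  by (metis dense ennreal_cases ennreal_less_zero_iff less_top order_less_trans top_neq_ennreal less_irrefl)
 obtain N where "\<And>n. n \<ge> N ==> a n \<le> ennreal e" using assms[OF e(3)] by blast
 then show "\<forall>\<^sub>F n in sequentially. a n < y"
  using e(2) by (auto simp: eventually_sequentially intro!: exI[of _ N] intro: le_less_trans)
qed auto

text \<open>If the integrals are summable, the series is finite almost everywhere, and the terms of
  a finite series tend to 0.\<close>

lemma AE_tendsto_0_suminf:
 fixes g :: "nat => 'a => ennreal"
 assumes [measurable]: "\<And>k. g k \<in> borel_measurable M" and s: "(\<Sum>k. \<integral>\<^sup>+x. g k x \<partial>M) < \<infinity>"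
 shows "AE x in M. (%k. g k x) \<longlonglongrightarrow> 0"
proof -
 have "(\<integral>\<^sup>+x. (\<Sum>k. g k x) \<partial>M) \<noteq> \<infinity>" using s by (subst nn_integral_suminf) auto
 then have "AE x in M. (\<Sum>k. g k x) \<noteq> \<infinity>" by (intro nn_integral_PInf_AE) auto
 then show ?thesis
 proof eventually_elim
  case (elim x)
  then have fin: "g k x \<noteq> \<infinity>" for k using ennreal_suminf_lessD[of "%k. g k x" \<infinity> k] by (auto simp: less_top)
  have "summable (%k. enn2real (g k x))"
  proof (rule summable_suminf_not_top)
   have "ennreal (enn2real (g k x)) = g k x" for k using fin[of k] by (simp add: less_top)
   then show "(\<Sum>k. ennreal (enn2real (g k x))) \<noteq> top" using elim by simp
  qed simp
  then have "(%k. enn2real (g k x)) \<longlonglongrightarrow> 0" by (rule summable_LIMSEQ_zero)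
  then have "(%k. ennreal (enn2real (g k x))) \<longlonglongrightarrow> ennreal 0" by (rule tendsto_ennrealI)
  moreover have "ennreal (enn2real (g k x)) = g k x" for k using fin[of k] by (simp add: less_top)
  ultimately show ?case by simp
 qed
qed

lemma ennreal_half_suminf: "(\<Sum>k. ennreal ((1/2)^k)) < \<infinity>" by (subst suminf_ennreal2) (auto simp: summable_geometric)

lemma tendsto_0_powrD:
 fixes a :: "nat => 'b::real_normed_vector"
 assumes "p > 0" "(%k. ennreal (norm (a k) powr p)) \<longlonglongrightarrow> 0"
 shows "a \<longlonglongrightarrow> 0"
proof -
 have "(%k. norm (a k) powr p) \<longlonglongrightarrow> 0" using assms(2) by (subst (asm) ennreal_0[symmetric], subst (asm) tendsto_ennreal_iff) auto
 then have "(%k. (norm (a k) powr p) powr (1 / p)) \<longlonglongrightarrow> 0 powr (1 / p)" by (intro tendsto_powr') (use assms(1) in auto)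
 then have "(%k. norm (a k)) \<longlonglongrightarrow> 0" using assms(1) by (simp add: powr_powr)
 then show ?thesis by (rule tendsto_norm_zero_cancel)
qed

lemma Lpow_AE_subseq:
 fixes f :: "nat => 'a => 'b::euclidean_space"
 assumes "p > 0" and [measurable]: "\<And>n. f n \<in> borel_measurable M" "g \<in> borel_measurable M"
  and lim: "(%n. Lpow M p (%x. f n x - g x)) \<longlonglongrightarrow> 0"
 obtains r where "strict_mono r" "AE x in M. (%k. f (r k) x) \<longlonglongrightarrow> g x"
proof -
 have "\<forall>\<^sub>F n in sequentially. Lpow M p (%x. f n x - g x) < ennreal ((1/2)^k)" for k by (rule order_tendstoD[OF lim]) simp
 then have ex: "\<exists>N. \<forall>n\<ge>N. Lpow M p (%x. f n x - g x) < ennreal ((1/2)^k)" for k by (auto simp: eventually_sequentially)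
 then obtain N where N: "\<And>k n. n \<ge> N k ==> Lpow M p (%x. f n x - g x) < ennreal ((1/2)^k)" by metis
 define r where "r = rec_nat (N 0) (%k m. max (Suc m) (N (Suc k)))"
 have r: "strict_mono r" "r k \<ge> N k" for k by (auto simp: r_def strict_mono_Suc_iff less_max_iff_disj) (cases k; simp add: r_def)
 have "(\<Sum>k. \<integral>\<^sup>+x. ennreal (norm (f (r k) x - g x) powr p) \<partial>M) \<le> (\<Sum>k. ennreal ((1/2)^k))"
  using N[OF r(2)] by (intro suminf_le) (auto simp: Lpow_def intro: less_imp_le)
 then have "AE x in M. (%k. ennreal (norm (f (r k) x - g x) powr p)) \<longlonglongrightarrow> 0"
  using ennreal_half_suminf by (intro AE_tendsto_0_suminf) (auto intro: le_less_trans)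
 then have "AE x in M. (%k. f (r k) x) \<longlonglongrightarrow> g x" by eventually_elim (rule LIM_zero_cancel, rule tendsto_0_powrD[OF assms(1)])
 with r(1) show ?thesis by (rule that)
qed

lemma Lpow_Fatou:
 fixes f :: "nat => 'a => 'b::euclidean_space"
 assumes [measurable]: "\<And>n. f n \<in> borel_measurable M" and p: "p > 0"
  and lim: "AE x in M. (%k. f k x) \<longlonglongrightarrow> g x"
 shows "Lpow M p g \<le> liminf (%k. Lpow M p (f k))"
proof -
 have "Lpow M p g = (\<integral>\<^sup>+x. liminf (%k. ennreal (norm (f k x) powr p)) \<partial>M)" unfolding Lpow_def
 proof (rule nn_integral_cong_AE, use lim in eventually_elim)
  case (elim x)
  have "(%k. ennreal (norm (f k x) powr p)) \<longlonglongrightarrow> ennreal (norm (g x) powr p)"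
   using elim p by (intro tendsto_ennrealI tendsto_powr' tendsto_norm) auto
  from lim_imp_Liminf[OF sequentially_bot this] show ?case by (simp only:)
 qed
 also have "\<dots> \<le> liminf (%k. Lpow M p (f k))" unfolding Lpow_def by (rule nn_integral_liminf) measurable
 finally show ?thesis .
qed

text \<open>The argument of Riesz and Fischer: a fast subsequence converges almost everywhere, and
  Fatou's lemma shows that the whole sequence converges to its limit in the p-th mean.\<close>

lemma Lpow_complete:
 fixes f :: "nat => 'a => 'b::euclidean_space"
 assumes p: "p > 0" and [measurable]: "\<And>n. f n \<in> borel_measurable M"
  and cauchy: "\<And>e. e > 0 ==> \<exists>N. \<forall>m\<ge>N. \<forall>n\<ge>N. Lpow M p (%x. f m x - f n x) \<le> ennreal e"
 obtains g where "g \<in> borel_measurable M" "(%n. Lpow M p (%x. f n x - g x)) \<longlonglongrightarrow> 0"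
proof -
 \<comment> \<open>Increments are multiplied by \<open>2 ^ k\<close>, which costs
   \<open>2 powr (p * k)\<close> in the p-th power. The rate chosen here still leaves a summable
   series, so that almost everywhere the increments are bounded by a multiple of
   \<open>(1/2) ^ k\<close>.\<close>
 define c where "c k = (2::real) powr (- 2 * p * real k)" for k :: nat
 have "\<exists>N. \<forall>m\<ge>N. \<forall>n\<ge>N. Lpow M p (%x. f m x - f n x) \<le> ennreal (c k)" for k by (rule cauchy) (simp add: c_def)
 then obtain N where N: "\<And>k m n. m \<ge> N k ==> n \<ge> N k ==> Lpow M p (%x. f m x - f n x) \<le> ennreal (c k)" by metis
 define r where "r = rec_nat (N 0) (%k m. max (Suc m) (N (Suc k)))"
 have r: "strict_mono r" "r k \<ge> N k" for k by (auto simp: r_def strict_mono_Suc_iff less_max_iff_disj) (cases k; simp add: r_def)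
 define d where "d k x = (2 ^ k) *\<^sub>R (f (r (Suc k)) x - f (r k) x)" for k x
 have dm [measurable]: "d k \<in> borel_measurable M" for k unfolding d_def by measurable
 have dk: "(\<integral>\<^sup>+x. ennreal (norm (d k x) powr p) \<partial>M) \<le> ennreal ((2 powr - p) ^ k)" for k
 proof -
  have "r (Suc k) \<ge> N k" using r(2)[of k] r(1) by (meson dual_order.trans lessI less_imp_le strict_mono_less)
  then have "Lpow M p (%x. f (r (Suc k)) x - f (r k) x) \<le> ennreal (c k)" using N r(2) by blast
  then have "Lpow M p (d k) \<le> ennreal ((2^k) powr p) * ennreal (c k)"
   unfolding d_def by (subst Lpow_scaleR) (auto intro: mult_left_mono)
  also have "\<dots> = ennreal ((2^k) powr p * c k)" by (simp add: ennreal_mult c_def)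
  also have "(2^k) powr p * c k = (2 powr - p) ^ k"
   by (simp add: c_def powr_powr powr_realpow[symmetric] powr_add[symmetric] algebra_simps)
  finally show ?thesis by (simp add: Lpow_def)
 qed
 have "(\<Sum>k. \<integral>\<^sup>+x. ennreal (norm (d k x) powr p) \<partial>M) \<le> (\<Sum>k. ennreal ((2 powr - p) ^ k))" by (intro suminf_le dk) auto
 also have "\<dots> < \<infinity>" by (subst suminf_ennreal2) (use p powr_less_mono[of "-p" 0 2] in "auto simp: summable_geometric")
 finally have "AE x in M. (%k. ennreal (norm (d k x) powr p)) \<longlonglongrightarrow> 0" by (intro AE_tendsto_0_suminf) auto
 then have conv: "AE x in M. convergent (%k. f (r k) x)"
 proof eventually_elim
  case (elim x)
  from tendsto_0_powrD[OF p this] have "(%k. d k x) \<longlonglongrightarrow> 0" .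
  then have "Bseq (%k. d k x)" by (intro convergent_imp_Bseq) (auto simp: convergent_def)
  then obtain K where K: "\<And>k. norm (d k x) \<le> K" by (auto simp: Bseq_def)
  have rate: "norm (f (r (Suc k)) x - f (r k) x) \<le> K * (1/2) ^ k" for k
   using K[of k] unfolding d_def norm_scaleR by (simp add: power_divide field_simps)
  have "summable (%k. f (r (Suc k)) x - f (r k) x)"
  proof (rule summable_comparison_test')
   show "summable (%k. K * (1/2) ^ k)" by (intro summable_mult summable_geometric) simp
  qed (rule rate)
  then have "convergent (%n. \<Sum>k<n. f (r (Suc k)) x - f (r k) x)" by (simp add: summable_iff_convergent)
  then have "convergent (%n. f (r n) x - f (r 0) x)" by (simp add: sum_lessThan_telescope[of "%k. f (r k) x"])
  from convergent_add[OF this convergent_const[of "f (r 0) x"]] show ?case by simp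
 qed
 \<comment> \<open>Where the subsequence diverges, \<open>lim\<close> has an unspecified value;
   \<open>g\<close> is measurable all the same, and this happens on a null set only.\<close>
 define g where "g x = lim (%k. f (r k) x)" for x
 have g: "g \<in> borel_measurable M" unfolding g_def by (rule borel_measurable_lim_metric) measurable
 have lim: "AE x in M. (%k. f (r k) x) \<longlonglongrightarrow> g x" using conv by eventually_elim (simp add: g_def convergent_LIMSEQ_iff)
 have "(%n. Lpow M p (%x. f n x - g x)) \<longlonglongrightarrow> 0"
 proof (rule tendsto_0_ennreal_eps)
  fix e :: real assume "e > 0"
  then obtain N where N: "\<And>m n. m \<ge> N ==> n \<ge> N ==> Lpow M p (%x. f m x - f n x) \<le> ennreal e" using cauchy by metis
  have "Lpow M p (%x. f n x - g x) \<le> ennreal e" if "n \<ge> N" for n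
  proof -
   have "Lpow M p (%x. f n x - g x) \<le> liminf (%k. Lpow M p (%x. f n x - f (r k) x))"
    by (rule Lpow_Fatou[OF _ p]) (measurable, use lim in eventually_elim, auto intro: tendsto_diff)
   also have "\<dots> \<le> ennreal e"
   proof (rule Liminf_le, simp)
    show "\<forall>\<^sub>F k in sequentially. Lpow M p (%x. f n x - f (r k) x) \<le> ennreal e" using eventually_ge_at_top[of N]
    proof eventually_elim
     case (elim k)
     then have "r k \<ge> N" using seq_suble[OF r(1), of k] by linarith
     then show ?case using N that by blast
    qed
   qed
   finally show ?thesis .
  qed
  then show "\<exists>N. \<forall>n\<ge>N. Lpow M p (%x. f n x - g x) \<le> ennreal e" by blast
 qed
 with g show ?thesis by (rule that)
qed

subsection \<open>Convexity inequalities\<close>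

text \<open>Strict convexity, by comparing the slope at an intermediate point with the slope at
  \<open>m\<close>. The case \<open>x = 0\<close> is computed directly because the derivative
  \<open>D\<close> is available at positive arguments.\<close>

lemma powr_tangent:
 fixes x m :: real
 assumes "x \<ge> 0" "m > 0" "p > 1" "x \<noteq> m"
 shows "x powr p > m powr p + p * m powr (p - 1) * (x - m)"
proof -
 have D: "((%t. t powr p) has_real_derivative p * t powr (p - 1)) (at t)" if "t > 0" for t :: real
  using that by (auto intro!: derivative_eq_intros)
 consider "x > m" | "0 < x" "x < m" | "x = 0" using assms by linarith
 then show ?thesis
 proof cases
  case 1
  have "\<exists>z>m. z < x \<and> x powr p - m powr p = (x - m) * (p * z powr (p - 1))" by (rule MVT2[OF 1]) (use D assms in auto)
  then obtain z where z: "z > m" "x powr p - m powr p = (x - m) * (p * z powr (p - 1))" by auto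
  have "m powr (p - 1) < z powr (p - 1)" using z assms by (intro powr_less_mono2) auto
  then have "(x - m) * (p * m powr (p - 1)) < (x - m) * (p * z powr (p - 1))" using 1 assms by simp
  then show ?thesis using z(2) by (simp add: mult_ac)
 next
  case 2
  have "\<exists>z>x. z < m \<and> m powr p - x powr p = (m - x) * (p * z powr (p - 1))" by (rule MVT2[OF 2(2)]) (use D 2 in auto)
  then obtain z where z: "z > x" "z < m" "m powr p - x powr p = (m - x) * (p * z powr (p - 1))" by auto
  have "z powr (p - 1) < m powr (p - 1)" using z 2 assms by (intro powr_less_mono2) auto
  then have "(m - x) * (p * z powr (p - 1)) < (m - x) * (p * m powr (p - 1))" using 2 assms by simp
  then show ?thesis using z(3) by (simp add: algebra_simps)
 next
  case 3
  have "m powr p = m powr (p - 1) * m" using assms by (simp add: powr_diff)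
  moreover have "m powr p * (p - 1) > 0" using assms by simp
  ultimately show ?thesis using 3 by (simp add: algebra_simps)
 qed
qed

text \<open>Adding the two tangent inequalities at the midpoint cancels the linear terms.\<close>

lemma powr_midpoint_real:
 fixes s t :: real
 assumes "s \<ge> 0" "t \<ge> 0" "s \<noteq> t" "p > 1"
 shows "((s + t) / 2) powr p < (s powr p + t powr p) / 2"
proof -
 define m where "m = (s + t) / 2"
 have m: "m > 0" "s \<noteq> m" "t \<noteq> m" using assms by (auto simp: m_def)
 have "s powr p + t powr p > (m powr p + p * m powr (p - 1) * (s - m)) + (m powr p + p * m powr (p - 1) * (t - m))"
  using powr_tangent[OF assms(1) m(1) assms(4) m(2)] powr_tangent[OF assms(2) m(1) assms(4) m(3)] by linarith
 also have "(m powr p + p * m powr (p - 1) * (s - m)) + (m powr p + p * m powr (p - 1) * (t - m))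
   = 2 * m powr p + p * m powr (p - 1) * (s + t - 2 * m)" by (simp add: algebra_simps)
 also have "s + t - 2 * m = 0" by (simp add: m_def)
 finally show ?thesis by (simp add: m_def)
qed

text \<open>By the parallelogram identity the squared norm of the midpoint falls short by a quarter
  of the square of \<open>norm (a - b)\<close>.\<close>

lemma norm_midpoint_strict:
 fixes a b :: "'b::real_inner"
 assumes "norm a = norm b" "a \<noteq> b"
 shows "norm ((1/2) *\<^sub>R (a + b)) < norm a"
proof -
 have "(norm (a + b))\<^sup>2 + (norm (a - b))\<^sup>2 = 2 * (norm a)\<^sup>2 + 2 * (norm b)\<^sup>2"
  by (simp add: power2_norm_eq_inner algebra_simps inner_commute)
 moreover have "(norm (a - b))\<^sup>2 > 0" using assms by simp
 moreover have "(2 * norm a)\<^sup>2 = 4 * (norm b)\<^sup>2" "(norm a)\<^sup>2 = (norm b)\<^sup>2" using assms(1) by (simp_all add: power_mult_distrib)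
 ultimately have "(norm (a + b))\<^sup>2 < (2 * norm a)\<^sup>2" by linarith
 then have "norm (a + b) < 2 * norm a" by (rule power_less_imp_less_base) simp
 then show ?thesis by simp
qed

text \<open>The defect in the midpoint convexity of the p-th power of the norm; it measures how far
  apart two nearly minimising functions can lie.\<close>

definition convex_gap :: "real => 'b::euclidean_space => 'b => real" where
 "convex_gap p a b = (norm a powr p + norm b powr p) / 2 - norm ((1/2) *\<^sub>R (a + b)) powr p"

lemma convex_gap_pos:
 assumes "p > 1" "a \<noteq> b" shows "convex_gap p a b > 0"
proof (cases "norm a = norm b")
 case True
 have "norm ((1/2) *\<^sub>R (a + b)) powr p < norm a powr p"
  by (rule powr_less_mono2) (use norm_midpoint_strict[OF True assms(2)] assms in auto)
 then show ?thesis using True by (simp add: convex_gap_def)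
next
 case False
 have "norm ((1/2) *\<^sub>R (a + b)) powr p \<le> ((norm a + norm b) / 2) powr p"
  using assms norm_triangle_ineq[of a b] by (intro powr_mono2) auto
 then show ?thesis using powr_midpoint_real[of "norm a" "norm b" p] False assms by (simp add: convex_gap_def)
qed

lemma convex_gap_nonneg: "p > 1 ==> convex_gap p a b \<ge> 0"
 using convex_gap_pos[of p a b] by (cases "a = b") (auto simp: convex_gap_def scaleR_add_right[symmetric] scaleR_2[symmetric])

text \<open>By homogeneity it suffices to bound the gap from below on a compact set, where it is positive.\<close>

lemma uniform_convexity:
 assumes p: "p > 1" and e: "e > 0"
 obtains C where "C > 0" "\<And>a b :: 'b::euclidean_space.
  norm (a - b) powr p \<le> e * (norm a powr p + norm b powr p) + C * convex_gap p a b"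
proof -
 let ?N = "%z :: 'b \<times> 'b. norm (fst z) powr p + norm (snd z) powr p"
 let ?G = "%z :: 'b \<times> 'b. convex_gap p (fst z) (snd z)"
 \<comment> \<open>Normalised pairs at a definite distance. As \<open>e > 0\<close>, no pair in
   \<open>K\<close> lies on the diagonal, the only place where the gap vanishes.\<close>
 define K :: "('b \<times> 'b) set" where "K = {z. ?N z = 1 \<and> e \<le> norm (fst z - snd z) powr p}"
 have c: "continuous_on UNIV (%z. norm (h z) powr p)" if "continuous_on UNIV h" for h :: "'b \<times> 'b => 'b"
  using p that by (intro continuous_on_powr' continuous_intros) auto
 have cN: "continuous_on UNIV ?N" by (intro continuous_on_add c continuous_intros)
 have cD: "continuous_on UNIV (%z :: 'b \<times> 'b. norm (fst z - snd z) powr p)" by (intro c continuous_intros)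
 have cG: "continuous_on UNIV ?G"
  unfolding convex_gap_def by (intro continuous_on_diff continuous_on_add continuous_on_divide c continuous_intros) auto
 have "closed K"
 proof -
  have "K = {z. ?N z = 1} \<inter> {z. e \<le> norm (fst z - snd z) powr p}" by (auto simp: K_def)
  then show ?thesis
   using closed_Collect_eq[OF cN continuous_on_const] closed_Collect_le[OF continuous_on_const cD] by (simp add: closed_Int)
 qed
 moreover have "bounded K"
 proof (rule boundedI)
  fix z assume "z \<in> K"
  then have 1: "?N z = 1" by (simp add: K_def)
  have le: "t \<le> 1" if "t \<ge> 0" "t powr p \<le> 1" for t :: real

  proof (rule ccontr)
   assume "\<not> t \<le> 1"
   then have "1 < t powr p" using p by (intro gr_one_powr) auto
   then show False using that by simp
  qed
  have "norm (fst z) powr p \<le> 1" "norm (snd z) powr p \<le> 1"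
   using 1 powr_ge_zero[of "norm (fst z)" p] powr_ge_zero[of "norm (snd z)" p] by linarith+
  then have "norm (fst z) \<le> 1" "norm (snd z) \<le> 1" using le by auto
  then show "norm z \<le> 2" using norm_Pair_le[of "fst z" "snd z"] by simp
 qed
 ultimately have "compact K" by (simp add: compact_eq_bounded_closed)
 obtain d where d: "d > 0" "\<And>z. z \<in> K ==> d \<le> ?G z"
 proof (cases "K = {}")
  case True then show ?thesis using that[of 1] by simp
 next
  case False
  obtain z0 where z0: "z0 \<in> K" "\<And>z. z \<in> K ==> ?G z0 \<le> ?G z"
   using continuous_attains_inf[OF \<open>compact K\<close> False continuous_on_subset[OF cG]] by auto
  have "fst z0 \<noteq> snd z0" using z0(1) e by (auto simp: K_def)
  then show ?thesis using that[of "?G z0"] z0 convex_gap_pos[OF p] by auto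
 qed
 \<comment> \<open>On \<open>K\<close> the left side is at most \<open>2 powr p\<close>, while the
   gap is at least \<open>d\<close>.\<close>
 define C where "C = 2 powr p / d"
 have C: "C > 0" using d by (simp add: C_def)
 have main: "norm (a - b) powr p \<le> e + C * convex_gap p a b" if "norm a powr p + norm b powr p = 1" for a b :: 'b
 proof (cases "(a, b) \<in> K")
  case True
  have "norm (a - b) powr p \<le> 2 powr p * 1" using powr_diff_le[of p a b] that p by simp
  also have "\<dots> \<le> C * convex_gap p a b" using d(2)[OF True] d(1) by (simp add: C_def field_simps)
  finally show ?thesis using e by simp
 next
  case False
  then have "norm (a - b) powr p < e" using that by (simp add: K_def)
  moreover have "C * convex_gap p a b \<ge> 0" using convex_gap_nonneg[OF p, of a b] C by simp
  ultimately show ?thesis by linarith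
 qed
 show ?thesis
 proof (rule that[OF C])
  fix a b :: 'b
  define l where "l = norm a powr p + norm b powr p"
  show "norm (a - b) powr p \<le> e * (norm a powr p + norm b powr p) + C * convex_gap p a b"
  proof (cases "l = 0")
   case True
   then have "norm a powr p = 0" "norm b powr p = 0" by (simp_all add: l_def add_nonneg_eq_0_iff)
   then have "a = 0" "b = 0" by auto
   then show ?thesis by (simp add: convex_gap_def)
  next
   case False
   moreover have "l \<ge> 0" by (simp add: l_def)
   ultimately have l: "l > 0" by simp
   \<comment> \<open>Scaling by \<open>s\<close> divides p-th powers by \<open>l\<close>, hence
     normalises the pair; the gap and the power of the distance are homogeneous of degree
     \<open>p\<close>.\<close>
   define s where "s = l powr (- (1 / p))"
   have s: "s > 0" "s powr p = 1 / l" unfolding s_def powr_powr using l p by (auto simp: powr_minus_divide)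
   have hom: "norm (s *\<^sub>R x) powr p = norm x powr p / l" for x :: 'b using s by (simp add: powr_mult)
   have "norm (s *\<^sub>R a - s *\<^sub>R b) powr p \<le> e + C * convex_gap p (s *\<^sub>R a) (s *\<^sub>R b)"
    by (rule main) (use l in "simp add: hom add_divide_distrib[symmetric] l_def[symmetric] del: norm_scaleR")
   moreover have "convex_gap p (s *\<^sub>R a) (s *\<^sub>R b) = convex_gap p a b / l"
   proof -
    have "(1/2) *\<^sub>R (s *\<^sub>R a + s *\<^sub>R b) = s *\<^sub>R ((1/2) *\<^sub>R (a + b))" by (simp add: scaleR_add_right mult.commute)
    then show ?thesis unfolding convex_gap_def by (simp only: hom) (simp add: diff_divide_distrib add_divide_distrib)
   qed
   moreover have "s *\<^sub>R a - s *\<^sub>R b = s *\<^sub>R (a - b)" by (simp add: scaleR_diff_right)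
   ultimately have "norm (a - b) powr p / l \<le> e + C * (convex_gap p a b / l)" by (simp only: hom)
   then have "norm (a - b) powr p \<le> (e + C * (convex_gap p a b / l)) * l" using l by (simp only: pos_divide_le_eq)
   also have "\<dots> = e * l + C * convex_gap p a b" using l by (simp add: field_simps)
   finally show ?thesis by (simp add: l_def)
  qed
 qed
qed

lemma conjugate_exponent:
 fixes p q :: real
 assumes "p > 1" "1 / p + 1 / q = 1"
 shows "q > 1" "(p - 1) * q = p" "1 / q + 1 / p = 1"
proof -
 have "1 / p < 1" "1 / p > 0" using assms(1) by auto
 then have "1 / q > 0" "1 / q < 1" using assms(2) by linarith+
 then show q: "q > 1" by (simp add: divide_less_eq split: if_splits)
 show "(p - 1) * q = p" using assms q by (simp add: field_simps)
 show "1 / q + 1 / p = 1" using assms by simp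
qed

text \<open>Young's inequality for the factors \<open>l * a\<close> and \<open>b / l\<close>, where
  \<open>l\<close> is chosen to give the first term the coefficient \<open>e\<close>.\<close>

lemma young_eps:
 fixes p q :: real
 assumes "p > 1" "1 / p + 1 / q = 1" "e > 0"
 obtains C where "C > 0" "\<And>a b :: real. a \<ge> 0 ==> b \<ge> 0 ==> a * b \<le> e * a powr p + C * b powr q"
proof -
 have q: "q > 1" using assms conjugate_exponent by blast
 define l where "l = (p * e) powr (1 / p)"
 have l: "l > 0" "l powr p = p * e" using assms by (auto simp: l_def powr_powr)
 define C where "C = (1 / l) powr q / q"
 show ?thesis
 proof (rule that[of C])
  show "C > 0" using l q by (simp add: C_def)
  fix a b :: real assume ab: "a \<ge> 0" "b \<ge> 0"
  have "a * b = (l * a) * (b / l)" using l by simp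
  also have "\<dots> \<le> (l * a) powr p / p + (b / l) powr q / q" by (rule Youngs_inequality) (use assms q ab l in auto)
  also have "(l * a) powr p / p = e * a powr p" using assms l ab by (simp add: powr_mult)
  also have "(b / l) powr q / q = C * b powr q" using powr_mult[of "1 / l" b q] by (simp add: C_def)
  finally show "a * b \<le> e * a powr p + C * b powr q" .
 qed
qed

subsection \<open>Minimisation of the energy\<close>

lemma Lpow_fin_integrable:
 fixes z :: "'c => 'd::euclidean_space"
 assumes [measurable]: "z \<in> borel_measurable N" and "Lpow N r z < \<infinity>"
 shows "integrable N (%x. norm (z x) powr r)" by (rule integrableI_nonneg) (use assms in "auto simp: Lpow_def")

text \<open>The last term does not depend on \<open>z\<close>. By Young's inequality it makes the
  density nonnegative, so that the energy can be an \<open>ennreal\<close> integral and Fatou's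
  lemma applies to it.\<close>

definition energy_density :: "real => real => 'b::euclidean_space => 'b => real" where
 "energy_density p q g z = norm z powr p / p + g \<bullet> z + norm g powr q / q"

definition energy :: "'a measure => real => real => ('a => 'b::euclidean_space) => ('a => 'b) => ennreal" where
 "energy M p q g z = (\<integral>\<^sup>+x. ennreal (energy_density p q (g x) (z x)) \<partial>M)"

section \<open>Pointwise inequalities for the energy density and the flux\<close>

context
 fixes p q :: real
 assumes p: "p > 1" and pq: "1 / p + 1 / q = 1"
begin

lemma energy_density_nonneg: "energy_density p q g z \<ge> 0"
proof -
 have "norm z * norm g \<le> norm z powr p / p + norm g powr q / q"
  by (rule Youngs_inequality) (use p pq conjugate_exponent(1)[OF p pq] in auto)
 moreover have "\<bar>g \<bullet> z\<bar> \<le> norm z * norm g" using Cauchy_Schwarz_ineq2[of g z] by (simp add: mult.commute)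
 ultimately show ?thesis unfolding energy_density_def by linarith
qed

lemma energy_density_le: "energy_density p q g z \<le> 2 * (norm z powr p / p + norm g powr q / q)"
proof -
 have "norm z * norm g \<le> norm z powr p / p + norm g powr q / q"
  by (rule Youngs_inequality) (use p pq conjugate_exponent(1)[OF p pq] in auto)
 moreover have "\<bar>g \<bullet> z\<bar> \<le> norm z * norm g" using Cauchy_Schwarz_ineq2[of g z] by (simp add: mult.commute)
 moreover have "A + c + B \<le> 2 * (A + B)" if "\<bar>c\<bar> \<le> A + B" for A B c :: real using that by simp
 ultimately show ?thesis unfolding energy_density_def by (meson order_trans)
qed

text \<open>Young's inequality with the coefficient \<open>1 / (2 * p)\<close> lets half of
  \<open>norm z powr p / p\<close> absorb the linear term.\<close>

lemma energy_density_coercive: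
 obtains C where "C > 0" "\<And>g z :: 'b::euclidean_space. norm z powr p \<le> 2 * p * energy_density p q g z + C * norm g powr q"
proof -
 obtain C where C: "C > 0" "\<And>a b :: real. a \<ge> 0 ==> b \<ge> 0 ==> a * b \<le> (1 / (2 * p)) * a powr p + C * b powr q"
  using young_eps[OF p pq, of "1 / (2 * p)"] p by auto
 show ?thesis
 proof (rule that[of "2 * p * C"])
  show "2 * p * C > 0" using C p by simp
  fix g z :: 'b
  have "- (g \<bullet> z) \<le> norm z * norm g" using Cauchy_Schwarz_ineq2[of g z] by (simp add: mult.commute)
  also have "\<dots> \<le> (1 / (2 * p)) * norm z powr p + C * norm g powr q" by (rule C(2)) auto
  finally have gz: "- (g \<bullet> z) \<le> (1 / (2 * p)) * norm z powr p + C * norm g powr q" .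
  have "norm z powr p / p - (1 / (2 * p)) * norm z powr p \<le> energy_density p q g z + C * norm g powr q"
  proof -
   have "norm g powr q / q \<ge> 0" using conjugate_exponent(1)[OF p pq] by simp
   moreover have "A - Q \<le> A + c + G + Y" if "- c \<le> Q + Y" "G \<ge> 0" for A Q c G Y :: real using that by simp
   ultimately show ?thesis using gz unfolding energy_density_def by blast
  qed
  moreover have "norm z powr p / p - (1 / (2 * p)) * norm z powr p = norm z powr p / (2 * p)" using p by (simp add: field_simps)
  ultimately have "norm z powr p / (2 * p) \<le> energy_density p q g z + C * norm g powr q" by simp
  then show "norm z powr p \<le> 2 * p * energy_density p q g z + 2 * p * C * norm g powr q" using p by (simp add: field_simps)
 qed
qed

text \<open>The terms that are affine in the second argument cancel, so the whole convexity defect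
  of the energy is that of the power.\<close>

lemma energy_density_midpoint:
 "energy_density p q g a + energy_density p q g b
   = 2 * energy_density p q g ((1/2) *\<^sub>R (a + b)) + 2 / p * convex_gap p a b"
 unfolding energy_density_def convex_gap_def using p by (simp add: inner_add_right field_simps)

text \<open>For \<open>p < 2\<close> the factor \<open>norm z powr (p - 2)\<close> is unbounded near
  0, but the flux has norm \<open>norm z powr (p - 1)\<close>, which tends to 0 there.\<close>

lemma p_flux_continuous: "continuous_on UNIV (p_flux p :: 'b::euclidean_space => 'b)"
proof (rule continuous_at_imp_continuous_on, rule)
 fix z :: 'b
 show "isCont (p_flux p) z"
 proof (cases "z = 0")
  case False
  then show ?thesis unfolding p_flux_def by (auto intro!: continuous_intros)
 next
  case True
  have "((%y::'b. norm y powr (p - 1)) \<longlongrightarrow> norm (0::'b) powr (p - 1)) (at 0)"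
   by (intro tendsto_powr' tendsto_intros) (use p in auto)
  then have "((%y::'b. norm y powr (p - 1)) \<longlongrightarrow> 0) (at 0)" by simp
  moreover have "norm (p_flux p y) = norm y powr (p - 1)" for y :: 'b
   by (cases "y = 0") (auto simp: p_flux_def powr_diff power2_eq_square)
  ultimately have "((%y::'b. norm (p_flux p y)) \<longlongrightarrow> 0) (at 0)" by simp
  then have "((p_flux p :: 'b => 'b) \<longlongrightarrow> 0) (at 0)" by (rule tendsto_norm_zero_cancel)
  then show ?thesis using True by (simp add: isCont_def p_flux_def)
 qed
qed

lemma norm_p_flux: "norm (p_flux p (y::'c::euclidean_space)) = norm y powr (p - 1)"
 by (cases "y = 0") (auto simp: p_flux_def powr_diff power2_eq_square)

lemma p_flux_inner_self: "p_flux p (y::'c::euclidean_space) \<bullet> y = norm y powr p"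
 by (cases "y = 0") (auto simp: p_flux_def powr_diff power2_norm_eq_inner[symmetric])

text \<open>The subgradient inequality for \<open>norm z powr p / p\<close> at \<open>w\<close>.
  Cauchy-Schwarz and Young suffice, since the flux paired with \<open>w\<close> is
  \<open>norm w powr p\<close>; no derivative of the power is taken.\<close>

lemma p_flux_convexity:
 fixes z w :: "'c::euclidean_space"
 shows "norm w powr p / p - norm z powr p / p \<le> p_flux p w \<bullet> (w - z)"
proof -
 have "p_flux p w \<bullet> z \<le> norm w powr (p - 1) * norm z" using norm_cauchy_schwarz[of "p_flux p w" z] by (simp add: norm_p_flux)
 also have "\<dots> \<le> (norm w powr (p - 1)) powr q / q + norm z powr p / p"
  by (rule Youngs_inequality) (use p pq conjugate_exponent[OF p pq] in auto)
 also have "(norm w powr (p - 1)) powr q / q = norm w powr p * (1 - 1 / p)"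
  using conjugate_exponent(2)[OF p pq] pq by (simp add: powr_powr diff_eq_eq[symmetric] divide_inverse)
 finally show ?thesis by (simp add: inner_diff_right p_flux_inner_self algebra_simps)
qed

lemma p_flux_measurable [measurable]:
 fixes z :: "'c => 'd::euclidean_space" assumes [measurable]: "z \<in> borel_measurable N"
 shows "(%x. p_flux p (z x)) \<in> borel_measurable N" using borel_measurable_continuous_onI[OF p_flux_continuous] by measurable

section \<open>Minimisers of the energy and their Euler-Lagrange equation\<close>

context
 fixes M :: "'a measure" and g :: "'a => 'b::euclidean_space"
 assumes g [measurable]: "g \<in> borel_measurable M" and gfin: "Lpow M q g < \<infinity>"
begin

lemma energy_density_measurable [measurable]:
 assumes [measurable]: "z \<in> borel_measurable M"
 shows "(%x. energy_density p q (g x) (z x)) \<in> borel_measurable M" unfolding energy_density_def by measurable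

lemma energy_finite:
 assumes [measurable]: "z \<in> borel_measurable M" and "Lpow M p z < \<infinity>"
 shows "energy M p q g z < \<infinity>"
proof -
 have "energy M p q g z \<le> (\<integral>\<^sup>+x. ennreal (2 / p) * ennreal (norm (z x) powr p) + ennreal (2 / q) * ennreal (norm (g x) powr q) \<partial>M)"
  unfolding energy_def
 proof (rule nn_integral_mono)
  fix x
  have "energy_density p q (g x) (z x) \<le> 2 / p * norm (z x) powr p + 2 / q * norm (g x) powr q"
   using energy_density_le[of "g x" "z x"] by (simp add: algebra_simps)
  then show "ennreal (energy_density p q (g x) (z x)) \<le> ennreal (2 / p) * ennreal (norm (z x) powr p) + ennreal (2 / q) * ennreal (norm (g x) powr q)"
   using p conjugate_exponent(1)[OF p pq] by (simp add: ennreal_mult[symmetric] ennreal_plus[symmetric] del: ennreal_plus)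
 qed
 also have "\<dots> = ennreal (2 / p) * Lpow M p z + ennreal (2 / q) * Lpow M q g"
  unfolding Lpow_def by (simp add: nn_integral_add nn_integral_cmult)
 also have "\<dots> < \<infinity>" using assms gfin by (simp add: ennreal_mult_less_top)
 finally show ?thesis .
qed

lemma energy_midpoint:
 assumes [measurable]: "a \<in> borel_measurable M" "b \<in> borel_measurable M"
 shows "energy M p q g a + energy M p q g b = 2 * energy M p q g (%x. (1/2) *\<^sub>R (a x + b x))
   + ennreal (2 / p) * (\<integral>\<^sup>+x. ennreal (convex_gap p (a x) (b x)) \<partial>M)"
proof -
 have [measurable]: "(%x. convex_gap p (a x) (b x)) \<in> borel_measurable M" unfolding convex_gap_def by measurable
 have "energy M p q g a + energy M p q g b
   = (\<integral>\<^sup>+x. ennreal (energy_density p q (g x) (a x)) + ennreal (energy_density p q (g x) (b x)) \<partial>M)"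
  unfolding energy_def by (rule nn_integral_add[symmetric]) measurable
 also have "\<dots> = (\<integral>\<^sup>+x. 2 * ennreal (energy_density p q (g x) ((1/2) *\<^sub>R (a x + b x))) + ennreal (2 / p) * ennreal (convex_gap p (a x) (b x)) \<partial>M)"
 proof (rule nn_integral_cong)
  fix x
  have "ennreal (energy_density p q (g x) (a x)) + ennreal (energy_density p q (g x) (b x))
   = ennreal (2 * energy_density p q (g x) ((1/2) *\<^sub>R (a x + b x)) + 2 / p * convex_gap p (a x) (b x))"
   by (subst ennreal_plus[symmetric]) (auto simp only: energy_density_nonneg energy_density_midpoint)
  also have "\<dots> = ennreal 2 * ennreal (energy_density p q (g x) ((1/2) *\<^sub>R (a x + b x))) + ennreal (2 / p) * ennreal (convex_gap p (a x) (b x))"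
  proof -
   have "ennreal (2 / p * G) = ennreal (2 / p) * ennreal G" "ennreal (2 * e) = ennreal 2 * ennreal e"
    "ennreal (2 * e + 2 / p * G) = ennreal (2 * e) + ennreal (2 / p * G)" if "G \<ge> 0" "e \<ge> 0" for G e
    using p that by (intro ennreal_mult ennreal_plus; simp)+
   from this[OF convex_gap_nonneg[OF p, of "a x" "b x"] energy_density_nonneg[of "g x" "(1/2) *\<^sub>R (a x + b x)"]]
   show ?thesis by (simp only:)
  qed
  finally show "ennreal (energy_density p q (g x) (a x)) + ennreal (energy_density p q (g x) (b x))
   = 2 * ennreal (energy_density p q (g x) ((1/2) *\<^sub>R (a x + b x))) + ennreal (2 / p) * ennreal (convex_gap p (a x) (b x))"
   by simp
 qed
 also have "\<dots> = 2 * energy M p q g (%x. (1/2) *\<^sub>R (a x + b x))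
   + ennreal (2 / p) * (\<integral>\<^sup>+x. ennreal (convex_gap p (a x) (b x)) \<partial>M)"
  unfolding energy_def by (subst nn_integral_add) (auto simp: nn_integral_cmult)
 finally show ?thesis .
qed

text \<open>The direct method without weak topologies: \<open>A\<close> is stable under midpoints,
  and uniform convexity makes a minimising sequence converge in norm. Closedness is asked only up to
  null sets, as members of \<open>A\<close> are functions and not classes.\<close>

lemma energy_minimiser:
 assumes ne: "A \<noteq> {}" and meas: "\<And>z. z \<in> A ==> z \<in> borel_measurable M"
  and fin: "\<And>z. z \<in> A ==> Lpow M p z < \<infinity>"
  and mid: "\<And>y z. y \<in> A ==> z \<in> A ==> (%x. (1/2) *\<^sub>R (y x + z x)) \<in> A"
  and closed: "\<And>z w. (\<And>n. z n \<in> A) ==> w \<in> borel_measurable M ==>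
   (%n. Lpow M p (%x. z n x - w x)) \<longlonglongrightarrow> 0 ==> \<exists>w'\<in>A. AE x in M. w' x = w x"
 obtains z where "z \<in> A" "\<And>y. y \<in> A ==> energy M p q g z \<le> energy M p q g y"
proof -
 define m where "m = (INF z\<in>A. energy M p q g z)"
 have m_le: "m \<le> energy M p q g z" if "z \<in> A" for z unfolding m_def using that by (rule INF_lower)
 have mfin: "m < \<infinity>" using ne m_le energy_finite meas fin by (metis ex_in_conv le_less_trans)
 have "\<exists>z\<in>A. energy M p q g z < m + ennreal (1 / Suc n)" for n
 proof -
  have "m < m + ennreal (1 / Suc n)" using mfin ennreal_add_left_cancel_less[of m 0 "ennreal (1 / Suc n)"] by simp
  then show ?thesis unfolding m_def by (auto simp: INF_less_iff)
 qed
 then obtain z where zA: "\<And>n. z n \<in> A" and zm: "\<And>n. energy M p q g (z n) < m + ennreal (1 / Suc n)" by metis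
 have [measurable]: "z n \<in> borel_measurable M" for n using zA meas by blast
 obtain C0 where C0: "C0 > 0" "\<And>g z :: 'b. norm z powr p \<le> 2 * p * energy_density p q g z + C0 * norm g powr q"
  using energy_density_coercive by metis
 \<comment> \<open>Coercivity bounds the sequence in the p-th mean, since its energies are at most
   \<open>m + 1\<close>.\<close>
 define B where "B = ennreal (2 * p) * (m + 1) + ennreal C0 * Lpow M q g"
 have B: "Lpow M p (z n) \<le> B" for n
 proof -
  have "Lpow M p (z n) \<le> (\<integral>\<^sup>+x. ennreal (2 * p) * ennreal (energy_density p q (g x) (z n x)) + ennreal C0 * ennreal (norm (g x) powr q) \<partial>M)"
   unfolding Lpow_def
  proof (rule nn_integral_mono)
   fix x
   show "ennreal (norm (z n x) powr p) \<le> ennreal (2 * p) * ennreal (energy_density p q (g x) (z n x)) + ennreal C0 * ennreal (norm (g x) powr q)"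
    using C0 p energy_density_nonneg[of "g x" "z n x"]
    by (simp add: ennreal_mult[symmetric] ennreal_plus[symmetric] del: ennreal_plus)
  qed
  also have "\<dots> = ennreal (2 * p) * energy M p q g (z n) + ennreal C0 * Lpow M q g"
   unfolding Lpow_def energy_def by (subst nn_integral_add) (auto simp: nn_integral_cmult)
  also have "\<dots> \<le> B"
  proof -
   have "energy M p q g (z n) \<le> m + ennreal (1 / Suc n)" using zm[of n] by simp
   also have "\<dots> \<le> m + 1" by (intro add_left_mono) (simp add: ennreal_le_1)
   finally show ?thesis unfolding B_def by (intro add_right_mono mult_left_mono) auto
  qed
  finally show ?thesis .
 qed
 have Bfin: "B < \<infinity>" unfolding B_def using mfin gfin by (simp add: ennreal_mult_less_top)
 \<comment> \<open>The midpoint belongs to \<open>A\<close> and has energy at least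
   \<open>m\<close>, so the gap is bounded by the excess of the two energies over \<open>m\<close>;
   the finite quantity \<open>2 * m\<close> is cancelled.\<close>
 have gap: "ennreal (2 / p) * (\<integral>\<^sup>+x. ennreal (convex_gap p (z i x) (z j x)) \<partial>M) \<le> ennreal (2 / Suc N)"
  if "i \<ge> N" "j \<ge> N" for i j N
 proof -
  have s: "1 / Suc i \<le> 1 / Suc N" "1 / Suc j \<le> 1 / Suc N" using that by (auto simp: frac_le)
  have "2 * m + ennreal (2 / p) * (\<integral>\<^sup>+x. ennreal (convex_gap p (z i x) (z j x)) \<partial>M)
    \<le> 2 * energy M p q g (%x. (1/2) *\<^sub>R (z i x + z j x)) + ennreal (2 / p) * (\<integral>\<^sup>+x. ennreal (convex_gap p (z i x) (z j x)) \<partial>M)"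
   by (intro add_right_mono mult_left_mono m_le mid zA) auto
  also have "\<dots> = energy M p q g (z i) + energy M p q g (z j)" by (rule energy_midpoint[symmetric]) measurable
  also have "\<dots> \<le> (m + ennreal (1 / Suc N)) + (m + ennreal (1 / Suc N))"
   by (intro add_mono order_trans[OF less_imp_le[OF zm]] add_left_mono ennreal_leI s)
  also have "\<dots> = 2 * m + ennreal (2 / Suc N)"
  proof -
   have "ennreal (2 / Suc N) = ennreal (1 / Suc N) + ennreal (1 / Suc N)"
    by (subst ennreal_plus[symmetric]) (auto simp: field_simps)
   then show ?thesis by (simp only: mult_2 add_ac)
  qed
  finally show ?thesis using mfin by (subst (asm) ennreal_add_left_cancel_le) (auto simp: ennreal_mult_eq_top_iff)
 qed
 have cauchy: "\<exists>N. \<forall>i\<ge>N. \<forall>j\<ge>N. Lpow M p (%x. z i x - z j x) \<le> ennreal e" if e: "e > 0" for e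
 proof -
  define b where "b = enn2real B"
  have b: "B = ennreal b" "b \<ge> 0" using Bfin by (auto simp: b_def)
  \<comment> \<open>\<open>e1\<close> is fixed by the bound on the norms, then \<open>C\<close> by
    uniform convexity, and only then \<open>N\<close>; each of the two terms is at most
    \<open>e / 2\<close>.\<close>
  define e1 where "e1 = e / (4 * (b + 1))"
  have e1: "e1 > 0" using e b by (simp add: e1_def)
  obtain C where C: "C > 0" "\<And>a b :: 'b. norm (a - b) powr p \<le> e1 * (norm a powr p + norm b powr p) + C * convex_gap p a b"
   using uniform_convexity[OF p e1] by metis
  obtain N :: nat where N: "real N > C * p / (e / 2)" using reals_Archimedean2 by blast
  have "Lpow M p (%x. z i x - z j x) \<le> ennreal e" if ij: "i \<ge> N" "j \<ge> N" for i j
  proof -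
   have [measurable]: "(%x. convex_gap p (z i x) (z j x)) \<in> borel_measurable M" unfolding convex_gap_def by measurable
   have "Lpow M p (%x. z i x - z j x) \<le> (\<integral>\<^sup>+x. ennreal e1 * (ennreal (norm (z i x) powr p) + ennreal (norm (z j x) powr p))
     + ennreal (C * p / 2) * (ennreal (2 / p) * ennreal (convex_gap p (z i x) (z j x))) \<partial>M)" unfolding Lpow_def
   proof (rule nn_integral_mono)
    fix x
    have "ennreal (norm (z i x - z j x) powr p) \<le> ennreal (e1 * (norm (z i x) powr p + norm (z j x) powr p) + C * convex_gap p (z i x) (z j x))"
     by (intro ennreal_leI C(2))
    also have "C * convex_gap p (z i x) (z j x) = (C * p / 2) * ((2 / p) * convex_gap p (z i x) (z j x))" using p by simp
    finally show "ennreal (norm (z i x - z j x) powr p) \<le> ennreal e1 * (ennreal (norm (z i x) powr p) + ennreal (norm (z j x) powr p))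
     + ennreal (C * p / 2) * (ennreal (2 / p) * ennreal (convex_gap p (z i x) (z j x)))"
     using e1 C(1) p convex_gap_nonneg[OF p, of "z i x" "z j x"]
     by (simp add: ennreal_mult'[symmetric] ennreal_mult''[symmetric] ennreal_plus[symmetric] del: ennreal_plus)
   qed
   also have "\<dots> = ennreal e1 * (Lpow M p (z i) + Lpow M p (z j)) + ennreal (C * p / 2) * (ennreal (2 / p) * (\<integral>\<^sup>+x. ennreal (convex_gap p (z i x) (z j x)) \<partial>M))"
    unfolding Lpow_def by (simp add: nn_integral_add nn_integral_cmult)
   also have "\<dots> \<le> ennreal e1 * (B + B) + ennreal (C * p / 2) * ennreal (2 / Suc N)"
    by (intro add_mono mult_left_mono B gap ij) auto
   also have "\<dots> = ennreal (e1 * (b + b) + (C * p / 2) * (2 / Suc N))"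
    using b e1 C p by (simp add: ennreal_mult[symmetric] ennreal_plus[symmetric] del: ennreal_plus)
   also have "\<dots> \<le> ennreal e"
   proof (rule ennreal_leI)
    have "e1 * (b + b) \<le> e / 2" using b e by (simp add: e1_def field_simps)
    moreover have "(C * p / 2) * (2 / Suc N) \<le> e / 2" using N e by (simp add: field_simps)
    ultimately show "e1 * (b + b) + (C * p / 2) * (2 / Suc N) \<le> e" by linarith
   qed
   finally show ?thesis .
  qed
  then show ?thesis by blast
 qed
 obtain w where w [measurable]: "w \<in> borel_measurable M" and lim: "(%n. Lpow M p (%x. z n x - w x)) \<longlonglongrightarrow> 0"
  by (rule Lpow_complete[of p z M]) (use p cauchy in auto)
 obtain w' where w': "w' \<in> A" "AE x in M. w' x = w x" using closed[OF zA w lim] by blast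
 obtain r where r: "strict_mono r" "AE x in M. (%k. z (r k) x) \<longlonglongrightarrow> w x" by (rule Lpow_AE_subseq[OF _ _ w lim]) (use p in auto)
 \<comment> \<open>Lower semicontinuity, by Fatou's lemma along a subsequence that converges almost
   everywhere.\<close>
 have "energy M p q g w' = (\<integral>\<^sup>+x. liminf (%k. ennreal (energy_density p q (g x) (z (r k) x))) \<partial>M)" unfolding energy_def
 proof (rule nn_integral_cong_AE, use r(2) w'(2) in eventually_elim)
  case (elim x)
  have "(%k. energy_density p q (g x) (z (r k) x)) \<longlonglongrightarrow> energy_density p q (g x) (w x)" unfolding energy_density_def
   by (intro tendsto_intros tendsto_powr' elim) (use p in auto)
  then have "(%k. ennreal (energy_density p q (g x) (z (r k) x))) \<longlonglongrightarrow> ennreal (energy_density p q (g x) (w' x))"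
   using elim(2) by (auto intro: tendsto_ennrealI)
  from lim_imp_Liminf[OF sequentially_bot this] show ?case by (simp only:)
 qed
 also have "\<dots> \<le> liminf (%k. energy M p q g (z (r k)))" unfolding energy_def by (rule nn_integral_liminf) measurable
 also have "\<dots> = m"
 proof (rule lim_imp_Liminf)
  have "(%n. energy M p q g (z n)) \<longlonglongrightarrow> m"
  proof (rule tendsto_sandwich)
   show "\<forall>\<^sub>F n in sequentially. m \<le> energy M p q g (z n)" using m_le zA by simp
   show "\<forall>\<^sub>F n in sequentially. energy M p q g (z n) \<le> m + ennreal (1 / Suc n)"
    using zm by (intro always_eventually allI less_imp_le)
   have "(%n. m + ennreal (1 / Suc n)) \<longlonglongrightarrow> m + ennreal 0"
    by (intro tendsto_add tendsto_const tendsto_ennrealI LIMSEQ_Suc[OF lim_const_over_n[of 1]])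
   then show "(%n. m + ennreal (1 / Suc n)) \<longlonglongrightarrow> m" by simp
  qed simp
  from LIMSEQ_subseq_LIMSEQ[OF this r(1)] show "(%k. energy M p q g (z (r k))) \<longlonglongrightarrow> m" by (simp add: o_def)
 qed simp
 finally have "energy M p q g w' \<le> m" .
 with w'(1) m_le show ?thesis by (meson that order_trans)
qed

lemma flux_integrable:
 fixes y z :: "'a => 'b"
 assumes [measurable]: "z \<in> borel_measurable M" "y \<in> borel_measurable M"
  and "Lpow M p z < \<infinity>" "Lpow M p y < \<infinity>"
 shows "integrable M (%x. (p_flux p (z x) + g x) \<bullet> y x)"
  and "AE x in M. \<bar>(p_flux p (z x) + g x) \<bullet> y x\<bar> \<le> norm (z x) powr p + norm (g x) powr q + 2 * norm (y x) powr p"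
proof -
 have b: "\<bar>(p_flux p (z x) + g x) \<bullet> y x\<bar> \<le> norm (z x) powr p + norm (g x) powr q + 2 * norm (y x) powr p" for x
 proof -
  have y1: "a * norm (y x) \<le> a powr q + norm (y x) powr p" if "a \<ge> 0" for a
  proof -
   have "a * norm (y x) \<le> a powr q / q + norm (y x) powr p / p"
    by (rule Youngs_inequality) (use p pq conjugate_exponent[OF p pq] that in auto)
   also have "\<dots> \<le> a powr q + norm (y x) powr p"
    using p conjugate_exponent(1)[OF p pq] by (intro add_mono) (auto simp: divide_le_eq mult_left_mono mult_le_cancel_left1)
   finally show ?thesis .
  qed
  have "\<bar>(p_flux p (z x) + g x) \<bullet> y x\<bar> \<le> norm (p_flux p (z x)) * norm (y x) + norm (g x) * norm (y x)"
   using Cauchy_Schwarz_ineq2[of "p_flux p (z x)" "y x"] Cauchy_Schwarz_ineq2[of "g x" "y x"] by (simp add: inner_add_left)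
  also have "\<dots> \<le> (norm (p_flux p (z x)) powr q + norm (y x) powr p) + (norm (g x) powr q + norm (y x) powr p)"
   by (intro add_mono y1) auto
  also have "norm (p_flux p (z x)) powr q = norm (z x) powr p"
   using conjugate_exponent(2)[OF p pq] by (simp add: norm_p_flux powr_powr)
  finally show ?thesis by simp
 qed
 then show "AE x in M. \<bar>(p_flux p (z x) + g x) \<bullet> y x\<bar> \<le> norm (z x) powr p + norm (g x) powr q + 2 * norm (y x) powr p" by simp
 have "integrable M (%x. norm (z x) powr p + norm (g x) powr q + 2 * norm (y x) powr p)"
  using assms gfin by (intro Bochner_Integration.integrable_add integrable_mult_right Lpow_fin_integrable) auto
 then show "integrable M (%x. (p_flux p (z x) + g x) \<bullet> y x)"
  by (rule Bochner_Integration.integrable_bound) (use b in "auto intro: order_trans[OF b]")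
qed

lemma energy_density_integrable:
 assumes [measurable]: "z \<in> borel_measurable M" and "Lpow M p z < \<infinity>"
 shows "integrable M (%x. energy_density p q (g x) (z x))"
 by (rule integrableI_nonneg) (use energy_finite[OF assms] energy_density_nonneg in "auto simp: energy_def")

text \<open>Convexity bounds the difference quotients of the energy by the flux at the perturbed point.\<close>

lemma energy_minimiser_flux_nonneg:
 fixes z y :: "'a => 'b"
 assumes [measurable]: "z \<in> borel_measurable M" "y \<in> borel_measurable M"
  and fin: "Lpow M p z < \<infinity>" "Lpow M p y < \<infinity>"
  and min: "\<And>t. energy M p q g z \<le> energy M p q g (%x. z x + t *\<^sub>R y x)"
 shows "0 \<le> (\<integral>x. (p_flux p (z x) + g x) \<bullet> y x \<partial>M)"
proof -
 define t where "t n = 1 / real (Suc n)" for n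
 have t: "t n > 0" "t n \<le> 1" for n by (auto simp: t_def)
 let ?w = "%n x. z x + t n *\<^sub>R y x"
 have wf: "Lpow M p (?w n) < \<infinity>" for n using p fin by (intro Lpow_add_fin Lpow_scaleR_fin) auto
 have pos: "0 \<le> (\<integral>x. (p_flux p (?w n x) + g x) \<bullet> y x \<partial>M)" for n
 proof -
  have i: "integrable M (%x. energy_density p q (g x) (z x))" "integrable M (%x. energy_density p q (g x) (?w n x))"
   using fin wf by (auto intro!: energy_density_integrable)
  have f: "integrable M (%x. (p_flux p (?w n x) + g x) \<bullet> y x)" by (rule flux_integrable(1)) (use wf fin in auto)
  have "ennreal (\<integral>x. energy_density p q (g x) (z x) \<partial>M) \<le> ennreal (\<integral>x. energy_density p q (g x) (?w n x) \<partial>M)"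
   using min[of "t n"] unfolding energy_def by (simp only: nn_integral_eq_integral[OF i(1) AE_I2[OF energy_density_nonneg]]
     nn_integral_eq_integral[OF i(2) AE_I2[OF energy_density_nonneg]])
  then have "0 \<le> (\<integral>x. energy_density p q (g x) (?w n x) \<partial>M) - (\<integral>x. energy_density p q (g x) (z x) \<partial>M)"
   by (subst (asm) ennreal_le_iff) (auto intro!: Bochner_Integration.integral_nonneg energy_density_nonneg)
  also have "\<dots> = (\<integral>x. energy_density p q (g x) (?w n x) - energy_density p q (g x) (z x) \<partial>M)" using i by simp
  also have "\<dots> \<le> (\<integral>x. t n * ((p_flux p (?w n x) + g x) \<bullet> y x) \<partial>M)"
  proof (rule integral_mono)
   fix x
   have "energy_density p q (g x) (?w n x) - energy_density p q (g x) (z x)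
    = (norm (?w n x) powr p / p - norm (z x) powr p / p) + t n * (g x \<bullet> y x)"
    by (simp add: energy_density_def inner_add_right)
   also have "\<dots> \<le> p_flux p (?w n x) \<bullet> (?w n x - z x) + t n * (g x \<bullet> y x)" by (intro add_right_mono p_flux_convexity)
   finally show "energy_density p q (g x) (?w n x) - energy_density p q (g x) (z x) \<le> t n * ((p_flux p (?w n x) + g x) \<bullet> y x)"
    by (simp add: inner_add_left distrib_left)
  qed (use i f in auto)
  finally show ?thesis using t(1)[of n] by (simp add: zero_le_mult_iff)
 qed
 \<comment> \<open>The flux at the perturbed point converges because \<open>p_flux\<close> is
   continuous; since \<open>t n \<le> 1\<close>, the majorant of \<open>flux_integrable\<close> can
   be taken independent of \<open>n\<close>.\<close>
 have "(%n. \<integral>x. (p_flux p (?w n x) + g x) \<bullet> y x \<partial>M) \<longlonglongrightarrow> (\<integral>x. (p_flux p (z x) + g x) \<bullet> y x \<partial>M)"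
 proof (rule integral_dominated_convergence[where w = "%x. 2 powr p * (norm (z x) powr p + norm (y x) powr p) + norm (g x) powr q + 2 * norm (y x) powr p"])
  show "integrable M (%x. 2 powr p * (norm (z x) powr p + norm (y x) powr p) + norm (g x) powr q + 2 * norm (y x) powr p)"
   using fin gfin by (intro Bochner_Integration.integrable_add integrable_mult_right Lpow_fin_integrable) auto
  show "AE x in M. (%n. (p_flux p (?w n x) + g x) \<bullet> y x) \<longlonglongrightarrow> (p_flux p (z x) + g x) \<bullet> y x"
  proof (rule AE_I2)
   fix x
   have "(%n. ?w n x) \<longlonglongrightarrow> z x + 0 *\<^sub>R y x" unfolding t_def by (intro tendsto_intros LIMSEQ_Suc[OF lim_const_over_n[of 1]])
   then have "(%n. ?w n x) \<longlonglongrightarrow> z x" by simp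
   then have "(%n. p_flux p (?w n x)) \<longlonglongrightarrow> p_flux p (z x)" by (rule continuous_on_tendsto_compose[OF p_flux_continuous]) auto
   then show "(%n. (p_flux p (?w n x) + g x) \<bullet> y x) \<longlonglongrightarrow> (p_flux p (z x) + g x) \<bullet> y x" by (intro tendsto_intros)
  qed
  show "AE x in M. norm ((p_flux p (?w n x) + g x) \<bullet> y x)
    \<le> 2 powr p * (norm (z x) powr p + norm (y x) powr p) + norm (g x) powr q + 2 * norm (y x) powr p" for n
  proof -
   have "AE x in M. \<bar>(p_flux p (?w n x) + g x) \<bullet> y x\<bar> \<le> norm (?w n x) powr p + norm (g x) powr q + 2 * norm (y x) powr p"
    by (rule flux_integrable(2)) (use wf fin in auto)
   then show ?thesis
   proof eventually_elim
    case (elim x)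
    have "norm (?w n x) powr p \<le> 2 powr p * (norm (z x) powr p + norm (t n *\<^sub>R y x) powr p)"
     using p by (intro powr_add_le) auto
    also have "\<dots> \<le> 2 powr p * (norm (z x) powr p + norm (y x) powr p)"
     using t[of n] p by (intro mult_left_mono add_left_mono powr_mono2) (auto simp: mult_left_le_one_le)
    finally show ?case using elim by simp
   qed
  qed
 qed measurable
 then show ?thesis by (rule LIMSEQ_le_const) (use pos in blast)
qed

lemma energy_minimiser_flux:
 fixes z y :: "'a => 'b"
 assumes [measurable]: "z \<in> borel_measurable M" "y \<in> borel_measurable M"
  and fin: "Lpow M p z < \<infinity>" "Lpow M p y < \<infinity>"
  and min: "\<And>t. energy M p q g z \<le> energy M p q g (%x. z x + t *\<^sub>R y x)"
 shows "(\<integral>x. (p_flux p (z x) + g x) \<bullet> y x \<partial>M) = 0"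
proof -
 have "0 \<le> (\<integral>x. (p_flux p (z x) + g x) \<bullet> y x \<partial>M)" by (rule energy_minimiser_flux_nonneg) (use assms in auto)
 \<comment> \<open>The opposite inequality comes from the direction \<open>- y\<close>.\<close>
 moreover have "0 \<le> (\<integral>x. (p_flux p (z x) + g x) \<bullet> (- y x) \<partial>M)"
  by (rule energy_minimiser_flux_nonneg) (use assms min[of "- t" for t] in auto)
 ultimately show ?thesis by simp
qed

end

text \<open>The flux paired with \<open>z\<close> itself is \<open>norm z powr p\<close>; the
  remaining products are absorbed by Young's inequality. The constant is chosen before the measure
  and the functions.\<close>

lemma flux_estimate:
 obtains C where "C > 0" "\<And>(M :: 'a measure) (g :: 'a => 'b::euclidean_space) z w.
  g \<in> borel_measurable M ==> z \<in> borel_measurable M ==> w \<in> borel_measurable M ==>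
  Lpow M q g < \<infinity> ==> Lpow M p z < \<infinity> ==> Lpow M p w < \<infinity> ==>
  (\<integral>x. (p_flux p (z x) + g x) \<bullet> (z x - w x) \<partial>M) = 0 ==>
  Lpow M p z \<le> ennreal C * Lpow M q g + ennreal C * Lpow M p w"
proof -
 note q = conjugate_exponent[OF p pq]
 obtain C1 where C1: "C1 > 0" "\<And>a b :: real. a \<ge> 0 ==> b \<ge> 0 ==> a * b \<le> (1/4) * a powr q + C1 * b powr p"
  using young_eps[OF q(1,3), of "1/4"] by auto
 obtain C2 where C2: "C2 > 0" "\<And>a b :: real. a \<ge> 0 ==> b \<ge> 0 ==> a * b \<le> (1/4) * a powr p + C2 * b powr q"
  using young_eps[OF p pq, of "1/4"] by auto
 \<comment> \<open>Young's inequality leaves half of \<open>norm z powr p\<close> on the left;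
   doubling gives the coefficients \<open>2 * (C1 + 1)\<close> and \<open>4 * C2\<close>, and
   \<open>C\<close> dominates both.\<close>
 define C where "C = 2 * (C1 + 2 * C2 + 1)"
 show ?thesis
 proof (rule that[of C])
  show "C > 0" using C1 C2 by (simp add: C_def)
  fix M :: "'a measure" and g z w :: "'a => 'b"
  assume [measurable]: "g \<in> borel_measurable M" "z \<in> borel_measurable M" "w \<in> borel_measurable M"
   and fin: "Lpow M q g < \<infinity>" "Lpow M p z < \<infinity>" "Lpow M p w < \<infinity>"
   and 0: "(\<integral>x. (p_flux p (z x) + g x) \<bullet> (z x - w x) \<partial>M) = 0"
  have ii: "integrable M (%x. norm (z x) powr p)" "integrable M (%x. norm (w x) powr p)" "integrable M (%x. norm (g x) powr q)"
   by (rule Lpow_fin_integrable; use fin in simp)+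
  have if0: "integrable M (%x. (p_flux p (z x) + g x) \<bullet> (z x - w x))"
   by (rule flux_integrable(1)) (use fin p Lpow_diff_fin[of p z M w] in auto)
  have pw: "norm (z x) powr p / 2 \<le> (p_flux p (z x) + g x) \<bullet> (z x - w x) + (C1 + 1) * norm (w x) powr p + 2 * C2 * norm (g x) powr q" for x
  proof -
   have "p_flux p (z x) \<bullet> w x \<le> norm (z x) powr (p - 1) * norm (w x)"
    using norm_cauchy_schwarz[of "p_flux p (z x)" "w x"] by (simp add: norm_p_flux)
   also have "\<dots> \<le> (1/4) * (norm (z x) powr (p - 1)) powr q + C1 * norm (w x) powr p" by (rule C1(2)) auto
   also have "(norm (z x) powr (p - 1)) powr q = norm (z x) powr p" using q(2) by (simp add: powr_powr)
   finally have a: "p_flux p (z x) \<bullet> w x \<le> (1/4) * norm (z x) powr p + C1 * norm (w x) powr p" .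
   have "- (g x \<bullet> z x) \<le> norm (z x) * norm (g x)" using Cauchy_Schwarz_ineq2[of "g x" "z x"] by (simp add: mult.commute)
   also have "\<dots> \<le> (1/4) * norm (z x) powr p + C2 * norm (g x) powr q" by (rule C2(2)) auto
   finally have b: "- (g x \<bullet> z x) \<le> (1/4) * norm (z x) powr p + C2 * norm (g x) powr q" .
   have "g x \<bullet> w x \<le> norm (w x) * norm (g x)" using norm_cauchy_schwarz[of "g x" "w x"] by (simp add: mult.commute)
   also have "\<dots> \<le> (1/4) * norm (w x) powr p + C2 * norm (g x) powr q" by (rule C2(2)) auto
   finally have c: "g x \<bullet> w x \<le> (1/4) * norm (w x) powr p + C2 * norm (g x) powr q" .
   have "(p_flux p (z x) + g x) \<bullet> (z x - w x) = norm (z x) powr p - p_flux p (z x) \<bullet> w x + g x \<bullet> z x - g x \<bullet> w x"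
    by (simp add: inner_add_left inner_diff_right p_flux_inner_self)
   moreover have "norm (w x) powr p \<ge> 0" by simp
   ultimately show ?thesis using a b c unfolding distrib_right mult_1 mult.assoc by linarith
  qed
  have "(\<integral>x. norm (z x) powr p / 2 \<partial>M) \<le> (\<integral>x. (p_flux p (z x) + g x) \<bullet> (z x - w x) + (C1 + 1) * norm (w x) powr p + 2 * C2 * norm (g x) powr q \<partial>M)"
   by (rule integral_mono) (use ii if0 pw in auto)
  also have "\<dots> = (C1 + 1) * (\<integral>x. norm (w x) powr p \<partial>M) + 2 * C2 * (\<integral>x. norm (g x) powr q \<partial>M)" using ii if0 0 by simp
  finally have "(\<integral>x. norm (z x) powr p \<partial>M) \<le> 2 * (C1 + 1) * (\<integral>x. norm (w x) powr p \<partial>M) + 4 * C2 * (\<integral>x. norm (g x) powr q \<partial>M)"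
   using ii by (simp add: algebra_simps)
  also have "\<dots> \<le> C * (\<integral>x. norm (w x) powr p \<partial>M) + C * (\<integral>x. norm (g x) powr q \<partial>M)"
   using C1 C2 by (intro add_mono mult_right_mono Bochner_Integration.integral_nonneg) (auto simp: C_def)
  finally have "ennreal (\<integral>x. norm (z x) powr p \<partial>M) \<le> ennreal (C * (\<integral>x. norm (w x) powr p \<partial>M) + C * (\<integral>x. norm (g x) powr q \<partial>M))"
   by (rule ennreal_leI)
  also have "\<dots> = ennreal C * ennreal (\<integral>x. norm (w x) powr p \<partial>M) + ennreal C * ennreal (\<integral>x. norm (g x) powr q \<partial>M)"
   using C1 C2 by (subst ennreal_plus) (auto simp: ennreal_mult C_def intro!: Bochner_Integration.integral_nonneg mult_nonneg_nonneg)
  finally show "Lpow M p z \<le> ennreal C * Lpow M q g + ennreal C * Lpow M p w"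
   unfolding Lpow_def using ii by (simp add: nn_integral_eq_integral add.commute)
 qed
qed

end

subsection \<open>Affine changes of variables\<close>

lemma nn_integral_lborel_affine:
 fixes f :: "'a::euclidean_space => ennreal"
 assumes [measurable]: "f \<in> borel_measurable borel" and "c \<noteq> 0"
 shows "(\<integral>\<^sup>+y. f y \<partial>lborel) = ennreal (\<bar>c\<bar> ^ DIM('a)) * (\<integral>\<^sup>+z. f (x + c *\<^sub>R z) \<partial>lborel)"
proof -
 have "(\<integral>\<^sup>+y. f y \<partial>lborel) = (\<integral>\<^sup>+y. f y \<partial>density (distr lborel borel (%z. x + c *\<^sub>R z)) (%_. ennreal (\<bar>c\<bar> ^ DIM('a))))"
  by (subst lborel_affine[OF assms(2), of x]) simp
 also have "\<dots> = (\<integral>\<^sup>+z. ennreal (\<bar>c\<bar> ^ DIM('a)) * f (x + c *\<^sub>R z) \<partial>lborel)"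
  by (subst nn_integral_density) (simp_all add: nn_integral_distr)
 finally show ?thesis by (simp add: nn_integral_cmult)
qed

lemma nn_integral_lborel_translate:
 fixes f :: "'a::euclidean_space => ennreal"
 assumes "f \<in> borel_measurable borel"
 shows "(\<integral>\<^sup>+h. f (x + h) \<partial>lborel) = (\<integral>\<^sup>+y. f y \<partial>lborel)" using nn_integral_lborel_affine[OF assms, of 1 x] by simp

lemma lborel_translate:
 fixes f :: "'a::euclidean_space => real"
 assumes [measurable]: "f \<in> borel_measurable borel"
 shows "integrable lborel (%h. f (x + h)) \<longleftrightarrow> integrable lborel f"
  and "(\<integral>h. f (x + h) \<partial>lborel) = (\<integral>y. f y \<partial>lborel)"
proof -
 have "integrable lborel (%h. f (x + h)) \<longleftrightarrow> integrable (distr lborel borel ((+) x)) f" by (subst integrable_distr_eq) auto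
 then show "integrable lborel (%h. f (x + h)) \<longleftrightarrow> integrable lborel f" by (simp only: lborel_distr_plus)
 have "(\<integral>h. f (x + h) \<partial>lborel) = (\<integral>y. f y \<partial>distr lborel borel ((+) x))" by (subst integral_distr) auto
 then show "(\<integral>h. f (x + h) \<partial>lborel) = (\<integral>y. f y \<partial>lborel)" by (simp only: lborel_distr_plus)
qed

subsection \<open>Jensen's inequality for powers\<close>

text \<open>Integrate the tangent to the power at the weighted mean \<open>I / W\<close>. The weight
  has arbitrary total mass, which produces the factor with exponent \<open>p - 1\<close>.\<close>

lemma jensen_powr:
 fixes F w :: "'a => real"
 assumes p: "p > 1" and [measurable]: "F \<in> borel_measurable M" "w \<in> borel_measurable M"
  and F: "\<And>x. F x \<ge> 0" and w: "\<And>x. w x \<ge> 0" "integrable M w"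
  and Fw: "integrable M (%x. F x * w x)"
 shows "ennreal ((\<integral>x. F x * w x \<partial>M) powr p)
  \<le> ennreal ((\<integral>x. w x \<partial>M) powr (p - 1)) * (\<integral>\<^sup>+x. ennreal (F x powr p * w x) \<partial>M)"
proof (cases "(\<integral>x. F x * w x \<partial>M) = 0 \<or> (\<integral>\<^sup>+x. ennreal (F x powr p * w x) \<partial>M) = \<infinity>")
 case True
 define W where "W = (\<integral>x. w x \<partial>M)"
 have W0: "W \<ge> 0" unfolding W_def using w by (intro Bochner_Integration.integral_nonneg) auto
 show ?thesis
 proof (cases "(\<integral>x. F x * w x \<partial>M) = 0")
  case False
  \<comment> \<open>In \<open>ennreal\<close> the product of 0 and \<infinity> is 0, so the factor
    in front must be nonzero before the right side counts as infinite.\<close>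
  have "W \<noteq> 0"
  proof
   assume "W = 0"
   then have "AE x in M. w x = 0" using w unfolding W_def by (subst (asm) integral_nonneg_eq_0_iff_AE) auto
   then have "(\<integral>x. F x * w x \<partial>M) = 0" by (intro integral_eq_zero_AE) auto
   then show False using False by simp
  qed
  then have "ennreal (W powr (p - 1)) \<noteq> 0" using W0 by simp
  then show ?thesis using True False unfolding W_def by (simp add: ennreal_mult_eq_top_iff ennreal_mult_top)
 qed simp
next
 case False
 define W where "W = (\<integral>x. w x \<partial>M)"
 define I where "I = (\<integral>x. F x * w x \<partial>M)"
 have W0: "W \<ge> 0" unfolding W_def using w by (intro Bochner_Integration.integral_nonneg) auto
 have I: "I > 0" using False F w unfolding I_def
  by (intro order.not_eq_order_implies_strict Bochner_Integration.integral_nonneg) auto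
 have W: "W > 0"
 proof (rule ccontr)
  assume "\<not> W > 0"
  then have "(\<integral>x. w x \<partial>M) = 0" using W0 W_def by simp
  then have "AE x in M. w x = 0" using w by (subst (asm) integral_nonneg_eq_0_iff_AE) auto
  then have "I = 0" unfolding I_def by (intro integral_eq_zero_AE) auto
  then show False using I by simp
 qed
 define m where "m = I / W"
 have m: "m > 0" using I W by (simp add: m_def)
 have Fp: "integrable M (%x. F x powr p * w x)" using False F w by (intro integrableI_nonneg) (auto simp: less_top)
 have "(\<integral>x. (m powr p + p * m powr (p - 1) * (F x - m)) * w x \<partial>M) \<le> (\<integral>x. F x powr p * w x \<partial>M)"
 proof (rule integral_mono)
  have "(%x. (m powr p + p * m powr (p - 1) * (F x - m)) * w x)
   = (%x. (m powr p - p * m powr (p - 1) * m) * w x + p * m powr (p - 1) * (F x * w x))" by (simp add: algebra_simps)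
  then show "integrable M (%x. (m powr p + p * m powr (p - 1) * (F x - m)) * w x)" using w Fw by simp
  fix x
  show "(m powr p + p * m powr (p - 1) * (F x - m)) * w x \<le> F x powr p * w x"
   using powr_tangent[OF F[of x] m p] by (intro mult_right_mono w) (cases "F x = m", auto)
 qed (rule Fp)
 also have "(\<integral>x. (m powr p + p * m powr (p - 1) * (F x - m)) * w x \<partial>M)
   = (\<integral>x. (m powr p - p * m powr (p - 1) * m) * w x + p * m powr (p - 1) * (F x * w x) \<partial>M)"
  by (rule Bochner_Integration.integral_cong) (auto simp: algebra_simps)
 also have "\<dots> = (m powr p - p * m powr (p - 1) * m) * W + p * m powr (p - 1) * I" using w Fw by (simp add: W_def I_def)
 also have "\<dots> = m powr p * W" using W by (simp add: m_def algebra_simps)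
 finally have "m powr p * W * W powr (p - 1) \<le> (\<integral>x. F x powr p * w x \<partial>M) * W powr (p - 1)" by (rule mult_right_mono) simp
 moreover have "m powr p * W * W powr (p - 1) = I powr p" using I W by (simp add: m_def powr_divide powr_diff)
 ultimately have "ennreal (I powr p) \<le> ennreal (W powr (p - 1) * (\<integral>x. F x powr p * w x \<partial>M))"
  by (intro ennreal_leI) (simp add: mult.commute)
 also have "\<dots> = ennreal (W powr (p - 1)) * ennreal (\<integral>x. F x powr p * w x \<partial>M)"
  using F w by (intro ennreal_mult Bochner_Integration.integral_nonneg) auto
 also have "ennreal (\<integral>x. F x powr p * w x \<partial>M) = (\<integral>\<^sup>+x. ennreal (F x powr p * w x) \<partial>M)"
  using Fp w F by (intro nn_integral_eq_integral[symmetric]) auto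
 finally show ?thesis by (simp add: I_def W_def)
qed

subsection \<open>Extension by averages\<close>

lemma partial_deriv_line:
 assumes "Cinf f"
 shows "((%t. f (X + t *\<^sub>R v)) has_real_derivative partial_deriv v f X) (at 0)"
proof -
 have "((%t. X + t *\<^sub>R v) has_derivative (%t. t *\<^sub>R v)) (at (0::real))" by (auto intro!: derivative_eq_intros)
 moreover have "(f has_derivative (%h. partial_deriv h f X)) (at (X + 0 *\<^sub>R v))"
  using Cinf_has_derivative[OF assms, of X] by simp
 ultimately have "(f \<circ> (%t. X + t *\<^sub>R v) has_derivative (%h. partial_deriv h f X) \<circ> (%t. t *\<^sub>R v)) (at 0)"
  by (rule diff_chain_at)
 moreover have "partial_deriv (t *\<^sub>R v) f X = partial_deriv v f X * t" for t
  using linear_cmul[OF has_derivative_linear[OF Cinf_has_derivative[OF assms, of X]], of t v] by (simp add: mult.commute)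
 ultimately show ?thesis by (simp add: has_field_derivative_def o_def)
qed

definition mollifier :: "real => 'a::euclidean_space => real" where
 "mollifier r z = bump r z / (\<integral>z. bump r (z::'a) \<partial>lborel)"

text \<open>The integral of the bump is not 0, for otherwise the bump would vanish almost everywhere
  and an open ball would be a null set.\<close>

lemma mollifier_props:
 assumes r: "r > 0"
 shows "Cinf (mollifier r :: 'a::euclidean_space => real)" "\<And>z::'a. mollifier r z \<ge> 0"
  "\<And>z::'a. norm z \<ge> r ==> mollifier r z = 0" "(\<integral>z. mollifier r (z::'a) \<partial>lborel) = 1"
proof -
 let ?I = "\<integral>z. bump r (z::'a) \<partial>lborel"
 have i: "integrable lborel (bump r :: 'a => real)"
  by (rule continuous_bounded_support(1)[OF Cinf_continuous[OF Cinf_bump], of r]) (use r in "simp add: bump_zero")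
 have "?I \<noteq> 0"
 proof
  assume "?I = 0"
  then have "AE z in lborel. bump r (z::'a) = 0" using i bump_nonneg by (subst (asm) integral_nonneg_eq_0_iff_AE) auto
  then have "AE z in lborel. (z::'a) \<notin> ball 0 r" by eventually_elim (use bump_pos in force)
  then have "emeasure lborel (ball (0::'a) r) = 0" by (subst (asm) AE_iff_measurable[where N = "ball 0 r"]) auto
  then have "ball (0::'a) r \<in> null_sets lebesgue" by (intro null_sets_completionI) auto
  then show False using open_not_negligible[of "ball (0::'a) r"] r by (simp add: negligible_iff_null_sets)
 qed
 moreover have "?I \<ge> 0" by (intro Bochner_Integration.integral_nonneg) (simp add: bump_nonneg)
 ultimately have I: "?I > 0" by simp
 show "Cinf (mollifier r :: 'a => real)" unfolding mollifier_def[abs_def] divide_inverse by (intro Cinf_mult Cinf_bump Cinf_const)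
 show "mollifier r z \<ge> 0" for z :: 'a using I bump_nonneg[of r z] by (simp add: mollifier_def)
 show "norm z \<ge> r ==> mollifier r z = 0" for z :: 'a using r by (simp add: mollifier_def bump_zero)
 show "(\<integral>z. mollifier r (z::'a) \<partial>lborel) = 1" using I i by (simp add: mollifier_def)
qed

text \<open>Convolution of \<open>f\<close> with the kernel dilated to the scale
  \<open>snd X\<close>, as a function of all N variables. At height 0 the division by zero makes it
  0, so only positive heights carry information.\<close>

definition average :: "('a::euclidean_space => real) => ('a => real) => 'a \<times> real => real" where
 "average \<eta> f X = (\<integral>y. f y * ((1 / snd X) ^ DIM('a) * \<eta> ((1 / snd X) *\<^sub>R (y - fst X))) \<partial>lebesgue)"

text \<open>A smooth positive function that is the identity on \<open>[\<delta>, \<infinity>)\<close>; it makes \<open>average\<close>, restricted to heights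
 at least \<open>\<delta>\<close>, extend to a smooth function on the whole space.\<close>

definition smooth_height :: "real => real => real" where
 "smooth_height \<delta> s = \<delta> / 2 + (s - \<delta> / 2) * smooth_step (2 * s / \<delta> - 1)"

lemma smooth_height_props:
 assumes d: "\<delta> > 0"
 shows "Cinf (smooth_height \<delta>)" "smooth_height \<delta> s > 0" "s \<ge> \<delta> ==> smooth_height \<delta> s = s"
proof -
 have id: "Cinf (%s::real. s)" by (rule Cinf_bounded_linear) simp
 have "Cinf (%s. 2 / \<delta> * s - 1)" by (intro Cinf_diff Cinf_mult Cinf_const id)
 then have "Cinf (%s. 2 * s / \<delta> - 1)" by (simp add: mult.commute)
 from Cinf_compose_real[OF Cinf_smooth_step this]
 show "Cinf (smooth_height \<delta>)" unfolding smooth_height_def[abs_def] by (intro Cinf_add Cinf_diff Cinf_mult Cinf_const id)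
 show "smooth_height \<delta> s > 0"
 proof (cases "s \<le> \<delta> / 2")
  case True
  then have "2 * s / \<delta> - 1 \<le> 0" using d by (simp add: field_simps)
  then show ?thesis using d by (simp add: smooth_height_def smooth_step_0)
 next
  case False
  then have "(s - \<delta> / 2) * smooth_step (2 * s / \<delta> - 1) \<ge> 0" using smooth_step_bounds by simp
  then show ?thesis using d unfolding smooth_height_def by linarith
 qed
 show "s \<ge> \<delta> ==> smooth_height \<delta> s = s" using d by (simp add: smooth_height_def smooth_step_1 field_simps)
qed

text \<open>\<open>\<kappa>\<close> is the ratio of averaging radius to height: the average at
  \<open>(x, s)\<close> sees \<open>f\<close> only within distance \<open>\<kappa> * s\<close> of
  \<open>x\<close>.\<close>

locale averaging_kernel =
 fixes \<kappa> :: real and \<eta> :: "'a::euclidean_space => real"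
 assumes \<kappa>: "\<kappa> > 0" and \<eta>: "Cinf \<eta>" "\<And>z. \<eta> z \<ge> 0" "\<And>z. norm z \<ge> \<kappa> ==> \<eta> z = 0"
  and \<eta>1: "(\<integral>z. \<eta> z \<partial>lborel) = 1"
begin

lemma \<eta>_measurable [measurable]: "\<eta> \<in> borel_measurable borel"
 by (rule borel_measurable_continuous_onI[OF Cinf_continuous[OF \<eta>(1)]])

text \<open>The averaging kernel with its scale replaced by \<open>smooth_height \<delta>\<close>:
  smooth on the whole space, and the true kernel at heights at least
  \<open>\<delta>\<close>.\<close>

definition "kern \<delta> = (%Z :: ('a \<times> real) \<times> 'a. (1 / smooth_height \<delta> (snd (fst Z))) ^ DIM('a)
  * \<eta> ((1 / smooth_height \<delta> (snd (fst Z))) *\<^sub>R (snd Z - fst (fst Z))))"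

lemma Cinf_kern:
 assumes d: "\<delta> > 0" shows "Cinf (kern \<delta>)"
proof -
 note h = smooth_height_props[OF d]
 have s: "Cinf (%Z :: ('a \<times> real) \<times> 'a. smooth_height \<delta> (snd (fst Z)))"
  by (rule Cinf_compose_real[OF h(1)], rule Cinf_bounded_linear)
   (intro bounded_linear_compose[OF bounded_linear_snd] bounded_linear_fst)
 have i: "Cinf (%Z :: ('a \<times> real) \<times> 'a. 1 / smooth_height \<delta> (snd (fst Z)))"
  unfolding divide_inverse by (intro Cinf_mult Cinf_const Cinf_inverse s) (use h(2) in "simp add: less_imp_neq[symmetric]")
 have l: "Cinf (%Z :: ('a \<times> real) \<times> 'a. (snd Z - fst (fst Z)) \<bullet> j)" for j by (rule Cinf_bounded_linear)
   (intro bounded_linear_compose[OF bounded_linear_inner_left] bounded_linear_sub bounded_linear_snd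
    bounded_linear_compose[OF bounded_linear_fst] bounded_linear_fst)
 show ?thesis unfolding kern_def
  by (intro Cinf_mult Cinf_power i Cinf_compose[OF \<eta>(1)]) (unfold inner_scaleR_left, intro Cinf_mult i l)
qed

lemma kern_support:
 assumes d: "\<delta> > 0"
 shows "\<exists>R'. \<forall>X y. norm X < R \<longrightarrow> norm y > R' \<longrightarrow> kern \<delta> (X, y) = 0"
proof -
 note h = smooth_height_props[OF d]
 have "compact (smooth_height \<delta> ` cball 0 R)"
  by (intro compact_continuous_image continuous_on_subset[OF Cinf_continuous[OF h(1)]]) auto
 then obtain B where "\<forall>s\<in>cball 0 R. \<bar>smooth_height \<delta> s\<bar> \<le> B" by (auto simp: bounded_iff dest!: compact_imp_bounded)
 then have B: "smooth_height \<delta> s \<le> B" if "\<bar>s\<bar> \<le> R" for s using that by (auto dest!: bspec[of _ _ s])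
 have "kern \<delta> (X, y) = 0" if X: "norm X < R" and y: "norm y > R + \<kappa> * B" for X y
 proof -
  obtain x s where Xs: "X = (x, s)" by (cases X)
  have n: "norm x < R" "\<bar>s\<bar> < R" using X norm_fst_le[of x s] norm_snd_le[of s x] Xs by auto
  then have "smooth_height \<delta> s \<le> B" using B by simp
  then have "\<kappa> * smooth_height \<delta> s \<le> \<kappa> * B" using \<kappa> by simp
  moreover have "norm (y - x) \<ge> norm y - norm x" by (rule norm_triangle_ineq2)
  ultimately have "norm (y - x) \<ge> \<kappa> * smooth_height \<delta> s" using n y by linarith
  then have "norm ((1 / smooth_height \<delta> s) *\<^sub>R (y - x)) \<ge> \<kappa>" using h(2)[of s] unfolding norm_scaleR by (simp add: field_simps)
  then show ?thesis using \<eta>(3) by (simp add: kern_def Xs)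
 qed
 then show ?thesis by blast
qed

lemma average_kern:
 assumes "\<delta> > 0" "snd X \<ge> \<delta>"
 shows "average \<eta> f X = (\<integral>y. f y * kern \<delta> (X, y) \<partial>lebesgue)"
 using assms by (simp add: average_def kern_def smooth_height_props(3))

lemma Cinf_param_kern:
 assumes "\<delta> > 0" "L1loc_on UNIV f"
 shows "Cinf (%X. \<integral>y. f y * kern \<delta> (X, y) \<partial>lebesgue)" unfolding Cinf_def
proof
 fix k show "Ck k (%X. \<integral>y. f y * kern \<delta> (X, y) \<partial>lebesgue)"
  using Cinf_kern[OF assms(1)] unfolding Cinf_def by (intro Ck_param_integral assms kern_support) auto
qed

lemma L1loc_const: "L1loc_on UNIV (%_::'a. c :: real)" by (intro continuous_L1loc continuous_on_const)

lemma kern_integral: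
 assumes "\<delta> > 0"
 shows "(\<integral>y. kern \<delta> (X, y) \<partial>lebesgue) = 1"
proof -
 let ?c = "smooth_height \<delta> (snd X)"
 have c: "?c > 0" using assms smooth_height_props by blast
 have "(\<integral>y. kern \<delta> (X, y) \<partial>lebesgue) = (\<integral>y. (1 / ?c) ^ DIM('a) * \<eta> ((1 / ?c) *\<^sub>R (y - fst X)) \<partial>lborel)"
  unfolding kern_def by (subst integral_completion) auto
 also have "\<dots> = (\<integral>y. (1 / ?c) ^ DIM('a) * \<eta> ((1 / ?c) *\<^sub>R (y - fst X)) \<partial>density (distr lborel borel (%z. fst X + ?c *\<^sub>R z)) (%_. ennreal (\<bar>?c\<bar> ^ DIM('a))))"
  using c by (subst lborel_affine[of ?c "fst X"]) auto
 also have "\<dots> = (\<integral>z. ?c ^ DIM('a) * ((1 / ?c) ^ DIM('a) * \<eta> ((1 / ?c) *\<^sub>R (?c *\<^sub>R z))) \<partial>lborel)"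
  using c by (subst integral_density) (simp_all add: integral_distr)
 also have "\<dots> = (\<integral>z. \<eta> z \<partial>lborel)" using c by (intro Bochner_Integration.integral_cong) (auto simp: power_divide)
 finally show ?thesis using \<eta>1 by simp
qed

text \<open>One constant for the rescaled kernel and its first derivatives:
  \<open>DIM('a) * \<eta> z\<close> comes from differentiating the power of the height, and
  \<open>\<kappa> + 1\<close> bounds the rate at which the rescaled point moves while
  \<open>norm z \<le> \<kappa>\<close>.\<close>

definition "kern_bound = (SOME B. \<forall>z. \<eta> z \<le> B \<and> DIM('a) * \<eta> z + norm (grad \<eta> z) * (\<kappa> + 1) \<le> B)"

lemma kern_bound: "\<eta> z \<le> kern_bound" "DIM('a) * \<eta> z + norm (grad \<eta> z) * (\<kappa> + 1) \<le> kern_bound"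
proof -
 have c: "continuous_on UNIV (%z. \<eta> z + (DIM('a) * \<eta> z + norm (grad \<eta> z) * (\<kappa> + 1)))"
  by (intro continuous_intros Cinf_continuous[OF \<eta>(1)] continuous_grad[OF \<eta>(1)])
 have g0: "grad \<eta> z = 0" if "norm z > \<kappa>" for z unfolding grad_def using partial_deriv_0_outside_cball[of \<kappa> \<eta> z] \<eta>(3) that by simp
 obtain B where B: "\<And>z. \<bar>\<eta> z + (DIM('a) * \<eta> z + norm (grad \<eta> z) * (\<kappa> + 1))\<bar> \<le> B"
  using continuous_bounded_support(2)[OF c, of \<kappa>] g0 \<eta>(3) by force
 have "\<forall>z. \<eta> z \<le> B \<and> DIM('a) * \<eta> z + norm (grad \<eta> z) * (\<kappa> + 1) \<le> B"
 proof
  fix z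
  have "DIM('a) * \<eta> z + norm (grad \<eta> z) * (\<kappa> + 1) \<ge> 0" using \<eta>(2)[of z] \<kappa> by simp
  then show "\<eta> z \<le> B \<and> DIM('a) * \<eta> z + norm (grad \<eta> z) * (\<kappa> + 1) \<le> B" using B[of z] \<eta>(2)[of z] by linarith
 qed
 then have "\<forall>z. \<eta> z \<le> kern_bound \<and> DIM('a) * \<eta> z + norm (grad \<eta> z) * (\<kappa> + 1) \<le> kern_bound"
  unfolding kern_bound_def by (rule someI)
 then show "\<eta> z \<le> kern_bound" "DIM('a) * \<eta> z + norm (grad \<eta> z) * (\<kappa> + 1) \<le> kern_bound" by auto
qed

lemma kern_bound_nonneg: "kern_bound \<ge> 0" using kern_bound(1)[of 0] \<eta>(2)[of 0] by linarith

text \<open>A derivative of the kernel costs one more power of \<open>1 / s\<close>, uniformly in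
  \<open>\<delta>\<close>, since above height \<open>\<delta>\<close> the regularised kernel is the
  true one.\<close>

lemma partial_kern_bound:
 assumes d: "\<delta> > 0" and s: "s > \<delta>" and i: "i \<in> (Basis :: ('a \<times> real) set)"
 shows "\<bar>partial_deriv (i, 0) (kern \<delta>) ((x, s), y)\<bar> \<le> kern_bound * (1 / s) ^ (DIM('a) + 1) * indicator (cball 0 (\<kappa> * s)) (y - x)"
proof -
 let ?n = "DIM('a)"
 obtain h \<tau> where i': "i = (h, \<tau>)" by (cases i)
 have n: "norm h \<le> 1" "\<bar>\<tau>\<bar> \<le> 1" using norm_fst_le[of h \<tau>] norm_snd_le[of \<tau> h] norm_Basis[OF i] i' by auto
 have s0: "s > 0" using d s by simp
 define z where "z = (1 / s) *\<^sub>R (y - x)"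
 have nz: "norm z = norm (y - x) / s" using s0 unfolding z_def norm_scaleR by simp
 have "((%t. kern \<delta> (((x, s), y) + t *\<^sub>R (i, 0))) has_real_derivative partial_deriv (i, 0) (kern \<delta>) ((x, s), y)) (at 0)"
  by (rule partial_deriv_line[OF Cinf_kern[OF d]])
 moreover have "((%t. kern \<delta> (((x, s), y) + t *\<^sub>R (i, 0))) has_real_derivative
   - ((1 / s) ^ (?n + 1) * (?n * \<tau> * \<eta> z + grad \<eta> z \<bullet> (\<tau> *\<^sub>R z + h)))) (at 0)"
 proof (rule has_field_derivative_transform_within_open)
  show "open {t. s + t * \<tau> > \<delta>}" by (intro open_Collect_less continuous_intros)
  show "0 \<in> {t. s + t * \<tau> > \<delta>}" using s by simp
  show "(1 / (s + t * \<tau>)) ^ ?n * \<eta> ((1 / (s + t * \<tau>)) *\<^sub>R (y - x - t *\<^sub>R h)) = kern \<delta> (((x, s), y) + t *\<^sub>R (i, 0))"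
   if "t \<in> {t. s + t * \<tau> > \<delta>}" for t using that d by (simp add: kern_def i' smooth_height_props(3) diff_diff_eq)
  have r: "((%t. 1 / (s + t * \<tau>)) has_real_derivative - (\<tau> / s\<^sup>2)) (at 0)"
   using s0 by (auto intro!: derivative_eq_intros simp: power2_eq_square)
  have rn: "((%t. (1 / (s + t * \<tau>)) ^ ?n) has_real_derivative ?n * (1 / s) ^ (?n - 1) * (- (\<tau> / s\<^sup>2))) (at 0)"
   using DERIV_power[OF r, of ?n] s0 by (simp add: mult_ac)
  have zd: "((%t. (1 / (s + t * \<tau>)) *\<^sub>R (y - x - t *\<^sub>R h)) has_derivative (%t. t *\<^sub>R (- ((1 / s) *\<^sub>R (\<tau> *\<^sub>R z + h))))) (at 0)"
  proof -
   have "((%t. (1 / (s + t * \<tau>)) *\<^sub>R (y - x - t *\<^sub>R h)) has_derivative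
    (%t. (1 / (s + 0 * \<tau>)) *\<^sub>R (0 - t *\<^sub>R h) + (- (\<tau> / s\<^sup>2) * t) *\<^sub>R (y - x - 0 *\<^sub>R h))) (at 0)"
    by (rule has_derivative_scaleR[OF r[unfolded has_field_derivative_def]]) (auto intro!: derivative_eq_intros)
   moreover have "(1 / (s + 0 * \<tau>)) *\<^sub>R (0 - t *\<^sub>R h) + (- (\<tau> / s\<^sup>2) * t) *\<^sub>R (y - x - 0 *\<^sub>R h) = t *\<^sub>R (- ((1 / s) *\<^sub>R (\<tau> *\<^sub>R z + h)))" for t
    by (simp add: z_def algebra_simps power2_eq_square)
   ultimately show ?thesis by simp
  qed
  have "(\<eta> has_derivative (%v. grad \<eta> z \<bullet> v)) (at ((1 / (s + 0 * \<tau>)) *\<^sub>R (y - x - 0 *\<^sub>R h)))"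
   using has_derivative_grad[OF Cinf_differentiable[OF \<eta>(1)], of z] by (simp add: z_def)
  from diff_chain_at[OF zd this]
  have ed: "((%t. \<eta> ((1 / (s + t * \<tau>)) *\<^sub>R (y - x - t *\<^sub>R h))) has_real_derivative - ((1 / s) * (grad \<eta> z \<bullet> (\<tau> *\<^sub>R z + h)))) (at 0)"
   unfolding has_field_derivative_def o_def by (rule has_derivative_eq_rhs) (simp add: fun_eq_iff)
  have pw: "(1 / s) ^ (?n + 1) = (1 / s) ^ (?n - 1) * (1 / s\<^sup>2)"
   using DIM_positive[where 'a = 'a] by (simp add: power_add[symmetric] power_one_over[symmetric] flip: power_add)
  show "((%t. (1 / (s + t * \<tau>)) ^ ?n * \<eta> ((1 / (s + t * \<tau>)) *\<^sub>R (y - x - t *\<^sub>R h))) has_real_derivative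
    - ((1 / s) ^ (?n + 1) * (?n * \<tau> * \<eta> z + grad \<eta> z \<bullet> (\<tau> *\<^sub>R z + h)))) (at 0)"
  proof (rule DERIV_cong[OF DERIV_mult[OF rn ed]])
   have "?n * (1 / s) ^ (?n - 1) * (- (\<tau> / s\<^sup>2)) = - ((1 / s) ^ (?n + 1) * (?n * \<tau>))" unfolding pw by simp
   then show "?n * (1 / s) ^ (?n - 1) * (- (\<tau> / s\<^sup>2)) * \<eta> ((1 / (s + 0 * \<tau>)) *\<^sub>R (y - x - 0 *\<^sub>R h))
     + - ((1 / s) * (grad \<eta> z \<bullet> (\<tau> *\<^sub>R z + h))) * (1 / (s + 0 * \<tau>)) ^ ?n
    = - ((1 / s) ^ (?n + 1) * (?n * \<tau> * \<eta> z + grad \<eta> z \<bullet> (\<tau> *\<^sub>R z + h)))" by (simp add: z_def algebra_simps)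
  qed
 qed
 ultimately have eq: "partial_deriv (i, 0) (kern \<delta>) ((x, s), y) = - ((1 / s) ^ (?n + 1) * (?n * \<tau> * \<eta> z + grad \<eta> z \<bullet> (\<tau> *\<^sub>R z + h)))"
  by (rule DERIV_unique)
 show ?thesis
 proof (cases "norm (y - x) \<le> \<kappa> * s")
  case True
  then have z: "norm z \<le> \<kappa>" using s0 by (simp add: nz field_simps)
  have "\<bar>?n * \<tau> * \<eta> z + grad \<eta> z \<bullet> (\<tau> *\<^sub>R z + h)\<bar> \<le> ?n * \<eta> z + norm (grad \<eta> z) * (\<kappa> + 1)"
  proof (rule order_trans[OF abs_triangle_ineq add_mono])
   show "\<bar>?n * \<tau> * \<eta> z\<bar> \<le> ?n * \<eta> z" using n \<eta>(2)[of z] by (simp add: abs_mult mult_left_le_one_le mult.assoc)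
   have "norm (\<tau> *\<^sub>R z + h) \<le> \<bar>\<tau>\<bar> * norm z + norm h" using norm_triangle_ineq[of "\<tau> *\<^sub>R z" h] by simp
   also have "\<dots> \<le> 1 * \<kappa> + 1" by (intro add_mono mult_mono n z) auto
   finally show "\<bar>grad \<eta> z \<bullet> (\<tau> *\<^sub>R z + h)\<bar> \<le> norm (grad \<eta> z) * (\<kappa> + 1)"
    by (intro order_trans[OF Cauchy_Schwarz_ineq2] mult_left_mono) auto
  qed
  also have "\<dots> \<le> kern_bound" by (rule kern_bound(2))
  finally have "(1 / s) ^ (?n + 1) * \<bar>?n * \<tau> * \<eta> z + grad \<eta> z \<bullet> (\<tau> *\<^sub>R z + h)\<bar> \<le> (1 / s) ^ (?n + 1) * kern_bound"
   using s0 by (intro mult_left_mono) auto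
  then show ?thesis unfolding eq using True s0 by (simp add: abs_mult mult.commute del: power_Suc)
 next
  case False
  then have z: "norm z > \<kappa>" using s0 by (simp add: nz field_simps)
  then have "grad \<eta> z = 0" unfolding grad_def using partial_deriv_0_outside_cball[of \<kappa> \<eta> z] \<eta>(3) by simp
  then show ?thesis unfolding eq using z \<eta>(3)[of z] kern_bound_nonneg s0 by simp
 qed
qed

end

text \<open>The p-th power of the seminorm. With \<open>DIM('a)\<close> equal to N - 1, the exponent
  of \<open>norm h\<close> is p + N - 2.\<close>

definition gagliardo :: "real => real => ('a::euclidean_space => real) => ennreal" where
 "gagliardo a p f = (\<integral>\<^sup>+x. (\<integral>\<^sup>+h. ennreal (\<bar>f (x + h) - f x\<bar> powr p / norm h powr (p + DIM('a) - 1))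
   * indicator (ball 0 a) h \<partial>lborel) \<partial>lborel)"

lemma nn_integral_powr_tail:
 assumes "c > 0" "m > 1"
 shows "(\<integral>\<^sup>+s. ennreal (s powr (- m)) * indicator {c..} s \<partial>lborel) = ennreal (c powr (1 - m) / (m - 1))"
proof -
 have "(\<integral>\<^sup>+s. ennreal (s powr (- m)) * indicator {c..} s \<partial>lborel) = ennreal (0 - (- (c powr (1 - m) / (m - 1))))"
 proof (rule nn_integral_FTC_atLeast)
  show "((%s. - (s powr (1 - m) / (m - 1))) has_real_derivative s powr (- m)) (at s)" if "c \<le> s" for s
  proof -
   have "((%s. s powr (1 - m)) has_real_derivative (1 - m) * s powr (1 - m - 1)) (at s)"
    by (rule has_real_derivative_powr) (use assms that in auto)
   from DERIV_minus[OF DERIV_cdivide[OF this, of "m - 1"]] show ?thesis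
    by (rule DERIV_cong) (use assms in "simp add: divide_simps, simp add: algebra_simps")
  qed
  have "((%s. - (s powr (1 - m) / (m - 1))) \<longlongrightarrow> - (0 / (m - 1))) at_top"
   by (intro tendsto_intros tendsto_neg_powr filterlim_ident) (use assms in auto)
  then show "((%s. - (s powr (1 - m) / (m - 1))) \<longlongrightarrow> 0) at_top" by simp
 qed auto
 then show ?thesis by simp
qed

lemma ball_borel [measurable]: "ball c r \<in> sets borel" "cball c r \<in> sets borel"
 for c :: "'a::euclidean_space" by auto

section \<open>Averages and their gradients bounded by the Gagliardo integral\<close>

context averaging_kernel
begin

text \<open>The total, not the mean, oscillation over the averaging ball: the powers of
  \<open>s\<close> stemming from its volume are collected later.\<close>

definition osc :: "('a => real) => real => 'a => real" where
 "osc f s x = (\<integral>h. \<bar>f (x + h) - f x\<bar> * indicator (cball 0 (\<kappa> * s)) h \<partial>lborel)"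

definition osc_powr :: "real => ('a => real) => real => 'a => ennreal" where
 "osc_powr p f s x = (\<integral>\<^sup>+h. ennreal (\<bar>f (x + h) - f x\<bar> powr p * indicator (cball 0 (\<kappa> * s)) h) \<partial>lborel)"

definition "ball_const = unit_ball_vol (real DIM('a)) * \<kappa> ^ DIM('a)"

context
 fixes f :: "'a => real" and p :: real
 assumes f [measurable]: "f \<in> borel_measurable borel" and fL: "L1loc_on UNIV f" and p: "p > 1"
begin

lemma osc_integrable: "integrable lborel (%h. (f (x + h) - f x) * indicator (cball 0 r) h)"
proof -
 have "f absolutely_integrable_on cball x r" using fL by (simp add: L1loc_on_def)
 then have "integrable lborel (%y. indicator (cball x r) y *\<^sub>R f y)"
  unfolding set_integrable_def by (subst (asm) integrable_completion) auto
 then have "integrable lborel (%h. indicator (cball x r) (x + h) *\<^sub>R f (x + h))" by (subst lborel_translate(1)) auto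
 moreover have "indicator (cball x r) (x + h) = (indicator (cball 0 r) h :: real)" for h by (simp add: indicator_def dist_norm)
 ultimately have 1: "integrable lborel (%h. indicator (cball 0 r) h * f (x + h))" by simp
 have "integrable lborel (%h. indicator (cball (0::'a) r) h *\<^sub>R f x)" by (rule borel_integrable_compact) auto
 from Bochner_Integration.integrable_diff[OF 1 this] show ?thesis by (simp add: algebra_simps)
qed

text \<open>Subtracting \<open>f x\<close> times the mass of \<open>k\<close> turns \<open>f\<close>
  into its increments. The kernel itself has mass 1, which yields the deviation of the average from
  \<open>f\<close>; its derivatives have mass 0, which yields the gradient.\<close>

lemma kernel_osc_bound:
 assumes s: "s > 0" and [measurable]: "k \<in> borel_measurable borel"
  and k: "\<And>y. \<bar>k y\<bar> \<le> B * indicator (cball 0 (\<kappa> * s)) (y - x)"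
 shows "\<bar>(\<integral>y. f y * k y \<partial>lebesgue) - f x * (\<integral>y. k y \<partial>lebesgue)\<bar> \<le> B * osc f s x"
proof -
 have B: "B \<ge> 0" using k[of x] \<kappa> s by (auto simp: indicator_def split: if_splits)
 have ki: "integrable lborel (%h. k (x + h))"
 proof (rule Bochner_Integration.integrable_bound)
  show "integrable lborel (%h. indicator (cball (0::'a) (\<kappa> * s)) h *\<^sub>R B)" by (rule borel_integrable_compact) auto
  show "AE h in lborel. norm (k (x + h)) \<le> norm (indicator (cball 0 (\<kappa> * s)) h *\<^sub>R B)"
   using k[of "x + h" for h] B by (intro AE_I2) (simp add: mult.commute)
 qed measurable
 have di: "integrable lborel (%h. (f (x + h) - f x) * k (x + h))"
 proof (rule Bochner_Integration.integrable_bound)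
  show "integrable lborel (%h. B * ((f (x + h) - f x) * indicator (cball 0 (\<kappa> * s)) h))"
   by (intro integrable_mult_right osc_integrable)
  show "AE h in lborel. norm ((f (x + h) - f x) * k (x + h)) \<le> norm (B * ((f (x + h) - f x) * indicator (cball 0 (\<kappa> * s)) h))"
  proof (rule AE_I2)
   fix h
   have "\<bar>f (x + h) - f x\<bar> * \<bar>k (x + h)\<bar> \<le> \<bar>f (x + h) - f x\<bar> * (B * indicator (cball 0 (\<kappa> * s)) h)"
    using k[of "x + h"] by (intro mult_left_mono) auto
   then show "norm ((f (x + h) - f x) * k (x + h)) \<le> norm (B * ((f (x + h) - f x) * indicator (cball 0 (\<kappa> * s)) h))"
    using B by (simp add: abs_mult mult_ac)
  qed
 qed measurable
 have "(\<integral>y. f y * k y \<partial>lebesgue) = (\<integral>h. f (x + h) * k (x + h) \<partial>lborel)"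
  "(\<integral>y. k y \<partial>lebesgue) = (\<integral>h. k (x + h) \<partial>lborel)"
  using lborel_translate(2)[of "%y. f y * k y" x] lborel_translate(2)[of k x] by (simp_all add: integral_completion)
 moreover have "(\<integral>h. f (x + h) * k (x + h) \<partial>lborel) = (\<integral>h. (f (x + h) - f x) * k (x + h) + f x * k (x + h) \<partial>lborel)"
  by (simp add: algebra_simps)
 ultimately have "(\<integral>y. f y * k y \<partial>lebesgue) - f x * (\<integral>y. k y \<partial>lebesgue) = (\<integral>h. (f (x + h) - f x) * k (x + h) \<partial>lborel)"
  using di ki by simp
 also have "\<bar>\<dots>\<bar> \<le> (\<integral>h. \<bar>(f (x + h) - f x) * k (x + h)\<bar> \<partial>lborel)" by (rule integral_abs_bound)
 also have "\<dots> \<le> (\<integral>h. B * (\<bar>f (x + h) - f x\<bar> * indicator (cball 0 (\<kappa> * s)) h) \<partial>lborel)"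
 proof (rule integral_mono)
  show "integrable lborel (%h. B * (\<bar>f (x + h) - f x\<bar> * indicator (cball 0 (\<kappa> * s)) h))"
   using integrable_abs[OF osc_integrable[of x "\<kappa> * s"]] by (intro integrable_mult_right) (simp add: abs_mult)
  fix h
  have "\<bar>f (x + h) - f x\<bar> * \<bar>k (x + h)\<bar> \<le> \<bar>f (x + h) - f x\<bar> * (B * indicator (cball 0 (\<kappa> * s)) h)"
   using k[of "x + h"] by (intro mult_left_mono) auto
  then show "\<bar>(f (x + h) - f x) * k (x + h)\<bar> \<le> B * (\<bar>f (x + h) - f x\<bar> * indicator (cball 0 (\<kappa> * s)) h)"
   by (simp add: abs_mult mult_ac)
 qed (use di in auto)
 also have "\<dots> = B * osc f s x" by (simp add: osc_def)
 finally show ?thesis .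
qed

lemma osc_powr_bound:
 assumes s: "s > 0" and B: "B \<ge> 0"
 shows "ennreal ((B * osc f s x) powr p) \<le> ennreal (B powr p * (ball_const * s ^ DIM('a)) powr (p - 1)) * osc_powr p f s x"
proof -
 have vol: "(\<integral>h. indicator (cball (0::'a) (\<kappa> * s)) h \<partial>lborel) = ball_const * s ^ DIM('a)"
  using s \<kappa> by (simp add: content_cball ball_const_def power_mult_distrib)
 have "ennreal (osc f s x powr p) \<le> ennreal ((ball_const * s ^ DIM('a)) powr (p - 1)) * osc_powr p f s x"
  unfolding osc_def osc_powr_def vol[symmetric]
 proof (rule jensen_powr[OF p])
  show "integrable lborel (%h. \<bar>f (x + h) - f x\<bar> * indicator (cball 0 (\<kappa> * s)) h)"
   using integrable_abs[OF osc_integrable[of x "\<kappa> * s"]] by (simp add: abs_mult)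
  show "integrable lborel (%h. indicator (cball (0::'a) (\<kappa> * s)) h :: real)"
   using borel_integrable_compact[of "cball (0::'a) (\<kappa> * s)" "%_. 1::real"] by simp
 qed auto
 then have "ennreal (B powr p) * ennreal (osc f s x powr p)
   \<le> ennreal (B powr p) * (ennreal ((ball_const * s ^ DIM('a)) powr (p - 1)) * osc_powr p f s x)" by (intro mult_left_mono) auto
 moreover have "ennreal ((B * osc f s x) powr p) = ennreal (B powr p) * ennreal (osc f s x powr p)"
  by (simp add: powr_mult ennreal_mult)
 ultimately show ?thesis by (simp add: ennreal_mult mult.assoc)
qed

lemma average_dev_le:
 assumes s: "s > 0"
 shows "\<bar>average \<eta> f (x, s) - f x\<bar> \<le> (kern_bound * (1 / s) ^ DIM('a)) * osc f s x"
proof -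
 let ?k = "%y. kern s ((x, s), y)"
 have "\<bar>(\<integral>y. f y * ?k y \<partial>lebesgue) - f x * (\<integral>y. ?k y \<partial>lebesgue)\<bar> \<le> (kern_bound * (1 / s) ^ DIM('a)) * osc f s x"
 proof (rule kernel_osc_bound[OF s])
  show "?k \<in> borel_measurable borel"
  proof (rule borel_measurable_continuous_onI)
   show "continuous_on UNIV ?k"
    by (rule continuous_on_compose2[OF Cinf_continuous[OF Cinf_kern[OF s]]]) (auto intro!: continuous_intros)
  qed
  fix y
  have sh: "smooth_height s s = s" using s by (simp add: smooth_height_props)
  show "\<bar>kern s ((x, s), y)\<bar> \<le> kern_bound * (1 / s) ^ DIM('a) * indicator (cball 0 (\<kappa> * s)) (y - x)"
  proof (cases "norm (y - x) \<le> \<kappa> * s")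
   case True
   then show ?thesis using s kern_bound(1)[of "(1 / s) *\<^sub>R (y - x)"] \<eta>(2)[of "(1 / s) *\<^sub>R (y - x)"]
    by (simp add: kern_def sh abs_mult mult.commute mult_left_mono del: scaleR_right_diff_distrib)
  next
   case False
   then have "norm ((1 / s) *\<^sub>R (y - x)) \<ge> \<kappa>" using s unfolding norm_scaleR by (simp add: field_simps)
   then show ?thesis using False \<eta>(3) by (simp add: kern_def sh del: scaleR_right_diff_distrib norm_scaleR)
  qed
 qed
 then show ?thesis using average_kern[OF s, of "(x, s)" f] kern_integral[OF s, of "(x, s)"] by simp
qed

lemma partial_param_kern:
 assumes d: "\<delta> > 0" and g: "L1loc_on UNIV g" and i: "i \<in> Basis"
 shows "partial_deriv i (%X. \<integral>y. g y * kern \<delta> (X, y) \<partial>lebesgue) X = (\<integral>y. g y * partial_deriv (i, 0) (kern \<delta>) (X, y) \<partial>lebesgue)"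
proof -
 have "Ck (Suc 0) (kern \<delta>)" using Cinf_kern[OF d] unfolding Cinf_def by blast
 from partial_deriv_eq[OF has_derivative_param_integral[OF g kern_support[OF d] this]]
 show ?thesis using sum_inner_Basis_mult[OF i] by simp
qed

lemma average_local:
 assumes "\<delta> > 0" "s > \<delta>"
 shows "(average \<eta> f has_derivative (%h. partial_deriv h (%X. \<integral>y. f y * kern \<delta> (X, y) \<partial>lebesgue) (x, s))) (at (x, s))"
proof (rule has_derivative_transform_within_open[OF Cinf_has_derivative[OF Cinf_param_kern[OF assms(1) fL]]])
 show "open {X :: 'a \<times> real. snd X > \<delta>}" by (intro open_Collect_less continuous_intros)
qed (use assms average_kern in auto)

lemma average_grad_le:
 assumes s: "s > 0"
 shows "norm (grad (average \<eta> f) (x, s)) \<le> ((DIM('a) + 1) * kern_bound * (1 / s) ^ (DIM('a) + 1)) * osc f s x"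
proof -
 \<comment> \<open>Any positive cut-off below \<open>s\<close> serves; it only has to make the
   average smooth near height \<open>s\<close>.\<close>
 define \<delta> where "\<delta> = s / 2"
 have d: "\<delta> > 0" "s > \<delta>" using s by (auto simp: \<delta>_def)
 have "\<bar>partial_deriv i (average \<eta> f) (x, s)\<bar> \<le> kern_bound * (1 / s) ^ (DIM('a) + 1) * osc f s x"
  if i: "i \<in> Basis" for i
 proof -
  let ?k = "%y. partial_deriv (i, 0) (kern \<delta>) ((x, s), y)"
  have e: "partial_deriv i (average \<eta> f) (x, s) = (\<integral>y. f y * ?k y \<partial>lebesgue)"
   using partial_deriv_eq[OF average_local[OF d], of i x] partial_param_kern[OF d(1) fL i] by simp
  \<comment> \<open>The average of the constant 1 is constant, so its derivative, the mass of the
    differentiated kernel, is 0.\<close>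
  have "(%X. \<integral>y. 1 * kern \<delta> (X, y) \<partial>lebesgue) = (%X. 1)" using kern_integral[OF d(1)] by simp
  then have "(\<integral>y. 1 * ?k y \<partial>lebesgue) = partial_deriv i (%X. 1) (x, s)"
   using partial_param_kern[OF d(1) L1loc_const[of 1] i, of "(x, s)"] by simp
  then have z: "(\<integral>y. ?k y \<partial>lebesgue) = 0" by (simp add: partial_deriv_eq[OF has_derivative_const])
  have "\<bar>(\<integral>y. f y * ?k y \<partial>lebesgue) - f x * (\<integral>y. ?k y \<partial>lebesgue)\<bar> \<le> (kern_bound * (1 / s) ^ (DIM('a) + 1)) * osc f s x"
  proof (rule kernel_osc_bound[OF s _ partial_kern_bound[OF d i]])
   have "continuous_on UNIV (partial_deriv (i, 0) (kern \<delta>))"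
    by (rule Cinf_continuous[OF Cinf_partial[OF Cinf_kern[OF d(1)]]], subst Basis_prod_def) (use i in blast)
   then have "continuous_on UNIV ?k" by (rule continuous_on_compose2) (auto intro!: continuous_intros)
   then show "?k \<in> borel_measurable borel" by (rule borel_measurable_continuous_onI)
  qed
  then show ?thesis using e z by simp
 qed
 then have "(\<Sum>i\<in>Basis. \<bar>grad (average \<eta> f) (x, s) \<bullet> i\<bar>) \<le> (\<Sum>i\<in>(Basis :: ('a \<times> real) set). kern_bound * (1 / s) ^ (DIM('a) + 1) * osc f s x)"
  by (intro sum_mono) (simp add: grad_inner_Basis)
 moreover have "norm (grad (average \<eta> f) (x, s)) \<le> (\<Sum>i\<in>Basis. \<bar>grad (average \<eta> f) (x, s) \<bullet> i\<bar>)" by (rule norm_le_l1)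
 ultimately show ?thesis by (simp add: mult_ac add.commute)
qed

definition "dev_const = kern_bound powr p * ball_const powr (p - 1)"

lemma average_dev_powr_le:
 assumes s: "s > 0"
 shows "ennreal (\<bar>average \<eta> f (x, s) - f x\<bar> powr p) \<le> ennreal (dev_const * s powr (- DIM('a))) * osc_powr p f s x"
proof -
 have "ennreal (\<bar>average \<eta> f (x, s) - f x\<bar> powr p) \<le> ennreal (((kern_bound * (1 / s) ^ DIM('a)) * osc f s x) powr p)"
  using p average_dev_le[OF s] by (intro ennreal_leI powr_mono2) auto
 also have "\<dots> \<le> ennreal ((kern_bound * (1 / s) ^ DIM('a)) powr p * (ball_const * s ^ DIM('a)) powr (p - 1)) * osc_powr p f s x"
  using s kern_bound_nonneg by (intro osc_powr_bound) auto
 also have "(kern_bound * (1 / s) ^ DIM('a)) powr p * (ball_const * s ^ DIM('a)) powr (p - 1) = dev_const * s powr (- DIM('a))"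
 proof -
  have "((1 / s) ^ DIM('a)) powr p = s powr (- (DIM('a) * p))"
   using s by (simp add: powr_realpow[symmetric] powr_powr powr_minus_divide powr_divide)
  moreover have "(s ^ DIM('a)) powr (p - 1) = s powr (DIM('a) * (p - 1))"
   using s by (simp add: powr_realpow[symmetric] powr_powr)
  moreover have "s powr (- (DIM('a) * p)) * s powr (DIM('a) * (p - 1)) = s powr (- DIM('a))"
   by (simp add: powr_add[symmetric] algebra_simps)
  ultimately show ?thesis by (simp add: dev_const_def powr_mult mult_ac)
 qed
 finally show ?thesis .
qed

definition "grad_const = (real (DIM('a) + 1) * kern_bound) powr p * ball_const powr (p - 1)"

lemma average_grad_powr_le:
 assumes s: "s > 0"
 shows "ennreal (norm (grad (average \<eta> f) (x, s)) powr p) \<le> ennreal (grad_const * s powr (- (p + DIM('a)))) * osc_powr p f s x"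
proof -
 have "ennreal (norm (grad (average \<eta> f) (x, s)) powr p) \<le> ennreal (((real (DIM('a) + 1) * kern_bound * (1 / s) ^ (DIM('a) + 1)) * osc f s x) powr p)"
  using p average_grad_le[OF s] by (intro ennreal_leI powr_mono2) auto
 also have "\<dots> \<le> ennreal ((real (DIM('a) + 1) * kern_bound * (1 / s) ^ (DIM('a) + 1)) powr p * (ball_const * s ^ DIM('a)) powr (p - 1)) * osc_powr p f s x"
  using s kern_bound_nonneg by (intro osc_powr_bound) auto
 also have "(real (DIM('a) + 1) * kern_bound * (1 / s) ^ (DIM('a) + 1)) powr p * (ball_const * s ^ DIM('a)) powr (p - 1) = grad_const * s powr (- (p + DIM('a)))"
 proof -
  have "((1 / s) ^ (DIM('a) + 1)) powr p = s powr (- (real (DIM('a) + 1) * p))"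
   using s powr_realpow[of "1 / s" "DIM('a) + 1"] by (simp only: powr_realpow[symmetric] zero_less_divide_1_iff) (simp add: powr_powr powr_minus_divide powr_divide)
  moreover have "(s ^ DIM('a)) powr (p - 1) = s powr (DIM('a) * (p - 1))"
   using s by (simp add: powr_realpow[symmetric] powr_powr)
  moreover have "s powr (- (real (DIM('a) + 1) * p)) * s powr (DIM('a) * (p - 1)) = s powr (- (p + DIM('a)))"
   by (simp add: powr_add[symmetric] algebra_simps)
  ultimately show ?thesis unfolding grad_const_def powr_mult by (simp add: mult_ac)
 qed
 finally show ?thesis .
qed

text \<open>On the averaging ball \<open>norm h \<le> \<kappa> * s\<close>, so the singular weight
  can be inserted at the price of a power of \<open>\<kappa> * s\<close>; the ball is contained in
  \<open>ball 0 a\<close>.\<close>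

lemma osc_powr_integral_le:
 assumes s: "s > 0" "\<kappa> * s < a"
 shows "(\<integral>\<^sup>+x. osc_powr p f s x \<partial>lborel) \<le> ennreal ((\<kappa> * s) powr (p + DIM('a) - 1)) * gagliardo a p f"
proof -
 have "(\<integral>\<^sup>+x. osc_powr p f s x \<partial>lborel) \<le> (\<integral>\<^sup>+x. ennreal ((\<kappa> * s) powr (p + DIM('a) - 1)) *
   (\<integral>\<^sup>+h. ennreal (\<bar>f (x + h) - f x\<bar> powr p / norm h powr (p + DIM('a) - 1)) * indicator (ball 0 a) h \<partial>lborel) \<partial>lborel)"
 proof (rule nn_integral_mono)
  fix x
  have "osc_powr p f s x \<le> (\<integral>\<^sup>+h. ennreal ((\<kappa> * s) powr (p + DIM('a) - 1)) * (ennreal (\<bar>f (x + h) - f x\<bar> powr p / norm h powr (p + DIM('a) - 1)) * indicator (ball 0 a) h) \<partial>lborel)"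
   unfolding osc_powr_def
  proof (rule nn_integral_mono)
   fix h :: 'a
   show "ennreal (\<bar>f (x + h) - f x\<bar> powr p * indicator (cball 0 (\<kappa> * s)) h)
    \<le> ennreal ((\<kappa> * s) powr (p + DIM('a) - 1)) * (ennreal (\<bar>f (x + h) - f x\<bar> powr p / norm h powr (p + DIM('a) - 1)) * indicator (ball 0 a) h)"
   proof (cases "h \<noteq> 0 \<and> norm h \<le> \<kappa> * s")
    case True
    have "norm h powr (p + DIM('a) - 1) \<le> (\<kappa> * s) powr (p + DIM('a) - 1)" using True p by (intro powr_mono2) auto
    then have "\<bar>f (x + h) - f x\<bar> powr p \<le> (\<kappa> * s) powr (p + DIM('a) - 1) * (\<bar>f (x + h) - f x\<bar> powr p / norm h powr (p + DIM('a) - 1))"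
     using mult_right_mono[of "norm h powr (p + DIM('a) - 1)" _ "\<bar>f (x + h) - f x\<bar> powr p / norm h powr (p + DIM('a) - 1)"] True
     by fastforce
    then show ?thesis using True s(2) by (simp add: ennreal_mult'[symmetric] ennreal_leI)
   qed (auto simp: indicator_def)
  qed
  also have "\<dots> = ennreal ((\<kappa> * s) powr (p + DIM('a) - 1)) * (\<integral>\<^sup>+h. ennreal (\<bar>f (x + h) - f x\<bar> powr p / norm h powr (p + DIM('a) - 1)) * indicator (ball 0 a) h \<partial>lborel)"
   by (rule nn_integral_cmult) measurable
  finally show "osc_powr p f s x \<le> ennreal ((\<kappa> * s) powr (p + DIM('a) - 1)) * (\<integral>\<^sup>+h. ennreal (\<bar>f (x + h) - f x\<bar> powr p / norm h powr (p + DIM('a) - 1)) * indicator (ball 0 a) h \<partial>lborel)" .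
 qed
 also have "\<dots> = ennreal ((\<kappa> * s) powr (p + DIM('a) - 1)) * gagliardo a p f"
  unfolding gagliardo_def by (rule nn_integral_cmult) measurable
 finally show ?thesis .
qed

text \<open>The exponents add up to \<open>s powr (p - 1)\<close>, which vanishes with
  \<open>s\<close> because \<open>p > 1\<close>. This is what makes \<open>f\<close> the trace of
  its averages.\<close>

lemma average_dev_integral_le:
 assumes s: "s > 0" "\<kappa> * s < a"
 shows "(\<integral>\<^sup>+x. ennreal (\<bar>average \<eta> f (x, s) - f x\<bar> powr p) \<partial>lborel)
   \<le> ennreal (dev_const * \<kappa> powr (p + DIM('a) - 1) * s powr (p - 1)) * gagliardo a p f"
proof -
 have [measurable]: "(%x. osc_powr p f s x) \<in> borel_measurable borel" unfolding osc_powr_def by measurable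
 have "(\<integral>\<^sup>+x. ennreal (\<bar>average \<eta> f (x, s) - f x\<bar> powr p) \<partial>lborel) \<le> (\<integral>\<^sup>+x. ennreal (dev_const * s powr (- DIM('a))) * osc_powr p f s x \<partial>lborel)"
  by (intro nn_integral_mono average_dev_powr_le s)
 also have "\<dots> = ennreal (dev_const * s powr (- DIM('a))) * (\<integral>\<^sup>+x. osc_powr p f s x \<partial>lborel)"
  by (rule nn_integral_cmult) measurable
 also have "\<dots> \<le> ennreal (dev_const * s powr (- DIM('a))) * (ennreal ((\<kappa> * s) powr (p + DIM('a) - 1)) * gagliardo a p f)"
  by (intro mult_left_mono osc_powr_integral_le s) auto
 also have "\<dots> = ennreal (dev_const * s powr (- DIM('a)) * (\<kappa> * s) powr (p + DIM('a) - 1)) * gagliardo a p f"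
  by (simp add: ennreal_mult'' mult.assoc)
 also have "dev_const * s powr (- DIM('a)) * (\<kappa> * s) powr (p + DIM('a) - 1) = dev_const * \<kappa> powr (p + DIM('a) - 1) * (s powr (- DIM('a)) * s powr (p + DIM('a) - 1))"
  by (simp add: powr_mult mult_ac)
 also have "s powr (- DIM('a)) * s powr (p + DIM('a) - 1) = s powr (p - 1)" by (simp add: powr_add[symmetric])
 finally show ?thesis .
qed

text \<open>After the integrals over \<open>s\<close> and \<open>h\<close> are exchanged, an
  increment \<open>h\<close> is seen only at heights \<open>s \<ge> norm h / \<kappa>\<close>.
  Integrating \<open>s powr (- (p + DIM('a)))\<close> from there on gives the Gagliardo weight up to
  a constant.\<close>

lemma average_grad_integral_le:
 assumes s1: "\<kappa> * s1 \<le> a"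
 shows "(\<integral>\<^sup>+X. ennreal (norm (grad (average \<eta> f) X) powr p) * indicator {X. 0 < snd X \<and> snd X < s1} X \<partial>lborel)
   \<le> ennreal (grad_const * \<kappa> powr (p + DIM('a) - 1) / (p + DIM('a) - 1)) * gagliardo a p f"
proof -
 define m where "m = p + DIM('a)"
 have m: "m > 1" using p by (simp add: m_def)
 define \<Phi> where "\<Phi> x h s = ennreal (grad_const * s powr (- m)) * indicator {0<..<s1} s *
   ennreal (\<bar>f (x + h) - f x\<bar> powr p * indicator (cball 0 (\<kappa> * s)) h)" for x h :: 'a and s :: real
 have [measurable]: "(%(x, s). \<integral>\<^sup>+h. \<Phi> x h s \<partial>lborel) \<in> borel_measurable (lborel \<Otimes>\<^sub>M lborel)"
  unfolding \<Phi>_def cball_def dist_norm indicator_def by measurable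
 have gc: "grad_const \<ge> 0" by (simp add: grad_const_def)
 have "(\<integral>\<^sup>+X. ennreal (norm (grad (average \<eta> f) X) powr p) * indicator {X. 0 < snd X \<and> snd X < s1} X \<partial>lborel)
   \<le> (\<integral>\<^sup>+X. (case X of (x, s) => \<integral>\<^sup>+h. \<Phi> x h s \<partial>lborel) \<partial>lborel)"
 proof (rule nn_integral_mono, clarsimp split: prod.split)
  fix x s
  show "ennreal (norm (grad (average \<eta> f) (x, s)) powr p) * indicator {X. 0 < snd X \<and> snd X < s1} (x, s) \<le> (\<integral>\<^sup>+h. \<Phi> x h s \<partial>lborel)"
  proof (cases "0 < s \<and> s < s1")
   case True
   have "(\<integral>\<^sup>+h. \<Phi> x h s \<partial>lborel) = ennreal (grad_const * s powr (- m)) * osc_powr p f s x"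
    unfolding \<Phi>_def osc_powr_def using True by (simp add: nn_integral_cmult)
   then show ?thesis using average_grad_powr_le[of s x] True by (simp add: m_def)
  qed simp
 qed
 also have "\<dots> = (\<integral>\<^sup>+x. \<integral>\<^sup>+s. \<integral>\<^sup>+h. \<Phi> x h s \<partial>lborel \<partial>lborel \<partial>lborel)"
  by (subst lborel_prod[symmetric], subst lborel.nn_integral_fst[symmetric]) auto
 also have "\<dots> = (\<integral>\<^sup>+x. \<integral>\<^sup>+h. \<integral>\<^sup>+s. \<Phi> x h s \<partial>lborel \<partial>lborel \<partial>lborel)"
 proof (rule nn_integral_cong)
  fix x
  show "(\<integral>\<^sup>+s. \<integral>\<^sup>+h. \<Phi> x h s \<partial>lborel \<partial>lborel) = (\<integral>\<^sup>+h. \<integral>\<^sup>+s. \<Phi> x h s \<partial>lborel \<partial>lborel)"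
   by (rule lborel_pair.Fubini') (unfold \<Phi>_def cball_def dist_norm indicator_def, measurable)
 qed
 also have "\<dots> \<le> (\<integral>\<^sup>+x. \<integral>\<^sup>+h. ennreal (grad_const * \<kappa> powr (p + DIM('a) - 1) / (p + DIM('a) - 1)) *
   (ennreal (\<bar>f (x + h) - f x\<bar> powr p / norm h powr (p + DIM('a) - 1)) * indicator (ball 0 a) h) \<partial>lborel \<partial>lborel)"
 proof (intro nn_integral_mono)
  fix x h :: 'a
  show "(\<integral>\<^sup>+s. \<Phi> x h s \<partial>lborel) \<le> ennreal (grad_const * \<kappa> powr (p + DIM('a) - 1) / (p + DIM('a) - 1)) *
   (ennreal (\<bar>f (x + h) - f x\<bar> powr p / norm h powr (p + DIM('a) - 1)) * indicator (ball 0 a) h)"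
  proof (cases "h = 0 \<or> norm h \<ge> a")
   case True
   \<comment> \<open>The averaging radius stays below \<open>\<kappa> * s1 \<le> a\<close>, so
     longer increments are never seen.\<close>
   have "\<Phi> x h s = 0" for s
   proof (cases "h = 0")
    case False
    then have "norm h \<ge> a" using True by simp
    moreover have "\<kappa> * s < a" if "s < s1" using mult_strict_left_mono[OF that \<kappa>] s1 by linarith
    ultimately show ?thesis by (auto simp: \<Phi>_def indicator_def)
   qed (simp add: \<Phi>_def)
   then show ?thesis by simp
  next
   case False
   define c where "c = norm h / \<kappa>"
   have c: "c > 0" using False \<kappa> by (simp add: c_def)
   let ?D = "\<bar>f (x + h) - f x\<bar> powr p"
   have "(\<integral>\<^sup>+s. \<Phi> x h s \<partial>lborel) \<le> (\<integral>\<^sup>+s. ennreal (grad_const * ?D) * (ennreal (s powr (- m)) * indicator {c..} s) \<partial>lborel)"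
   proof (rule nn_integral_mono)
    fix s
    show "\<Phi> x h s \<le> ennreal (grad_const * ?D) * (ennreal (s powr (- m)) * indicator {c..} s)"
    proof (cases "norm h \<le> \<kappa> * s")
     case True
     then have "s \<ge> c" using \<kappa> by (simp add: c_def field_simps)
     then show ?thesis using gc by (auto simp: \<Phi>_def ennreal_mult[symmetric] mult_ac indicator_def)
    qed (simp add: \<Phi>_def)
   qed
   also have "\<dots> = ennreal (grad_const * ?D) * ennreal (c powr (1 - m) / (m - 1))"
    by (subst nn_integral_cmult) (auto simp: nn_integral_powr_tail[OF c m])
   also have "\<dots> = ennreal (grad_const * ?D * (c powr (1 - m) / (m - 1)))" using m by (subst ennreal_mult''[symmetric]) auto
   also have "c powr (1 - m) = \<kappa> powr (m - 1) / norm h powr (m - 1)"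
    using powr_minus_divide[of c "m - 1"] False \<kappa> by (simp add: c_def powr_divide)
   also have "grad_const * ?D * (\<kappa> powr (m - 1) / norm h powr (m - 1) / (m - 1))
     = (grad_const * \<kappa> powr (p + DIM('a) - 1) / (p + DIM('a) - 1)) * (?D / norm h powr (p + DIM('a) - 1))"
    by (simp add: m_def mult_ac)
   also have "ennreal \<dots> = ennreal (grad_const * \<kappa> powr (p + DIM('a) - 1) / (p + DIM('a) - 1)) * ennreal (?D / norm h powr (p + DIM('a) - 1))"
    by (rule ennreal_mult'') simp
   finally show ?thesis using False by simp
  qed
 qed
 also have "\<dots> = ennreal (grad_const * \<kappa> powr (p + DIM('a) - 1) / (p + DIM('a) - 1)) * gagliardo a p f" unfolding gagliardo_def
  by (subst nn_integral_cmult, measurable, subst nn_integral_cmult, measurable)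
 finally show ?thesis .
qed

end

end

subsection \<open>Convergence of translates\<close>

text \<open>Convergence almost everywhere together with convergence of the norms gives strong convergence: apply
 Fatou's lemma to the nonnegative functions \<open>2\<^sup>p (|f\<^sub>k|\<^sup>p + |f|\<^sup>p) - |f\<^sub>k - f|\<^sup>p\<close>.\<close>

lemma Lpow_tendsto_of_norms:
 fixes f :: "nat => 'a => 'b::euclidean_space"
 assumes p: "p > 0" and [measurable]: "\<And>k. f k \<in> borel_measurable M" "g \<in> borel_measurable M"
  and lim: "AE x in M. (%k. f k x) \<longlonglongrightarrow> g x"
  and le: "\<And>k. Lpow M p (f k) \<le> c k" and c: "c \<longlonglongrightarrow> Lpow M p g" and fin: "Lpow M p g < \<infinity>"
 shows "(%k. Lpow M p (%x. f k x - g x)) \<longlonglongrightarrow> 0"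
proof -
 define C where "C = (2::real) powr p"
 have C: "C > 0" by (simp add: C_def)
 define a where "a k = Lpow M p (%x. f k x - g x)" for k
 define d where "d k x = C * (norm (f k x) powr p + norm (g x) powr p) - norm (f k x - g x) powr p" for k x
 have d0: "d k x \<ge> 0" for k x unfolding d_def C_def using powr_diff_le[OF p, of "f k x" "g x"] by simp
 have [measurable]: "d k \<in> borel_measurable M" for k unfolding d_def by measurable
 define I where "I k = (\<integral>\<^sup>+x. ennreal (d k x) \<partial>M)" for k
 have sum: "I k + a k \<le> ennreal C * (c k + Lpow M p g)" for k
 proof -
  have "I k + a k = (\<integral>\<^sup>+x. ennreal (d k x) + ennreal (norm (f k x - g x) powr p) \<partial>M)"
   unfolding I_def a_def Lpow_def by (rule nn_integral_add[symmetric]) measurable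
  also have "\<dots> = (\<integral>\<^sup>+x. ennreal C * (ennreal (norm (f k x) powr p) + ennreal (norm (g x) powr p)) \<partial>M)"
   by (rule nn_integral_cong) (use d0 C in "simp add: ennreal_plus[symmetric] ennreal_mult[symmetric] d_def del: ennreal_plus")
  also have "\<dots> = ennreal C * (Lpow M p (f k) + Lpow M p g)" unfolding Lpow_def by (simp add: nn_integral_add nn_integral_cmult)
  finally show ?thesis using le[of k] by (auto intro: order_trans mult_left_mono add_right_mono)
 qed
 define i where "i = 2 * C * enn2real (Lpow M p g)"
 have g_eq: "Lpow M p g = ennreal (enn2real (Lpow M p g))" using fin by simp
 have i: "i \<ge> 0" "ennreal C * (Lpow M p g + Lpow M p g) = ennreal i"
 proof -
  show "i \<ge> 0" using C by (simp add: i_def)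
  have "ennreal C * (Lpow M p g + Lpow M p g) = ennreal C * (ennreal (enn2real (Lpow M p g)) + ennreal (enn2real (Lpow M p g)))"
   using g_eq by simp
  also have "\<dots> = ennreal i"
   using C unfolding i_def by (simp add: ennreal_mult[symmetric] ennreal_plus[symmetric] del: ennreal_plus)
  finally show "ennreal C * (Lpow M p g + Lpow M p g) = ennreal i" .
 qed
 have "ennreal i = (\<integral>\<^sup>+x. ennreal (2 * C * norm (g x) powr p) \<partial>M)"
 proof -
  have "(\<integral>\<^sup>+x. ennreal (2 * C * norm (g x) powr p) \<partial>M) = ennreal (2 * C) * Lpow M p g"
   unfolding Lpow_def using C by (subst nn_integral_cmult[symmetric]) (auto simp: ennreal_mult)
  also have "\<dots> = ennreal i" unfolding i_def using C by (subst g_eq) (simp add: ennreal_mult)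
  finally show ?thesis by simp
 qed
 also have "\<dots> = (\<integral>\<^sup>+x. liminf (%k. ennreal (d k x)) \<partial>M)"
 proof (rule nn_integral_cong_AE, use lim in eventually_elim)
  case (elim x)
  have "(%k. d k x) \<longlonglongrightarrow> C * (norm (g x) powr p + norm (g x) powr p) - norm (g x - g x) powr p"
   unfolding d_def by (intro tendsto_intros tendsto_powr' elim) (use p in auto)
  then have "(%k. d k x) \<longlonglongrightarrow> 2 * C * norm (g x) powr p" by (simp add: algebra_simps)
  from lim_imp_Liminf[OF sequentially_bot tendsto_ennrealI[OF this]] show ?case by (simp only:)
 qed
 also have "\<dots> \<le> liminf I" unfolding I_def by (rule nn_integral_liminf) measurable
 finally have liminf: "ennreal i \<le> liminf I" .
 have "(%k. ennreal C * (c k + Lpow M p g)) \<longlonglongrightarrow> ennreal C * (Lpow M p g + Lpow M p g)"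
  by (intro ennreal_tendsto_cmult tendsto_add c tendsto_const) simp
 then have lim2: "(%k. ennreal C * (c k + Lpow M p g)) \<longlonglongrightarrow> ennreal i" by (simp only: i)
 have "a \<longlonglongrightarrow> 0"
 proof (rule tendsto_0_ennreal_eps)
  fix e :: real assume e: "e > 0"
  have up: "\<forall>\<^sub>F k in sequentially. I k + a k < ennreal (i + e / 2)"
  proof -
   have "\<forall>\<^sub>F k in sequentially. ennreal C * (c k + Lpow M p g) < ennreal (i + e / 2)"
    by (rule order_tendstoD(2)[OF lim2]) (use i e in "simp add: ennreal_less_iff")
   then show ?thesis by eventually_elim (rule le_less_trans[OF sum])
  qed
  have "\<forall>\<^sub>F k in sequentially. a k \<le> ennreal e"
  \<comment> \<open>Lower bounds for \<open>I k\<close> are of use only while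
    \<open>i - e / 2\<close> is positive; otherwise \<open>a k \<le> I k + a k\<close> is already
    small enough.\<close>
  proof (cases "i \<le> e / 2")
   case True
   from up show ?thesis
   proof eventually_elim
    case (elim k)
    have "a k \<le> I k + a k" by simp
    also have "\<dots> \<le> ennreal (i + e / 2)" using elim by simp
    also have "\<dots> \<le> ennreal e" using True by (intro ennreal_leI) simp
    finally show ?case .
   qed
  next
   case False
   then have "ennreal (i - e / 2) < ennreal i" using e by (simp add: ennreal_less_iff)
   then have "\<forall>\<^sub>F k in sequentially. ennreal (i - e / 2) < I k" using liminf by (metis le_Liminf_iff)
   with up show ?thesis
   proof eventually_elim
    case (elim k)
    have "ennreal (i - e / 2) + a k \<le> I k + a k" using elim by (intro add_right_mono) simp
    also have "\<dots> \<le> ennreal (i + e / 2)" using elim by simp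
    also have "\<dots> = ennreal (i - e / 2) + ennreal e" using False e by (subst ennreal_plus[symmetric]) auto
    finally show ?case by (subst (asm) ennreal_add_left_cancel_le) auto
   qed
  qed
  then show "\<exists>N. \<forall>n\<ge>N. a n \<le> ennreal e" by (simp add: eventually_sequentially)
 qed
 moreover have "a = (%k. Lpow M p (%x. f k x - g x))" by (simp add: a_def fun_eq_iff)
 ultimately show ?thesis by simp
qed

lemma fst_borel [measurable]: "fst \<in> borel_measurable (borel :: ('a::euclidean_space \<times> 'b::euclidean_space) measure)"
 and snd_borel [measurable]: "snd \<in> borel_measurable (borel :: ('a::euclidean_space \<times> 'b::euclidean_space) measure)"
 by (intro borel_measurable_continuous_onI continuous_intros)+

text \<open>Continuity of translations in the p-th mean, for a function continuous in the open half
  space only: shifts go upwards, away from the boundary, where \<open>F\<close> may be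
  singular.\<close>

lemma Lpow_shift_tendsto:
 fixes F :: "'a::euclidean_space \<times> real => 'b::euclidean_space"
 assumes p: "p > 0" and L: "L > 0" and [measurable]: "B \<in> sets borel"
  and c: "continuous_on {X. snd X > 0} F"
  and fin: "(\<integral>\<^sup>+X. ennreal (norm (F X) powr p) * indicator {X. fst X \<in> B \<and> 0 < snd X \<and> snd X < 2 * L} X \<partial>lborel) < \<infinity>"
 shows "(%k. \<integral>\<^sup>+X. ennreal (norm (F (X + (0, L / (real k + 2))) - F X) powr p) * indicator {X. fst X \<in> B \<and> 0 < snd X \<and> snd X \<le> L} X \<partial>lborel) \<longlonglongrightarrow> 0"
proof -
 let ?P = "{X :: 'a \<times> real. snd X > 0}"
 \<comment> \<open>The offset 2 makes every shift smaller than \<open>L\<close>, so the shifted slab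
   stays below height \<open>2 * L\<close>, where the integral is finite.\<close>
 define e where "e k = L / (real k + 2)" for k :: nat
 have e: "e k > 0" "e k < L" for k using L by (auto simp: e_def field_simps intro: add_pos_nonneg)
 have e0: "e \<longlonglongrightarrow> 0" unfolding e_def using LIMSEQ_ignore_initial_segment[OF lim_const_over_n[of L], of 2] by (simp add: add.commute)
 \<comment> \<open>Continuity holds in the open half space only; cutting off there gives a function
   that is Borel measurable everywhere.\<close>
 define F0 where "F0 X = indicator ?P X *\<^sub>R F X" for X
 have oP: "open ?P" by (intro open_Collect_less continuous_intros)
 have F0m [measurable]: "F0 \<in> borel_measurable borel"
  unfolding F0_def using borel_measurable_continuous_on_indicator[OF _ c] oP by simp
 \<comment> \<open>Including the top face makes the indicators of \<open>Q (L + e k)\<close>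
   converge at every point to that of \<open>Q L\<close>.\<close>
 define Q where "Q l = {X :: 'a \<times> real. fst X \<in> B \<and> 0 < snd X \<and> snd X \<le> l}" for l
 have Qm [measurable]: "Q l \<in> sets borel" for l
 proof -
  have "Q l = B \<times> {0<..l}" by (auto simp: Q_def)
  then show ?thesis by (simp add: borel_prod[symmetric])
 qed
 define f where "f k X = indicator (Q L) X *\<^sub>R F0 (X + (0, e k))" for k X
 define g where "g X = indicator (Q L) X *\<^sub>R F0 X" for X
 have [measurable]: "f k \<in> borel_measurable borel" "g \<in> borel_measurable borel" for k unfolding f_def g_def by measurable
 \<comment> \<open>By translation invariance the norm of the shifted function is bounded by the norm
   over the enlarged slab, which converges to the norm of the limit.\<close>
 define cc where "cc k = (\<integral>\<^sup>+X. ennreal (norm (F0 X) powr p) * indicator (Q (L + e k)) X \<partial>lborel)" for k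
 have fin': "(\<integral>\<^sup>+X. ennreal (norm (F0 X) powr p) * indicator {X. fst X \<in> B \<and> 0 < snd X \<and> snd X < 2 * L} X \<partial>lborel) < \<infinity>"
  using fin by (rule le_less_trans[rotated]) (auto intro!: nn_integral_mono simp: F0_def indicator_def)
 have Q2m [measurable]: "{X :: 'a \<times> real. fst X \<in> B \<and> 0 < snd X \<and> snd X < 2 * L} \<in> sets borel"
 proof -
  have "{X :: 'a \<times> real. fst X \<in> B \<and> 0 < snd X \<and> snd X < 2 * L} = B \<times> {0<..<2 * L}" by auto
  then show ?thesis by (simp add: borel_prod[symmetric])
 qed
 have g_eq: "Lpow lborel p g = (\<integral>\<^sup>+X. ennreal (norm (F0 X) powr p) * indicator (Q L) X \<partial>lborel)"
  unfolding Lpow_def g_def by (intro nn_integral_cong) (auto simp: indicator_def)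
 have "(%k. Lpow lborel p (%X. f k X - g X)) \<longlonglongrightarrow> 0"
 proof (rule Lpow_tendsto_of_norms[OF p, where c = cc])
  show "AE X in lborel. (%k. f k X) \<longlonglongrightarrow> g X"
  proof (rule AE_I2)
   fix X
   show "(%k. f k X) \<longlonglongrightarrow> g X"
   proof (cases "X \<in> Q L")
    case True
    then have P: "snd X > 0" by (simp add: Q_def)
    have "(%k. X + (0, e k)) \<longlonglongrightarrow> X + (0, 0)" by (intro tendsto_add tendsto_const tendsto_Pair e0)
    moreover have "isCont F X" using c P continuous_on_eq_continuous_at[OF oP, of F] by blast
    ultimately have "(%k. F (X + (0, e k))) \<longlonglongrightarrow> F X"
     by (intro isCont_tendsto_compose[of X F]) (simp_all add: zero_prod_def[symmetric])
    then show ?thesis using True P e(1) by (simp add: f_def g_def F0_def add_pos_pos)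
   qed (simp add: f_def g_def)
  qed
  show "Lpow lborel p (f k) \<le> cc k" for k
  proof -
   have "Lpow lborel p (f k) \<le> (\<integral>\<^sup>+X. ennreal (norm (F0 ((0, e k) + X)) powr p) * indicator (Q (L + e k)) ((0, e k) + X) \<partial>lborel)"
    unfolding Lpow_def f_def
   proof (intro nn_integral_mono)
    fix X
    show "ennreal (norm (indicator (Q L) X *\<^sub>R F0 (X + (0, e k))) powr p) \<le> ennreal (norm (F0 ((0, e k) + X)) powr p) * indicator (Q (L + e k)) ((0, e k) + X)"
     using e(1)[of k] by (cases "X \<in> Q L") (auto simp: Q_def add.commute)
   qed
   also have "\<dots> = cc k" unfolding cc_def
    by (subst nn_integral_lborel_translate[where f = "%X. ennreal (norm (F0 X) powr p) * indicator (Q (L + e k)) X"]) auto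
   finally show ?thesis .
  qed
  show "cc \<longlonglongrightarrow> Lpow lborel p g" unfolding cc_def g_eq
  proof (rule nn_integral_dominated_convergence[where w = "%X. ennreal (norm (F0 X) powr p) * indicator {X. fst X \<in> B \<and> 0 < snd X \<and> snd X < 2 * L} X"])
   show "AE X in lborel. ennreal (norm (F0 X) powr p) * indicator (Q (L + e k)) X
     \<le> ennreal (norm (F0 X) powr p) * indicator {X. fst X \<in> B \<and> 0 < snd X \<and> snd X < 2 * L} X" for k
    using e(2)[of k] by (intro AE_I2) (auto simp: Q_def indicator_def)
   show "AE X in lborel. (%k. ennreal (norm (F0 X) powr p) * indicator (Q (L + e k)) X) \<longlonglongrightarrow> ennreal (norm (F0 X) powr p) * indicator (Q L) X"
   proof (rule AE_I2)
    fix X :: "'a \<times> real"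
    have "\<forall>\<^sub>F k in sequentially. indicator (Q (L + e k)) X = (indicator (Q L) X :: ennreal)"
    proof (cases "snd X \<le> L")
     case True
     then have "snd X \<le> L + e k" for k using e(1)[of k] by simp
     then show ?thesis using True by (auto simp: Q_def indicator_def)
    next
     case False
     then have "\<forall>\<^sub>F k in sequentially. e k < snd X - L" by (intro order_tendstoD[OF e0]) simp
     then show ?thesis by eventually_elim (use False in "auto simp: Q_def indicator_def")
    qed
    then have "\<forall>\<^sub>F k in sequentially. ennreal (norm (F0 X) powr p) * indicator (Q (L + e k)) X = ennreal (norm (F0 X) powr p) * indicator (Q L) X"
     by eventually_elim simp
    then show "(%k. ennreal (norm (F0 X) powr p) * indicator (Q (L + e k)) X) \<longlonglongrightarrow> ennreal (norm (F0 X) powr p) * indicator (Q L) X"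
     by (rule tendsto_eventually)
   qed
  qed (use fin' in auto)
  show "Lpow lborel p g < \<infinity>" unfolding g_eq using fin'
   by (rule le_less_trans[rotated]) (use L in "auto intro!: nn_integral_mono simp: Q_def indicator_def")
 qed auto
 moreover have "Lpow lborel p (%X. f k X - g X) = (\<integral>\<^sup>+X. ennreal (norm (F (X + (0, L / (real k + 2))) - F X) powr p) * indicator {X. fst X \<in> B \<and> 0 < snd X \<and> snd X \<le> L} X \<partial>lborel)" for k
  unfolding Lpow_def
 proof (intro nn_integral_cong)
  fix X
  show "ennreal (norm (f k X - g X) powr p) = ennreal (norm (F (X + (0, L / (real k + 2))) - F X) powr p) * indicator {X. fst X \<in> B \<and> 0 < snd X \<and> snd X \<le> L} X"
   using e(1)[of k] by (cases "X \<in> Q L") (auto simp: f_def g_def F0_def Q_def e_def add_pos_pos)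
 qed
 ultimately show ?thesis by simp
qed

section \<open>Averages of a function with finite Gagliardo integral, up to the boundary\<close>

context averaging_kernel
begin

context
 fixes f :: "'a => real" and p :: real and L a :: real
 assumes f [measurable]: "f \<in> borel_measurable borel" and fL: "L1loc_on UNIV f" and p: "p > 1"
  and L: "L > 0" and a: "a = \<kappa> * (3 * L)" and fin: "gagliardo a p f < \<infinity>"
begin

lemma average_Cinf:
 assumes "\<delta> > 0"
 obtains F where "Cinf F" "\<And>X. snd X \<ge> \<delta> ==> F X = average \<eta> f X"
 using that[OF Cinf_param_kern[OF assms fL]] average_kern[OF assms] by simp

lemma average_derivative:
 assumes "snd X > 0"
 shows "(average \<eta> f has_derivative (%h. grad (average \<eta> f) X \<bullet> h)) (at X)"
proof -
 obtain x s where X: "X = (x, s)" "s > 0" using assms by (cases X) auto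
 have "average \<eta> f differentiable (at X)" using average_local[OF f fL p, of "s / 2" s x] X by (auto simp: differentiable_def)
 then show ?thesis by (rule has_derivative_grad)
qed

lemma average_continuous: "continuous_on {X. snd X > 0} (average \<eta> f)" "continuous_on {X. snd X > 0} (grad (average \<eta> f))"
proof -
 have oP: "open {X :: 'a \<times> real. snd X > 0}" by (intro open_Collect_less continuous_intros)
 have "isCont (average \<eta> f) X \<and> isCont (grad (average \<eta> f)) X" if X: "snd X > 0" for X
 proof -
  have d: "snd X / 2 > 0" using X by simp
  obtain F where F: "Cinf F" "\<And>Y. snd Y \<ge> snd X / 2 ==> F Y = average \<eta> f Y" using average_Cinf[OF d] by blast
  define U where "U = {Y :: 'a \<times> real. snd Y > snd X / 2}"
  have U: "open U" "X \<in> U" unfolding U_def using X by (auto intro!: open_Collect_less continuous_intros)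
  have gr: "grad (average \<eta> f) Y = grad F Y" if "Y \<in> U" for Y
  proof -
   have "(average \<eta> f has_derivative (%h. partial_deriv h F Y)) (at Y)"
    by (rule has_derivative_transform_within_open[OF Cinf_has_derivative[OF F(1)] U(1) that]) (use F(2) in "auto simp: U_def")
   then show ?thesis unfolding grad_def by (simp add: partial_deriv_eq)
  qed
  have "isCont F X" "isCont (grad F) X" using Cinf_continuous[OF F(1)] continuous_grad[OF F(1)]
   unfolding continuous_on_eq_continuous_at[OF open_UNIV] by blast+
  moreover have ev: "\<forall>\<^sub>F Y in nhds X. Y \<in> U" using U by (rule eventually_nhds_in_open)
  have "\<forall>\<^sub>F Y in nhds X. F Y = average \<eta> f Y" "\<forall>\<^sub>F Y in nhds X. grad F Y = grad (average \<eta> f) Y"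
   by (rule eventually_mono[OF ev], simp add: F(2) U_def, rule eventually_mono[OF ev], simp only: gr)
  ultimately show ?thesis using isCont_cong[of F "average \<eta> f" X] isCont_cong[of "grad F" "grad (average \<eta> f)" X] by blast
 qed
 then show "continuous_on {X. snd X > 0} (average \<eta> f)" "continuous_on {X. snd X > 0} (grad (average \<eta> f))"
  by (auto intro!: continuous_at_imp_continuous_on)
qed

lemma fin_2L: "s \<le> 2 * L ==> \<kappa> * s < a" using L \<kappa> unfolding a by (intro mult_strict_left_mono) auto

text \<open>A finite Gagliardo integral upgrades local integrability to the power \<open>p\<close>:
  \<open>f\<close> differs from its average at height \<open>L\<close>, a continuous function, by a
  function in \<open>L\<^sup>p\<close>.\<close>

lemma Lp_local: "(\<integral>\<^sup>+x. ennreal (\<bar>f x\<bar> powr p) * indicator (ball 0 R) x \<partial>lborel) < \<infinity>"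
proof -
 have "continuous_on UNIV (%x. average \<eta> f (x, L))"
  by (rule continuous_on_compose2[OF average_continuous(1)]) (use L in "auto intro!: continuous_intros")
 then have c: "continuous_on UNIV (%x. average \<eta> f (x, L))" and [measurable]: "(%x. average \<eta> f (x, L)) \<in> borel_measurable borel"
  by (auto intro: borel_measurable_continuous_onI)
 have "compact ((%x. average \<eta> f (x, L)) ` cball 0 R)"
  by (intro compact_continuous_image compact_cball continuous_on_subset[OF c]) auto
 then obtain B where "\<forall>x\<in>cball 0 R. \<bar>average \<eta> f (x, L)\<bar> \<le> B" by (auto simp: bounded_iff dest!: compact_imp_bounded)
 then have B: "\<bar>average \<eta> f (x, L)\<bar> \<le> \<bar>B\<bar>" if "x \<in> ball 0 R" for x
  using that subsetD[OF ball_subset_cball] by (metis abs_ge_self order_trans)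
 have "(\<integral>\<^sup>+x. ennreal (\<bar>f x\<bar> powr p) * indicator (ball 0 R) x \<partial>lborel)
  \<le> (\<integral>\<^sup>+x. ennreal (2 powr p) * (ennreal (\<bar>average \<eta> f (x, L) - f x\<bar> powr p) + ennreal (\<bar>B\<bar> powr p) * indicator (ball 0 R) x) \<partial>lborel)"
 proof (rule nn_integral_mono)
  fix x
  show "ennreal (\<bar>f x\<bar> powr p) * indicator (ball 0 R) x
   \<le> ennreal (2 powr p) * (ennreal (\<bar>average \<eta> f (x, L) - f x\<bar> powr p) + ennreal (\<bar>B\<bar> powr p) * indicator (ball 0 R) x)"
  proof (cases "x \<in> ball 0 R")
   case True
   have "\<bar>f x\<bar> powr p = norm (average \<eta> f (x, L) - (average \<eta> f (x, L) - f x)) powr p" by simp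
   also have "\<dots> \<le> 2 powr p * (norm (average \<eta> f (x, L)) powr p + norm (average \<eta> f (x, L) - f x) powr p)"
    by (rule powr_diff_le) (use p in simp)
   also have "\<dots> \<le> 2 powr p * (\<bar>B\<bar> powr p + \<bar>average \<eta> f (x, L) - f x\<bar> powr p)"
    using B[OF True] p by (intro mult_left_mono add_mono powr_mono2) auto
   finally show ?thesis using True by (simp add: ennreal_plus[symmetric] ennreal_mult[symmetric] add.commute del: ennreal_plus)
  qed simp
 qed
 also have "\<dots> = ennreal (2 powr p) * ((\<integral>\<^sup>+x. ennreal (\<bar>average \<eta> f (x, L) - f x\<bar> powr p) \<partial>lborel) + ennreal (\<bar>B\<bar> powr p) * emeasure lborel (ball (0::'a) R))"
  by (subst nn_integral_cmult, measurable, subst nn_integral_add, measurable) (simp add: nn_integral_cmult)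
 also have "\<dots> < \<infinity>"
 proof -
  have "(\<integral>\<^sup>+x. ennreal (\<bar>average \<eta> f (x, L) - f x\<bar> powr p) \<partial>lborel) < \<infinity>"
   by (rule le_less_trans[OF average_dev_integral_le[OF f fL p L fin_2L]]) (use L fin in "auto simp: ennreal_mult_less_top")
  then show ?thesis by (simp add: ennreal_mult_less_top emeasure_bounded_finite[OF bounded_ball, unfolded infinity_ennreal_def])
 qed
 finally show ?thesis .
qed

definition "dev_height = dev_const p * \<kappa> powr (p + DIM('a) - 1) * (2 * L) powr (p - 1)"

lemma average_dev_strip_le:
 assumes l: "0 < l" "l \<le> 2 * L"
 shows "(\<integral>\<^sup>+X. ennreal (\<bar>average \<eta> f X - f (fst X)\<bar> powr p) * indicator {X. 0 < snd X \<and> snd X < l} X \<partial>lborel)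
   \<le> ennreal (l * dev_height) * gagliardo a p f"
proof -
 define A0 where "A0 X = indicator {X. snd X > 0} X *\<^sub>R average \<eta> f X" for X
 have oP: "open {X :: 'a \<times> real. snd X > 0}" by (intro open_Collect_less continuous_intros)
 have [measurable]: "A0 \<in> borel_measurable borel"
  unfolding A0_def using borel_measurable_continuous_on_indicator[OF _ average_continuous(1)] oP by simp
 have m: "(%X. ennreal (\<bar>A0 X - f (fst X)\<bar> powr p) * indicator {0<..<l} (snd X)) \<in> borel_measurable borel" by measurable
 have "(\<integral>\<^sup>+X. ennreal (\<bar>average \<eta> f X - f (fst X)\<bar> powr p) * indicator {X. 0 < snd X \<and> snd X < l} X \<partial>lborel)
  = (\<integral>\<^sup>+X. ennreal (\<bar>A0 X - f (fst X)\<bar> powr p) * indicator {0<..<l} (snd X) \<partial>lborel)"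
  by (intro nn_integral_cong) (auto simp: A0_def indicator_def)
 also have "\<dots> = (\<integral>\<^sup>+s. \<integral>\<^sup>+x. ennreal (\<bar>A0 (x, s) - f x\<bar> powr p) * indicator {0<..<l} s \<partial>lborel \<partial>lborel)"
  using m by (subst lborel_prod[symmetric], subst lborel_pair.nn_integral_snd[symmetric]) (simp_all add: lborel_prod)
 also have "\<dots> \<le> (\<integral>\<^sup>+s. ennreal dev_height * gagliardo a p f * indicator {0<..<l} s \<partial>lborel)"
 proof (rule nn_integral_mono)
  fix s :: real
  show "(\<integral>\<^sup>+x. ennreal (\<bar>A0 (x, s) - f x\<bar> powr p) * indicator {0<..<l} s \<partial>lborel) \<le> ennreal dev_height * gagliardo a p f * indicator {0<..<l} s"
  proof (cases "0 < s \<and> s < l")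
   case True
   have "(\<integral>\<^sup>+x. ennreal (\<bar>average \<eta> f (x, s) - f x\<bar> powr p) \<partial>lborel) \<le> ennreal (dev_const p * \<kappa> powr (p + DIM('a) - 1) * s powr (p - 1)) * gagliardo a p f"
    by (rule average_dev_integral_le[OF f fL p _ fin_2L]) (use True l in auto)
   also have "\<dots> \<le> ennreal dev_height * gagliardo a p f" unfolding dev_height_def using True l p
    by (intro mult_right_mono ennreal_leI mult_left_mono powr_mono2) (auto simp: dev_const_def[OF f fL p])
   finally show ?thesis using True by (simp add: A0_def)
  qed auto
 qed
 also have "\<dots> = ennreal dev_height * gagliardo a p f * ennreal l" using l by (subst nn_integral_cmult) auto
 also have "\<dots> = ennreal (l * dev_height) * gagliardo a p f" using l by (simp add: ennreal_mult' mult_ac)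
 finally show ?thesis .
qed

lemma average_Lp_local:
 "(\<integral>\<^sup>+X. ennreal (norm (average \<eta> f X) powr p) * indicator {X. fst X \<in> ball 0 R \<and> 0 < snd X \<and> snd X < 2 * L} X \<partial>lborel) < \<infinity>"
proof -
 define A0 where "A0 X = indicator {X. snd X > 0} X *\<^sub>R average \<eta> f X" for X
 have oP: "open {X :: 'a \<times> real. snd X > 0}" by (intro open_Collect_less continuous_intros)
 have [measurable]: "A0 \<in> borel_measurable borel"
  unfolding A0_def using borel_measurable_continuous_on_indicator[OF _ average_continuous(1)] oP by simp
 have [measurable]: "{X :: 'a \<times> real. 0 < snd X \<and> snd X < 2 * L} \<in> sets borel"
  by (intro borel_open open_Collect_conj open_Collect_less continuous_intros)
 have "(\<integral>\<^sup>+X. ennreal (norm (average \<eta> f X) powr p) * indicator {X. fst X \<in> ball 0 R \<and> 0 < snd X \<and> snd X < 2 * L} X \<partial>lborel)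
  \<le> (\<integral>\<^sup>+X. ennreal (2 powr p) * (ennreal (\<bar>A0 X - f (fst X)\<bar> powr p) * indicator {X. 0 < snd X \<and> snd X < 2 * L} X
     + (ennreal (\<bar>f (fst X)\<bar> powr p) * indicator (ball 0 R) (fst X)) * indicator {0<..<2 * L} (snd X)) \<partial>lborel)"
 proof (rule nn_integral_mono)
  fix X :: "'a \<times> real"
  show "ennreal (norm (average \<eta> f X) powr p) * indicator {X. fst X \<in> ball 0 R \<and> 0 < snd X \<and> snd X < 2 * L} X
   \<le> ennreal (2 powr p) * (ennreal (\<bar>A0 X - f (fst X)\<bar> powr p) * indicator {X. 0 < snd X \<and> snd X < 2 * L} X
     + (ennreal (\<bar>f (fst X)\<bar> powr p) * indicator (ball 0 R) (fst X)) * indicator {0<..<2 * L} (snd X))"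
  proof (cases "fst X \<in> ball 0 R \<and> 0 < snd X \<and> snd X < 2 * L")
   case True
   have "norm (average \<eta> f X) powr p = norm ((average \<eta> f X - f (fst X)) + f (fst X)) powr p" by simp
   also have "\<dots> \<le> 2 powr p * (norm (average \<eta> f X - f (fst X)) powr p + norm (f (fst X)) powr p)"
    by (rule powr_add_le) (use p in simp)
   finally show ?thesis using True by (simp add: A0_def ennreal_plus[symmetric] ennreal_mult[symmetric] del: ennreal_plus)
  qed simp
 qed
 also have "\<dots> = ennreal (2 powr p) * ((\<integral>\<^sup>+X. ennreal (\<bar>A0 X - f (fst X)\<bar> powr p) * indicator {X. 0 < snd X \<and> snd X < 2 * L} X \<partial>lborel)
   + (\<integral>\<^sup>+X. (ennreal (\<bar>f (fst X)\<bar> powr p) * indicator (ball 0 R) (fst X)) * indicator {0<..<2 * L} (snd X) \<partial>lborel))"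
  by (subst nn_integral_cmult, measurable, subst nn_integral_add, measurable)
 also have "\<dots> < \<infinity>"
 proof -
  have "(\<integral>\<^sup>+X. ennreal (\<bar>A0 X - f (fst X)\<bar> powr p) * indicator {X. 0 < snd X \<and> snd X < 2 * L} X \<partial>lborel)
    = (\<integral>\<^sup>+X. ennreal (\<bar>average \<eta> f X - f (fst X)\<bar> powr p) * indicator {X. 0 < snd X \<and> snd X < 2 * L} X \<partial>lborel)"
   by (intro nn_integral_cong) (auto simp: A0_def indicator_def)
  also have "\<dots> < \<infinity>" by (rule le_less_trans[OF average_dev_strip_le]) (use L fin in "auto simp: ennreal_mult_less_top")
  finally have 1: "(\<integral>\<^sup>+X. ennreal (\<bar>A0 X - f (fst X)\<bar> powr p) * indicator {X. 0 < snd X \<and> snd X < 2 * L} X \<partial>lborel) < \<infinity>" .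
  have "(\<integral>\<^sup>+X. (ennreal (\<bar>f (fst X)\<bar> powr p) * indicator (ball 0 R) (fst X)) * indicator {0<..<2 * L} (snd X) \<partial>lborel)
   = (\<integral>\<^sup>+x. \<integral>\<^sup>+s. (ennreal (\<bar>f x\<bar> powr p) * indicator (ball 0 R) x) * indicator {0<..<2 * L} s \<partial>lborel \<partial>lborel)"
   by (subst lborel_prod[symmetric], subst lborel.nn_integral_fst[symmetric]) auto
  also have "\<dots> = (\<integral>\<^sup>+x. (ennreal (\<bar>f x\<bar> powr p) * indicator (ball 0 R) x) * ennreal (2 * L) \<partial>lborel)"
   using L by (intro nn_integral_cong, subst nn_integral_cmult) auto
  also have "\<dots> < \<infinity>" using Lp_local[of R] by (subst nn_integral_multc) (auto simp: ennreal_mult_less_top)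
  finally show ?thesis using 1 by (simp add: ennreal_mult_less_top)
 qed
 finally show ?thesis .
qed

definition "grad_strip = grad_const p * \<kappa> powr (p + DIM('a) - 1) / (p + DIM('a) - 1)"

lemma average_grad_strip_le:
 "l \<le> 2 * L ==> (\<integral>\<^sup>+X. ennreal (norm (grad (average \<eta> f) X) powr p) * indicator {X. 0 < snd X \<and> snd X < l} X \<partial>lborel)
   \<le> ennreal grad_strip * gagliardo a p f"
 unfolding grad_strip_def by (rule average_grad_integral_le[OF f fL p less_imp_le[OF fin_2L]])

lemma average_shift_tendsto:
 "(%k. \<integral>\<^sup>+X. ennreal (norm (average \<eta> f (X + (0, L / (real k + 2))) - average \<eta> f X) powr p)
   * indicator {X. fst X \<in> ball 0 R \<and> 0 < snd X \<and> snd X \<le> L} X \<partial>lborel) \<longlonglongrightarrow> 0"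
 by (rule Lpow_shift_tendsto[OF _ L _ average_continuous(1) average_Lp_local]) (use p in auto)

lemma average_grad_shift_tendsto:
 "(%k. \<integral>\<^sup>+X. ennreal (norm (grad (average \<eta> f) (X + (0, L / (real k + 2))) - grad (average \<eta> f) X) powr p)
   * indicator {X. fst X \<in> UNIV \<and> 0 < snd X \<and> snd X \<le> L} X \<partial>lborel) \<longlonglongrightarrow> 0"
proof (rule Lpow_shift_tendsto[OF _ L _ average_continuous(2)])
 show "(\<integral>\<^sup>+X. ennreal (norm (grad (average \<eta> f) X) powr p) * indicator {X. fst X \<in> UNIV \<and> 0 < snd X \<and> snd X < 2 * L} X \<partial>lborel) < \<infinity>"
  using le_less_trans[OF average_grad_strip_le[of "2 * L"]] fin by (simp add: ennreal_mult_less_top)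
qed (use p in auto)

lemma average_trace_tendsto:
 "(%k. \<integral>\<^sup>+x. ennreal (\<bar>average \<eta> f (x, L / (real k + 2)) - f x\<bar> powr p) \<partial>lborel) \<longlonglongrightarrow> 0"
proof (rule tendsto_zero_ennreal_le)
 let ?s = "%k. L / (real k + 2)"
 let ?c = "dev_const p * \<kappa> powr (p + DIM('a) - 1)"
 have s: "?s k > 0" "?s k \<le> 2 * L" for k using L by (auto simp: field_simps)
 show "(\<integral>\<^sup>+x. ennreal (\<bar>average \<eta> f (x, ?s k) - f x\<bar> powr p) \<partial>lborel) \<le> ennreal (?c * ?s k powr (p - 1)) * gagliardo a p f" for k
  by (intro average_dev_integral_le[OF f fL p s(1) fin_2L[OF s(2)]])
 have "?s \<longlonglongrightarrow> 0" using LIMSEQ_ignore_initial_segment[OF lim_const_over_n[of L], of 2] by (simp add: add.commute)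
 then have "(%k. ?c * ?s k powr (p - 1)) \<longlonglongrightarrow> ?c * 0 powr (p - 1)"
  by (intro tendsto_mult tendsto_const tendsto_powr') (use p s in "auto simp: less_imp_le")
 then have "(%k. ennreal (?c * ?s k powr (p - 1))) \<longlonglongrightarrow> 0" using tendsto_ennrealI by fastforce
 from tendsto_cmult_zero_ennreal[OF this fin] show "(%k. ennreal (?c * ?s k powr (p - 1)) * gagliardo a p f) \<longlonglongrightarrow> 0"
  by (simp add: mult.commute)
qed

end

end

subsection \<open>The extension operator on the strip\<close>

lemma grad_eqI:
 assumes "(f has_derivative (%h. v \<bullet> h)) (at x)" shows "grad f x = v"
 unfolding grad_def using partial_deriv_eq[OF assms] by (simp add: euclidean_representation)

text \<open>Coordinates attached to the face at height \<open>t0\<close>: \<open>e\<close> will be 1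
  or -1 and point into the strip, so that the second component is the distance to the face.\<close>

definition side :: "real => real => 'a::euclidean_space \<times> real => 'a \<times> real" where
 "side e t0 X = (fst X, e * (snd X - t0))"

text \<open>The linear part of \<open>side\<close>; being symmetric, it also transforms
  gradients.\<close>

definition reflect :: "real => 'a::euclidean_space \<times> real => 'a \<times> real" where
 "reflect e v = (fst v, e * snd v)"

lemma norm_reflect: "e\<^sup>2 = 1 ==> norm (reflect e v) = norm v" by (simp add: reflect_def norm_prod_def power_mult_distrib)

lemma reflect_diff: "reflect e v - reflect e w = reflect e (v - w)" by (simp add: reflect_def algebra_simps)

lemma side_continuous: "continuous_on UNIV (side e t0)" unfolding side_def by (intro continuous_intros)

lemma side_measurable [measurable]: "side e t0 \<in> borel_measurable borel"
 by (rule borel_measurable_continuous_onI[OF side_continuous])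

lemma nn_integral_side:
 fixes F :: "'a::euclidean_space \<times> real => ennreal"
 assumes e: "e\<^sup>2 = 1" and [measurable]: "F \<in> borel_measurable borel"
 shows "(\<integral>\<^sup>+X. F (side e t0 X) \<partial>lborel) = (\<integral>\<^sup>+X. F X \<partial>lborel)"
proof -
 have e': "e \<noteq> 0" "\<bar>e\<bar> = 1" using e by (auto simp: power2_eq_1_iff)
 have m: "F \<in> borel_measurable (lborel \<Otimes>\<^sub>M lborel)" "(%X. F (side e t0 X)) \<in> borel_measurable (lborel \<Otimes>\<^sub>M lborel)"
  by (simp_all add: lborel_prod)
 have "(\<integral>\<^sup>+X. F (side e t0 X) \<partial>lborel) = (\<integral>\<^sup>+x. \<integral>\<^sup>+t. F (side e t0 (x, t)) \<partial>lborel \<partial>lborel)"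
  using m(2) by (subst lborel_prod[symmetric], subst lborel.nn_integral_fst[symmetric]) auto
 also have "\<dots> = (\<integral>\<^sup>+x. \<integral>\<^sup>+s. F (x, s) \<partial>lborel \<partial>lborel)"
 proof (rule nn_integral_cong)
  fix x
  have [measurable]: "(%s. F (x, s)) \<in> borel_measurable borel" by measurable
  show "(\<integral>\<^sup>+t. F (side e t0 (x, t)) \<partial>lborel) = (\<integral>\<^sup>+s. F (x, s) \<partial>lborel)"
   using nn_integral_real_affine[of "%s. F (x, s)" e "- e * t0"] e' by (simp add: side_def algebra_simps)
 qed
 also have "\<dots> = (\<integral>\<^sup>+X. F X \<partial>lborel)" using m(1) by (subst lborel_prod[symmetric], subst lborel.nn_integral_fst) auto
 finally show ?thesis .
qed

lemma Cinf_side: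
 assumes "Cinf F" shows "Cinf (%X. F (side e t0 X + c))"
proof (rule Cinf_compose[OF assms])
 fix j :: "'a \<times> real"
 have "Cinf (%X :: 'a \<times> real. X \<bullet> (fst j, e * snd j) + (c \<bullet> j - e * t0 * snd j))" by (intro Cinf_add Cinf_inner Cinf_const)
 moreover have "(%X. (side e t0 X + c) \<bullet> j) = (%X. X \<bullet> (fst j, e * snd j) + (c \<bullet> j - e * t0 * snd j))"
  by (rule ext) (simp add: side_def inner_prod_def algebra_simps)
 ultimately show "Cinf (%X. (side e t0 X + c) \<bullet> j)" by simp
qed

lemma has_derivative_side:
 assumes "(F has_derivative (%h. v \<bullet> h)) (at (side e t0 X + c))"
 shows "((%X. F (side e t0 X + c)) has_derivative (%h. reflect e v \<bullet> h)) (at X)"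
proof -
 have "((%X. side e t0 X + c) has_derivative (%h. reflect e h)) (at X)"
  unfolding side_def reflect_def by (auto intro!: derivative_eq_intros)
 from diff_chain_at[OF this assms] show ?thesis by (simp add: o_def reflect_def inner_prod_def mult_ac)
qed

section \<open>Averages attached to either face of the strip\<close>

context averaging_kernel
begin

context
 fixes f :: "'a => real" and p :: real and L a :: real and e t0 bm bp :: real
 assumes f [measurable]: "f \<in> borel_measurable borel" and fL: "L1loc_on UNIV f" and p: "p > 1"
  and L: "L > 0" and a: "a = \<kappa> * (3 * L)" and fin: "gagliardo a p f < \<infinity>"
  and e: "e\<^sup>2 = 1" and strip: "\<And>t. bm < t \<and> t < bp \<longleftrightarrow> 0 < e * (t - t0) \<and> e * (t - t0) < L"
begin

lemma average_side_Cinf: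
 assumes "\<delta> > 0"
 obtains F where "Cinf F" "\<And>X. e * (snd X - t0) \<ge> \<delta> ==> F X = average \<eta> f (side e t0 X)"
proof -
 obtain F where F: "Cinf F" "\<And>X. snd X \<ge> \<delta> ==> F X = average \<eta> f X" using average_Cinf[OF f fL p L a fin assms] by blast
 show ?thesis by (rule that[of "%X. F (side e t0 X + 0)"]) (use Cinf_side[OF F(1), of e t0 0] F(2) in "auto simp: side_def")
qed

lemma grad_average_side:
 assumes "e * (snd X - t0) > 0"
 shows "grad (%X. average \<eta> f (side e t0 X)) X = reflect e (grad (average \<eta> f) (side e t0 X))"
proof (rule grad_eqI)
 have "((%X. average \<eta> f (side e t0 X + 0)) has_derivative (%h. reflect e (grad (average \<eta> f) (side e t0 X)) \<bullet> h)) (at X)"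
  by (rule has_derivative_side) (use average_derivative[OF f fL p L a fin, of "side e t0 X"] assms in "simp add: side_def")
 then show "((%X. average \<eta> f (side e t0 X)) has_derivative (%h. reflect e (grad (average \<eta> f) (side e t0 X)) \<bullet> h)) (at X)" by simp
qed

lemma open_half: "open {X :: 'a \<times> real. snd X > 0}" by (intro open_Collect_less continuous_intros)

lemma average_half_measurable [measurable]:
 "(%X. indicator {X. snd X > 0} X *\<^sub>R average \<eta> f X) \<in> borel_measurable borel"
 "(%X. indicator {X. snd X > 0} X *\<^sub>R grad (average \<eta> f) X) \<in> borel_measurable borel"
 using borel_measurable_continuous_on_indicator[OF _ average_continuous(1)[OF f fL p L a fin]]
  borel_measurable_continuous_on_indicator[OF _ average_continuous(2)[OF f fL p L a fin]] open_half by simp_all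

lemma grad_average_side_le:
 "(\<integral>\<^sup>+X. ennreal (norm (grad (%X. average \<eta> f (side e t0 X)) X) powr p) * indicator {X. bm < snd X \<and> snd X < bp} X \<partial>lborel)
   \<le> ennreal (grad_strip p) * gagliardo a p f"
proof -
 let ?S = "{X :: 'a \<times> real. 0 < snd X \<and> snd X < L}"
 define G where "G X = indicator {X. snd X > 0} X *\<^sub>R grad (average \<eta> f) X" for X
 have [measurable]: "G \<in> borel_measurable borel" unfolding G_def by measurable
 have [measurable]: "?S \<in> sets borel" by (intro borel_open open_Collect_conj open_Collect_less continuous_intros)
 have "(\<integral>\<^sup>+X. ennreal (norm (grad (%X. average \<eta> f (side e t0 X)) X) powr p) * indicator {X. bm < snd X \<and> snd X < bp} X \<partial>lborel)
  = (\<integral>\<^sup>+X. ennreal (norm (G (side e t0 X)) powr p) * indicator ?S (side e t0 X) \<partial>lborel)"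
 proof (rule nn_integral_cong)
  fix X :: "'a \<times> real"
  show "ennreal (norm (grad (%X. average \<eta> f (side e t0 X)) X) powr p) * indicator {X. bm < snd X \<and> snd X < bp} X
   = ennreal (norm (G (side e t0 X)) powr p) * indicator ?S (side e t0 X)"
  proof (cases "bm < snd X \<and> snd X < bp")
   case True
   then have s: "e * (snd X - t0) > 0" "e * (snd X - t0) < L" using strip by auto
   have "norm (grad (%X. average \<eta> f (side e t0 X)) X) = norm (grad (average \<eta> f) (side e t0 X))"
    by (simp only: grad_average_side[OF s(1)] norm_reflect[OF e])
   then show ?thesis using True s by (simp add: G_def side_def)
  next
   case False
   then show ?thesis using strip[of "snd X"] by (auto simp: side_def indicator_def)
  qed
 qed
 also have "\<dots> = (\<integral>\<^sup>+X. ennreal (norm (G X) powr p) * indicator ?S X \<partial>lborel)"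
  by (rule nn_integral_side[OF e, where F = "%X. ennreal (norm (G X) powr p) * indicator ?S X"]) measurable
 also have "\<dots> = (\<integral>\<^sup>+X. ennreal (norm (grad (average \<eta> f) X) powr p) * indicator ?S X \<partial>lborel)"
  by (intro nn_integral_cong) (auto simp: G_def indicator_def)
 also have "\<dots> \<le> ennreal (grad_strip p) * gagliardo a p f" by (rule average_grad_strip_le[OF f fL p L a fin]) (use L in simp)
 finally show ?thesis .
qed

lemma dev_average_side_le:
 "(\<integral>\<^sup>+X. ennreal (\<bar>average \<eta> f (side e t0 X) - f (fst X)\<bar> powr p) * indicator {X. bm < snd X \<and> snd X < bp} X \<partial>lborel)
   \<le> ennreal (L * dev_height p L) * gagliardo a p f"
proof -
 let ?S = "{X :: 'a \<times> real. 0 < snd X \<and> snd X < L}"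
 define G where "G X = indicator {X. snd X > 0} X *\<^sub>R average \<eta> f X" for X
 have [measurable]: "G \<in> borel_measurable borel" unfolding G_def by measurable
 have [measurable]: "?S \<in> sets borel" by (intro borel_open open_Collect_conj open_Collect_less continuous_intros)
 have "(\<integral>\<^sup>+X. ennreal (\<bar>average \<eta> f (side e t0 X) - f (fst X)\<bar> powr p) * indicator {X. bm < snd X \<and> snd X < bp} X \<partial>lborel)
  = (\<integral>\<^sup>+X. ennreal (\<bar>G (side e t0 X) - f (fst (side e t0 X))\<bar> powr p) * indicator ?S (side e t0 X) \<partial>lborel)"
  using strip by (intro nn_integral_cong) (auto simp: G_def side_def indicator_def)
 also have "\<dots> = (\<integral>\<^sup>+X. ennreal (\<bar>G X - f (fst X)\<bar> powr p) * indicator ?S X \<partial>lborel)"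
  by (rule nn_integral_side[OF e, where F = "%X. ennreal (\<bar>G X - f (fst X)\<bar> powr p) * indicator ?S X"]) measurable
 also have "\<dots> = (\<integral>\<^sup>+X. ennreal (\<bar>average \<eta> f X - f (fst X)\<bar> powr p) * indicator ?S X \<partial>lborel)"
  by (intro nn_integral_cong) (auto simp: G_def indicator_def)
 also have "\<dots> \<le> ennreal (L * dev_height p L) * gagliardo a p f"
  by (rule average_dev_strip_le[OF f fL p L a fin L]) (use L in simp)
 finally show ?thesis .
qed

text \<open>The approximations are averages shifted inwards by \<open>L / (k + 2)\<close>: up to the
  face they use only heights at which the average extends smoothly to the whole space, and on the
  face they are the averages at a small height.\<close>

lemma average_side_approx:
 obtains \<phi> where "\<And>k::nat. Cinf (\<phi> k)"
  "\<And>R. (%k. \<integral>\<^sup>+X. ennreal (norm (\<phi> k X - average \<eta> f (side e t0 X)) powr p)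
    * indicator (ball 0 R \<times> {bm<..<bp}) X \<partial>lborel) \<longlonglongrightarrow> 0"
  "(%k. \<integral>\<^sup>+X. ennreal (norm (grad (\<phi> k) X - grad (%X. average \<eta> f (side e t0 X)) X) powr p)
    * indicator {X. bm < snd X \<and> snd X < bp} X \<partial>lborel) \<longlonglongrightarrow> 0"
  "(%k. \<integral>\<^sup>+x. ennreal (\<bar>\<phi> k (x, t0) - f x\<bar> powr p) \<partial>lborel) \<longlonglongrightarrow> 0"
proof -
 define \<epsilon> where "\<epsilon> k = L / (real k + 2)" for k :: nat
 have \<epsilon>: "\<epsilon> k > 0" for k using L by (auto simp: \<epsilon>_def)
 have "\<exists>F. Cinf F \<and> (\<forall>X. snd X \<ge> \<epsilon> k \<longrightarrow> F X = average \<eta> f X)" for k using average_Cinf[OF f fL p L a fin \<epsilon>[of k]] by blast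
 then obtain F where F: "\<And>k. Cinf (F k)" "\<And>k X. snd X \<ge> \<epsilon> k ==> F k X = average \<eta> f X" by metis
 define \<phi> where "\<phi> k X = F k (side e t0 X + (0, \<epsilon> k))" for k X
 have C: "Cinf (\<phi> k)" for k using Cinf_side[OF F(1)[of k], of e t0 "(0, \<epsilon> k)"] by (simp add: \<phi>_def[abs_def])
 have \<phi>1: "\<phi> k X = average \<eta> f (side e t0 X + (0, \<epsilon> k))" if "e * (snd X - t0) \<ge> 0" for k X
  using that F(2)[of k "side e t0 X + (0, \<epsilon> k)"] by (simp add: \<phi>_def side_def)
 have g1: "grad (\<phi> k) X = reflect e (grad (average \<eta> f) (side e t0 X + (0, \<epsilon> k)))" if "e * (snd X - t0) > 0" for k X
 proof (rule grad_eqI)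
  have "((%X. average \<eta> f (side e t0 X + (0, \<epsilon> k))) has_derivative
    (%h. reflect e (grad (average \<eta> f) (side e t0 X + (0, \<epsilon> k))) \<bullet> h)) (at X)"
   by (rule has_derivative_side[OF average_derivative[OF f fL p L a fin]])
    (use that \<epsilon>[of k] in "simp add: side_def add_pos_pos")
  then show "(\<phi> k has_derivative (%h. reflect e (grad (average \<eta> f) (side e t0 X + (0, \<epsilon> k))) \<bullet> h)) (at X)"
  proof (rule has_derivative_transform_within_open)
   show "open {Y :: 'a \<times> real. e * (snd Y - t0) > 0}" by (intro open_Collect_less continuous_intros)
  qed (use that \<phi>1 in auto)
 qed
 define A where "A X = indicator {X. snd X > 0} X *\<^sub>R average \<eta> f X" for X
 define G where "G X = indicator {X. snd X > 0} X *\<^sub>R grad (average \<eta> f) X" for X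
 have [measurable]: "A \<in> borel_measurable borel" "G \<in> borel_measurable borel" unfolding A_def G_def by measurable
 have b1: "(\<integral>\<^sup>+X. ennreal (norm (\<phi> k X - average \<eta> f (side e t0 X)) powr p) * indicator (ball 0 R \<times> {bm<..<bp}) X \<partial>lborel)
   \<le> (\<integral>\<^sup>+X. ennreal (norm (average \<eta> f (X + (0, L / (real k + 2))) - average \<eta> f X) powr p)
   * indicator {X. fst X \<in> ball 0 R \<and> 0 < snd X \<and> snd X \<le> L} X \<partial>lborel)" for k R
 proof -
  let ?Q = "ball 0 R \<times> {0<..<L} :: ('a \<times> real) set"
  have [measurable]: "?Q \<in> sets borel" by (intro borel_open open_Times) auto
  have "(\<integral>\<^sup>+X. ennreal (norm (\<phi> k X - average \<eta> f (side e t0 X)) powr p) * indicator (ball 0 R \<times> {bm<..<bp}) X \<partial>lborel)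
   = (\<integral>\<^sup>+X. ennreal (norm (A (side e t0 X + (0, \<epsilon> k)) - A (side e t0 X)) powr p) * indicator ?Q (side e t0 X) \<partial>lborel)"
  proof (rule nn_integral_cong)
   fix X :: "'a \<times> real"
   show "ennreal (norm (\<phi> k X - average \<eta> f (side e t0 X)) powr p) * indicator (ball 0 R \<times> {bm<..<bp}) X
    = ennreal (norm (A (side e t0 X + (0, \<epsilon> k)) - A (side e t0 X)) powr p) * indicator ?Q (side e t0 X)"
    using strip[of "snd X"] \<phi>1[of X k] \<epsilon>[of k] by (cases X) (auto simp: A_def side_def indicator_def add_pos_pos)
  qed
  also have "\<dots> = (\<integral>\<^sup>+X. ennreal (norm (A (X + (0, \<epsilon> k)) - A X) powr p) * indicator ?Q X \<partial>lborel)"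
   by (rule nn_integral_side[OF e, where F = "%X. ennreal (norm (A (X + (0, \<epsilon> k)) - A X) powr p) * indicator ?Q X"]) measurable
  also have "\<dots> \<le> (\<integral>\<^sup>+X. ennreal (norm (average \<eta> f (X + (0, L / (real k + 2))) - average \<eta> f X) powr p)
   * indicator {X. fst X \<in> ball 0 R \<and> 0 < snd X \<and> snd X \<le> L} X \<partial>lborel)"
   using \<epsilon>[of k] by (intro nn_integral_mono) (auto simp: A_def indicator_def \<epsilon>_def add_pos_pos)
  finally show ?thesis .
 qed
 have b2: "(\<integral>\<^sup>+X. ennreal (norm (grad (\<phi> k) X - grad (%X. average \<eta> f (side e t0 X)) X) powr p) * indicator {X. bm < snd X \<and> snd X < bp} X \<partial>lborel)
   \<le> (\<integral>\<^sup>+X. ennreal (norm (grad (average \<eta> f) (X + (0, L / (real k + 2))) - grad (average \<eta> f) X) powr p)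
   * indicator {X. fst X \<in> UNIV \<and> 0 < snd X \<and> snd X \<le> L} X \<partial>lborel)" for k
 proof -
  let ?Q = "{X :: 'a \<times> real. 0 < snd X \<and> snd X < L}"
  have [measurable]: "?Q \<in> sets borel" by (intro borel_open open_Collect_conj open_Collect_less continuous_intros)
  have "(\<integral>\<^sup>+X. ennreal (norm (grad (\<phi> k) X - grad (%X. average \<eta> f (side e t0 X)) X) powr p) * indicator {X. bm < snd X \<and> snd X < bp} X \<partial>lborel)
   = (\<integral>\<^sup>+X. ennreal (norm (G (side e t0 X + (0, \<epsilon> k)) - G (side e t0 X)) powr p) * indicator ?Q (side e t0 X) \<partial>lborel)"
  proof (rule nn_integral_cong)
   fix X :: "'a \<times> real"
   show "ennreal (norm (grad (\<phi> k) X - grad (%X. average \<eta> f (side e t0 X)) X) powr p) * indicator {X. bm < snd X \<and> snd X < bp} X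
    = ennreal (norm (G (side e t0 X + (0, \<epsilon> k)) - G (side e t0 X)) powr p) * indicator ?Q (side e t0 X)"
   proof (cases "bm < snd X \<and> snd X < bp")
    case True
    then have s: "e * (snd X - t0) > 0" "e * (snd X - t0) < L" using strip by auto
    have "norm (grad (\<phi> k) X - grad (%X. average \<eta> f (side e t0 X)) X)
     = norm (grad (average \<eta> f) (side e t0 X + (0, \<epsilon> k)) - grad (average \<eta> f) (side e t0 X))"
     using g1[OF s(1)] grad_average_side[OF s(1)] by (simp add: reflect_diff norm_reflect[OF e])
    then show ?thesis using True s \<epsilon>[of k] by (simp add: G_def side_def add_pos_pos)
   next
    case False
    then show ?thesis using strip[of "snd X"] by (auto simp: side_def indicator_def)
   qed
  qed
  also have "\<dots> = (\<integral>\<^sup>+X. ennreal (norm (G (X + (0, \<epsilon> k)) - G X) powr p) * indicator ?Q X \<partial>lborel)"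
   by (rule nn_integral_side[OF e, where F = "%X. ennreal (norm (G (X + (0, \<epsilon> k)) - G X) powr p) * indicator ?Q X"]) measurable
  also have "\<dots> \<le> (\<integral>\<^sup>+X. ennreal (norm (grad (average \<eta> f) (X + (0, L / (real k + 2))) - grad (average \<eta> f) X) powr p)
   * indicator {X. fst X \<in> UNIV \<and> 0 < snd X \<and> snd X \<le> L} X \<partial>lborel)"
   using \<epsilon>[of k] by (intro nn_integral_mono) (auto simp: G_def indicator_def \<epsilon>_def add_pos_pos)
  finally show ?thesis .
 qed
 show ?thesis
 proof (rule that[of \<phi>, OF C])
  show "(%k. \<integral>\<^sup>+X. ennreal (norm (\<phi> k X - average \<eta> f (side e t0 X)) powr p)
    * indicator (ball 0 R \<times> {bm<..<bp}) X \<partial>lborel) \<longlonglongrightarrow> 0" for R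
   by (rule tendsto_zero_ennreal_le[OF average_shift_tendsto[OF f fL p L a fin] b1])
  show "(%k. \<integral>\<^sup>+X. ennreal (norm (grad (\<phi> k) X - grad (%X. average \<eta> f (side e t0 X)) X) powr p)
    * indicator {X. bm < snd X \<and> snd X < bp} X \<partial>lborel) \<longlonglongrightarrow> 0"
   by (rule tendsto_zero_ennreal_le[OF average_grad_shift_tendsto[OF f fL p L a fin] b2])
  have "\<phi> k (x, t0) = average \<eta> f (x, L / (real k + 2))" for k x using \<phi>1[of "(x, t0)" k] by (simp add: side_def \<epsilon>_def)
  then show "(%k. \<integral>\<^sup>+x. ennreal (\<bar>\<phi> k (x, t0) - f x\<bar> powr p) \<partial>lborel) \<longlonglongrightarrow> 0"
   using average_trace_tendsto[OF f fL p L a fin] by simp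
 qed
qed

lemma average_side_continuous:
 "continuous_on {X. bm < snd X \<and> snd X < bp} (%X. average \<eta> f (side e t0 X))"
 "continuous_on {X. bm < snd X \<and> snd X < bp} (grad (%X. average \<eta> f (side e t0 X)))"
proof -
 let ?S = "{X :: 'a \<times> real. bm < snd X \<and> snd X < bp}"
 have sub: "side e t0 ` ?S \<subseteq> {X. snd X > 0}"
 proof (clarsimp simp: side_def)
  fix t assume "bm < t" "t < bp"
  then show "0 < e * (t - t0)" using strip[of t] by simp
 qed
 have sc: "continuous_on ?S (side e t0)" by (rule continuous_on_subset[OF side_continuous]) simp
 show "continuous_on ?S (%X. average \<eta> f (side e t0 X))"
  by (rule continuous_on_compose2[OF average_continuous(1)[OF f fL p L a fin] sc sub])
 have "continuous_on ?S (%X. reflect e (grad (average \<eta> f) (side e t0 X)))" unfolding reflect_def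
  by (intro continuous_intros continuous_on_compose2[OF average_continuous(2)[OF f fL p L a fin] sc sub])
 then show "continuous_on ?S (grad (%X. average \<eta> f (side e t0 X)))"
 proof (rule continuous_on_eq)
  fix X assume "X \<in> ?S"
  then have "e * (snd X - t0) > 0" using strip[of "snd X"] by simp
  then show "reflect e (grad (average \<eta> f) (side e t0 X)) = grad (%X. average \<eta> f (side e t0 X)) X"
   using grad_average_side by simp
 qed
qed

end

end

section \<open>Interpolation between the two faces\<close>

abbreviation Lpow_on :: "'a::euclidean_space set => real => ('a => 'b::euclidean_space) => ennreal" where
 "Lpow_on S \<equiv> Lpow (lebesgue_on S)"

lemma Lpow_lebesgue_on:
 assumes "S \<in> sets lebesgue"
 shows "Lpow_on S p f = (\<integral>\<^sup>+x\<in>S. ennreal (norm (f x) powr p) \<partial>lebesgue)"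
 unfolding Lpow_def using assms by (simp add: nn_integral_restrict_space)

lemma Lpow_lebesgue_on_lborel:
 assumes "S \<in> sets lebesgue"
 shows "Lpow_on S p f = (\<integral>\<^sup>+x. ennreal (norm (f x) powr p) * indicator S x \<partial>lborel)"
 using Lpow_lebesgue_on[OF assms] by (simp add: nn_integral_completion)

lemma powr_sum5_le:
 fixes a b c d e :: real
 assumes "a \<ge> 0" "b \<ge> 0" "c \<ge> 0" "d \<ge> 0" "e \<ge> 0" "p > 0"
 shows "(a + b + c + d + e) powr p \<le> 5 powr p * (a powr p + b powr p + c powr p + d powr p + e powr p)"
proof -
 define m where "m = Max {a, b, c, d, e}"
 have m: "a \<le> m" "b \<le> m" "c \<le> m" "d \<le> m" "e \<le> m" unfolding m_def by (intro Max_ge; simp)+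
 have "m \<in> {a, b, c, d, e}" unfolding m_def by (rule Max_in) auto
 then have "m powr p \<le> a powr p + b powr p + c powr p + d powr p + e powr p" by auto
 moreover have "(a + b + c + d + e) powr p \<le> (5 * m) powr p" using m assms by (intro powr_mono2) auto
 ultimately show ?thesis using m assms by (simp add: powr_mult) (meson mult_left_mono order_trans powr_ge_zero)
qed

text \<open>Five terms occur in the gradient of the interpolated extension: two gradients of
  averages, two deviations from the data, and the difference of the data.\<close>

lemma Lpow_sum5_le:
 fixes f1 :: "'a => 'b1::euclidean_space" and f2 :: "'a => 'b2::euclidean_space" and f3 :: "'a => 'b3::euclidean_space"
  and f4 :: "'a => 'b4::euclidean_space" and f5 :: "'a => 'b5::euclidean_space"
 assumes p: "p > 0" and [measurable]: "f1 \<in> borel_measurable M" "f2 \<in> borel_measurable M" "f3 \<in> borel_measurable M"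
  "f4 \<in> borel_measurable M" "f5 \<in> borel_measurable M"
  and le: "\<And>x. x \<in> space M ==> norm (f x) \<le> norm (f1 x) + norm (f2 x) + norm (f3 x) + norm (f4 x) + norm (f5 x)"
 shows "Lpow M p f \<le> ennreal (5 powr p) * (Lpow M p f1 + Lpow M p f2 + Lpow M p f3 + Lpow M p f4 + Lpow M p f5)"
proof -
 have "Lpow M p f \<le> (\<integral>\<^sup>+x. ennreal (5 powr p) * (ennreal (norm (f1 x) powr p) + ennreal (norm (f2 x) powr p)
   + ennreal (norm (f3 x) powr p) + ennreal (norm (f4 x) powr p) + ennreal (norm (f5 x) powr p)) \<partial>M)" unfolding Lpow_def
 proof (rule nn_integral_mono)
  fix x assume "x \<in> space M"
  then have "norm (f x) powr p \<le> (norm (f1 x) + norm (f2 x) + norm (f3 x) + norm (f4 x) + norm (f5 x)) powr p"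
   using le p by (intro powr_mono2) auto
  also have "\<dots> \<le> 5 powr p * (norm (f1 x) powr p + norm (f2 x) powr p + norm (f3 x) powr p + norm (f4 x) powr p + norm (f5 x) powr p)"
   by (rule powr_sum5_le) (use p in auto)
  finally show "ennreal (norm (f x) powr p) \<le> ennreal (5 powr p) * (ennreal (norm (f1 x) powr p) + ennreal (norm (f2 x) powr p)
   + ennreal (norm (f3 x) powr p) + ennreal (norm (f4 x) powr p) + ennreal (norm (f5 x) powr p))"
   by (simp add: ennreal_plus[symmetric] ennreal_mult[symmetric] del: ennreal_plus)
 qed
 also have "\<dots> = ennreal (5 powr p) * (Lpow M p f1 + Lpow M p f2 + Lpow M p f3 + Lpow M p f4 + Lpow M p f5)"
  unfolding Lpow_def by (simp add: nn_integral_cmult nn_integral_add)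
 finally show ?thesis .
qed

lemma Lpow_cmult_real:
 fixes f :: "'a => real"
 assumes "f \<in> borel_measurable M"
 shows "Lpow M p (%x. c * f x) = ennreal (\<bar>c\<bar> powr p) * Lpow M p f" using Lpow_scaleR[OF assms, of p c] by simp

abbreviation slab :: "real => real => ('a::euclidean_space \<times> real) set" where
 "slab bm bp \<equiv> {X. bm < snd X \<and> snd X < bp}"

lemma slab_open: "open (slab bm bp)" by (intro open_Collect_conj open_Collect_less continuous_intros)

lemma slab_lebesgue: "slab bm bp \<in> sets lebesgue" using slab_open by (intro sets_completionI_sets) simp

lemma cyl_lebesgue: "ball (0::'a::euclidean_space) R \<times> {bm<..<bp::real} \<in> sets lebesgue"
 by (intro sets_completionI_sets) (simp add: open_Times)

lemma cyl_subset: "ball 0 R \<times> {bm<..<bp} \<subseteq> slab bm bp" by auto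

lemma Lpow_subset:
 assumes "A \<subseteq> S" "A \<in> sets lebesgue" "S \<in> sets lebesgue"
 shows "Lpow_on A p f \<le> Lpow_on S p f"
 unfolding Lpow_lebesgue_on_lborel[OF assms(2)] Lpow_lebesgue_on_lborel[OF assms(3)]
 using assms(1) by (intro nn_integral_mono) (auto simp: indicator_def)

lemma measurable_lebesgue_on_subset:
 assumes "f \<in> borel_measurable (lebesgue_on S)" "A \<subseteq> S" "S \<in> sets lebesgue"
 shows "f \<in> borel_measurable (lebesgue_on A)" using measurable_restrict_mono[OF assms(1,2)] .

lemma interpolate_has_derivative:
 fixes u1 u2 :: "'a::euclidean_space \<times> real => real"
 assumes u1: "(u1 has_derivative (%h. g1 \<bullet> h)) (at X)" and u2: "(u2 has_derivative (%h. g2 \<bullet> h)) (at X)"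
 shows "((%X. u1 X + (snd X - bm) / L * (u2 X - u1 X)) has_derivative
   (%h. (g1 + ((snd X - bm) / L) *\<^sub>R (g2 - g1) + ((u2 X - u1 X) / L) *\<^sub>R (0, 1)) \<bullet> h)) (at X)"
proof (rule has_derivative_eq_rhs)
 have "((%X :: 'a \<times> real. (snd X - bm) / L) has_derivative (%h. snd h / L)) (at X)"
  unfolding divide_inverse by (auto intro!: derivative_eq_intros)
 then show "((%X. u1 X + (snd X - bm) / L * (u2 X - u1 X)) has_derivative
   (%h. g1 \<bullet> h + ((snd X - bm) / L * (g2 \<bullet> h - g1 \<bullet> h) + snd h / L * (u2 X - u1 X)))) (at X)"
  by (intro has_derivative_add u1 has_derivative_mult has_derivative_diff u2)
 show "(%h. g1 \<bullet> h + ((snd X - bm) / L * (g2 \<bullet> h - g1 \<bullet> h) + snd h / L * (u2 X - u1 X)))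
   = (%h. (g1 + ((snd X - bm) / L) *\<^sub>R (g2 - g1) + ((u2 X - u1 X) / L) *\<^sub>R (0, 1)) \<bullet> h)"
  by (rule ext) (simp add: inner_add_left inner_diff_left inner_prod_def algebra_simps diff_divide_distrib)
qed

text \<open>The sequence \<open>\<Phi>\<close> is common to both faces, because its members are
  interpolated from the two one-sided approximations exactly as \<open>w\<close> is from the
  averages.\<close>

lemma extension:
 fixes a p bm bp :: real
 assumes b: "bm < bp" and a: "0 < a" and p: "1 < p"
 obtains C :: real where "C \<ge> 0"
  "\<And>fm fp :: 'a::euclidean_space => real. fm \<in> borel_measurable borel ==> fp \<in> borel_measurable borel ==>
   L1loc_on UNIV fm ==> L1loc_on UNIV fp ==> gagliardo a p fm < \<infinity> ==> gagliardo a p fp < \<infinity> ==>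
   Lpow lborel p (%x. fp x - fm x) < \<infinity> ==>
   (\<forall>R. Lpow_on (ball 0 R) p fm < \<infinity> \<and> Lpow_on (ball 0 R) p fp < \<infinity>) \<and>
   (\<exists>w. (\<forall>i\<in>Basis. has_weak_partial (slab bm bp) i w (partial_deriv i w)) \<and> continuous_on (slab bm bp) (grad w) \<and>
    Lpow_on (slab bm bp) p (grad w) \<le> ennreal C * (Lpow lborel p (%x. fp x - fm x) + gagliardo a p fm + gagliardo a p fp) \<and>
    (\<exists>\<Phi>. (\<forall>k::nat. Cinf (\<Phi> k)) \<and> (\<forall>R. (%k. Lpow_on (ball 0 R \<times> {bm<..<bp}) p (%X. \<Phi> k X - w X)) \<longlonglongrightarrow> 0 \<and>
     (%k. Lpow_on (ball 0 R \<times> {bm<..<bp}) p (%X. grad (\<Phi> k) X - grad w X)) \<longlonglongrightarrow> 0 \<and>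
     (%k. Lpow_on (ball 0 R) p (%x. \<Phi> k (x, bm) - fm x)) \<longlonglongrightarrow> 0 \<and>
     (%k. Lpow_on (ball 0 R) p (%x. \<Phi> k (x, bp) - fp x)) \<longlonglongrightarrow> 0)))"
proof -
 define L where "L = bp - bm"
 have L: "L > 0" using b by (simp add: L_def)
 define \<kappa> where "\<kappa> = a / (3 * L)"
 have kap: "\<kappa> > 0" "a = \<kappa> * (3 * L)" using a L by (auto simp: \<kappa>_def)
 define \<eta> :: "'a => real" where "\<eta> = mollifier \<kappa>"
 interpret averaging_kernel \<kappa> \<eta> by standard (use kap mollifier_props[OF kap(1)] in "auto simp: \<eta>_def")
 have st1: "bm < t \<and> t < bp \<longleftrightarrow> 0 < 1 * (t - bm) \<and> 1 * (t - bm) < L"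
  and st2: "bm < t \<and> t < bp \<longleftrightarrow> 0 < (- 1) * (t - bp) \<and> (- 1) * (t - bp) < L" for t by (auto simp: L_def)
 \<comment> \<open>The maxima make the signs of the constants evident; enlarging the constants is
   harmless.\<close>
 define gs ds where "gs = max 0 (grad_strip p)" and "ds = max 0 (L * dev_height p L)"
 have gsds: "gs \<ge> 0" "ds \<ge> 0" by (auto simp: gs_def ds_def)
 \<comment> \<open>The slope of the interpolation brings a factor \<open>1 / L\<close>; the
   deviations contribute \<open>ds\<close>, and the difference of the data, constant in height,
   contributes \<open>L\<close>.\<close>
 define C where "C = 5 powr p * (gs + (1 / L) powr p * (ds + L))"
 have C0: "C \<ge> 0" using gsds L by (simp add: C_def)
 show ?thesis
 proof (rule that[OF C0])
  fix fm fp :: "'a => real"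
  assume [measurable]: "fm \<in> borel_measurable borel" "fp \<in> borel_measurable borel"
   and fL: "L1loc_on UNIV fm" "L1loc_on UNIV fp"
   and fin: "gagliardo a p fm < \<infinity>" "gagliardo a p fp < \<infinity>"
   and D: "Lpow lborel p (%x. fp x - fm x) < \<infinity>"
  let ?D = "Lpow lborel p (%x. fp x - fm x)" and ?gm = "gagliardo a p fm" and ?gp = "gagliardo a p fp"
  let ?B = "%R. lebesgue_on (ball 0 R) :: 'a measure"
  let ?C = "%R. lebesgue_on (ball 0 R \<times> {bm<..<bp}) :: ('a \<times> real) measure"
  let ?S = "slab bm bp :: ('a \<times> real) set"
  note c1 = \<open>fm \<in> borel_measurable borel\<close> fL(1) p L kap(2) fin(1) and c2 = \<open>fp \<in> borel_measurable borel\<close> fL(2) p L kap(2) fin(2)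
  have one: "(1::real)\<^sup>2 = 1" "(- 1::real)\<^sup>2 = 1" by simp_all
  define u1 where "u1 = (%X. average \<eta> fm (side 1 bm X))"
  define u2 where "u2 = (%X. average \<eta> fp (side (- 1) bp X))"
  obtain \<phi>1 where \<phi>1: "\<And>k::nat. Cinf (\<phi>1 k)"
   "\<And>R. (%k. \<integral>\<^sup>+X. ennreal (norm (\<phi>1 k X - u1 X) powr p) * indicator (ball 0 R \<times> {bm<..<bp}) X \<partial>lborel) \<longlonglongrightarrow> 0"
   "(%k. \<integral>\<^sup>+X. ennreal (norm (grad (\<phi>1 k) X - grad u1 X) powr p) * indicator ?S X \<partial>lborel) \<longlonglongrightarrow> 0"
   "(%k. \<integral>\<^sup>+x. ennreal (\<bar>\<phi>1 k (x, bm) - fm x\<bar> powr p) \<partial>lborel) \<longlonglongrightarrow> 0"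
   unfolding u1_def using average_side_approx[OF c1 one(1) st1] by blast
  obtain \<phi>2 where \<phi>2: "\<And>k::nat. Cinf (\<phi>2 k)"
   "\<And>R. (%k. \<integral>\<^sup>+X. ennreal (norm (\<phi>2 k X - u2 X) powr p) * indicator (ball 0 R \<times> {bm<..<bp}) X \<partial>lborel) \<longlonglongrightarrow> 0"
   "(%k. \<integral>\<^sup>+X. ennreal (norm (grad (\<phi>2 k) X - grad u2 X) powr p) * indicator ?S X \<partial>lborel) \<longlonglongrightarrow> 0"
   "(%k. \<integral>\<^sup>+x. ennreal (\<bar>\<phi>2 k (x, bp) - fp x\<bar> powr p) \<partial>lborel) \<longlonglongrightarrow> 0"
   unfolding u2_def using average_side_approx[OF c2 one(2) st2] by blast
  have uc: "continuous_on ?S u1" "continuous_on ?S (grad u1)" "continuous_on ?S u2" "continuous_on ?S (grad u2)"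
   unfolding u1_def u2_def by (rule average_side_continuous[OF c1 one(1) st1] average_side_continuous[OF c2 one(2) st2])+
  have Sm: "?S \<in> sets lebesgue" by (rule slab_lebesgue)
  note cm = continuous_imp_measurable_on_sets_lebesgue[OF _ Sm]
  have um [measurable]: "u1 \<in> borel_measurable (lebesgue_on ?S)" "grad u1 \<in> borel_measurable (lebesgue_on ?S)"
   "u2 \<in> borel_measurable (lebesgue_on ?S)" "grad u2 \<in> borel_measurable (lebesgue_on ?S)" using uc cm by auto
  have gr1: "Lpow_on ?S p (grad u1) \<le> ennreal gs * ?gm"
   unfolding Lpow_lebesgue_on_lborel[OF Sm] u1_def gs_def
   by (rule order_trans[OF grad_average_side_le[OF c1 one(1) st1]]) (intro mult_right_mono ennreal_leI, auto)
  have gr2: "Lpow_on ?S p (grad u2) \<le> ennreal gs * ?gp"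
   unfolding Lpow_lebesgue_on_lborel[OF Sm] u2_def gs_def
   by (rule order_trans[OF grad_average_side_le[OF c2 one(2) st2]]) (intro mult_right_mono ennreal_leI, auto)
  have dv1: "Lpow_on ?S p (%X. u1 X - fm (fst X)) \<le> ennreal ds * ?gm"
   unfolding Lpow_lebesgue_on_lborel[OF Sm] u1_def ds_def real_norm_def
   by (rule order_trans[OF dev_average_side_le[OF c1 one(1) st1]]) (intro mult_right_mono ennreal_leI, auto)
  have dv2: "Lpow_on ?S p (%X. u2 X - fp (fst X)) \<le> ennreal ds * ?gp"
   unfolding Lpow_lebesgue_on_lborel[OF Sm] u2_def ds_def real_norm_def
   by (rule order_trans[OF dev_average_side_le[OF c2 one(2) st2]]) (intro mult_right_mono ennreal_leI, auto)
  have df: "Lpow_on ?S p (%X. fp (fst X) - fm (fst X)) = ennreal L * ?D"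
  proof -
   have "Lpow_on ?S p (%X. fp (fst X) - fm (fst X))
    = (\<integral>\<^sup>+X. ennreal (norm (fp (fst X) - fm (fst X)) powr p) * indicator {bm<..<bp} (snd X) \<partial>lborel)"
    unfolding Lpow_lebesgue_on_lborel[OF Sm] by (intro nn_integral_cong) (auto simp: indicator_def)
   also have "\<dots> = (\<integral>\<^sup>+x. \<integral>\<^sup>+t. ennreal (norm (fp x - fm x) powr p) * indicator {bm<..<bp} t \<partial>lborel \<partial>lborel)"
    by (subst lborel_prod[symmetric], subst lborel.nn_integral_fst[symmetric]) auto
   also have "\<dots> = (\<integral>\<^sup>+x. ennreal L * ennreal (norm (fp x - fm x) powr p) \<partial>lborel)"
    using b by (intro nn_integral_cong, subst nn_integral_cmult) (auto simp: L_def mult.commute)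
   also have "\<dots> = ennreal L * ?D" unfolding Lpow_def by (rule nn_integral_cmult) measurable
   finally show ?thesis .
  qed
  have loc: "Lpow (?B R) p fm < \<infinity>" "Lpow (?B R) p fp < \<infinity>" for R
   using Lp_local[OF c1, of R] Lp_local[OF c2, of R] by (simp_all add: Lpow_lebesgue_on_lborel)
  define w where "w = (%X. u1 X + (snd X - bm) / L * (u2 X - u1 X))"
  define \<Phi> where "\<Phi> k = (%X. \<phi>1 k X + (snd X - bm) / L * (\<phi>2 k X - \<phi>1 k X))" for k
  have Ci: "Cinf (%X. v1 X + (snd X - bm) / L * (v2 X - v1 X))" if "Cinf v1" "Cinf v2" for v1 v2 :: "'a \<times> real => real"
  proof -
   have "Cinf (%X :: 'a \<times> real. snd X)" by (rule Cinf_bounded_linear) (rule bounded_linear_snd)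
   then show ?thesis unfolding divide_inverse using that by (intro Cinf_add Cinf_mult Cinf_diff Cinf_const)
  qed
  have C\<Phi>: "Cinf (\<Phi> k)" for k unfolding \<Phi>_def by (rule Ci[OF \<phi>1(1) \<phi>2(1)])
  \<comment> \<open>A compact subset keeps a distance \<open>\<delta>\<close> from both faces, and
    there each average agrees with a function smooth everywhere.\<close>
  have locw: "\<exists>w0 U. Cinf w0 \<and> open U \<and> K \<subseteq> U \<and> (\<forall>X\<in>U. w0 X = w X)" if K: "compact K" "K \<subseteq> ?S" for K
  proof -
   obtain \<delta> where \<delta>: "\<delta> > 0" "\<And>X. X \<in> K ==> snd X - bm > \<delta> \<and> bp - snd X > \<delta>"
   proof (cases "K = {}")
    case True then show ?thesis using that[of 1] by simp
   next
    case False
    have "continuous_on K (%X. min (snd X - bm) (bp - snd X))" by (intro continuous_intros)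
    from continuous_attains_inf[OF K(1) False this] obtain X0 where
     X0: "X0 \<in> K" "\<And>X. X \<in> K ==> min (snd X0 - bm) (bp - snd X0) \<le> min (snd X - bm) (bp - snd X)" by blast
    have "min (snd X0 - bm) (bp - snd X0) > 0" using X0(1) K(2) by auto
    then show ?thesis using X0(2) by (intro that[of "min (snd X0 - bm) (bp - snd X0) / 2"]) fastforce+
   qed
   obtain U1 where U1: "Cinf U1" "\<And>X. 1 * (snd X - bm) \<ge> \<delta> ==> U1 X = u1 X"
    unfolding u1_def using average_side_Cinf[OF c1 one(1) st1 \<delta>(1)] by blast
   obtain U2 where U2: "Cinf U2" "\<And>X. (- 1) * (snd X - bp) \<ge> \<delta> ==> U2 X = u2 X"
    unfolding u2_def using average_side_Cinf[OF c2 one(2) st2 \<delta>(1)] by blast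
   show ?thesis
   proof (intro exI conjI ballI)
    show "Cinf (%X. U1 X + (snd X - bm) / L * (U2 X - U1 X))" by (rule Ci[OF U1(1) U2(1)])
    show "open {X :: 'a \<times> real. snd X - bm > \<delta> \<and> bp - snd X > \<delta>}"
     by (intro open_Collect_conj open_Collect_less continuous_intros)
    show "K \<subseteq> {X. snd X - bm > \<delta> \<and> bp - snd X > \<delta>}" using \<delta>(2) by blast
    show "U1 X + (snd X - bm) / L * (U2 X - U1 X) = w X" if "X \<in> {X. snd X - bm > \<delta> \<and> bp - snd X > \<delta>}" for X
     using that U1(2)[of X] U2(2)[of X] by (simp add: w_def)
   qed
  qed
  have ud: "(u1 has_derivative (%h. grad u1 X \<bullet> h)) (at X)" "(u2 has_derivative (%h. grad u2 X \<bullet> h)) (at X)" if X: "X \<in> ?S" for X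
  proof -
   have s: "1 * (snd X - bm) > 0" "(- 1) * (snd X - bp) > 0" using X by auto
   have "((%Y. average \<eta> fm (side 1 bm Y + 0)) has_derivative (%h. reflect 1 (grad (average \<eta> fm) (side 1 bm X)) \<bullet> h)) (at X)"
    by (rule has_derivative_side) (use average_derivative[OF c1, of "side 1 bm X"] s in "simp add: side_def")
   then show "(u1 has_derivative (%h. grad u1 X \<bullet> h)) (at X)" unfolding u1_def grad_average_side[OF c1 one(1) st1 s(1)] by simp
   have "((%Y. average \<eta> fp (side (- 1) bp Y + 0)) has_derivative (%h. reflect (- 1) (grad (average \<eta> fp) (side (- 1) bp X)) \<bullet> h)) (at X)"
    by (rule has_derivative_side) (use average_derivative[OF c2, of "side (- 1) bp X"] s in "simp add: side_def")
   then show "(u2 has_derivative (%h. grad u2 X \<bullet> h)) (at X)" unfolding u2_def grad_average_side[OF c2 one(2) st2 s(2)] by simp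
  qed
  have gw: "grad w X = grad u1 X + ((snd X - bm) / L) *\<^sub>R (grad u2 X - grad u1 X) + ((u2 X - u1 X) / L) *\<^sub>R (0, 1)" if "X \<in> ?S" for X
   unfolding w_def by (rule grad_eqI[OF interpolate_has_derivative[OF ud[OF that]]])
  have g\<Phi>: "grad (\<Phi> k) X = grad (\<phi>1 k) X + ((snd X - bm) / L) *\<^sub>R (grad (\<phi>2 k) X - grad (\<phi>1 k) X) + ((\<phi>2 k X - \<phi>1 k X) / L) *\<^sub>R (0, 1)" for k X
   unfolding \<Phi>_def by (rule grad_eqI[OF interpolate_has_derivative[OF has_derivative_grad has_derivative_grad]])
    (intro Cinf_differentiable \<phi>1 \<phi>2)+
  have gwc: "continuous_on ?S (grad w)"
  proof -
   have "continuous_on ?S (%X. grad u1 X + ((snd X - bm) / L) *\<^sub>R (grad u2 X - grad u1 X) + ((u2 X - u1 X) / L) *\<^sub>R (0, 1))"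
    using L by (intro continuous_intros uc) auto
   then show ?thesis by (rule continuous_on_eq) (simp only: gw)
  qed
  have \<theta>: "0 \<le> (snd X - bm) / L" "(snd X - bm) / L \<le> 1" if "X \<in> ?S" for X using that L by (auto simp: L_def)
  have comb: "norm (g1 + t *\<^sub>R (g2 - g1)) \<le> norm g1 + norm g2" if t: "0 \<le> t" "t \<le> 1" for t and g1 g2 :: "'b::real_normed_vector"
  proof -
   have "g1 + t *\<^sub>R (g2 - g1) = (1 - t) *\<^sub>R g1 + t *\<^sub>R g2" by (simp add: algebra_simps)
   also have "norm \<dots> \<le> (1 - t) * norm g1 + t * norm g2" using t norm_triangle_ineq[of "(1 - t) *\<^sub>R g1" "t *\<^sub>R g2"] by simp
   also have "\<dots> \<le> norm g1 + norm g2" using t by (intro add_mono mult_left_le_one_le) auto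
   finally show ?thesis .
  qed
  have n01: "norm (c *\<^sub>R (0::'a, 1::real)) = \<bar>c\<bar>" for c by (simp add: norm_Pair)
  have fmS [measurable]: "(%X. fm (fst X)) \<in> borel_measurable (lebesgue_on ?S)" "(%X. fp (fst X)) \<in> borel_measurable (lebesgue_on ?S)"
   by (intro measurable_restrict_space1 measurable_completion; measurable)+
  have bound: "Lpow_on ?S p (grad w) \<le> ennreal C * (?D + ?gm + ?gp)"
  proof -
   let ?M = "lebesgue_on ?S"
   define G where "G = ?gm + ?gp"
   have "Lpow ?M p (grad w) \<le> ennreal (5 powr p) * (Lpow ?M p (grad u1) + Lpow ?M p (grad u2)
    + Lpow ?M p (%X. (1 / L) * (u2 X - fp (fst X))) + Lpow ?M p (%X. (1 / L) * (fp (fst X) - fm (fst X)))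
    + Lpow ?M p (%X. (1 / L) * (u1 X - fm (fst X))))"
   proof (rule Lpow_sum5_le)
    fix X assume "X \<in> space ?M"
    then have X: "X \<in> ?S" by simp
    have "norm (grad w X) \<le> norm (grad u1 X + ((snd X - bm) / L) *\<^sub>R (grad u2 X - grad u1 X)) + norm (((u2 X - u1 X) / L) *\<^sub>R (0::'a, 1::real))"
     unfolding gw[OF X] by (rule norm_triangle_ineq)
    also have "\<dots> \<le> (norm (grad u1 X) + norm (grad u2 X)) + \<bar>(u2 X - u1 X) / L\<bar>"
     unfolding n01 by (intro add_right_mono comb \<theta>[OF X])
    \<comment> \<open>The slope is split by inserting the data, so that only deviations of averages
      and the difference of the data remain.\<close>
    also have "(u2 X - u1 X) / L = (1 / L) * (u2 X - fp (fst X)) + (1 / L) * (fp (fst X) - fm (fst X)) - (1 / L) * (u1 X - fm (fst X))"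
     by (simp add: algebra_simps diff_divide_distrib)
    finally show "norm (grad w X) \<le> norm (grad u1 X) + norm (grad u2 X) + norm ((1 / L) * (u2 X - fp (fst X)))
     + norm ((1 / L) * (fp (fst X) - fm (fst X))) + norm ((1 / L) * (u1 X - fm (fst X)))" unfolding real_norm_def by linarith
   qed (use p in auto)
   also have "\<dots> \<le> ennreal (5 powr p) * (ennreal gs * ?gm + ennreal gs * ?gp
    + ennreal ((1 / L) powr p) * (ennreal ds * ?gp) + ennreal ((1 / L) powr p) * (ennreal L * ?D)
    + ennreal ((1 / L) powr p) * (ennreal ds * ?gm))"
    using L by (subst (1 2 3) Lpow_cmult_real) (auto intro!: mult_left_mono add_mono gr1 gr2 dv1 dv2 simp: df)
   also have "\<dots> = ennreal (5 powr p) * (ennreal gs * G + ennreal ((1 / L) powr p) * (ennreal ds * G + ennreal L * ?D))"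
    by (simp add: G_def algebra_simps)
   also have "\<dots> \<le> ennreal (5 powr p) * (ennreal gs * (?D + G)
     + ennreal ((1 / L) powr p) * (ennreal ds * (?D + G) + ennreal L * (?D + G)))"
    by (intro mult_left_mono add_mono) auto
   also have "\<dots> = ennreal C * (?D + G)"
   proof -
    have "ennreal C = ennreal (5 powr p) * (ennreal gs + ennreal ((1 / L) powr p) * (ennreal ds + ennreal L))"
     unfolding C_def using gsds L by (simp add: ennreal_mult[symmetric] ennreal_plus[symmetric] del: ennreal_plus)
    then show ?thesis by (simp add: distrib_right distrib_left mult.assoc)
   qed
   finally show ?thesis by (simp add: G_def add.assoc)
  qed
  have cyl: "(%k. Lpow (?C R) p (%X. \<Phi> k X - w X)) \<longlonglongrightarrow> 0 \<and>
     (%k. Lpow (?C R) p (%X. grad (\<Phi> k) X - grad w X)) \<longlonglongrightarrow> 0" for R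
  proof -
   let ?Q = "ball 0 R \<times> {bm<..<bp} :: ('a \<times> real) set"
   let ?M = "lebesgue_on ?Q"
   let ?a = "%k. Lpow_on ?Q p (%X. \<phi>1 k X - u1 X)" and ?b = "%k. Lpow_on ?Q p (%X. \<phi>2 k X - u2 X)"
   let ?z = "Lpow_on ?Q p (%X. 0 :: real)"
   let ?ga = "%k. Lpow_on ?Q p (%X. grad (\<phi>1 k) X - grad u1 X)" and ?gb = "%k. Lpow_on ?Q p (%X. grad (\<phi>2 k) X - grad u2 X)"
   let ?ca = "%k. Lpow_on ?Q p (%X. (1 / L) * (\<phi>1 k X - u1 X))" and ?cb = "%k. Lpow_on ?Q p (%X. (1 / L) * (\<phi>2 k X - u2 X))"
   note sub = measurable_lebesgue_on_subset[OF _ cyl_subset Sm]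
   have Qm: "?Q \<in> sets lebesgue" by (rule cyl_lebesgue)
   have [measurable]: "u1 \<in> borel_measurable ?M" "grad u1 \<in> borel_measurable ?M" "u2 \<in> borel_measurable ?M" "grad u2 \<in> borel_measurable ?M"
    by (rule sub, rule um)+
   have [measurable]: "\<phi>1 k \<in> borel_measurable ?M" "grad (\<phi>1 k) \<in> borel_measurable ?M" "\<phi>2 k \<in> borel_measurable ?M" "grad (\<phi>2 k) \<in> borel_measurable ?M" for k
    by (rule continuous_imp_measurable_on_sets_lebesgue[OF _ Qm], rule continuous_on_subset[of UNIV],
      (rule Cinf_continuous continuous_grad), (rule \<phi>1(1) \<phi>2(1)), simp)+
   have t1: "(%k. ?a k) \<longlonglongrightarrow> 0" "(%k. ?b k) \<longlonglongrightarrow> 0"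
    using \<phi>1(2)[of R] \<phi>2(2)[of R] unfolding Lpow_lebesgue_on_lborel[OF Qm] .
   have t2: "(%k. ?ga k) \<longlonglongrightarrow> 0" "(%k. ?gb k) \<longlonglongrightarrow> 0"
    by (rule tendsto_zero_ennreal_le[OF \<phi>1(3)], unfold Lpow_lebesgue_on_lborel[OF Sm, symmetric], rule Lpow_subset[OF cyl_subset Qm Sm])
      (rule tendsto_zero_ennreal_le[OF \<phi>2(3)], unfold Lpow_lebesgue_on_lborel[OF Sm, symmetric], rule Lpow_subset[OF cyl_subset Qm Sm])
   have z: "?z = 0" using p by (simp add: Lpow_def)
   have t3: "(%k. ?ca k) \<longlonglongrightarrow> 0" "(%k. ?cb k) \<longlonglongrightarrow> 0"
    using Lpow_tendsto_scaleR[OF _ t1(1), of "1 / L"] Lpow_tendsto_scaleR[OF _ t1(2), of "1 / L"] by simp_all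
   have 1: "(%k. Lpow ?M p (%X. \<Phi> k X - w X)) \<longlonglongrightarrow> 0"
   proof (rule tendsto_zero_ennreal_le)
    \<comment> \<open>Two of the five places suffice here; zero functions fill the others.\<close>
    show "Lpow ?M p (%X. \<Phi> k X - w X) \<le> ennreal (5 powr p) * (?a k + ?b k
     + ?z + ?z + ?z)" for k
    proof (rule Lpow_sum5_le)
     fix X assume "X \<in> space ?M"
     then have X: "X \<in> ?S" by auto
     have "\<Phi> k X - w X = (\<phi>1 k X - u1 X) + ((snd X - bm) / L) *\<^sub>R ((\<phi>2 k X - u2 X) - (\<phi>1 k X - u1 X))"
     proof -
      have "a1 + t * (b1 - a1) - (a2 + t * (b2 - a2)) = (a1 - a2) + t * ((b1 - b2) - (a1 - a2))" for a1 a2 b1 b2 t :: real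
       by (simp add: algebra_simps)
      then show ?thesis unfolding \<Phi>_def w_def real_scaleR_def .
     qed
     also have "norm \<dots> \<le> norm (\<phi>1 k X - u1 X) + norm (\<phi>2 k X - u2 X)" by (rule comb[OF \<theta>[OF X]])
     finally show "norm (\<Phi> k X - w X) \<le> norm (\<phi>1 k X - u1 X) + norm (\<phi>2 k X - u2 X) + norm (0::real) + norm (0::real) + norm (0::real)" by simp
    qed (use p in auto)
    show "(%k. ennreal (5 powr p) * (?a k + ?b k
     + ?z + ?z + ?z)) \<longlonglongrightarrow> 0"
     unfolding z by (intro tendsto_cmult_zero_ennreal tendsto_add_zero_ennreal t1) auto
   qed
   have 2: "(%k. Lpow ?M p (%X. grad (\<Phi> k) X - grad w X)) \<longlonglongrightarrow> 0"
   proof (rule tendsto_zero_ennreal_le)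
    show "Lpow ?M p (%X. grad (\<Phi> k) X - grad w X) \<le> ennreal (5 powr p) * (?ga k
     + ?gb k
     + ?ca k + ?cb k + ?z)" for k
    proof (rule Lpow_sum5_le)
     fix X assume "X \<in> space ?M"
     then have X: "X \<in> ?S" by auto
     define A1 A2 t c1 c2 where "A1 = grad (\<phi>1 k) X - grad u1 X" and "A2 = grad (\<phi>2 k) X - grad u2 X"
      and "t = (snd X - bm) / L" and "c1 = (1 / L) * (\<phi>1 k X - u1 X)" and "c2 = (1 / L) * (\<phi>2 k X - u2 X)"
     have eq: "grad (\<Phi> k) X - grad w X = (A1 + t *\<^sub>R (A2 - A1)) + (c2 - c1) *\<^sub>R (0, 1)"
      unfolding g\<Phi> gw[OF X] A1_def A2_def t_def[symmetric] c1_def c2_def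
      by (simp add: scaleR_diff_right prod_eq_iff diff_divide_distrib)
     have "norm (grad (\<Phi> k) X - grad w X) \<le> norm (A1 + t *\<^sub>R (A2 - A1)) + \<bar>c2 - c1\<bar>"
      unfolding eq using norm_triangle_ineq[of "A1 + t *\<^sub>R (A2 - A1)" "(c2 - c1) *\<^sub>R (0, 1)"] n01[of "c2 - c1"] by simp
     moreover have "norm (A1 + t *\<^sub>R (A2 - A1)) \<le> norm A1 + norm A2" by (rule comb) (use \<theta>[OF X] in "simp_all add: t_def")
     ultimately have "norm (grad (\<Phi> k) X - grad w X) \<le> norm A1 + norm A2 + \<bar>c1\<bar> + \<bar>c2\<bar> + 0" by linarith
     then show "norm (grad (\<Phi> k) X - grad w X) \<le> norm (grad (\<phi>1 k) X - grad u1 X) + norm (grad (\<phi>2 k) X - grad u2 X)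
      + norm ((1 / L) * (\<phi>1 k X - u1 X)) + norm ((1 / L) * (\<phi>2 k X - u2 X)) + norm (0::real)"
      by (simp only: A1_def A2_def c1_def c2_def real_norm_def abs_zero)
    qed (use p in auto)
    show "(%k. ennreal (5 powr p) * (?ga k + ?gb k
     + ?ca k + ?cb k + ?z)) \<longlonglongrightarrow> 0"
     unfolding z by (intro tendsto_cmult_zero_ennreal tendsto_add_zero_ennreal t2 t3) auto
   qed
   show ?thesis using 1 2 by blast
  qed
  have tr: "(%k. Lpow (?B R) p (%x. \<Phi> k (x, bm) - fm x)) \<longlonglongrightarrow> 0"
   "(%k. Lpow (?B R) p (%x. \<Phi> k (x, bp) - fp x)) \<longlonglongrightarrow> 0" for R
  proof -
   have B: "ball (0::'a) R \<in> sets lebesgue" by simp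
   \<comment> \<open>The interpolation weight is 0 on the lower face and 1 on the upper one.\<close>
   have e: "\<Phi> k (x, bm) = \<phi>1 k (x, bm)" "\<Phi> k (x, bp) = \<phi>2 k (x, bp)" for k x using L by (simp_all add: \<Phi>_def L_def[symmetric])
   show "(%k. Lpow (?B R) p (%x. \<Phi> k (x, bm) - fm x)) \<longlonglongrightarrow> 0" unfolding e Lpow_lebesgue_on_lborel[OF B]
    by (rule tendsto_zero_ennreal_le[OF \<phi>1(4)]) (intro nn_integral_mono, auto simp: indicator_def)
   show "(%k. Lpow (?B R) p (%x. \<Phi> k (x, bp) - fp x)) \<longlonglongrightarrow> 0" unfolding e Lpow_lebesgue_on_lborel[OF B]
    by (rule tendsto_zero_ennreal_le[OF \<phi>2(4)]) (intro nn_integral_mono, auto simp: indicator_def)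
  qed
  have wp: "\<forall>i\<in>Basis. has_weak_partial ?S i w (partial_deriv i w)" using has_weak_partial_smooth[OF slab_open _ locw] by blast
  show "(\<forall>R. Lpow (?B R) p fm < \<infinity> \<and> Lpow (?B R) p fp < \<infinity>) \<and>
   (\<exists>w. (\<forall>i\<in>Basis. has_weak_partial ?S i w (partial_deriv i w)) \<and> continuous_on ?S (grad w) \<and>
    Lpow_on ?S p (grad w) \<le> ennreal C * (?D + ?gm + ?gp) \<and>
    (\<exists>\<Phi>. (\<forall>k::nat. Cinf (\<Phi> k)) \<and> (\<forall>R. (%k. Lpow (?C R) p (%X. \<Phi> k X - w X)) \<longlonglongrightarrow> 0 \<and>
     (%k. Lpow (?C R) p (%X. grad (\<Phi> k) X - grad w X)) \<longlonglongrightarrow> 0 \<and>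
     (%k. Lpow (?B R) p (%x. \<Phi> k (x, bm) - fm x)) \<longlonglongrightarrow> 0 \<and>
     (%k. Lpow (?B R) p (%x. \<Phi> k (x, bp) - fp x)) \<longlonglongrightarrow> 0)))" using loc wp gwc bound C\<Phi> cyl tr by blast
 qed
qed

subsection \<open>Traces of smooth functions\<close>

text \<open>Both measures are compared on the half-lines \<open>{..r}\<close>: the norm pulls them
  back to balls, whose volume is the integral of the density.\<close>

lemma distr_norm_lborel:
 "distr lborel borel (norm :: 'a::euclidean_space => real) =
   density lborel (%r. ennreal (DIM('a) * unit_ball_vol DIM('a) * r ^ (DIM('a) - 1) * indicator {0..} r))"
 (is "?N = density lborel ?d")
proof -
 let ?n = "DIM('a)"
 define \<omega> where "\<omega> = unit_ball_vol (real ?n)"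
 have \<omega>: "\<omega> \<ge> 0" by (simp add: \<omega>_def)
 have dm: "?d \<in> borel_measurable lborel" by measurable
 have eN: "emeasure ?N {..r} = ennreal (if r \<ge> 0 then \<omega> * r ^ ?n else 0)" for r
 proof (cases "r \<ge> 0")
  case True
  have "emeasure ?N {..r} = emeasure lborel (cball (0::'a) r)"
   by (subst emeasure_distr) (auto intro!: arg_cong[where f = "emeasure lborel"] simp: vimage_def)
  then show ?thesis using True by (simp add: emeasure_cball \<omega>_def)
 next
  case False
  then have "norm -` {..r} = ({} :: 'a set)" by (auto dest: order_trans[OF norm_ge_zero])
  then show ?thesis using False by (subst emeasure_distr) auto
 qed
 have eD: "emeasure (density lborel ?d) {..r} = ennreal (if r \<ge> 0 then \<omega> * r ^ ?n else 0)" for r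
 proof -
  have "emeasure (density lborel ?d) {..r} = (\<integral>\<^sup>+s. ennreal (?n * \<omega> * s ^ (?n - 1)) * indicator {0..r} s \<partial>lborel)"
   using dm by (subst emeasure_density) (auto simp: \<omega>_def indicator_def intro!: nn_integral_cong)
  also have "\<dots> = ennreal (if r \<ge> 0 then \<omega> * r ^ ?n else 0)"
  proof (cases "r \<ge> 0")
   case True
   have "(\<integral>\<^sup>+s. ennreal (?n * \<omega> * s ^ (?n - 1)) * indicator {0..r} s \<partial>lborel) = ennreal (\<omega> * r ^ ?n - \<omega> * 0 ^ ?n)"
    by (rule nn_integral_FTC_Icc) (use True \<omega> in "auto intro!: derivative_eq_intros simp: mult_ac")
   then show ?thesis using True by (simp add: power_0_left)
  qed simp
  finally show ?thesis .
 qed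
 show ?thesis
 proof (rule measure_eqI_generator_eq[where E = "range atMost" and \<Omega> = UNIV and A = "%k::nat. {..real k}"])
  have b: "sets (borel :: real measure) = sigma_sets UNIV (range atMost)"
   by (subst borel_eq_atMost) (rule sets_measure_of, simp)
  show "sets ?N = sigma_sets UNIV (range atMost)" "sets (density lborel ?d) = sigma_sets UNIV (range atMost)"
   using b by simp_all
  show "Int_stable (range (atMost :: real => real set))" unfolding Int_stable_def
  proof (intro ballI)
   fix a b :: "real set" assume "a \<in> range atMost" "b \<in> range atMost"
   then obtain x y where "a = {..x}" "b = {..y}" by auto
   then have "a \<inter> b = {..min x y}" by auto
   then show "a \<inter> b \<in> range atMost" by blast
  qed
  show "(\<Union>k::nat. {..real k}) = UNIV" by (auto intro: real_nat_ceiling_ge)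
  show "emeasure ?N {..real k} \<noteq> \<infinity>" for k :: nat unfolding eN by simp
 qed (use eN eD in auto)
qed

text \<open>The weight is, up to a constant, the reciprocal of the Jacobian of polar coordinates, so
  a one-dimensional integral without weight remains.\<close>

lemma nn_integral_radial:
 fixes G :: "real => ennreal"
 assumes [measurable]: "G \<in> borel_measurable borel"
 shows "(\<integral>\<^sup>+(h::'a::euclidean_space). ennreal (norm h powr (1 - real DIM('a))) * G (norm h) * indicator (ball 0 a) h \<partial>lborel)
  = ennreal (DIM('a) * unit_ball_vol DIM('a)) * (\<integral>\<^sup>+r. G r * indicator {0<..<a} r \<partial>lborel)"
proof -
 let ?n = "DIM('a)"
 let ?F = "%r. ennreal (r powr (1 - real ?n)) * G r * indicator {0<..<a} r"
 have "(\<integral>\<^sup>+(h::'a). ennreal (norm h powr (1 - real ?n)) * G (norm h) * indicator (ball 0 a) h \<partial>lborel)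
  = (\<integral>\<^sup>+h. ?F (norm (h::'a)) \<partial>lborel)"
 proof (rule nn_integral_cong)
  fix h :: 'a
  show "ennreal (norm h powr (1 - real ?n)) * G (norm h) * indicator (ball 0 a) h = ?F (norm h)"
   by (cases "h = 0") (auto simp: indicator_def)
 qed
 also have "\<dots> = (\<integral>\<^sup>+r. ?F r \<partial>distr lborel borel (norm :: 'a => real))" by (rule nn_integral_distr[symmetric]) auto
 also have "\<dots> = (\<integral>\<^sup>+r. ennreal (?n * unit_ball_vol ?n * r ^ (?n - 1) * indicator {0..} r) * ?F r \<partial>lborel)"
  unfolding distr_norm_lborel by (rule nn_integral_density) auto
 also have "\<dots> = (\<integral>\<^sup>+r. ennreal (?n * unit_ball_vol ?n) * (G r * indicator {0<..<a} r) \<partial>lborel)"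
 proof (rule nn_integral_cong)
  fix r :: real
  show "ennreal (?n * unit_ball_vol ?n * r ^ (?n - 1) * indicator {0..} r) * ?F r = ennreal (?n * unit_ball_vol ?n) * (G r * indicator {0<..<a} r)"
  proof (cases "0 < r \<and> r < a")
   case True
   have "r ^ (?n - 1) * r powr (1 - real ?n) = 1"
    using True DIM_positive[where 'a = 'a] by (simp add: powr_realpow[symmetric] powr_add[symmetric] of_nat_diff)
   then have "ennreal (?n * unit_ball_vol ?n * r ^ (?n - 1)) * ennreal (r powr (1 - real ?n)) = ennreal (?n * unit_ball_vol ?n)"
    using True by (simp add: ennreal_mult[symmetric] mult.assoc)
   then show ?thesis using True by (simp add: mult.assoc[symmetric])
  qed simp
 qed
 also have "\<dots> = ennreal (?n * unit_ball_vol ?n) * (\<integral>\<^sup>+r. G r * indicator {0<..<a} r \<partial>lborel)"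
  by (rule nn_integral_cmult) measurable
 finally show ?thesis .
qed

lemma powr_integral_from_0:
 fixes b c :: real
 assumes "b > -1" "c > 0"
 shows "(\<integral>\<^sup>+x. ennreal (x powr b) * indicator {0..c} x \<partial>lborel) = ennreal (c powr (b + 1) / (b + 1))"
  and "integrable lborel (%x. x powr b * indicator {0..c} x)"
  and "(\<integral>x. x powr b * indicator {0..c} x \<partial>lborel) = c powr (b + 1) / (b + 1)"
proof -
 show 1: "(\<integral>\<^sup>+x. ennreal (x powr b) * indicator {0..c} x \<partial>lborel) = ennreal (c powr (b + 1) / (b + 1))"
  by (rule nn_integral_has_integral_lebesgue') (use has_integral_powr_from_0[of b c] assms in auto)
 have 2: "(\<integral>\<^sup>+x. ennreal (x powr b * indicator {0..c} x) \<partial>lborel) = ennreal (c powr (b + 1) / (b + 1))"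
  unfolding 1[symmetric] by (intro nn_integral_cong) (auto simp: indicator_def)
 then show "integrable lborel (%x. x powr b * indicator {0..c} x)" by (intro integrableI_nonneg) auto
 show "(\<integral>x. x powr b * indicator {0..c} x \<partial>lborel) = c powr (b + 1) / (b + 1)"
  by (rule integral_eq_nn_integral[THEN trans]) (use 2 assms in auto)
qed

lemma abs_diff_le_integral:
 fixes f f' u :: "real => real"
 assumes ab: "a \<le> b" and d: "\<And>t. (f has_real_derivative f' t) (at t)" and c: "continuous_on UNIV f'"
  and u: "\<And>t. \<bar>f' t\<bar> \<le> u t" "continuous_on UNIV u"
 shows "\<bar>f b - f a\<bar> \<le> (\<integral>t. u t * indicator {a..b} t \<partial>lborel)"
  and "integrable lborel (%t. u t * indicator {a..b} t)"
proof -
 have iu: "integrable lborel (%t. indicator {a..b} t *\<^sub>R u t)" and i': "integrable lborel (%t. indicator {a..b} t *\<^sub>R f' t)"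
  using borel_integrable_compact[of "{a..b}" u] borel_integrable_compact[of "{a..b}" f'] u(2) c continuous_on_subset by auto
 have "(\<integral>t. indicator {a..b} t *\<^sub>R f' t \<partial>lborel) = f b - f a" by (rule integral_FTC_atLeastAtMost[OF ab])
   (use d c in "auto intro: has_vector_derivative_at_within continuous_on_subset simp: has_real_derivative_iff_has_vector_derivative")
 then have "\<bar>f b - f a\<bar> \<le> (\<integral>t. \<bar>indicator {a..b} t *\<^sub>R f' t\<bar> \<partial>lborel)" by (metis integral_abs_bound)
 also have "\<dots> \<le> (\<integral>t. indicator {a..b} t *\<^sub>R u t \<partial>lborel)"
  by (rule integral_mono[OF integrable_abs[OF i'] iu]) (use u(1) in "auto simp: abs_mult indicator_def")
 finally show "\<bar>f b - f a\<bar> \<le> (\<integral>t. u t * indicator {a..b} t \<partial>lborel)" by (simp add: mult.commute)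
 show "integrable lborel (%t. u t * indicator {a..b} t)" using iu by (simp add: mult.commute)
qed

text \<open>Jensen's inequality with the integrable weight \<open>t powr (- (1/2))\<close> leaves
  \<open>t powr ((p - 1) / 2)\<close> beside the power of \<open>u\<close>. This surplus compensates
  a factor \<open>1 / t\<close> that a change of variables brings later; the resulting integral is
  finite for all \<open>p > 1\<close>.\<close>

lemma line_powr_le:
 fixes f f' u :: "real => real"
 assumes p: "p > 1" and d: "\<And>t. (f has_real_derivative f' t) (at t)" and c: "continuous_on UNIV f'"
  and u: "\<And>t. \<bar>f' t\<bar> \<le> u t" "continuous_on UNIV u" and l: "l > 0"
 shows "ennreal (\<bar>f l - f 0\<bar> powr p) \<le> ennreal ((2 * sqrt l) powr (p - 1)) *
   (\<integral>\<^sup>+t. ennreal (u t powr p * t powr ((p - 1) / 2)) * indicator {0..l} t \<partial>lborel)"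
proof -
 have [measurable]: "u \<in> borel_measurable borel" using borel_measurable_continuous_onI[OF u(2)] .
 have u0: "u t \<ge> 0" for t using u(1)[of t] by linarith
 let ?w = "%t. t powr (- (1/2)) * indicator {0..l} t"
 let ?F = "%t. u t * t powr (1/2)"
 have W: "(\<integral>t. ?w t \<partial>lborel) = 2 * sqrt l" "integrable lborel ?w"
  using powr_integral_from_0(2,3)[of "-(1/2)" l] l by (simp_all add: powr_half_sqrt)
 note I = abs_diff_le_integral[of 0 l f f' u, OF less_imp_le[OF l] d c u]
 \<comment> \<open>At \<open>t = 0\<close> all powers are 0 and the factorisation of
   \<open>u\<close> may fail; a single point is negligible.\<close>
 have Fw: "?F t * ?w t = u t * indicator {0..l} t" if "t \<noteq> 0" for t using that by (auto simp: indicator_def powr_minus_divide)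
 have ae: "AE t in lborel. ?F t * ?w t = u t * indicator {0..l} t"
  using AE_lborel_singleton[of "0::real"] by eventually_elim (rule Fw)
 have iFw: "integrable lborel (%t. ?F t * ?w t)"
  by (rule Bochner_Integration.integrable_cong_AE_imp[OF I(2)]) (use ae in "auto elim: eventually_mono")
 have "\<bar>f l - f 0\<bar> \<le> (\<integral>t. ?F t * ?w t \<partial>lborel)"
 proof -
  have "(\<integral>t. ?F t * ?w t \<partial>lborel) = (\<integral>t. u t * indicator {0..l} t \<partial>lborel)" by (rule integral_cong_AE) (use ae in auto)
  then show ?thesis using I(1) by simp
 qed
 then have "ennreal (\<bar>f l - f 0\<bar> powr p) \<le> ennreal ((\<integral>t. ?F t * ?w t \<partial>lborel) powr p)"
  using p by (intro ennreal_leI powr_mono2) auto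
 also have "\<dots> \<le> ennreal ((\<integral>t. ?w t \<partial>lborel) powr (p - 1)) * (\<integral>\<^sup>+t. ennreal (?F t powr p * ?w t) \<partial>lborel)"
  by (rule jensen_powr[OF p]) (use u0 W iFw in auto)
 also have "(\<integral>\<^sup>+t. ennreal (?F t powr p * ?w t) \<partial>lborel) = (\<integral>\<^sup>+t. ennreal (u t powr p * t powr ((p - 1) / 2)) * indicator {0..l} t \<partial>lborel)"
 proof (rule nn_integral_cong)
  fix t
  show "ennreal (?F t powr p * ?w t) = ennreal (u t powr p * t powr ((p - 1) / 2)) * indicator {0..l} t"
   by (auto simp: indicator_def powr_mult powr_powr mult.assoc powr_add[symmetric] field_simps)
 qed
 finally show ?thesis by (simp only: W)
qed

lemma line_powr_le_unweighted:
 fixes f f' u :: "real => real"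
 assumes p: "p > 1" and d: "\<And>t. (f has_real_derivative f' t) (at t)" and c: "continuous_on UNIV f'"
  and u: "\<And>t. \<bar>f' t\<bar> \<le> u t" "continuous_on UNIV u" and ab: "a < b"
  and st: "s \<in> {a..b}" "t \<in> {a..b}"
 shows "ennreal (\<bar>f t - f s\<bar> powr p) \<le> ennreal ((b - a) powr (p - 1)) * (\<integral>\<^sup>+t. ennreal (u t powr p) * indicator {a..b} t \<partial>lborel)"
proof -
 have [measurable]: "u \<in> borel_measurable borel" using borel_measurable_continuous_onI[OF u(2)] .
 have u0: "u t \<ge> 0" for t using u(1)[of t] by linarith
 have I: "integrable lborel (%t. u t * indicator {a..b} t)"
  using abs_diff_le_integral(2)[of a b f f' u, OF less_imp_le[OF ab] d c u] .
 have le: "\<bar>f y - f x\<bar> \<le> (\<integral>t. u t * indicator {a..b} t \<partial>lborel)" if xy: "a \<le> x" "x \<le> y" "y \<le> b" for x y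
 proof -
  note J = abs_diff_le_integral[of x y f f' u, OF xy(2) d c u]
  have "\<bar>f y - f x\<bar> \<le> (\<integral>t. u t * indicator {x..y} t \<partial>lborel)" by (rule J(1))
  also have "\<dots> \<le> (\<integral>t. u t * indicator {a..b} t \<partial>lborel)"
   by (rule integral_mono[OF J(2) I]) (use xy u0 in "auto simp: indicator_def")
  finally show ?thesis .
 qed
 have "\<bar>f t - f s\<bar> \<le> (\<integral>t. u t * indicator {a..b} t \<partial>lborel)"
  using le[of s t] le[of t s] st by (cases "s \<le> t") (auto simp: abs_minus_commute)
 then have "ennreal (\<bar>f t - f s\<bar> powr p) \<le> ennreal ((\<integral>t. u t * indicator {a..b} t \<partial>lborel) powr p)"
  using p by (intro ennreal_leI powr_mono2) auto
 also have "\<dots> \<le> ennreal ((\<integral>t. indicator {a..b} t \<partial>lborel) powr (p - 1)) * (\<integral>\<^sup>+t. ennreal (u t powr p * indicator {a..b} t) \<partial>lborel)"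
  by (rule jensen_powr[OF p]) (use u0 I borel_integrable_compact[of "{a..b}" "%_. 1::real"] in auto)
 also have "(\<integral>t. indicator {a..b} t \<partial>lborel) = b - a" using ab by simp
 also have "(\<integral>\<^sup>+t. ennreal (u t powr p * indicator {a..b} t) \<partial>lborel) = (\<integral>\<^sup>+t. ennreal (u t powr p) * indicator {a..b} t \<partial>lborel)"
  by (intro nn_integral_cong) (auto simp: indicator_def)
 finally show ?thesis .
qed

section \<open>Smooth functions on cylinders: Poincare and trace inequalities\<close>

lemma Cinf_line_derivative:
 fixes \<phi> :: "'a::euclidean_space => real"
 assumes "Cinf \<phi>"
 shows "((%t. \<phi> (X + t *\<^sub>R v)) has_real_derivative grad \<phi> (X + t *\<^sub>R v) \<bullet> v) (at t)"
proof -
 have "((%t. X + t *\<^sub>R v) has_derivative (%t. t *\<^sub>R v)) (at t)" by (auto intro!: derivative_eq_intros)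
 from diff_chain_at[OF this has_derivative_grad[OF Cinf_differentiable[OF assms]]]
 show ?thesis by (simp add: has_field_derivative_def o_def mult_commute_abs)
qed

lemma vertical_powr_le:
 fixes \<phi> :: "'a::euclidean_space \<times> real => real"
 assumes \<phi>: "Cinf \<phi>" and p: "p > 1" and b: "bm < bp" and st: "s \<in> {bm..bp}" "t \<in> {bm..bp}"
 shows "ennreal (\<bar>\<phi> (x, t) - \<phi> (x, s)\<bar> powr p) \<le> ennreal ((bp - bm) powr (p - 1)) *
  (\<integral>\<^sup>+\<tau>. ennreal (norm (grad \<phi> (x, \<tau>)) powr p) * indicator {bm<..<bp} \<tau> \<partial>lborel)"
proof -
 have e: "(x, 0) + t *\<^sub>R (0, 1) = (x, t)" for t :: real by simp
 have "ennreal (\<bar>\<phi> (x, t) - \<phi> (x, s)\<bar> powr p) \<le> ennreal ((bp - bm) powr (p - 1)) *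
  (\<integral>\<^sup>+\<tau>. ennreal (norm (grad \<phi> (x, \<tau>)) powr p) * indicator {bm..bp} \<tau> \<partial>lborel)"
 proof (rule line_powr_le_unweighted[OF p _ _ _ _ b st])
  show "((%t. \<phi> (x, t)) has_real_derivative grad \<phi> (x, t) \<bullet> (0, 1)) (at t)" for t
   using Cinf_line_derivative[OF \<phi>, of "(x, 0)" "(0, 1)" t] by (simp only: e)
  have c: "continuous_on UNIV (%t. grad \<phi> (x, t))"
   by (rule continuous_on_compose2[OF continuous_grad[OF \<phi>]]) (auto intro!: continuous_intros)
  then show "continuous_on UNIV (%t. grad \<phi> (x, t) \<bullet> (0, 1))" "continuous_on UNIV (%t. norm (grad \<phi> (x, t)))"
   by (auto intro!: continuous_intros)
  show "\<bar>grad \<phi> (x, t) \<bullet> (0, 1)\<bar> \<le> norm (grad \<phi> (x, t))" for t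
   using Cauchy_Schwarz_ineq2[of "grad \<phi> (x, t)" "(0, 1)"] by (simp add: norm_Pair)
 qed
 also have "(\<integral>\<^sup>+\<tau>. ennreal (norm (grad \<phi> (x, \<tau>)) powr p) * indicator {bm..bp} \<tau> \<partial>lborel)
  = (\<integral>\<^sup>+\<tau>. ennreal (norm (grad \<phi> (x, \<tau>)) powr p) * indicator {bm<..<bp} \<tau> \<partial>lborel)"
 proof (rule nn_integral_cong_AE)
  have "AE \<tau> in lborel. \<tau> \<noteq> bm" "AE \<tau> in lborel. \<tau> \<noteq> bp" by (rule AE_lborel_singleton)+
  then show "AE \<tau> in lborel. ennreal (norm (grad \<phi> (x, \<tau>)) powr p) * indicator {bm..bp} \<tau>
    = ennreal (norm (grad \<phi> (x, \<tau>)) powr p) * indicator {bm<..<bp} \<tau>" by eventually_elim (auto simp: indicator_def)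
 qed
 finally show ?thesis .
qed

lemma Lpow_cylinder:
 fixes F :: "'a::euclidean_space \<times> real => 'b::euclidean_space"
 assumes [measurable]: "F \<in> borel_measurable borel"
 shows "Lpow_on (ball 0 R \<times> {bm<..<bp}) p F
  = (\<integral>\<^sup>+x. (\<integral>\<^sup>+t. ennreal (norm (F (x, t)) powr p) * indicator {bm<..<bp} t \<partial>lborel) * indicator (ball 0 R) x \<partial>lborel)"
proof -
 have "Lpow_on (ball 0 R \<times> {bm<..<bp}) p F
  = (\<integral>\<^sup>+X. ennreal (norm (F X) powr p) * (indicator {bm<..<bp} (snd X) * indicator (ball 0 R) (fst X)) \<partial>lborel)"
  unfolding Lpow_lebesgue_on_lborel[OF cyl_lebesgue] by (intro nn_integral_cong) (auto simp: indicator_def)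
 also have "\<dots> = (\<integral>\<^sup>+x. \<integral>\<^sup>+t. ennreal (norm (F (x, t)) powr p) * (indicator {bm<..<bp} t * indicator (ball 0 R) x) \<partial>lborel \<partial>lborel)"
  by (subst lborel_prod[symmetric], subst lborel.nn_integral_fst[symmetric]) (auto simp: lborel_prod)
 also have "\<dots> = (\<integral>\<^sup>+x. (\<integral>\<^sup>+t. ennreal (norm (F (x, t)) powr p) * indicator {bm<..<bp} t \<partial>lborel) * indicator (ball 0 R) x \<partial>lborel)"
  by (intro nn_integral_cong) (simp add: mult.assoc[symmetric] nn_integral_multc)
 finally show ?thesis .
qed

lemma Lpow_ball:
 fixes f :: "'a::euclidean_space => 'b::euclidean_space"
 shows "Lpow_on (ball 0 R) p f = (\<integral>\<^sup>+x. ennreal (norm (f x) powr p) * indicator (ball 0 R) x \<partial>lborel)"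
 by (rule Lpow_lebesgue_on_lborel) simp

context
 fixes \<phi> :: "'a::euclidean_space \<times> real => real" and p bm bp R :: real
 assumes \<phi>: "Cinf \<phi>" and p: "p > 1" and b: "bm < bp"
begin

lemma Cinf_borel_measurable [measurable]: "\<phi> \<in> borel_measurable borel" "grad \<phi> \<in> borel_measurable borel"
 using borel_measurable_continuous_onI Cinf_continuous[OF \<phi>] continuous_grad[OF \<phi>] by auto

lemma slice_diff_le:
 assumes "s \<in> {bm..bp}" "t \<in> {bm..bp}"
 shows "Lpow_on (ball 0 R) p (%x. \<phi> (x, t) - \<phi> (x, s))
  \<le> ennreal ((bp - bm) powr (p - 1)) * Lpow_on (ball 0 R \<times> {bm<..<bp}) p (grad \<phi>)"
proof -
 have "Lpow_on (ball 0 R) p (%x. \<phi> (x, t) - \<phi> (x, s))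
  \<le> (\<integral>\<^sup>+x. ennreal ((bp - bm) powr (p - 1)) * ((\<integral>\<^sup>+\<tau>. ennreal (norm (grad \<phi> (x, \<tau>)) powr p) * indicator {bm<..<bp} \<tau> \<partial>lborel) * indicator (ball 0 R) x) \<partial>lborel)"
  unfolding Lpow_ball
 proof (rule nn_integral_mono)
  fix x
  show "ennreal (norm (\<phi> (x, t) - \<phi> (x, s)) powr p) * indicator (ball 0 R) x \<le>
   ennreal ((bp - bm) powr (p - 1)) * ((\<integral>\<^sup>+\<tau>. ennreal (norm (grad \<phi> (x, \<tau>)) powr p) * indicator {bm<..<bp} \<tau> \<partial>lborel) * indicator (ball 0 R) x)"
   using vertical_powr_le[OF \<phi> p b assms, of x] by (auto simp: indicator_def)
 qed
 also have "\<dots> = ennreal ((bp - bm) powr (p - 1)) * Lpow_on (ball 0 R \<times> {bm<..<bp}) p (grad \<phi>)"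
  unfolding Lpow_cylinder[OF Cinf_borel_measurable(2)] by (rule nn_integral_cmult) measurable
 finally show ?thesis .
qed

lemma slice_measurable [measurable]: "(%x. \<phi> (x, t)) \<in> borel_measurable borel" by measurable

text \<open>Integrating \<open>\<phi> (x, s) = \<phi> (x, t) + (\<phi> (x, s) - \<phi> (x, t))\<close> over \<open>x\<close> and one of the two heights gives both
 the Poincare inequality and the continuity of the trace.\<close>

lemma slice_le:
 assumes "s \<in> {bm..bp}" "t \<in> {bm..bp}"
 shows "Lpow_on (ball 0 R) p (%x. \<phi> (x, s)) \<le> ennreal (2 powr p) *
  (Lpow_on (ball 0 R) p (%x. \<phi> (x, t)) + ennreal ((bp - bm) powr (p - 1)) * Lpow_on (ball 0 R \<times> {bm<..<bp}) p (grad \<phi>))"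
proof -
 let ?M = "lebesgue_on (ball (0::'a) R)"
 have m: "(%x. \<phi> (x, t)) \<in> borel_measurable ?M" for t by (intro measurable_restrict_space1 measurable_completion) measurable
 have "Lpow ?M p (%x. \<phi> (x, t) + (\<phi> (x, s) - \<phi> (x, t))) \<le> ennreal (2 powr p) * (Lpow ?M p (%x. \<phi> (x, t)) + Lpow ?M p (%x. \<phi> (x, s) - \<phi> (x, t)))"
  using p m by (intro Lpow_add_le) auto
 also have "\<dots> \<le> ennreal (2 powr p) * (Lpow ?M p (%x. \<phi> (x, t)) + ennreal ((bp - bm) powr (p - 1)) * Lpow_on (ball 0 R \<times> {bm<..<bp}) p (grad \<phi>))"
  by (intro mult_left_mono add_left_mono slice_diff_le assms) auto
 finally show ?thesis by simp
qed

lemma Lpow_cylinder_slices: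
 "Lpow_on (ball 0 R \<times> {bm<..<bp}) p \<phi> = (\<integral>\<^sup>+t. Lpow_on (ball 0 R) p (%x. \<phi> (x, t)) * indicator {bm<..<bp} t \<partial>lborel)"
proof -
 have "Lpow_on (ball 0 R \<times> {bm<..<bp}) p \<phi>
  = (\<integral>\<^sup>+x. \<integral>\<^sup>+t. ennreal (norm (\<phi> (x, t)) powr p) * indicator (ball 0 R) x * indicator {bm<..<bp} t \<partial>lborel \<partial>lborel)"
  unfolding Lpow_cylinder[OF Cinf_borel_measurable(1)]
  by (intro nn_integral_cong, subst nn_integral_multc[symmetric], measurable) (intro nn_integral_cong, simp add: mult_ac)
 also have "\<dots> = (\<integral>\<^sup>+t. \<integral>\<^sup>+x. ennreal (norm (\<phi> (x, t)) powr p) * indicator (ball 0 R) x * indicator {bm<..<bp} t \<partial>lborel \<partial>lborel)"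
  by (rule lborel_pair.Fubini'[symmetric]) measurable
 also have "\<dots> = (\<integral>\<^sup>+t. Lpow_on (ball 0 R) p (%x. \<phi> (x, t)) * indicator {bm<..<bp} t \<partial>lborel)"
  unfolding Lpow_ball by (intro nn_integral_cong) (simp add: nn_integral_multc)
 finally show ?thesis .
qed

lemma poincare_smooth:
 assumes t: "t \<in> {bm..bp}"
 shows "Lpow_on (ball 0 R \<times> {bm<..<bp}) p \<phi> \<le> ennreal (bp - bm) * (ennreal (2 powr p) *
  (Lpow_on (ball 0 R) p (%x. \<phi> (x, t)) + ennreal ((bp - bm) powr (p - 1)) * Lpow_on (ball 0 R \<times> {bm<..<bp}) p (grad \<phi>)))"
proof -
 let ?C = "ennreal (2 powr p) * (Lpow_on (ball 0 R) p (%x. \<phi> (x, t)) + ennreal ((bp - bm) powr (p - 1)) * Lpow_on (ball 0 R \<times> {bm<..<bp}) p (grad \<phi>))"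
 have "Lpow_on (ball 0 R \<times> {bm<..<bp}) p \<phi> \<le> (\<integral>\<^sup>+s. ?C * indicator {bm<..<bp} s \<partial>lborel)"
  unfolding Lpow_cylinder_slices
 proof (rule nn_integral_mono)
  fix s
  show "Lpow_on (ball 0 R) p (%x. \<phi> (x, s)) * indicator {bm<..<bp} s \<le> ?C * indicator {bm<..<bp} s"
   using slice_le[OF _ t, of s] by (auto simp: indicator_def)
 qed
 also have "\<dots> = ?C * ennreal (bp - bm)" using b by (subst nn_integral_cmult) auto
 finally show ?thesis by (simp add: mult.commute)
qed

lemma trace_smooth:
 assumes s: "s \<in> {bm..bp}"
 shows "ennreal (bp - bm) * Lpow_on (ball 0 R) p (%x. \<phi> (x, s)) \<le> ennreal (2 powr p) *
  (Lpow_on (ball 0 R \<times> {bm<..<bp}) p \<phi> + ennreal (bp - bm) * (ennreal ((bp - bm) powr (p - 1)) * Lpow_on (ball 0 R \<times> {bm<..<bp}) p (grad \<phi>)))"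
proof -
 let ?A = "Lpow_on (ball 0 R) p (%x. \<phi> (x, s))"
 let ?G = "ennreal ((bp - bm) powr (p - 1)) * Lpow_on (ball 0 R \<times> {bm<..<bp}) p (grad \<phi>)"
 have [measurable]: "(%t. Lpow_on (ball 0 R) p (%x. \<phi> (x, t))) \<in> borel_measurable borel"
  unfolding Lpow_ball by measurable
 have "ennreal (bp - bm) * ?A = (\<integral>\<^sup>+t. ?A * indicator {bm<..<bp} t \<partial>lborel)"
  using b by (subst nn_integral_cmult) (auto simp: mult.commute)
 also have "\<dots> \<le> (\<integral>\<^sup>+t. ennreal (2 powr p) * (Lpow_on (ball 0 R) p (%x. \<phi> (x, t)) * indicator {bm<..<bp} t + ?G * indicator {bm<..<bp} t) \<partial>lborel)"
  by (intro nn_integral_mono) (auto simp: indicator_def intro!: slice_le s)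
 also have "\<dots> = ennreal (2 powr p) * (Lpow_on (ball 0 R \<times> {bm<..<bp}) p \<phi> + ?G * ennreal (bp - bm))"
  unfolding Lpow_cylinder_slices using b
  by (subst nn_integral_cmult, measurable, subst nn_integral_add, measurable) (subst nn_integral_cmult, auto)
 finally show ?thesis by (simp add: mult.commute)
qed

end

text \<open>The points \<open>(x, t\<^sub>0)\<close> and \<open>(x + h, t\<^sub>0)\<close> are joined by a tent with apex at height proportional to \<open>\<bar>h\<bar>\<close>.
 Weighting the two sides of the tent by a power of the distance to the boundary keeps all
 integrals finite.\<close>

lemma gagliardo_smooth:
 fixes a p bm bp t0 e :: real
 assumes p: "p > 1" and a: "a > 0" and b: "bm < bp" and e: "e\<^sup>2 = 1"
  and st: "\<And>s. 0 < s ==> s < bp - bm ==> bm < t0 + e * s \<and> t0 + e * s < bp"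
 obtains C :: real where "C \<ge> 0" "\<And>(\<phi> :: 'a::euclidean_space \<times> real => real) R. Cinf \<phi> ==>
  (\<integral>\<^sup>+x. (\<integral>\<^sup>+h. ennreal (\<bar>\<phi> (x + h, t0) - \<phi> (x, t0)\<bar> powr p / norm h powr (p + DIM('a) - 1)) * indicator (ball 0 a) h \<partial>lborel)
    * indicator (ball 0 (R - a)) x \<partial>lborel)
  \<le> ennreal C * Lpow_on (ball 0 R \<times> {bm<..<bp}) p (grad \<phi>)"
proof -
 let ?n = "DIM('a)"
 define L where "L = bp - bm"
 have L: "L > 0" using b by (simp add: L_def)
 \<comment> \<open>With this slope the apex lies at height \<open>\<kappa> * norm h / 2 < L\<close>,
   as \<open>norm h < a\<close>: the tent stays inside the strip.\<close>
 define \<kappa> where "\<kappa> = 2 * L / a"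
 have \<kappa>: "\<kappa> > 0" using L a by (simp add: \<kappa>_def)
 \<comment> \<open>The constant of \<open>line_powr_le\<close> for a path with parameter in
   \<open>{0..1/2}\<close>.\<close>
 define K where "K = (2 * sqrt (1/2)) powr (p - 1)"
 \<comment> \<open>The value of the integral of \<open>\<theta> powr ((p - 3) / 2)\<close> over
   \<open>{0..1/2}\<close>, finite as \<open>p > 1\<close>.\<close>
 define W where "W = (1/2) powr ((p - 1) / 2) / ((p - 1) / 2)"
 define \<omega> where "\<omega> = ?n * unit_ball_vol (real ?n)"
 \<comment> \<open>\<open>2 powr p\<close> splits the tent into its two sides, and
   \<open>(1 + \<kappa>) * norm h\<close> bounds the speed along each of them.\<close>
 define C1 where "C1 = 2 powr p * K * (1 + \<kappa>) powr p"
 define C where "C = 2 * C1 * \<omega> * W / \<kappa>"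
 have nn: "K \<ge> 0" "W \<ge> 0" "\<omega> \<ge> 0" "C1 \<ge> 0" using p by (auto simp: K_def W_def \<omega>_def C1_def)
 have C0: "C \<ge> 0" using nn \<kappa> by (simp add: C_def)
 show ?thesis
 proof (rule that[OF C0])
  fix \<phi> :: "'a \<times> real => real" and R :: real
  assume \<phi>: "Cinf \<phi>"
  let ?D = "%x h. ennreal (\<bar>\<phi> (x + h, t0) - \<phi> (x, t0)\<bar> powr p / norm h powr (p + ?n - 1))"
  let ?E = "Lpow_on (ball 0 R \<times> {bm<..<bp}) p (grad \<phi>)"
  let ?k = "%h :: 'a. ennreal (norm h powr (1 - real ?n))" and ?B = "indicator (ball (0::'a) a) :: 'a => ennreal"
  let ?e = "%\<theta>. ennreal (\<theta> powr ((p - 1) / 2))" and ?i = "indicator {0..1/2} :: real => ennreal"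
  note [measurable] = Cinf_borel_measurable[OF \<phi> p b]
  let ?Q = "ball 0 R \<times> {bm<..<bp} :: ('a \<times> real) set"
  have [measurable]: "?Q \<in> sets borel" by (intro borel_open open_Times) auto
  \<comment> \<open>Extended by 0 outside the cylinder, the power of the gradient can be translated
    freely in the horizontal variable.\<close>
  define g where "g X = ennreal (norm (grad \<phi> X) powr p) * indicator ?Q X" for X
  have [measurable]: "g \<in> borel_measurable borel" unfolding g_def by measurable
  define M where "M s = (\<integral>\<^sup>+x. g (x, t0 + e * s) \<partial>lborel)" for s
  have [measurable]: "M \<in> borel_measurable borel" unfolding M_def by measurable
  \<comment> \<open>The side starting at \<open>x\<close> has horizontal position
    \<open>\<theta>\<close> along \<open>h\<close>, the side starting at \<open>x + h\<close> has
    position \<open>1 - \<theta>\<close>; they meet at \<open>\<theta> = 1/2\<close>.\<close>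
  define c where "c i \<theta> = (if i then \<theta> else 1 - \<theta>)" for i and \<theta> :: real
  have [measurable]: "c i \<in> borel_measurable borel" for i unfolding c_def by measurable
  define \<Psi> where "\<Psi> i x h \<theta> = g (x + c i \<theta> *\<^sub>R h, t0 + e * (\<kappa> * norm h * \<theta>)) * ?e \<theta> * ?i \<theta>"
   for i x h \<theta>
  have \<Psi>m [measurable]: "(%(x, h, \<theta>). \<Psi> i x h \<theta>) \<in> borel_measurable (borel \<Otimes>\<^sub>M borel \<Otimes>\<^sub>M borel)" for i
   unfolding \<Psi>_def by measurable
  let ?T = "%i x h. \<integral>\<^sup>+\<theta>. \<Psi> i x h \<theta> \<partial>lborel"
  let ?I = "%i. \<integral>\<^sup>+x. \<integral>\<^sup>+h. ?k h * ?T i x h * ?B h \<partial>lborel \<partial>lborel"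
  let ?M = "%r. \<integral>\<^sup>+\<theta>. M (\<kappa> * r * \<theta>) * ?e \<theta> * ?i \<theta> \<partial>lborel"
  have pw: "?D x h
   \<le> ennreal C1 * (?k h * ((\<integral>\<^sup>+\<theta>. \<Psi> True x h \<theta> \<partial>lborel) + (\<integral>\<^sup>+\<theta>. \<Psi> False x h \<theta> \<partial>lborel)))"
   if x: "x \<in> ball 0 (R - a)" and h: "h \<in> ball 0 a" for x h
  proof (cases "h = 0")
   case False
   have nx: "norm x + norm h < R" "norm h < a" using x h by auto
   define m where "m = (x + (1/2) *\<^sub>R h, t0 + e * (\<kappa> * norm h / 2))"
   have half: "ennreal (\<bar>\<phi> m - \<phi> (y, t0)\<bar> powr p) \<le> ennreal (K * ((1 + \<kappa>) * norm h) powr p) * (\<integral>\<^sup>+\<theta>. \<Psi> i x h \<theta> \<partial>lborel)"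
    if y: "y = x \<and> v = h \<and> i \<or> y = x + h \<and> v = - h \<and> \<not> i" for y v i
   proof -
    define V where "V = (v, e * (\<kappa> * norm h))"
    have pt: "(y, t0) + \<theta> *\<^sub>R V = (x + c i \<theta> *\<^sub>R h, t0 + e * (\<kappa> * norm h * \<theta>))" for \<theta>
     using y by (auto simp: V_def c_def algebra_simps)
    have mm: "m = (y, t0) + (1/2) *\<^sub>R V" unfolding pt using y by (auto simp: m_def c_def)
    have e1: "\<bar>e\<bar> = 1" using e by (auto simp: power2_eq_1_iff)
    have "norm V \<le> norm v + \<bar>e * (\<kappa> * norm h)\<bar>" unfolding V_def using norm_Pair_le[of v "e * (\<kappa> * norm h)"] by simp
    also have "\<dots> = (1 + \<kappa>) * norm h" using y \<kappa> e1 by (auto simp: abs_mult algebra_simps)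
    finally have V: "norm V \<le> (1 + \<kappa>) * norm h" .
    let ?u = "%\<theta>. norm (grad \<phi> ((y, t0) + \<theta> *\<^sub>R V)) * ((1 + \<kappa>) * norm h)"
    have cg: "continuous_on UNIV (%\<theta>. grad \<phi> ((y, t0) + \<theta> *\<^sub>R V))"
     by (rule continuous_on_compose2[OF continuous_grad[OF \<phi>]]) (auto intro!: continuous_intros)
    have "ennreal (\<bar>\<phi> ((y, t0) + (1/2) *\<^sub>R V) - \<phi> ((y, t0) + 0 *\<^sub>R V)\<bar> powr p) \<le> ennreal K *
     (\<integral>\<^sup>+\<theta>. ennreal (?u \<theta> powr p * \<theta> powr ((p - 1) / 2)) * ?i \<theta> \<partial>lborel)" unfolding K_def
    proof (rule line_powr_le[OF p Cinf_line_derivative[OF \<phi>]])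
     show "continuous_on UNIV (%\<theta>. grad \<phi> ((y, t0) + \<theta> *\<^sub>R V) \<bullet> V)" "continuous_on UNIV ?u"
      using cg by (auto intro!: continuous_intros)
     show "\<bar>grad \<phi> ((y, t0) + \<theta> *\<^sub>R V) \<bullet> V\<bar> \<le> ?u \<theta>" for \<theta>
      by (rule order_trans[OF Cauchy_Schwarz_ineq2 mult_left_mono[OF V]]) simp
    qed simp
    also have "(\<integral>\<^sup>+\<theta>. ennreal (?u \<theta> powr p * \<theta> powr ((p - 1) / 2)) * ?i \<theta> \<partial>lborel)
     \<le> (\<integral>\<^sup>+\<theta>. ennreal (((1 + \<kappa>) * norm h) powr p) * \<Psi> i x h \<theta> \<partial>lborel)"
    proof (rule nn_integral_mono)
     fix \<theta> :: real
     show "ennreal (?u \<theta> powr p * \<theta> powr ((p - 1) / 2)) * ?i \<theta> \<le> ennreal (((1 + \<kappa>) * norm h) powr p) * \<Psi> i x h \<theta>"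
     proof (cases "0 < \<theta> \<and> \<theta> \<le> 1/2")
      case True
      have c1: "0 \<le> c i \<theta>" "c i \<theta> \<le> 1" using True by (auto simp: c_def)
      have "norm (x + c i \<theta> *\<^sub>R h) \<le> norm x + norm (c i \<theta> *\<^sub>R h)" by (rule norm_triangle_ineq)
      also have "\<dots> \<le> norm x + norm h" using c1 by (simp add: mult_left_le_one_le)
      finally have "norm (x + c i \<theta> *\<^sub>R h) < R" using nx by simp
      moreover have "bm < t0 + e * (\<kappa> * norm h * \<theta>) \<and> t0 + e * (\<kappa> * norm h * \<theta>) < bp"
      proof (rule st)
       show "0 < \<kappa> * norm h * \<theta>" using \<kappa> False True by simp
       have "\<kappa> * norm h * \<theta> \<le> \<kappa> * norm h * (1/2)" using True \<kappa> by (intro mult_left_mono) auto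
       also have "\<dots> < \<kappa> * a * (1/2)" using nx(2) \<kappa> by simp
       also have "\<dots> = bp - bm" using a by (simp add: \<kappa>_def L_def)
       finally show "\<kappa> * norm h * \<theta> < bp - bm" .
      qed
      ultimately have "(x + c i \<theta> *\<^sub>R h, t0 + e * (\<kappa> * norm h * \<theta>)) \<in> ?Q" by simp
      then show ?thesis using True unfolding \<Psi>_def g_def pt by (simp add: powr_mult ennreal_mult mult_ac)
     next
      case F: False
      then show ?thesis using p by (cases "\<theta> = 0") (auto simp: indicator_def)
     qed
    qed
    also have "\<dots> = ennreal (((1 + \<kappa>) * norm h) powr p) * (\<integral>\<^sup>+\<theta>. \<Psi> i x h \<theta> \<partial>lborel)"
     by (rule nn_integral_cmult) (unfold \<Psi>_def, measurable)
    finally show ?thesis using nn by (simp add: mm ennreal_mult mult.assoc mult_left_mono)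
   qed
   have "\<bar>\<phi> (x + h, t0) - \<phi> (x, t0)\<bar> powr p = norm ((\<phi> m - \<phi> (x, t0)) - (\<phi> m - \<phi> (x + h, t0))) powr p" by simp
   also have "\<dots> \<le> 2 powr p * (norm (\<phi> m - \<phi> (x, t0)) powr p + norm (\<phi> m - \<phi> (x + h, t0)) powr p)"
    by (rule powr_diff_le) (use p in simp)
   finally have "ennreal (\<bar>\<phi> (x + h, t0) - \<phi> (x, t0)\<bar> powr p) \<le> ennreal (2 powr p) * (ennreal (\<bar>\<phi> m - \<phi> (x, t0)\<bar> powr p) + ennreal (\<bar>\<phi> m - \<phi> (x + h, t0)\<bar> powr p))"
    by (simp add: ennreal_mult[symmetric] ennreal_plus[symmetric] ennreal_leI del: ennreal_plus)
   also have "\<dots> \<le> ennreal (2 powr p) * (ennreal (K * ((1 + \<kappa>) * norm h) powr p) * (\<integral>\<^sup>+\<theta>. \<Psi> True x h \<theta> \<partial>lborel)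
     + ennreal (K * ((1 + \<kappa>) * norm h) powr p) * (\<integral>\<^sup>+\<theta>. \<Psi> False x h \<theta> \<partial>lborel))"
    by (intro mult_left_mono add_mono half[of x h True] half[of "x + h" "- h" False]) auto
   also have "\<dots> = ennreal (2 powr p * (K * ((1 + \<kappa>) * norm h) powr p)) * ((\<integral>\<^sup>+\<theta>. \<Psi> True x h \<theta> \<partial>lborel) + (\<integral>\<^sup>+\<theta>. \<Psi> False x h \<theta> \<partial>lborel))"
    using nn by (simp add: ennreal_mult distrib_left mult.assoc)
   also have "2 powr p * (K * ((1 + \<kappa>) * norm h) powr p) = C1 * norm h powr p" by (simp add: C1_def powr_mult)
   finally have le: "ennreal (\<bar>\<phi> (x + h, t0) - \<phi> (x, t0)\<bar> powr p) \<le> ennreal (C1 * norm h powr p) * ((\<integral>\<^sup>+\<theta>. \<Psi> True x h \<theta> \<partial>lborel) + (\<integral>\<^sup>+\<theta>. \<Psi> False x h \<theta> \<partial>lborel))" .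
   have "?D x h
    = ennreal (norm h powr (- (p + ?n - 1))) * ennreal (\<bar>\<phi> (x + h, t0) - \<phi> (x, t0)\<bar> powr p)"
   proof -
    have "X / N powr m = N powr (- m) * X" for X N m :: real by (simp add: powr_minus_divide)
    then show ?thesis by (subst ennreal_mult[symmetric]) (simp_all only: powr_ge_zero)
   qed
   also have "\<dots> \<le> ennreal (norm h powr (- (p + ?n - 1))) * (ennreal (C1 * norm h powr p) * ((\<integral>\<^sup>+\<theta>. \<Psi> True x h \<theta> \<partial>lborel) + (\<integral>\<^sup>+\<theta>. \<Psi> False x h \<theta> \<partial>lborel)))"
    by (intro mult_left_mono le) auto
   also have "\<dots> = ennreal (C1 * (norm h powr (- (p + ?n - 1)) * norm h powr p)) * ((\<integral>\<^sup>+\<theta>. \<Psi> True x h \<theta> \<partial>lborel) + (\<integral>\<^sup>+\<theta>. \<Psi> False x h \<theta> \<partial>lborel))"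
    using nn by (simp add: ennreal_mult mult_ac)
   \<comment> \<open>The length of the path contributes \<open>norm h powr p\<close>; what remains
     of the Gagliardo weight is the kernel removed by polar coordinates.\<close>
   also have "norm h powr (- (p + ?n - 1)) * norm h powr p = norm h powr (1 - real ?n)" by (simp add: powr_add[symmetric])
   finally show ?thesis using nn by (simp add: ennreal_mult mult.assoc)
  qed simp
  have int: "(\<integral>\<^sup>+x. \<integral>\<^sup>+h. ?k h * (\<integral>\<^sup>+\<theta>. \<Psi> i x h \<theta> \<partial>lborel) * ?B h \<partial>lborel \<partial>lborel)
   \<le> ennreal (\<omega> * W / \<kappa>) * ?E" for i
  proof -
   have "(\<integral>\<^sup>+x. \<integral>\<^sup>+h. ?k h * (\<integral>\<^sup>+\<theta>. \<Psi> i x h \<theta> \<partial>lborel) * ?B h \<partial>lborel \<partial>lborel)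
    = (\<integral>\<^sup>+h. \<integral>\<^sup>+x. ?k h * (\<integral>\<^sup>+\<theta>. \<Psi> i x h \<theta> \<partial>lborel) * ?B h \<partial>lborel \<partial>lborel)"
    by (rule lborel_pair.Fubini'[symmetric]) (unfold \<Psi>_def, measurable)
   also have "\<dots> = (\<integral>\<^sup>+h. ?k h * ?B h * (\<integral>\<^sup>+x. ?T i x h \<partial>lborel) \<partial>lborel)"
   proof (rule nn_integral_cong)
    fix h :: 'a
    have "(\<integral>\<^sup>+x. (?k h * ?B h) * (\<integral>\<^sup>+\<theta>. \<Psi> i x h \<theta> \<partial>lborel) \<partial>lborel)
     = (?k h * ?B h) * (\<integral>\<^sup>+x. ?T i x h \<partial>lborel)"
     by (rule nn_integral_cmult) (unfold \<Psi>_def, measurable)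
    then show "(\<integral>\<^sup>+x. ?k h * (\<integral>\<^sup>+\<theta>. \<Psi> i x h \<theta> \<partial>lborel) * ?B h \<partial>lborel)
     = ?k h * ?B h * (\<integral>\<^sup>+x. ?T i x h \<partial>lborel)"
     by (simp only: mult.assoc mult.commute[of _ "?B h"])
   qed
   also have "\<dots> = (\<integral>\<^sup>+(h::'a). ?k h * ?B h *
     ?M (norm h) \<partial>lborel)"
   proof (rule nn_integral_cong)
    fix h :: 'a
    have "(\<integral>\<^sup>+x. ?T i x h \<partial>lborel) = (\<integral>\<^sup>+\<theta>. \<integral>\<^sup>+x. \<Psi> i x h \<theta> \<partial>lborel \<partial>lborel)"
     by (rule lborel_pair.Fubini'[symmetric]) (unfold \<Psi>_def, measurable)
    also have "\<dots> = ?M (norm h)"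
    proof (rule nn_integral_cong)
     fix \<theta> :: real
     \<comment> \<open>Integration over all \<open>x\<close> absorbs the horizontal displacement, so
       the result depends on \<open>h\<close> through its norm only.\<close>
     have "(\<integral>\<^sup>+x. g (c i \<theta> *\<^sub>R h + x, t0 + e * (\<kappa> * norm h * \<theta>)) \<partial>lborel) = M (\<kappa> * norm h * \<theta>)"
      unfolding M_def by (rule nn_integral_lborel_translate[where f = "%x. g (x, t0 + e * (\<kappa> * norm h * \<theta>))"]) measurable
     then show "(\<integral>\<^sup>+x. \<Psi> i x h \<theta> \<partial>lborel) = M (\<kappa> * norm h * \<theta>) * ?e \<theta> * ?i \<theta>"
      unfolding \<Psi>_def by (subst nn_integral_multc, measurable, subst nn_integral_multc, measurable) (simp add: add.commute)
    qed
    finally show "?k h * ?B h * (\<integral>\<^sup>+x. ?T i x h \<partial>lborel)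
     = ?k h * ?B h *
     ?M (norm h)" by (simp only:)
   qed
   also have "\<dots> = ennreal \<omega> * (\<integral>\<^sup>+r. ?M r * indicator {0<..<a} r \<partial>lborel)"
    unfolding \<omega>_def by (subst nn_integral_radial[symmetric]) (measurable, simp add: mult_ac)
   finally have eq: "(\<integral>\<^sup>+x. \<integral>\<^sup>+h. ?k h * (\<integral>\<^sup>+\<theta>. \<Psi> i x h \<theta> \<partial>lborel) * ?B h \<partial>lborel \<partial>lborel)
    = ennreal \<omega> * (\<integral>\<^sup>+r. ?M r * indicator {0<..<a} r \<partial>lborel)" .
   have "(\<integral>\<^sup>+r. ?M r * indicator {0<..<a} r \<partial>lborel)
    = (\<integral>\<^sup>+r. \<integral>\<^sup>+\<theta>. M (\<kappa> * r * \<theta>) * ?e \<theta> * ?i \<theta> * indicator {0<..<a} r \<partial>lborel \<partial>lborel)"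
    by (intro nn_integral_cong nn_integral_multc[symmetric]) measurable
   also have "\<dots> = (\<integral>\<^sup>+\<theta>. \<integral>\<^sup>+r. M (\<kappa> * r * \<theta>) * ?e \<theta> * ?i \<theta> * indicator {0<..<a} r \<partial>lborel \<partial>lborel)"
    by (rule lborel_pair.Fubini'[symmetric]) measurable
   also have "\<dots> \<le> (\<integral>\<^sup>+\<theta>. (ennreal (1 / \<kappa>) * ?E) * (ennreal (\<theta> powr ((p - 3) / 2)) * ?i \<theta>) \<partial>lborel)"
   proof (rule nn_integral_mono)
    fix \<theta> :: real
    show "(\<integral>\<^sup>+r. M (\<kappa> * r * \<theta>) * ?e \<theta> * ?i \<theta> * indicator {0<..<a} r \<partial>lborel)
     \<le> (ennreal (1 / \<kappa>) * ?E) * (ennreal (\<theta> powr ((p - 3) / 2)) * ?i \<theta>)"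
    proof (cases "0 < \<theta> \<and> \<theta> \<le> 1/2")
     case True
     \<comment> \<open>Substituting \<open>s\<close> for \<open>k * r\<close> costs
       \<open>1 / k\<close>, that is a factor \<open>1 / \<theta>\<close> up to a constant, which
       lowers the exponent \<open>(p - 1) / 2\<close> to \<open>(p - 3) / 2 > -1\<close>.\<close>
     define k where "k = \<kappa> * \<theta>"
     let ?r = "\<integral>\<^sup>+r. M (k * r) * indicator {0<..<a} r \<partial>lborel" and ?s = "%l. \<integral>\<^sup>+s. M s * indicator {0<..<l} s \<partial>lborel"
     have k: "k > 0" using True \<kappa> by (simp add: k_def)
     have ka: "k * a \<le> L" using True a L by (simp add: k_def \<kappa>_def field_simps)
     have "(\<integral>\<^sup>+s. M s * indicator {0<..<L} s \<partial>lborel) \<le> ?E"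
     proof -
      have "(\<integral>\<^sup>+s. M s * indicator {0<..<L} s \<partial>lborel) \<le> (\<integral>\<^sup>+s. M s \<partial>lborel)"
       by (intro nn_integral_mono) (auto simp: indicator_def)
      also have "\<dots> = (\<integral>\<^sup>+t. \<integral>\<^sup>+x. g (x, t) \<partial>lborel \<partial>lborel)"
       using nn_integral_real_affine[of "%t. \<integral>\<^sup>+x. g (x, t) \<partial>lborel" e t0] e unfolding M_def
       by (auto simp: power2_eq_1_iff)
      also have "\<dots> = (\<integral>\<^sup>+X. g X \<partial>lborel)" by (subst lborel_pair.nn_integral_snd) (auto simp: lborel_prod)
      also have "\<dots> = ?E" unfolding g_def Lpow_lebesgue_on_lborel[OF cyl_lebesgue] ..
      finally show ?thesis .
     qed
     moreover have "?r \<le> ennreal (1 / k) * (\<integral>\<^sup>+s. M s * indicator {0<..<L} s \<partial>lborel)"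
     proof -
      have "(\<integral>\<^sup>+s. M s * indicator {0<..<k * a} s \<partial>lborel) = ennreal k * (\<integral>\<^sup>+r. M (k * r) * indicator {0<..<k * a} (k * r) \<partial>lborel)"
       using nn_integral_real_affine[of "%s. M s * indicator {0<..<k * a} s" k 0] k by simp
      also have "(\<integral>\<^sup>+r. M (k * r) * indicator {0<..<k * a} (k * r) \<partial>lborel) = ?r"
       using k by (intro nn_integral_cong) (auto simp: indicator_def zero_less_mult_iff)
      finally have "ennreal (1 / k) * (\<integral>\<^sup>+s. M s * indicator {0<..<k * a} s \<partial>lborel)
        = (ennreal (1 / k) * ennreal k) * ?r" by (simp add: mult.assoc)
      also have "ennreal (1 / k) * ennreal k = 1" using k by (simp add: ennreal_mult[symmetric])
      finally have "?r = ennreal (1 / k) * (\<integral>\<^sup>+s. M s * indicator {0<..<k * a} s \<partial>lborel)" by simp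
      also have "\<dots> \<le> ennreal (1 / k) * (\<integral>\<^sup>+s. M s * indicator {0<..<L} s \<partial>lborel)"
       using ka by (intro mult_left_mono nn_integral_mono) (auto simp: indicator_def)
      finally show ?thesis .
     qed
     ultimately have le: "?r \<le> ennreal (1 / k) * ?E"
      by (meson order_trans mult_left_mono zero_le)
     have "(\<integral>\<^sup>+r. M (\<kappa> * r * \<theta>) * ?e \<theta> * ?i \<theta> * indicator {0<..<a} r \<partial>lborel)
      = (\<integral>\<^sup>+r. ?e \<theta> * (M (k * r) * indicator {0<..<a} r) \<partial>lborel)"
      using True by (intro nn_integral_cong) (simp add: k_def mult_ac)
     also have "\<dots> = ?e \<theta> * ?r"
      by (rule nn_integral_cmult) measurable
     also have "\<dots> \<le> ?e \<theta> * (ennreal (1 / k) * ?E)"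
      by (intro mult_left_mono le) auto
     also have "\<dots> = ennreal (\<theta> powr ((p - 1) / 2) * (1 / k)) * ?E"
     proof -
      have "ennreal (\<theta> powr ((p - 1) / 2) * (1 / k)) = ?e \<theta> * ennreal (1 / k)"
       by (rule ennreal_mult) (use k in auto)
      then show ?thesis by (simp only: mult.assoc)
     qed
     also have "\<theta> powr ((p - 1) / 2) * (1 / k) = (1 / \<kappa>) * \<theta> powr ((p - 3) / 2)"
     proof -
      have eq: "(p - 3) / 2 = (p - 1) / 2 - 1" by (simp add: field_simps)
      show ?thesis unfolding eq powr_diff using True by (simp add: k_def)
     qed
     also have "ennreal \<dots> = ennreal (1 / \<kappa>) * ennreal (\<theta> powr ((p - 3) / 2))" by (rule ennreal_mult) (use \<kappa> in auto)
     finally show ?thesis using True by (simp add: mult_ac)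
    next
     case False
     then show ?thesis using p by (cases "\<theta> = 0") (auto simp: indicator_def)
    qed
   qed
   also have "\<dots> = (ennreal (1 / \<kappa>) * ?E) * ennreal W"
   proof -
    have w: "(p - 3) / 2 + 1 = (p - 1) / 2" by (simp add: field_simps)
    have "(\<integral>\<^sup>+\<theta>. ennreal (\<theta> powr ((p - 3) / 2)) * ?i \<theta> \<partial>lborel) = ennreal W"
     unfolding W_def w[symmetric] by (rule powr_integral_from_0(1)) (use p in auto)
    then show ?thesis by (subst nn_integral_cmult) auto
   qed
   finally have "(\<integral>\<^sup>+x. \<integral>\<^sup>+h. ?k h * (\<integral>\<^sup>+\<theta>. \<Psi> i x h \<theta> \<partial>lborel) * ?B h \<partial>lborel \<partial>lborel)
    \<le> ennreal \<omega> * (ennreal (1 / \<kappa>) * ?E * ennreal W)" unfolding eq by (rule mult_left_mono) simp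
   also have "\<dots> = ennreal (\<omega> * W / \<kappa>) * ?E"
   proof -
    have "ennreal (\<omega> * W / \<kappa>) = ennreal \<omega> * ennreal W * ennreal (1 / \<kappa>)" using nn \<kappa> by (simp add: ennreal_mult[symmetric])
    then show ?thesis by (simp only: mult_ac)
   qed
   finally show ?thesis .
  qed
  have "(\<integral>\<^sup>+x. (\<integral>\<^sup>+h. ?D x h * ?B h \<partial>lborel)
    * indicator (ball 0 (R - a)) x \<partial>lborel)
   \<le> (\<integral>\<^sup>+x. (\<integral>\<^sup>+h. ennreal C1 * (?k h * (\<integral>\<^sup>+\<theta>. \<Psi> True x h \<theta> \<partial>lborel) * ?B h
      + ?k h * (\<integral>\<^sup>+\<theta>. \<Psi> False x h \<theta> \<partial>lborel) * ?B h) \<partial>lborel) \<partial>lborel)"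
  proof (rule nn_integral_mono)
   fix x
   show "(\<integral>\<^sup>+h. ?D x h * ?B h \<partial>lborel) * indicator (ball 0 (R - a)) x
    \<le> (\<integral>\<^sup>+h. ennreal C1 * (?k h * (\<integral>\<^sup>+\<theta>. \<Psi> True x h \<theta> \<partial>lborel) * ?B h
      + ?k h * (\<integral>\<^sup>+\<theta>. \<Psi> False x h \<theta> \<partial>lborel) * ?B h) \<partial>lborel)"
   proof (cases "x \<in> ball 0 (R - a)")
    case True
    show ?thesis using True
    proof (simp del: mem_ball, intro nn_integral_mono)
     fix h :: 'a
     show "?D x h * ?B h
      \<le> ennreal C1 * (?k h * (\<integral>\<^sup>+\<theta>. \<Psi> True x h \<theta> \<partial>lborel) * ?B h
      + ?k h * (\<integral>\<^sup>+\<theta>. \<Psi> False x h \<theta> \<partial>lborel) * ?B h)"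
      using pw[OF True, of h] by (cases "h \<in> ball 0 a") (simp_all add: distrib_left del: mem_ball)
    qed
   qed simp
  qed
  also have "\<dots> = ennreal C1 * ((\<integral>\<^sup>+x. \<integral>\<^sup>+h. ?k h * (\<integral>\<^sup>+\<theta>. \<Psi> True x h \<theta> \<partial>lborel) * ?B h \<partial>lborel \<partial>lborel)
    + (\<integral>\<^sup>+x. \<integral>\<^sup>+h. ?k h * (\<integral>\<^sup>+\<theta>. \<Psi> False x h \<theta> \<partial>lborel) * ?B h \<partial>lborel \<partial>lborel))"
   unfolding \<Psi>_def
   by (subst nn_integral_cmult, measurable, subst nn_integral_cmult, measurable, subst nn_integral_add, measurable, subst nn_integral_add, measurable)
  also have "\<dots> \<le> ennreal C1 * (ennreal (\<omega> * W / \<kappa>) * ?E + ennreal (\<omega> * W / \<kappa>) * ?E)"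
   by (intro mult_left_mono add_mono int) auto
  also have "\<dots> = ennreal C * ?E"
  proof -
   have "ennreal C = ennreal C1 * (ennreal (\<omega> * W / \<kappa>) + ennreal (\<omega> * W / \<kappa>))"
    using nn \<kappa> unfolding C_def by (simp add: ennreal_mult[symmetric] ennreal_plus[symmetric] del: ennreal_plus)
   then show ?thesis by (simp add: distrib_right mult.assoc)
  qed
  finally show "(\<integral>\<^sup>+x. (\<integral>\<^sup>+h. ?D x h * ?B h \<partial>lborel)
    * indicator (ball 0 (R - a)) x \<partial>lborel) \<le> ennreal C * ?E" .
 qed
qed

subsection \<open>Homogeneous Sobolev functions\<close>

text \<open>\<open>L1loc_on\<close> gives measurability on compact sets only; on \<open>S\<close> it
  is glued from the pieces of a countable cover by boxes.\<close>

lemma L1loc_measurable: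
 fixes w :: "'a::euclidean_space => real"
 assumes S: "open S" and w: "L1loc_on S w"
 shows "w \<in> borel_measurable (lebesgue_on S)"
proof -
 obtain \<D> where \<D>: "countable \<D>" "\<And>X. X \<in> \<D> ==> X \<subseteq> S" "\<And>X. X \<in> \<D> ==> \<exists>a b. X = cbox a b" "\<Union>\<D> = S"
  by (rule open_countable_Union_open_cbox[OF S]) blast
 show ?thesis
 proof (rule measurable_piecewise_restrict[OF \<D>(1)])
  show "X \<inter> space (lebesgue_on S) \<in> sets (lebesgue_on S)" if X: "X \<in> \<D>" for X
  proof -
   have "X \<subseteq> S" "X \<in> sets lebesgue" using \<D>(2,3)[OF X] by auto
   then show ?thesis by (auto simp: sets_restrict_space)
  qed
  show "space (lebesgue_on S) \<subseteq> \<Union>\<D>" using \<D>(4) by simp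
  show "w \<in> borel_measurable (restrict_space (lebesgue_on S) X)" if X: "X \<in> \<D>" for X
  proof -
   have XS: "X \<subseteq> S" "X \<in> sets lebesgue" "compact X" using \<D>(2,3)[OF X] by auto
   then have "integrable lebesgue (%x. indicator X x *\<^sub>R w x)" using w by (simp add: L1loc_on_def set_integrable_def)
   then have "w \<in> borel_measurable (lebesgue_on X)"
    using XS by (subst borel_measurable_restrict_space_iff) (auto dest: borel_measurable_integrable)
   moreover have "restrict_space (lebesgue_on S) X = lebesgue_on X"
    using XS S by (subst restrict_restrict_space) (auto intro: arg_cong2[where f = restrict_space])
   ultimately show ?thesis by simp
  qed
 qed
qed

text \<open>Pointwise \<open>\<bar>t\<bar> \<le> 1 + \<bar>t\<bar> powr p\<close>, and compact sets
  have finite measure.\<close>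

lemma Lpow_imp_L1loc:
 fixes w :: "'a::euclidean_space => real"
 assumes p: "p > 1" and S: "S \<in> sets lebesgue" and m: "w \<in> borel_measurable (lebesgue_on S)"
  and fin: "\<And>K. compact K ==> K \<subseteq> S ==> Lpow_on K p w < \<infinity>"
 shows "L1loc_on S w" unfolding L1loc_on_def
proof (intro allI impI, elim conjE)
 fix K assume K: "compact K" "K \<subseteq> S"
 have Km: "K \<in> sets lebesgue" by (intro sets_completionI_sets) (simp add: borel_closed[OF compact_imp_closed[OF K(1)]])
 have mK: "w \<in> borel_measurable (lebesgue_on K)" using measurable_lebesgue_on_subset[OF m K(2) S] .
 have "integrable (lebesgue_on K) (%x. 1 + norm (w x) powr p)"
 proof (intro Bochner_Integration.integrable_add Lpow_fin_integrable[OF mK fin[OF K]])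
  have "emeasure lebesgue K < \<infinity>" using lmeasurable_compact[OF K(1)] by (simp add: fmeasurable_def del: emeasure_completion)
  then show "integrable (lebesgue_on K) (%x. 1 :: real)"
   using Km by (intro finite_measure.integrable_const finite_measureI) (simp add: emeasure_restrict_space space_restrict_space less_top del: emeasure_completion)
 qed
 then have "integrable (lebesgue_on K) w"
 proof (rule Bochner_Integration.integrable_bound[OF _ mK])
  have "\<bar>w x\<bar> \<le> 1 + \<bar>w x\<bar> powr p" for x
  proof (cases "\<bar>w x\<bar> \<le> 1")
   case True
   moreover have "\<bar>w x\<bar> powr p \<ge> 0" by simp
   ultimately show ?thesis by linarith
  next
   case False
   then have "\<bar>w x\<bar> powr 1 \<le> \<bar>w x\<bar> powr p" using p by (intro powr_mono) auto
   then show ?thesis using False by simp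
  qed
  then show "AE x in lebesgue_on K. norm (w x) \<le> norm (1 + norm (w x) powr p)" by (intro AE_I2) (simp add: abs_of_nonneg)
 qed
 then show "w absolutely_integrable_on K" using Km by (simp add: set_integrable_def integrable_restrict_space)
qed

lemma weak_partial_eq:
 assumes "open S" "has_weak_partial S i u w"
 shows "has_weak_partial S i u (weak_partial S i u)" "AE x in lebesgue. x \<in> S \<longrightarrow> weak_partial S i u x = w x"
proof -
 show 1: "has_weak_partial S i u (weak_partial S i u)"
  unfolding weak_partial_def using assms(2) by (rule someI[of "has_weak_partial S i u"])
 show "AE x in lebesgue. x \<in> S \<longrightarrow> weak_partial S i u x = w x" by (rule has_weak_partial_unique[OF assms(1) 1 assms(2)])
qed

text \<open>\<open>weak_partial\<close> is a choice of representative, so its values are accessible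
  only through uniqueness almost everywhere; this rule computes weak gradients from any
  candidate.\<close>

lemma weak_grad_eq:
 fixes W :: "'a::euclidean_space => 'a"
 assumes S: "open S" and W: "\<And>i. i \<in> Basis ==> has_weak_partial S i u (%x. W x \<bullet> i)"
 shows "AE x in lebesgue_on S. weak_grad S u x = W x"
proof -
 have "AE x in lebesgue. \<forall>i\<in>Basis. x \<in> S \<longrightarrow> weak_partial S i u x = W x \<bullet> i"
  by (subst AE_finite_all[OF finite_Basis]) (blast intro: weak_partial_eq(2)[OF S W])
 then have "AE x in lebesgue. x \<in> S \<longrightarrow> weak_grad S u x = W x"
  by eventually_elim (simp add: weak_grad_def euclidean_representation)
 then show ?thesis using S by (simp add: AE_restrict_space_iff)
qed

lemma hom_sobolevD:
 fixes u :: "'a::euclidean_space => real"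
 assumes S: "open S" and p: "p > 1" and u: "u \<in> hom_sobolev p S"
 shows "i \<in> Basis ==> has_weak_partial S i u (%x. weak_grad S u x \<bullet> i)"
  and "u \<in> borel_measurable (lebesgue_on S)" and "weak_grad S u \<in> borel_measurable (lebesgue_on S)"
  and "Lpow_on S p (weak_grad S u) < \<infinity>"
proof -
 have Sm: "S \<in> sets lebesgue" by (intro sets_completionI_sets) (simp add: S)
 have ex: "\<exists>w. has_weak_partial S i u w \<and> Lp_on p S w" if "i \<in> Basis" for i using u that by (auto simp: hom_sobolev_def)
 have wg: "weak_grad S u x \<bullet> i = weak_partial S i u x" if "i \<in> Basis" for i x using that by (simp add: weak_grad_def)
 have hp: "has_weak_partial S i u (weak_partial S i u)" if "i \<in> Basis" for i using ex[OF that] weak_partial_eq(1)[OF S] by blast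
 then show "i \<in> Basis ==> has_weak_partial S i u (%x. weak_grad S u x \<bullet> i)" for i using wg by simp
 show "u \<in> borel_measurable (lebesgue_on S)" using u L1loc_measurable[OF S] by (simp add: hom_sobolev_def)
 have wm: "weak_partial S i u \<in> borel_measurable (lebesgue_on S)" if "i \<in> Basis" for i
  using hp[OF that] L1loc_measurable[OF S] by (simp add: has_weak_partial_def)
 show gm: "weak_grad S u \<in> borel_measurable (lebesgue_on S)"
  unfolding weak_grad_def using wm by (intro borel_measurable_sum borel_measurable_scaleR) auto
 have fi: "Lpow_on S p (weak_partial S i u) < \<infinity>" if i: "i \<in> Basis" for i
 proof -
  obtain w where w: "has_weak_partial S i u w" "Lp_on p S w" using ex[OF i] by blast
  have "AE x in lebesgue_on S. weak_partial S i u x = w x"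
   using weak_partial_eq(2)[OF S w(1)] S by (simp add: AE_restrict_space_iff)
  then show ?thesis using w(2) Lpow_cong_AE[of "weak_partial S i u" w "lebesgue_on S" p]
   by (simp add: Lp_on_def Lpow_lebesgue_on[OF Sm])
 qed
 have "Lpow_on S p (%x. \<Sum>i\<in>A. weak_partial S i u x *\<^sub>R i) < \<infinity>" if "A \<subseteq> Basis" for A
  using finite_subset[OF that finite_Basis] that
 proof (induction A rule: finite_induct)
  case empty then show ?case using p by (simp add: Lpow_def)
 next
  case (insert i A)
  have "Lpow_on S p (%x. weak_partial S i u x *\<^sub>R i) = Lpow_on S p (weak_partial S i u)"
   using insert.prems by (simp add: Lpow_def)
  then have "Lpow_on S p (%x. weak_partial S i u x *\<^sub>R i + (\<Sum>i\<in>A. weak_partial S i u x *\<^sub>R i)) < \<infinity>"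
   using p insert fi[of i] wm by (intro Lpow_add_fin borel_measurable_sum borel_measurable_scaleR) auto
  then show ?case using insert.hyps by simp
 qed
 from this[OF subset_refl] show "Lpow_on S p (weak_grad S u) < \<infinity>" by (simp add: weak_grad_def[abs_def])
qed

lemma hom_sobolevI:
 fixes u :: "'a::euclidean_space => real" and W :: "'a => 'a"
 assumes S: "open S" and p: "p > 1" and W: "\<And>i. i \<in> Basis ==> has_weak_partial S i u (%x. W x \<bullet> i)"
  and m: "W \<in> borel_measurable (lebesgue_on S)" and fin: "Lpow_on S p W < \<infinity>"
 shows "u \<in> hom_sobolev p S"
proof -
 have Sm: "S \<in> sets lebesgue" by (intro sets_completionI_sets) (simp add: S)
 have "Lp_on p S (%x. W x \<bullet> i)" if i: "i \<in> Basis" for i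
 proof -
  have "Lpow_on S p (%x. W x \<bullet> i) \<le> Lpow_on S p W"
   by (rule Lpow_mono) (use i p in "auto simp: Basis_le_norm")
  then show ?thesis using fin m by (simp add: Lp_on_def Lpow_lebesgue_on[OF Sm])
 qed
 moreover have "L1loc_on S u" using W[OF SOME_Basis] by (simp add: has_weak_partial_def)
 ultimately show ?thesis using W by (auto simp: hom_sobolev_def)
qed

lemma hom_sobolev_lincomb:
 fixes u v :: "'a::euclidean_space => real"
 assumes S: "open S" and p: "p > 1" and u: "u \<in> hom_sobolev p S" and v: "v \<in> hom_sobolev p S"
 shows "(%x. u x + c * v x) \<in> hom_sobolev p S"
  and "AE x in lebesgue_on S. weak_grad S (%x. u x + c * v x) x = weak_grad S u x + c *\<^sub>R weak_grad S v x"
proof -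
 note U = hom_sobolevD[OF S p u] and V = hom_sobolevD[OF S p v]
 have h: "has_weak_partial S i (%x. u x + c * v x) (%x. (weak_grad S u x + c *\<^sub>R weak_grad S v x) \<bullet> i)" if "i \<in> Basis" for i
  using has_weak_partial_lincomb[OF that U(1)[OF that] V(1)[OF that], of c] by (simp add: inner_add_left)
 show "(%x. u x + c * v x) \<in> hom_sobolev p S"
 proof (rule hom_sobolevI[OF S p h])
  have m: "(%x. c *\<^sub>R weak_grad S v x) \<in> borel_measurable (lebesgue_on S)" using V(3) by (intro borel_measurable_scaleR) auto
  show "(%x. weak_grad S u x + c *\<^sub>R weak_grad S v x) \<in> borel_measurable (lebesgue_on S)" by (intro borel_measurable_add U(3) m)
  show "Lpow_on S p (%x. weak_grad S u x + c *\<^sub>R weak_grad S v x) < \<infinity>"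
   by (rule Lpow_add_fin[OF _ U(3) m U(4) Lpow_scaleR_fin[OF V(3,4)]]) (use p in simp)
 qed
 show "AE x in lebesgue_on S. weak_grad S (%x. u x + c * v x) x = weak_grad S u x + c *\<^sub>R weak_grad S v x"
  by (rule weak_grad_eq[OF S h])
qed

text \<open>Splitting at a small level \<open>\<delta>\<close> bounds \<open>t\<close> by
  \<open>\<delta> + \<delta> powr (1 - p) * t powr p\<close>: the first part is small on a finite
  measure space, the second along the sequence.\<close>

lemma L1_tendsto_of_Lpow:
 fixes f :: "nat => 'a => real"
 assumes p: "p > 1" and fin: "emeasure M (space M) < \<infinity>" and [measurable]: "\<And>n. f n \<in> borel_measurable M"
  and lim: "(%n. Lpow M p (f n)) \<longlonglongrightarrow> 0"
 shows "(%n. \<integral>\<^sup>+x. ennreal \<bar>f n x\<bar> \<partial>M) \<longlonglongrightarrow> 0"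
proof (rule tendsto_0_ennreal_eps)
 fix e :: real assume e: "e > 0"
 define V where "V = measure M (space M)"
 have V: "emeasure M (space M) = ennreal V" "V \<ge> 0" using fin by (auto simp: V_def emeasure_eq_ennreal_measure less_top)
 define \<delta> where "\<delta> = e / (2 * (V + 1))"
 have d: "\<delta> > 0" using e V by (simp add: \<delta>_def)
 have pw: "t \<le> \<delta> + \<delta> powr (1 - p) * t powr p" if "t \<ge> 0" for t
 proof (cases "t \<le> \<delta>")
  case True
  moreover have "\<delta> powr (1 - p) * t powr p \<ge> 0" by simp
  ultimately show ?thesis by linarith
 next
  case False
  have "\<delta> powr (p - 1) \<le> t powr (p - 1)" using False d p by (intro powr_mono2) auto
  then have "\<delta> powr (1 - p) * \<delta> powr (p - 1) * t \<le> \<delta> powr (1 - p) * t powr (p - 1) * t"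
   using that by (intro mult_right_mono mult_left_mono) auto
  moreover have "\<delta> powr (1 - p) * \<delta> powr (p - 1) = 1" using d by (simp add: powr_add[symmetric])
  moreover have "t powr (p - 1) * t = t powr p" using False d by (simp add: powr_diff)
  ultimately show ?thesis using d by (simp add: mult.assoc)
 qed
 have "(%n. ennreal (\<delta> powr (1 - p)) * Lpow M p (f n)) \<longlonglongrightarrow> 0" by (rule tendsto_cmult_zero_ennreal[OF lim]) simp
 from order_tendstoD(2)[OF this, of "ennreal (e / 2)"] e
 obtain N where N: "\<And>n. n \<ge> N ==> ennreal (\<delta> powr (1 - p)) * Lpow M p (f n) < ennreal (e / 2)"
  by (auto simp: eventually_sequentially)
 have "(\<integral>\<^sup>+x. ennreal \<bar>f n x\<bar> \<partial>M) \<le> ennreal e" if n: "n \<ge> N" for n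
 proof -
  have "(\<integral>\<^sup>+x. ennreal \<bar>f n x\<bar> \<partial>M) \<le> (\<integral>\<^sup>+x. ennreal \<delta> + ennreal (\<delta> powr (1 - p)) * ennreal (norm (f n x) powr p) \<partial>M)"
   using pw d by (intro nn_integral_mono) (simp add: ennreal_mult[symmetric] ennreal_plus[symmetric] ennreal_leI del: ennreal_plus)
  also have "\<dots> = ennreal \<delta> * ennreal V + ennreal (\<delta> powr (1 - p)) * Lpow M p (f n)"
   unfolding Lpow_def V(1)[symmetric] by (simp add: nn_integral_add nn_integral_cmult)
  also have "\<dots> \<le> ennreal (e / 2) + ennreal (e / 2)"
  proof (intro add_mono less_imp_le[OF N[OF n]])
   have "\<delta> * V \<le> e / 2" using e V by (simp add: \<delta>_def field_simps)
   then show "ennreal \<delta> * ennreal V \<le> ennreal (e / 2)" using d V by (simp add: ennreal_mult[symmetric] ennreal_leI)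
  qed
  also have "\<dots> = ennreal e" using e by (simp add: ennreal_plus[symmetric] del: ennreal_plus)
  finally show ?thesis .
 qed
 then show "\<exists>N. \<forall>n\<ge>N. (\<integral>\<^sup>+x. ennreal \<bar>f n x\<bar> \<partial>M) \<le> ennreal e" by blast
qed

lemma test_integral_tendsto:
 fixes w :: "nat => 'a::euclidean_space => real"
 assumes p: "p > 1" and S: "S \<in> sets lebesgue" and K: "compact K" "K \<subseteq> S"
  and \<psi>: "continuous_on UNIV \<psi>" "\<And>x. x \<notin> K ==> \<psi> x = 0" "\<And>x. \<bar>\<psi> x\<bar> \<le> B"
  and wn: "\<And>n. L1loc_on S (w n)" and w0: "L1loc_on S w0"
  and m: "\<And>n. w n \<in> borel_measurable (lebesgue_on S)" "w0 \<in> borel_measurable (lebesgue_on S)"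
  and lim: "(%n. Lpow_on S p (%x. w n x - w0 x)) \<longlonglongrightarrow> 0"
 shows "(%n. LINT x:S|lebesgue. w n x * \<psi> x) \<longlonglongrightarrow> (LINT x:S|lebesgue. w0 x * \<psi> x)"
proof -
 let ?N = "%n. \<integral>\<^sup>+x. ennreal \<bar>w n x - w0 x\<bar> \<partial>lebesgue_on K" and ?J = "%n. LINT x:S|lebesgue. w n x * \<psi> x" and ?L = "LINT x:S|lebesgue. w0 x * \<psi> x"
 have Km: "K \<in> sets lebesgue" by (intro sets_completionI_sets) (simp add: borel_closed[OF compact_imp_closed[OF K(1)]])
 have B: "B \<ge> 0" using \<psi>(3)[of 0] by linarith
 have i: "set_integrable lebesgue S (%x. v x * \<psi> x)" if "L1loc_on S v" for v by (rule L1loc_mult_test[OF that \<psi>(1) K \<psi>(2)])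
 have mK: "(%x. w n x - w0 x) \<in> borel_measurable (lebesgue_on K)" for n
  using m by (intro measurable_lebesgue_on_subset[OF _ K(2) S] borel_measurable_diff)
 have bound: "\<bar>?J n - ?L\<bar>
   \<le> enn2real (ennreal B * ?N n)"
  and fin: "?N n < \<infinity>" for n
 proof -
  let ?d = "%x. w n x - w0 x"
  have dL: "L1loc_on S ?d" by (rule L1loc_diff[OF wn w0])
  then have dK: "integrable (lebesgue_on K) ?d"
   using K Km by (simp add: L1loc_on_def set_integrable_def integrable_restrict_space)
  then show fin: "?N n < \<infinity>" by (simp add: integrable_iff_bounded)
  have "?J n - ?L = (LINT x:S|lebesgue. ?d x * \<psi> x)"
   using i[OF wn] i[OF w0] by (simp add: set_integral_diff left_diff_distrib)
  also have "\<dots> = (\<integral>x. ?d x * \<psi> x \<partial>lebesgue_on K)"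
  proof -
   have "(%x. indicator S x *\<^sub>R (?d x * \<psi> x)) = (%x. indicator K x *\<^sub>R (?d x * \<psi> x))"
   proof
    fix x show "indicator S x *\<^sub>R (?d x * \<psi> x) = indicator K x *\<^sub>R (?d x * \<psi> x)"
     using \<psi>(2)[of x] K(2) by (cases "x \<in> K") (auto simp: indicator_def)
   qed
   then show ?thesis using Km by (simp add: set_lebesgue_integral_def integral_restrict_space)
  qed
  also have "\<bar>\<dots>\<bar> \<le> enn2real (\<integral>\<^sup>+x. ennreal \<bar>?d x * \<psi> x\<bar> \<partial>lebesgue_on K)"
  proof -
   have "\<bar>\<integral>x. ?d x * \<psi> x \<partial>lebesgue_on K\<bar> \<le> (\<integral>x. \<bar>?d x * \<psi> x\<bar> \<partial>lebesgue_on K)" by (rule integral_abs_bound)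
   also have "\<dots> = enn2real (\<integral>\<^sup>+x. ennreal \<bar>?d x * \<psi> x\<bar> \<partial>lebesgue_on K)"
   proof (rule integral_eq_nn_integral)
    have "\<psi> \<in> borel_measurable (lebesgue_on K)"
     by (intro measurable_restrict_space1 measurable_completion) (simp add: borel_measurable_continuous_onI[OF \<psi>(1)])
    then show "(%x. \<bar>?d x * \<psi> x\<bar>) \<in> borel_measurable (lebesgue_on K)"
     by (intro borel_measurable_abs borel_measurable_times mK)
   qed simp
   finally show ?thesis .
  qed
  also have "\<dots> \<le> enn2real (ennreal B * ?N n)"
  proof (rule enn2real_mono)
   have "(\<integral>\<^sup>+x. ennreal \<bar>?d x * \<psi> x\<bar> \<partial>lebesgue_on K) \<le> (\<integral>\<^sup>+x. ennreal B * ennreal \<bar>?d x\<bar> \<partial>lebesgue_on K)"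
    using B \<psi>(3) by (intro nn_integral_mono) (auto simp: abs_mult ennreal_mult[symmetric] mult.commute intro!: ennreal_leI mult_right_mono)
   also have "\<dots> = ennreal B * ?N n"
    by (intro nn_integral_cmult measurable_compose[OF mK[of n]]) measurable
   finally show "(\<integral>\<^sup>+x. ennreal \<bar>?d x * \<psi> x\<bar> \<partial>lebesgue_on K) \<le> ennreal B * ?N n" .
   show "ennreal B * ?N n < top" using fin by (simp add: ennreal_mult_less_top)
  qed
  finally show "\<bar>?J n - ?L\<bar>
   \<le> enn2real (ennreal B * ?N n)" .
 qed
 have "(%n. ?N n) \<longlonglongrightarrow> 0"
 proof (rule L1_tendsto_of_Lpow[OF p _ mK])
  show "emeasure (lebesgue_on K) (space (lebesgue_on K)) < \<infinity>"
   using Km lmeasurable_compact[OF K(1)] by (simp add: emeasure_restrict_space space_restrict_space fmeasurable_def del: emeasure_completion)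
  show "(%n. Lpow_on K p (%x. w n x - w0 x)) \<longlonglongrightarrow> 0" by (rule tendsto_zero_ennreal_le[OF lim Lpow_subset[OF K(2) Km S]])
 qed
 then have "(%n. ennreal B * ?N n) \<longlonglongrightarrow> 0" by (rule tendsto_cmult_zero_ennreal) simp
 then have "((%n. ennreal B * ?N n) \<longlongrightarrow> ennreal 0) sequentially" by simp
 from tendsto_enn2real[OF this] have "(%n. enn2real (ennreal B * ?N n)) \<longlonglongrightarrow> 0" by simp
 then have "(%n. ?J n - ?L) \<longlonglongrightarrow> 0"
  by (rule Lim_null_comparison[rotated]) (use bound in simp)
 then show ?thesis by (rule LIM_zero_cancel)
qed

text \<open>Both sides of the defining identity are integrals over the compact support of a test
  function and pass to the limit: the weak derivative is a closed operator.\<close>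

lemma has_weak_partial_limit:
 fixes u w :: "nat => 'a::euclidean_space => real"
 assumes p: "p > 1" and S: "open S" and i: "i \<in> Basis" and h: "\<And>n. has_weak_partial S i (u n) (w n)"
  and L: "L1loc_on S u0" "L1loc_on S w0"
  and lim: "(%n. Lpow_on S p (%x. u n x - u0 x)) \<longlonglongrightarrow> 0" "(%n. Lpow_on S p (%x. w n x - w0 x)) \<longlonglongrightarrow> 0"
 shows "has_weak_partial S i u0 w0" unfolding has_weak_partial_def
proof (intro conjI allI impI L)
 fix \<phi> assume \<phi>: "test_function S \<phi>"
 let ?K = "closure {x. \<phi> x \<noteq> 0}"
 have Sm: "S \<in> sets lebesgue" by (intro sets_completionI_sets) (simp add: S)
 have K: "compact ?K" "?K \<subseteq> S" "Cinf \<phi>" using \<phi> by (auto simp: test_function_def)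
 have 0: "\<phi> x = 0" if "x \<notin> ?K" for x using that closure_subset[of "{x. \<phi> x \<noteq> 0}"] by auto
 have 1: "partial_deriv i \<phi> x = 0" if "x \<notin> ?K" for x
 proof (rule partial_deriv_outside[where U = "- ?K"])
  show "open (- ?K)" by (rule open_Compl[OF closed_closure])
  show "x \<in> - ?K" using that unfolding Compl_iff .
  show "\<phi> y = 0" if "y \<in> - ?K" for y using that unfolding Compl_iff by (rule 0)
 qed
 obtain R where R: "\<And>x. norm x > R ==> \<phi> x = 0" using test_function_bounded_support[OF \<phi>] by metis
 note c0 = Cinf_continuous[OF K(3)] and c1 = Cinf_continuous[OF Cinf_partial[OF K(3) i]]
 obtain B0 where B0: "\<And>x. \<bar>\<phi> x\<bar> \<le> B0" using continuous_bounded_support(2)[OF c0 R] by blast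
 have 2: "partial_deriv i \<phi> x = 0" if "norm x > R" for x by (rule partial_deriv_0_outside_cball[OF R that])
 obtain B1 where B1: "\<And>x. \<bar>partial_deriv i \<phi> x\<bar> \<le> B1" using continuous_bounded_support(2)[OF c1 2] by blast
 have Ln: "L1loc_on S (u n)" "L1loc_on S (w n)" for n using h[of n] by (auto simp: has_weak_partial_def)
 have "(%n. LINT x:S|lebesgue. u n x * partial_deriv i \<phi> x) \<longlonglongrightarrow> (LINT x:S|lebesgue. u0 x * partial_deriv i \<phi> x)"
  by (rule test_integral_tendsto[OF p Sm K(1,2) c1 1 B1 Ln(1) L(1) L1loc_measurable[OF S Ln(1)] L1loc_measurable[OF S L(1)] lim(1)])
 moreover have "(%n. LINT x:S|lebesgue. w n x * \<phi> x) \<longlonglongrightarrow> (LINT x:S|lebesgue. w0 x * \<phi> x)"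
  by (rule test_integral_tendsto[OF p Sm K(1,2) c0 0 B0 Ln(2) L(2) L1loc_measurable[OF S Ln(2)] L1loc_measurable[OF S L(2)] lim(2)])
 then have "(%n. - (LINT x:S|lebesgue. w n x * \<phi> x)) \<longlonglongrightarrow> - (LINT x:S|lebesgue. w0 x * \<phi> x)" by (rule tendsto_minus)
 moreover have "(LINT x:S|lebesgue. u n x * partial_deriv i \<phi> x) = - (LINT x:S|lebesgue. w n x * \<phi> x)" for n
  using h[of n] \<phi> by (simp add: has_weak_partial_def)
 ultimately show "(LINT x:S|lebesgue. u0 x * partial_deriv i \<phi> x) = - (LINT x:S|lebesgue. w0 x * \<phi> x)"
  using LIMSEQ_unique by simp
qed

subsection \<open>Traces\<close>

lemma strip_eq_slab: "strip bm bp = slab bm bp" by (simp add: strip_def)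

lemma Lpow_exhaust_le:
 assumes f: "f \<in> borel_measurable (lebesgue_on S)" and S: "S \<in> sets lebesgue" and A: "\<And>n. A n \<in> sets lebesgue"
  and inc: "incseq A" and U: "(\<Union>n. A n) = S" and le: "\<And>n. Lpow_on (A n) p f \<le> B"
 shows "Lpow_on S p f \<le> B"
proof -
 let ?F = "%n x. ennreal (norm (f x) powr p) * indicator (A n) x"
 have Am: "A n \<in> sets (lebesgue_on S)" for n using A[of n] U by (auto simp: sets_restrict_space_iff S)
 have "Lpow_on S p f = (\<integral>\<^sup>+x. (SUP n. ?F n x) \<partial>lebesgue_on S)" unfolding Lpow_def
 proof (rule nn_integral_cong)
  fix x assume "x \<in> space (lebesgue_on S)"
  then obtain n where n: "x \<in> A n" using U by auto
  have "(SUP n. ?F n x) = ennreal (norm (f x) powr p)"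
  proof (rule antisym)
   show "(SUP n. ?F n x) \<le> ennreal (norm (f x) powr p)" by (rule SUP_least) (simp add: indicator_def)
   show "ennreal (norm (f x) powr p) \<le> (SUP n. ?F n x)" by (rule SUP_upper2[of n]) (use n in auto)
  qed
  then show "ennreal (norm (f x) powr p) = (SUP n. ?F n x)" by simp
 qed
 also have "\<dots> = (SUP n. \<integral>\<^sup>+x. ?F n x \<partial>lebesgue_on S)"
 proof (rule nn_integral_monotone_convergence_SUP)
  show "incseq ?F" using inc by (intro incseq_SucI le_funI mult_left_mono) (auto simp: indicator_def incseq_Suc_iff)
  show "?F n \<in> borel_measurable (lebesgue_on S)" for n
   using f Am[of n] by (intro borel_measurable_times_ennreal borel_measurable_indicator) measurable
 qed
 also have "\<dots> \<le> B"
 proof (rule SUP_least)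
  fix n
  have AS: "A n \<subseteq> S" using U by auto
  have "(\<integral>\<^sup>+x. ?F n x \<partial>lebesgue_on S) = (\<integral>\<^sup>+x. ennreal (norm (f x) powr p) * indicator (A n) x * indicator S x \<partial>lebesgue)"
   using S by (simp add: nn_integral_restrict_space)
  also have "\<dots> = Lpow_on (A n) p f"
   unfolding Lpow_lebesgue_on[OF A] using AS by (intro nn_integral_cong) (auto simp: indicator_def)
  finally show "(\<integral>\<^sup>+x. ?F n x \<partial>lebesgue_on S) \<le> B" using le[of n] by simp
 qed
 finally show ?thesis .
qed

lemma Lpow_exhaust_slab:
 fixes f :: "'a::euclidean_space \<times> real => 'b::euclidean_space"
 assumes "f \<in> borel_measurable (lebesgue_on (slab bm bp))"
  and "\<And>R. R > 0 ==> Lpow_on (ball 0 R \<times> {bm<..<bp}) p f \<le> B"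
 shows "Lpow_on (slab bm bp) p f \<le> B"
proof (rule Lpow_exhaust_le[OF assms(1) slab_lebesgue, of "%n. ball 0 (real (Suc n)) \<times> {bm<..<bp}"])
 show "(\<Union>n. ball (0::'a) (real (Suc n)) \<times> {bm<..<bp}) = slab bm bp"
 proof (intro equalityI subsetI)
  fix X :: "'a \<times> real" assume X: "X \<in> slab bm bp"
  obtain n where "norm (fst X) < real n" using reals_Archimedean2 by blast
  then have "X \<in> ball 0 (real (Suc n)) \<times> {bm<..<bp}" using X by (auto simp: mem_Times_iff)
  then show "X \<in> (\<Union>n. ball 0 (real (Suc n)) \<times> {bm<..<bp})" by blast
 qed auto
 show "incseq (%n. ball (0::'a) (real (Suc n)) \<times> {bm<..<bp})" by (intro incseq_SucI Sigma_mono subset_ball) auto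
qed (use assms(2) in "auto intro: cyl_lebesgue")

lemma ennreal_le_of_tendsto_0:
 fixes a :: "nat => ennreal"
 assumes "\<And>n. x \<le> a n + b" "a \<longlonglongrightarrow> 0"
 shows "x \<le> b"
proof -
 have "(%n. a n + b) \<longlonglongrightarrow> 0 + b" by (intro tendsto_add assms(2) tendsto_const)
 then have "(%n. a n + b) \<longlonglongrightarrow> b" by simp
 then show ?thesis by (rule LIMSEQ_le_const) (use assms(1) in blast)
qed

lemma ball_lebesgue: "ball x R \<in> sets (lebesgue :: 'a::euclidean_space measure)" by (intro sets_completionI_sets) simp

lemma borel_measurable_lebesgue_on: "f \<in> borel_measurable borel ==> f \<in> borel_measurable (lebesgue_on S)"
 for f :: "'a::euclidean_space => 'b::euclidean_space" by (intro measurable_restrict_space1 measurable_completion) simp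

lemma AE_lebesgue_on_subset:
 assumes "AE x in lebesgue_on S. P x" "A \<subseteq> S" "A \<in> sets lebesgue" "S \<in> sets lebesgue"
 shows "AE x in lebesgue_on A. P x"
proof -
 have "AE x in lebesgue. x \<in> S \<longrightarrow> P x" using assms(1,4) by (simp add: AE_restrict_space_iff)
 then have "AE x in lebesgue. x \<in> A \<longrightarrow> P x" by eventually_elim (use assms(2) in auto)
 then show ?thesis using assms(3) by (simp add: AE_restrict_space_iff)
qed

lemma has_trace_iff:
 fixes u :: "(real^'n) \<times> real => real"
 shows "has_trace p bm bp t u f \<longleftrightarrow> (\<forall>R>0. f \<in> borel_measurable (lebesgue_on (ball 0 R)) \<and> Lpow_on (ball 0 R) p f < \<infinity> \<and>
  (\<exists>\<phi>. (\<forall>n::nat. Cinf (\<phi> n)) \<and>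
   (%n. Lpow_on (ball 0 R \<times> {bm<..<bp}) p (%x. \<phi> n x - u x)) \<longlonglongrightarrow> 0 \<and>
   (%n. Lpow_on (ball 0 R \<times> {bm<..<bp}) p (%x. grad (\<phi> n) x - weak_grad (slab bm bp) u x)) \<longlonglongrightarrow> 0 \<and>
   (%n. Lpow_on (ball 0 R) p (%y. \<phi> n (y, t) - f y)) \<longlonglongrightarrow> 0))"
 unfolding has_trace_def Lp_on_def strip_eq_slab Lpow_lebesgue_on[OF cyl_lebesgue] Lpow_lebesgue_on[OF ball_lebesgue]
  real_norm_def conj_assoc ..

definition zero_trace :: "real => real => real => ((real^'n) \<times> real => real) set" where
 "zero_trace p bm bp =
  {v \<in> hom_sobolev p (slab bm bp). has_trace p bm bp bm v (%_. 0) \<and> has_trace p bm bp bp v (%_. 0)}"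

context
 fixes p bm bp :: real
 assumes p: "p > 1" and b: "bm < bp"
begin

private lemma p0: "p > 0" using p by simp

private abbreviation (input) "Q R \<equiv> ball 0 R \<times> {bm<..<bp}"

lemma sobolev_cyl_measurable:
 fixes u :: "(real^'n) \<times> real => real"
 assumes "u \<in> hom_sobolev p (slab bm bp)"
 shows "u \<in> borel_measurable (lebesgue_on (Q R))" "weak_grad (slab bm bp) u \<in> borel_measurable (lebesgue_on (Q R))"
 using hom_sobolevD(2,3)[OF slab_open p assms] by (auto intro: measurable_lebesgue_on_subset[OF _ cyl_subset slab_lebesgue])

lemma smooth_cyl_measurable:
 fixes \<phi> :: "(real^'n) \<times> real => real"
 assumes "Cinf \<phi>"
 shows "\<phi> \<in> borel_measurable (lebesgue_on S)" "grad \<phi> \<in> borel_measurable (lebesgue_on S)"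
  "(%x. \<phi> (x, t)) \<in> borel_measurable (lebesgue_on T)"
 using Cinf_borel_measurable[OF assms p b] slice_measurable[OF assms p b] by (auto intro: borel_measurable_lebesgue_on)

lemma has_trace_lincomb:
 fixes u v :: "(real^'n) \<times> real => real"
 assumes u: "u \<in> hom_sobolev p (slab bm bp)" and v: "v \<in> hom_sobolev p (slab bm bp)"
  and tu: "has_trace p bm bp t u f" and tv: "has_trace p bm bp t v g"
 shows "has_trace p bm bp t (%x. u x + c * v x) (%x. f x + c * g x)" unfolding has_trace_iff
proof (intro allI impI)
 fix R :: real assume R: "R > 0"
 let ?B = "lebesgue_on (ball (0::real^'n) R)" and ?Q = "lebesgue_on (ball (0::real^'n) R \<times> {bm<..<bp})"
 let ?W = "weak_grad (slab bm bp)"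
 obtain \<phi> where f: "f \<in> borel_measurable ?B" "Lpow ?B p f < \<infinity>" and \<phi>: "\<And>n::nat. Cinf (\<phi> n)"
  "(%n. Lpow ?Q p (%x. \<phi> n x - u x)) \<longlonglongrightarrow> 0"
  "(%n. Lpow ?Q p (%x. grad (\<phi> n) x - ?W u x)) \<longlonglongrightarrow> 0"
  "(%n. Lpow ?B p (%y. \<phi> n (y, t) - f y)) \<longlonglongrightarrow> 0" using tu R unfolding has_trace_iff by blast
 obtain \<psi> where g: "g \<in> borel_measurable ?B" "Lpow ?B p g < \<infinity>" and \<psi>: "\<And>n::nat. Cinf (\<psi> n)"
  "(%n. Lpow ?Q p (%x. \<psi> n x - v x)) \<longlonglongrightarrow> 0"
  "(%n. Lpow ?Q p (%x. grad (\<psi> n) x - ?W v x)) \<longlonglongrightarrow> 0"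
  "(%n. Lpow ?B p (%y. \<psi> n (y, t) - g y)) \<longlonglongrightarrow> 0" using tv R unfolding has_trace_iff by blast
 note m = sobolev_cyl_measurable[OF u, of R] sobolev_cyl_measurable[OF v, of R] smooth_cyl_measurable[OF \<phi>(1)] smooth_cyl_measurable[OF \<psi>(1)] f(1) g(1)
 have cg: "(%x. c *\<^sub>R g x) \<in> borel_measurable ?B" using g(1) by simp
 show "(%x. f x + c * g x) \<in> borel_measurable ?B \<and> Lpow ?B p (%x. f x + c * g x) < \<infinity> \<and>
  (\<exists>\<theta>. (\<forall>n::nat. Cinf (\<theta> n)) \<and>
   (%n. Lpow ?Q p (%x. \<theta> n x - (u x + c * v x))) \<longlonglongrightarrow> 0 \<and>
   (%n. Lpow ?Q p (%x. grad (\<theta> n) x - ?W (%x. u x + c * v x) x)) \<longlonglongrightarrow> 0 \<and>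
   (%n. Lpow ?B p (%y. \<theta> n (y, t) - (f y + c * g y))) \<longlonglongrightarrow> 0)"
 proof (intro conjI exI[of _ "%n x. \<phi> n x + c * \<psi> n x"] allI)
  show "(%x. f x + c * g x) \<in> borel_measurable ?B" using borel_measurable_add[OF f(1) cg] by simp
  show "Lpow ?B p (%x. f x + c * g x) < \<infinity>" using Lpow_add_fin[OF p0 f(1) cg f(2) Lpow_scaleR_fin[OF g]] by simp
  show "Cinf (%x. \<phi> n x + c * \<psi> n x)" for n by (intro Cinf_add Cinf_mult Cinf_const \<phi> \<psi>)
  have "(%n. Lpow ?Q p (%x. (\<phi> n x - u x) + c *\<^sub>R (\<psi> n x - v x))) \<longlonglongrightarrow> 0"
   by (intro Lpow_tendsto_add[OF p0] Lpow_tendsto_scaleR \<phi> \<psi> borel_measurable_scaleR borel_measurable_diff borel_measurable_const m)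
  then show "(%n. Lpow ?Q p (%x. \<phi> n x + c * \<psi> n x - (u x + c * v x))) \<longlonglongrightarrow> 0" by (simp add: algebra_simps)
  have "(%n. Lpow ?B p (%y. (\<phi> n (y, t) - f y) + c *\<^sub>R (\<psi> n (y, t) - g y))) \<longlonglongrightarrow> 0"
   by (intro Lpow_tendsto_add[OF p0] Lpow_tendsto_scaleR \<phi> \<psi> borel_measurable_scaleR borel_measurable_diff borel_measurable_const m)
  then show "(%n. Lpow ?B p (%y. \<phi> n (y, t) + c * \<psi> n (y, t) - (f y + c * g y))) \<longlonglongrightarrow> 0" by (simp add: algebra_simps)
  have "AE x in lebesgue_on (slab bm bp). ?W (%x. u x + c * v x) x = ?W u x + c *\<^sub>R ?W v x"
   by (rule hom_sobolev_lincomb(2)[OF slab_open p u v])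
  then have AE: "AE x in ?Q. ?W (%x. u x + c * v x) x = ?W u x + c *\<^sub>R ?W v x"
   by (rule AE_lebesgue_on_subset[OF _ cyl_subset cyl_lebesgue slab_lebesgue])
  have "(%n. Lpow ?Q p (%x. (grad (\<phi> n) x - ?W u x) + c *\<^sub>R (grad (\<psi> n) x - ?W v x))) \<longlonglongrightarrow> 0"
   by (intro Lpow_tendsto_add[OF p0] Lpow_tendsto_scaleR \<phi> \<psi> borel_measurable_scaleR borel_measurable_diff borel_measurable_const m)
  moreover have "Lpow ?Q p (%x. grad (%x. \<phi> n x + c * \<psi> n x) x - ?W (%x. u x + c * v x) x)
   = Lpow ?Q p (%x. (grad (\<phi> n) x - ?W u x) + c *\<^sub>R (grad (\<psi> n) x - ?W v x))" for n
  proof (rule Lpow_cong_AE, use AE in eventually_elim)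
   case (elim x)
   have "grad (%x. \<phi> n x + c * \<psi> n x) x = grad (\<phi> n) x + c *\<^sub>R grad (\<psi> n) x"
    using grad_add[OF \<phi>(1) Cinf_mult[OF Cinf_const \<psi>(1)]] grad_cmult[OF \<psi>(1)] by simp
   then show ?case using elim by (simp add: algebra_simps)
  qed
  ultimately show "(%n. Lpow ?Q p (%x. grad (%x. \<phi> n x + c * \<psi> n x) x - ?W (%x. u x + c * v x) x)) \<longlonglongrightarrow> 0" by simp
 qed
qed

lemma has_trace_cong_AE:
 fixes u :: "(real^'n) \<times> real => real"
 assumes t: "has_trace p bm bp t u f" and g: "g \<in> borel_measurable lebesgue" and AE: "AE x in lebesgue. f x = g x"
 shows "has_trace p bm bp t u g"
proof -
 have AB: "AE x in lebesgue_on (ball (0::real^'n) R). f x = g x" for R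
 proof -
  have "AE x in lebesgue. x \<in> ball 0 R \<longrightarrow> f x = g x" using AE by eventually_elim simp
  then show ?thesis by (subst AE_restrict_space_iff) (use ball_lebesgue[of 0 R] in auto)
 qed
 have 1: "Lpow_on (ball 0 R) p g = Lpow_on (ball 0 R) p f" for R
  by (rule Lpow_cong_AE) (use AB in eventually_elim, simp)
 have 2: "Lpow_on (ball 0 R) p (%y. \<phi> (y, t) - g y) = Lpow_on (ball 0 R) p (%y. \<phi> (y, t) - f y)" for R and \<phi> :: "(real^'n) \<times> real => real"
  by (rule Lpow_cong_AE) (use AB in eventually_elim, simp)
 have 3: "g \<in> borel_measurable (lebesgue_on (ball 0 R))" for R using g by (rule measurable_restrict_space1)
 show ?thesis using t 3 unfolding has_trace_iff 1 2 by blast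
qed

text \<open>The difference of approximations attached to the two faces is small in \<open>W\<^sup>1\<^sup>,\<^sup>p\<close>, hence so are its traces.\<close>

lemma two_traces:
 fixes u :: "(real^'n) \<times> real => real"
 assumes u: "u \<in> hom_sobolev p (slab bm bp)" and s: "s \<in> {bm..bp}"
  and tu: "has_trace p bm bp t u f" and su: "has_trace p bm bp s u g" and R: "R > 0"
 obtains \<phi> where "\<And>n::nat. Cinf (\<phi> n)"
  "(%n. Lpow_on (Q R) p (%x. grad (\<phi> n) x - weak_grad (slab bm bp) u x)) \<longlonglongrightarrow> 0"
  "(%n. Lpow_on (ball 0 R) p (%y. \<phi> n (y, t) - f y)) \<longlonglongrightarrow> 0"
  "(%n. Lpow_on (ball 0 R) p (%y. \<phi> n (y, s) - g y)) \<longlonglongrightarrow> 0"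
  "f \<in> borel_measurable (lebesgue_on (ball 0 R))" "g \<in> borel_measurable (lebesgue_on (ball 0 R))"
proof -
 let ?B = "lebesgue_on (ball (0::real^'n) R)" and ?Q = "lebesgue_on (ball (0::real^'n) R \<times> {bm<..<bp})"
 let ?W = "weak_grad (slab bm bp)"
 obtain \<phi> where f: "f \<in> borel_measurable ?B" and \<phi>: "\<And>n::nat. Cinf (\<phi> n)"
  "(%n. Lpow ?Q p (%x. \<phi> n x - u x)) \<longlonglongrightarrow> 0"
  "(%n. Lpow ?Q p (%x. grad (\<phi> n) x - ?W u x)) \<longlonglongrightarrow> 0"
  "(%n. Lpow ?B p (%y. \<phi> n (y, t) - f y)) \<longlonglongrightarrow> 0" using tu R unfolding has_trace_iff by blast
 obtain \<psi> where g: "g \<in> borel_measurable ?B" and \<psi>: "\<And>n::nat. Cinf (\<psi> n)"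
  "(%n. Lpow ?Q p (%x. \<psi> n x - u x)) \<longlonglongrightarrow> 0"
  "(%n. Lpow ?Q p (%x. grad (\<psi> n) x - ?W u x)) \<longlonglongrightarrow> 0"
  "(%n. Lpow ?B p (%y. \<psi> n (y, s) - g y)) \<longlonglongrightarrow> 0" using su R unfolding has_trace_iff by blast
 note m = sobolev_cyl_measurable[OF u, of R] smooth_cyl_measurable[OF \<phi>(1)] smooth_cyl_measurable[OF \<psi>(1)] f g
 define d where "d n = (%x. \<phi> n x + (-1) * \<psi> n x)" for n
 have d: "Cinf (d n)" for n unfolding d_def by (intro Cinf_add Cinf_mult Cinf_const \<phi> \<psi>)
 have gd: "grad (d n) x = (grad (\<phi> n) x - ?W u x) + (-1) *\<^sub>R (grad (\<psi> n) x - ?W u x)" for n x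
 proof -
  have "grad (d n) x = grad (\<phi> n) x + (-1) *\<^sub>R grad (\<psi> n) x"
   unfolding d_def by (simp only: grad_add[OF \<phi>(1) Cinf_mult[OF Cinf_const \<psi>(1)]] grad_cmult[OF \<psi>(1)])
  then show ?thesis by simp
 qed
 have d1: "(%n. Lpow ?Q p (d n)) \<longlonglongrightarrow> 0"
 proof -
  have "(%n. Lpow ?Q p (%x. (\<phi> n x - u x) + (-1) *\<^sub>R (\<psi> n x - u x))) \<longlonglongrightarrow> 0"
   by (intro Lpow_tendsto_add[OF p0] Lpow_tendsto_scaleR \<phi> \<psi> borel_measurable_scaleR borel_measurable_diff borel_measurable_const m)
  then show ?thesis by (simp add: d_def)
 qed
 have d2: "(%n. Lpow ?Q p (grad (d n))) \<longlonglongrightarrow> 0" unfolding gd[abs_def]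
  by (intro Lpow_tendsto_add[OF p0] Lpow_tendsto_scaleR \<phi> \<psi> borel_measurable_scaleR borel_measurable_diff borel_measurable_const m)
 have "(%n. ennreal (bp - bm) * Lpow ?B p (%x. d n (x, s))) \<longlonglongrightarrow> 0" by (rule tendsto_zero_ennreal_le[OF _ trace_smooth[OF d p b s]])
   (intro tendsto_cmult_zero_ennreal tendsto_add_zero_ennreal d1 d2; simp)
 then have "(%n. ennreal (1 / (bp - bm)) * (ennreal (bp - bm) * Lpow ?B p (%x. d n (x, s)))) \<longlonglongrightarrow> 0"
  by (rule tendsto_cmult_zero_ennreal) simp
 then have ds: "(%n. Lpow ?B p (%x. d n (x, s))) \<longlonglongrightarrow> 0" using b by (simp add: mult.assoc[symmetric] ennreal_mult[symmetric])
 have "(%n. Lpow ?B p (%y. d n (y, s) + (\<psi> n (y, s) - g y))) \<longlonglongrightarrow> 0"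
  by (intro Lpow_tendsto_add[OF p0] ds \<psi> borel_measurable_diff m smooth_cyl_measurable[OF d])
 then have "(%n. Lpow ?B p (%y. \<phi> n (y, s) - g y)) \<longlonglongrightarrow> 0" by (simp add: d_def)
 with \<phi> f g show ?thesis by (intro that)
qed

lemma zero_trace_lincomb: "u \<in> zero_trace p bm bp ==> v \<in> zero_trace p bm bp ==> (%x. u x + c * v x) \<in> zero_trace p bm bp"
 using has_trace_lincomb[of u v _ "%_. 0" "%_. 0" c] hom_sobolev_lincomb(1)[OF slab_open p] by (auto simp: zero_trace_def)

lemma zero_trace_0: "(%_. 0) \<in> (zero_trace p bm bp :: ((real^'n) \<times> real => real) set)"
 and weak_grad_0: "AE x in lebesgue_on (slab bm bp). weak_grad (slab bm bp) (%_. 0) x = (0 :: (real^'n) \<times> real)"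
proof -
 let ?S = "slab bm bp :: ((real^'n) \<times> real) set"
 have L: "L1loc_on ?S (%_. 0)" by (rule continuous_L1loc) simp
 have h: "has_weak_partial ?S i (%_. 0) (%x. 0 \<bullet> i)" for i :: "(real^'n) \<times> real" using L by (simp add: has_weak_partial_def set_lebesgue_integral_def)
 show AE: "AE x in lebesgue_on ?S. weak_grad ?S (%_. 0) x = 0" by (rule weak_grad_eq[OF slab_open h])
 have H: "(%_. 0) \<in> hom_sobolev p ?S" by (rule hom_sobolevI[OF slab_open p h]) (use p in "auto simp: Lpow_def")
 have 0: "Lpow_on (Q R) p (%x. grad (%_. 0) x - weak_grad ?S (%_. 0) x) = 0" for R
 proof -
  have A: "AE x in lebesgue_on (Q R). weak_grad ?S (%_. 0) x = 0"
   by (rule AE_lebesgue_on_subset[OF AE cyl_subset cyl_lebesgue slab_lebesgue])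
  have g: "grad (%_. 0 :: real) x = 0" for x :: "(real^'n) \<times> real" using grad_cmult[OF Cinf_const, of 0 0 x] by simp
  have "Lpow_on (Q R) p (%x. grad (%_. 0) x - weak_grad ?S (%_. 0) x) = Lpow_on (Q R) p (%x :: (real^'n) \<times> real. 0 :: (real^'n) \<times> real)"
   by (rule Lpow_cong_AE) (use A in eventually_elim, simp add: g)
  then show ?thesis using p by (simp add: Lpow_def)
 qed
 have "has_trace p bm bp t (%_. 0) (%_ :: real^'n. 0)" for t
  unfolding has_trace_iff by (intro allI impI conjI exI[of _ "%_ _. 0"]) (use p 0 in "auto simp: Lpow_def")
 with H show "(%_. 0) \<in> (zero_trace p bm bp :: ((real^'n) \<times> real => real) set)" by (simp add: zero_trace_def)
qed

text \<open>The inequality for smooth functions is passed to the limit. Only vertical lines are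
  integrated, so the constant does not involve \<open>R\<close> and survives the exhaustion of the
  strip.\<close>

lemma poincare_cyl:
 fixes v :: "(real^'n) \<times> real => real"
 assumes v: "v \<in> hom_sobolev p (slab bm bp)" and t: "has_trace p bm bp bm v (%_. 0)" and R: "R > 0"
 shows "Lpow_on (Q R) p v \<le> ennreal (2 powr p * ((bp - bm) * (2 powr p * ((bp - bm) powr (p - 1) * 2 powr p)))) *
  Lpow_on (Q R) p (weak_grad (slab bm bp) v)"
proof -
 let ?B = "lebesgue_on (ball (0::real^'n) R)" and ?Q = "lebesgue_on (ball (0::real^'n) R \<times> {bm<..<bp})"
 let ?W = "weak_grad (slab bm bp)"
 obtain \<phi> where \<phi>: "\<And>n::nat. Cinf (\<phi> n)"
  "(%n. Lpow ?Q p (%x. \<phi> n x - v x)) \<longlonglongrightarrow> 0"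
  "(%n. Lpow ?Q p (%x. grad (\<phi> n) x - ?W v x)) \<longlonglongrightarrow> 0"
  "(%n. Lpow ?B p (%y. \<phi> n (y, bm) - 0)) \<longlonglongrightarrow> 0" using t R unfolding has_trace_iff by blast
 note m = sobolev_cyl_measurable[OF v, of R] smooth_cyl_measurable[OF \<phi>(1)]
 let ?c = "ennreal (2 powr p)" and ?L = "ennreal (bp - bm)" and ?k = "ennreal ((bp - bm) powr (p - 1))"
 define A where "A n = Lpow ?Q p (%x. \<phi> n x - v x)" for n
 define E where "E n = Lpow ?Q p (%x. grad (\<phi> n) x - ?W v x)" for n
 define T where "T n = Lpow ?B p (%y. \<phi> n (y, bm))" for n
 define w where "w = Lpow ?Q p (?W v)"
 have lim: "A \<longlonglongrightarrow> 0" "E \<longlonglongrightarrow> 0" "T \<longlonglongrightarrow> 0" using \<phi>(2-4) by (simp_all add: A_def[abs_def] E_def[abs_def] T_def[abs_def])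
 \<comment> \<open>All terms that tend to 0 with \<open>n\<close> are collected in the first
   summand.\<close>
 have "Lpow ?Q p v \<le> (?c * (A n + ?L * (?c * (T n + ?k * (?c * E n))))) + ?c * (?L * (?c * (?k * (?c * w))))" for n
 proof -
  have "Lpow ?Q p v = Lpow ?Q p (%x. \<phi> n x - (\<phi> n x - v x))" by simp
  also have "\<dots> \<le> ?c * (Lpow ?Q p (\<phi> n) + A n)" unfolding A_def by (intro Lpow_diff_le p0 borel_measurable_diff m)
  also have "Lpow ?Q p (\<phi> n) \<le> ?L * (?c * (T n + ?k * Lpow ?Q p (grad (\<phi> n))))"
   unfolding T_def by (rule poincare_smooth[OF \<phi>(1) p b]) (use b in simp)
  also have "Lpow ?Q p (grad (\<phi> n)) = Lpow ?Q p (%x. (grad (\<phi> n) x - ?W v x) + ?W v x)" by simp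
  also have "\<dots> \<le> ?c * (E n + w)" unfolding E_def w_def by (intro Lpow_add_le p0 borel_measurable_diff m)
  finally show ?thesis by (simp add: distrib_left add_ac add_mono mult_left_mono)
 qed
 moreover have "(%n. ?c * (A n + ?L * (?c * (T n + ?k * (?c * E n))))) \<longlonglongrightarrow> 0"
  by (intro tendsto_cmult_zero_ennreal tendsto_add_zero_ennreal lim) auto
 ultimately have "Lpow ?Q p v \<le> ?c * (?L * (?c * (?k * (?c * w))))" by (rule ennreal_le_of_tendsto_0)
 then show ?thesis using b by (simp add: ennreal_mult mult.assoc w_def)
qed

lemma poincare:
 obtains C where "C > 0" "\<And>v :: (real^'n) \<times> real => real. v \<in> hom_sobolev p (slab bm bp) ==> has_trace p bm bp bm v (%_. 0) ==>
  Lpow_on (slab bm bp) p v \<le> ennreal C * Lpow_on (slab bm bp) p (weak_grad (slab bm bp) v)"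
proof
 let ?C = "2 powr p * ((bp - bm) * (2 powr p * ((bp - bm) powr (p - 1) * 2 powr p)))"
 show "?C > 0" using b by simp
 fix v :: "(real^'n) \<times> real => real"
 assume v: "v \<in> hom_sobolev p (slab bm bp)" "has_trace p bm bp bm v (%_. 0)"
 show "Lpow_on (slab bm bp) p v \<le> ennreal ?C * Lpow_on (slab bm bp) p (weak_grad (slab bm bp) v)"
 proof (rule Lpow_exhaust_slab[OF hom_sobolevD(2)[OF slab_open p v(1)]])
  fix R :: real assume "R > 0"
  from poincare_cyl[OF v this] show "Lpow_on (Q R) p v \<le> ennreal ?C * Lpow_on (slab bm bp) p (weak_grad (slab bm bp) v)"
   by (rule order_trans) (intro mult_left_mono Lpow_subset[OF cyl_subset cyl_lebesgue slab_lebesgue]; simp)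
 qed
qed

lemma zero_trace_approx:
 assumes t: "has_trace p bm bp t v (%_. 0)" and R: "R > 0" and e: "e > 0"
 obtains \<phi> where "Cinf \<phi>" "Lpow_on (Q R) p (%x. \<phi> x - v x) < ennreal e"
  "Lpow_on (Q R) p (%x. grad \<phi> x - weak_grad (slab bm bp) v x) < ennreal e"
  "Lpow_on (ball 0 R) p (%y. \<phi> (y, t)) < ennreal e"
proof -
 obtain \<phi> where \<phi>: "\<And>n::nat. Cinf (\<phi> n)"
  "(%n. Lpow_on (Q R) p (%x. \<phi> n x - v x)) \<longlonglongrightarrow> 0"
  "(%n. Lpow_on (Q R) p (%x. grad (\<phi> n) x - weak_grad (slab bm bp) v x)) \<longlonglongrightarrow> 0"
  "(%n. Lpow_on (ball 0 R) p (%y. \<phi> n (y, t) - 0)) \<longlonglongrightarrow> 0" using t R unfolding has_trace_iff by blast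
 have e0: "0 < ennreal e" using e by simp
 have "\<forall>\<^sub>F n in sequentially. Lpow_on (Q R) p (%x. \<phi> n x - v x) < ennreal e \<and>
  Lpow_on (Q R) p (%x. grad (\<phi> n) x - weak_grad (slab bm bp) v x) < ennreal e \<and>
  Lpow_on (ball 0 R) p (%y. \<phi> n (y, t) - 0) < ennreal e"
  by (intro eventually_conj order_tendstoD(2)[OF \<phi>(2) e0] order_tendstoD(2)[OF \<phi>(3) e0] order_tendstoD(2)[OF \<phi>(4) e0])
 then obtain n where "Lpow_on (Q R) p (%x. \<phi> n x - v x) < ennreal e"
  "Lpow_on (Q R) p (%x. grad (\<phi> n) x - weak_grad (slab bm bp) v x) < ennreal e"
  "Lpow_on (ball 0 R) p (%y. \<phi> n (y, t) - 0) < ennreal e" using eventually_happens'[OF sequentially_bot] by blast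
 then show ?thesis using that[OF \<phi>(1)] by simp
qed

text \<open>For each \<open>n\<close> an approximation of \<open>v n\<close> within
  \<open>1 / Suc n\<close> is selected; the selected sequence approximates
  \<open>v0\<close>.\<close>

lemma has_trace_0_limit:
 fixes v :: "nat => (real^'n) \<times> real => real"
 assumes v: "\<And>n. v n \<in> hom_sobolev p (slab bm bp)" "\<And>n. has_trace p bm bp t (v n) (%_. 0)"
  and v0: "v0 \<in> hom_sobolev p (slab bm bp)"
  and lim: "(%n. Lpow_on (slab bm bp) p (%x. v n x - v0 x)) \<longlonglongrightarrow> 0"
   "(%n. Lpow_on (slab bm bp) p (%x. weak_grad (slab bm bp) (v n) x - weak_grad (slab bm bp) v0 x)) \<longlonglongrightarrow> 0"
 shows "has_trace p bm bp t v0 (%_. 0)" unfolding has_trace_iff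
proof (intro allI impI conjI)
 fix R :: real assume R: "R > 0"
 let ?B = "lebesgue_on (ball (0::real^'n) R)" and ?Q = "lebesgue_on (ball (0::real^'n) R \<times> {bm<..<bp})"
 let ?W = "weak_grad (slab bm bp)"
 show "(%_. 0) \<in> borel_measurable ?B" "Lpow ?B p (%_. 0::real) < \<infinity>" using p by (auto simp: Lpow_def)
 have "\<forall>n. \<exists>\<phi>. Cinf \<phi> \<and> Lpow ?Q p (%x. \<phi> x - v n x) < ennreal (1 / real (Suc n)) \<and>
  Lpow ?Q p (%x. grad \<phi> x - ?W (v n) x) < ennreal (1 / real (Suc n)) \<and> Lpow ?B p (%y. \<phi> (y, t)) < ennreal (1 / real (Suc n))"
 proof
  fix n
  have "1 / real (Suc n) > 0" by simp
  from zero_trace_approx[OF v(2) R this, of n] show "\<exists>\<phi>. Cinf \<phi> \<and> Lpow ?Q p (%x. \<phi> x - v n x) < ennreal (1 / real (Suc n)) \<and>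
  Lpow ?Q p (%x. grad \<phi> x - ?W (v n) x) < ennreal (1 / real (Suc n)) \<and> Lpow ?B p (%y. \<phi> (y, t)) < ennreal (1 / real (Suc n))" by blast
 qed
 from choice[OF this] obtain \<phi> where "\<forall>n. Cinf (\<phi> n) \<and> Lpow ?Q p (%x. \<phi> n x - v n x) < ennreal (1 / real (Suc n)) \<and>
  Lpow ?Q p (%x. grad (\<phi> n) x - ?W (v n) x) < ennreal (1 / real (Suc n)) \<and> Lpow ?B p (%y. \<phi> n (y, t)) < ennreal (1 / real (Suc n))" ..
 then have \<phi>: "\<And>n. Cinf (\<phi> n)" "\<And>n. Lpow ?Q p (%x. \<phi> n x - v n x) < ennreal (1 / real (Suc n))"
  "\<And>n. Lpow ?Q p (%x. grad (\<phi> n) x - ?W (v n) x) < ennreal (1 / real (Suc n))"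
  "\<And>n. Lpow ?B p (%y. \<phi> n (y, t)) < ennreal (1 / real (Suc n))" by simp_all
 have "(%n. 1 / real (Suc n)) \<longlonglongrightarrow> 0" by (rule LIMSEQ_Suc[OF lim_1_over_n])
 then have e: "(%n. ennreal (1 / real (Suc n))) \<longlonglongrightarrow> 0" using tendsto_ennrealI by fastforce
 note m = sobolev_cyl_measurable[OF v(1), where R = R] sobolev_cyl_measurable[OF v0, where R = R] smooth_cyl_measurable[OF \<phi>(1)]
 note sub = Lpow_subset[OF cyl_subset cyl_lebesgue slab_lebesgue]
 show "\<exists>\<phi>. (\<forall>n. Cinf (\<phi> n)) \<and> (%n. Lpow ?Q p (%x. \<phi> n x - v0 x)) \<longlonglongrightarrow> 0 \<and>
  (%n. Lpow ?Q p (%x. grad (\<phi> n) x - ?W v0 x)) \<longlonglongrightarrow> 0 \<and> (%n. Lpow ?B p (%y. \<phi> n (y, t) - 0)) \<longlonglongrightarrow> 0"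
 proof (intro exI[of _ \<phi>] conjI allI \<phi>(1))
  have "(%n. Lpow ?Q p (%x. (\<phi> n x - v n x) + (v n x - v0 x))) \<longlonglongrightarrow> 0"
   by (intro Lpow_tendsto_add p0 borel_measurable_diff m tendsto_zero_ennreal_le[OF e less_imp_le[OF \<phi>(2)]] tendsto_zero_ennreal_le[OF lim(1) sub])
  then show "(%n. Lpow ?Q p (%x. \<phi> n x - v0 x)) \<longlonglongrightarrow> 0" by simp
  have "(%n. Lpow ?Q p (%x. (grad (\<phi> n) x - ?W (v n) x) + (?W (v n) x - ?W v0 x))) \<longlonglongrightarrow> 0"
   by (intro Lpow_tendsto_add p0 borel_measurable_diff m tendsto_zero_ennreal_le[OF e less_imp_le[OF \<phi>(3)]] tendsto_zero_ennreal_le[OF lim(2) sub])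
  then show "(%n. Lpow ?Q p (%x. grad (\<phi> n) x - ?W v0 x)) \<longlonglongrightarrow> 0" by simp
  show "(%n. Lpow ?B p (%y. \<phi> n (y, t) - 0)) \<longlonglongrightarrow> 0" using tendsto_zero_ennreal_le[OF e less_imp_le[OF \<phi>(4)]] by simp
 qed
qed

text \<open>Poincare's inequality, applied to differences, turns the convergence of gradients into
  convergence of the functions. The limit is weakly differentiable with gradient \<open>W\<close>,
  and its traces vanish by \<open>has_trace_0_limit\<close>.\<close>

lemma zero_trace_closed:
 fixes v :: "nat => (real^'n) \<times> real => real" and W :: "(real^'n) \<times> real => (real^'n) \<times> real"
 assumes v: "\<And>n. v n \<in> zero_trace p bm bp" and W: "W \<in> borel_measurable (lebesgue_on (slab bm bp))"
  and lim: "(%n. Lpow_on (slab bm bp) p (%x. weak_grad (slab bm bp) (v n) x - W x)) \<longlonglongrightarrow> 0"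
 obtains v0 where "v0 \<in> zero_trace p bm bp" "AE x in lebesgue_on (slab bm bp). weak_grad (slab bm bp) v0 x = W x"
proof -
 let ?S = "slab bm bp :: ((real^'n) \<times> real) set"
 let ?M = "lebesgue_on ?S" and ?W = "weak_grad ?S"
 have vh: "v n \<in> hom_sobolev p ?S" "has_trace p bm bp bm (v n) (%_. 0)" "has_trace p bm bp bp (v n) (%_. 0)" for n
  using v[of n] by (auto simp: zero_trace_def)
 note D = hom_sobolevD[OF slab_open p vh(1)]
 obtain C where C: "C > 0" "\<And>v :: (real^'n) \<times> real => real. v \<in> hom_sobolev p ?S ==> has_trace p bm bp bm v (%_. 0) ==>
  Lpow ?M p v \<le> ennreal C * Lpow ?M p (?W v)" using poincare by blast
 define a where "a n = Lpow ?M p (%x. ?W (v n) x - W x)" for n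
 have diff: "Lpow ?M p (%x. v m x - v n x) \<le> ennreal C * (ennreal (2 powr p) * (a m + a n))" for m n
 proof -
  have z: "(%x. v m x + (-1) * v n x) \<in> zero_trace p bm bp" by (rule zero_trace_lincomb[OF v v])
  have "Lpow ?M p (%x. v m x + (-1) * v n x) \<le> ennreal C * Lpow ?M p (?W (%x. v m x + (-1) * v n x))"
   using z by (intro C(2)) (auto simp: zero_trace_def)
  also have "Lpow ?M p (?W (%x. v m x + (-1) * v n x)) = Lpow ?M p (%x. (?W (v m) x - W x) - (?W (v n) x - W x))"
   by (rule Lpow_cong_AE) (use hom_sobolev_lincomb(2)[OF slab_open p vh(1)[of m] vh(1)[of n], of "-1"] in eventually_elim, simp)
  also have "\<dots> \<le> ennreal (2 powr p) * (a m + a n)" unfolding a_def by (intro Lpow_diff_le p0 borel_measurable_diff D W)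
  finally show ?thesis by (simp add: mult_left_mono)
 qed
 have a0: "(%n. ennreal C * (ennreal (2 powr p) * a n)) \<longlonglongrightarrow> 0"
  using lim by (intro tendsto_cmult_zero_ennreal) (simp_all add: a_def)
 obtain v0 where v0: "v0 \<in> borel_measurable ?M" "(%n. Lpow ?M p (%x. v n x - v0 x)) \<longlonglongrightarrow> 0"
 proof (rule Lpow_complete[OF p0, of v ?M])
  show "v n \<in> borel_measurable ?M" for n by (rule D)
  fix e :: real assume e: "e > 0"
  have "\<forall>\<^sub>F n in sequentially. ennreal C * (ennreal (2 powr p) * a n) < ennreal (e / 2)"
   by (rule order_tendstoD(2)[OF a0]) (use e in simp)
  then obtain N where N: "\<And>n. n \<ge> N ==> ennreal C * (ennreal (2 powr p) * a n) < ennreal (e / 2)"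
   by (auto simp: eventually_sequentially)
  have "Lpow ?M p (%x. v m x - v n x) \<le> ennreal e" if "m \<ge> N" "n \<ge> N" for m n
  proof -
   have "Lpow ?M p (%x. v m x - v n x) \<le> ennreal C * (ennreal (2 powr p) * a m) + ennreal C * (ennreal (2 powr p) * a n)"
    using diff[of m n] by (simp add: distrib_left)
   also have "\<dots> \<le> ennreal (e / 2) + ennreal (e / 2)" by (intro add_mono less_imp_le[OF N] that)
   also have "\<dots> = ennreal e" using e by (simp add: ennreal_plus[symmetric] del: ennreal_plus)
   finally show ?thesis .
  qed
  then show "\<exists>N. \<forall>m\<ge>N. \<forall>n\<ge>N. Lpow ?M p (%x. v m x - v n x) \<le> ennreal e" by blast
 qed
 \<comment> \<open>One member of the sequence close to the limit suffices to see that the limit has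
   finite norm.\<close>
 have fin_lim: "Lpow ?M p h < \<infinity>"
  if h: "h \<in> borel_measurable ?M" "\<And>n. f n \<in> borel_measurable ?M" "\<And>n. Lpow ?M p (f n) < \<infinity>" "(%n. Lpow ?M p (%x. f n x - h x)) \<longlonglongrightarrow> 0"
  for f :: "nat => (real^'n) \<times> real => 'd::euclidean_space" and h
 proof -
  have "\<forall>\<^sub>F n in sequentially. Lpow ?M p (%x. f n x - h x) < 1" by (rule order_tendstoD(2)[OF h(4)]) simp
  then obtain n where n: "Lpow ?M p (%x. f n x - h x) < 1" using eventually_happens'[OF sequentially_bot] by blast
  have "Lpow ?M p (%x. f n x - (f n x - h x)) < \<infinity>"
   by (rule Lpow_diff_fin[OF p0 h(2) _ h(3)]) (use n h in "auto intro: less_trans")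
  then show ?thesis by simp
 qed
 have "Lpow ?M p (v n) < \<infinity>" for n
 proof -
  have "Lpow ?M p (v n) \<le> ennreal C * Lpow ?M p (?W (v n))" by (rule C(2)[OF vh(1,2)])
  also have "\<dots> < \<infinity>" using D(4)[of n] by (simp add: ennreal_mult_less_top)
  finally show ?thesis .
 qed
 from fin_lim[OF v0(1) D(2) this v0(2)] have f0: "Lpow ?M p v0 < \<infinity>" .
 have fW: "Lpow ?M p W < \<infinity>" by (rule fin_lim[OF W D(3) D(4) lim])
 have L: "L1loc_on ?S h" if h: "h \<in> borel_measurable ?M" "Lpow ?M p h < \<infinity>" for h
 proof (rule Lpow_imp_L1loc[OF p slab_lebesgue h(1)])
  fix K :: "((real^'n) \<times> real) set" assume K: "compact K" "K \<subseteq> ?S"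
  have "K \<in> sets lebesgue" by (intro sets_completionI_sets) (simp add: borel_closed[OF compact_imp_closed[OF K(1)]])
  from Lpow_subset[OF K(2) this slab_lebesgue] h(2) show "Lpow_on K p h < \<infinity>" by (rule le_less_trans)
 qed
 have weak: "has_weak_partial ?S i v0 (%x. W x \<bullet> i)" if i: "i \<in> Basis" for i
 proof (rule has_weak_partial_limit[OF p slab_open i D(1)[OF i] L[OF v0(1) f0] L _ ])
  show Wi: "(%x. W x \<bullet> i) \<in> borel_measurable ?M" using W by measurable
  have "Lpow ?M p (%x. W x \<bullet> i) \<le> Lpow ?M p W" by (rule Lpow_mono) (use i p0 in "auto simp: Basis_le_norm")
  then show "Lpow ?M p (%x. W x \<bullet> i) < \<infinity>" using fW by (rule le_less_trans)
  show "(%n. Lpow ?M p (%x. v n x - v0 x)) \<longlonglongrightarrow> 0" by (rule v0)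
  show "(%n. Lpow ?M p (%x. ?W (v n) x \<bullet> i - W x \<bullet> i)) \<longlonglongrightarrow> 0" by (rule tendsto_zero_ennreal_le[OF lim])
    (rule Lpow_mono, use i p0 in \<open>auto simp: Basis_le_norm inner_diff_left[symmetric]\<close>)
 qed
 have h0: "v0 \<in> hom_sobolev p ?S" by (rule hom_sobolevI[OF slab_open p weak W fW])
 have AE: "AE x in ?M. ?W v0 x = W x" by (rule weak_grad_eq[OF slab_open weak])
 have "Lpow ?M p (%x. ?W (v n) x - ?W v0 x) = a n" for n unfolding a_def by (rule Lpow_cong_AE) (use AE in eventually_elim, simp)
 then have lim': "(%n. Lpow ?M p (%x. ?W (v n) x - ?W v0 x)) \<longlonglongrightarrow> 0" using lim by (simp add: a_def)
 have "v0 \<in> zero_trace p bm bp"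
  using has_trace_0_limit[OF vh(1,2) h0 v0(2) lim'] has_trace_0_limit[OF vh(1,3) h0 v0(2) lim'] h0 by (simp add: zero_trace_def)
 then show ?thesis using AE by (rule that)
qed

end

subsection \<open>Existence and the a priori estimate\<close>

lemma dirichlet_solution_iff:
 fixes g :: "(real^'n) \<times> real => (real^'n) \<times> real"
 shows "dirichlet_solution p bm bp g fm fp u \<longleftrightarrow>
   u \<in> hom_sobolev p (slab bm bp) \<and> has_trace p bm bp bm u fm \<and> has_trace p bm bp bp u fp \<and>
   (\<forall>v\<in>zero_trace p bm bp. (\<integral>x. (p_flux p (weak_grad (slab bm bp) u x) + g x) \<bullet> weak_grad (slab bm bp) v x \<partial>lebesgue_on (slab bm bp)) = 0)"
proof -
 have L: "(LINT x:slab bm bp|lebesgue. f x) = (\<integral>x. f x \<partial>lebesgue_on (slab bm bp))" for f :: "(real^'n) \<times> real => real"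
  using slab_lebesgue[of bm bp] by (simp add: set_lebesgue_integral_def integral_restrict_space)
 then show ?thesis unfolding dirichlet_solution_def strip_eq_slab zero_trace_def L by blast
qed

lemma dirichlet_existence:
 fixes g :: "(real^'n) \<times> real => (real^'n) \<times> real"
 assumes p: "p > 1" and pq: "1 / p + 1 / q = 1" and b: "bm < bp"
  and g: "g \<in> borel_measurable (lebesgue_on (slab bm bp))" "Lpow_on (slab bm bp) q g < \<infinity>"
  and w: "w \<in> hom_sobolev p (slab bm bp)" "has_trace p bm bp bm w fm" "has_trace p bm bp bp w fp"
 obtains u where "dirichlet_solution p bm bp g fm fp u"
proof -
 let ?S = "slab bm bp :: ((real^'n) \<times> real) set"
 let ?M = "lebesgue_on ?S" and ?W = "weak_grad ?S"
 have p0: "p > 0" using p by simp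
 \<comment> \<open>The minimisation runs over gradients rather than functions. Membership is tested
   up to null sets, since \<open>?W\<close> is additive only almost everywhere.\<close>
 define A where "A = {z \<in> borel_measurable ?M. \<exists>v\<in>zero_trace p bm bp. AE x in ?M. z x = ?W w x + ?W v x}"
 note W = hom_sobolevD[OF slab_open p w(1)]
 have Z: "?W v \<in> borel_measurable ?M" "Lpow ?M p (?W v) < \<infinity>" if "v \<in> zero_trace p bm bp" for v
  using that hom_sobolevD(3,4)[OF slab_open p] by (auto simp: zero_trace_def)
 have lin: "AE x in ?M. ?W (%x. u x + c * v x) x = ?W u x + c *\<^sub>R ?W v x"
  if "u \<in> hom_sobolev p ?S" "v \<in> hom_sobolev p ?S" for u v c by (rule hom_sobolev_lincomb(2)[OF slab_open p that])
 have zh: "v \<in> hom_sobolev p ?S" if "v \<in> zero_trace p bm bp" for v using that by (simp add: zero_trace_def)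
 have A_fin: "Lpow ?M p z < \<infinity>" if "z \<in> A" for z
 proof -
  obtain v where v: "v \<in> zero_trace p bm bp" "AE x in ?M. z x = ?W w x + ?W v x" using \<open>z \<in> A\<close> by (auto simp: A_def)
  show ?thesis unfolding Lpow_cong_AE[OF v(2)] by (rule Lpow_add_fin[OF p0 W(3) Z(1)[OF v(1)] W(4) Z(2)[OF v(1)]])
 qed
 have A_add: "(%x. z x + t *\<^sub>R ?W v x) \<in> A" if z: "z \<in> A" and v: "v \<in> zero_trace p bm bp" for z v t
 proof -
  obtain v' where v': "v' \<in> zero_trace p bm bp" "AE x in ?M. z x = ?W w x + ?W v' x" and zm: "z \<in> borel_measurable ?M"
   using z by (auto simp: A_def)
  have "AE x in ?M. z x + t *\<^sub>R ?W v x = ?W w x + ?W (%x. v' x + t * v x) x"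
   using v'(2) lin[OF zh[OF v'(1)] zh[OF v], of t] by eventually_elim (simp add: add.assoc)
  moreover have "(%x. z x + t *\<^sub>R ?W v x) \<in> borel_measurable ?M"
   using zm Z(1)[OF v] by (intro borel_measurable_add borel_measurable_scaleR) auto
  ultimately show ?thesis using zero_trace_lincomb[OF p b v'(1) v, of t] by (auto simp: A_def)
 qed
 obtain z where z: "z \<in> A" "\<And>y. y \<in> A ==> energy ?M p q g z \<le> energy ?M p q g y"
 proof (rule energy_minimiser[OF p pq g])
  have "AE x in ?M. ?W w x = ?W w x + ?W (%_. 0) x" using weak_grad_0[OF p b] by eventually_elim simp
  then have "?W w \<in> A" using W(3) zero_trace_0[OF p b] by (auto simp: A_def)
  then show "A \<noteq> {}" by blast
  show "z \<in> borel_measurable ?M" if "z \<in> A" for z using that by (simp add: A_def)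
  show "Lpow ?M p z < \<infinity>" if "z \<in> A" for z by (rule A_fin[OF that])
  show "(%x. (1/2) *\<^sub>R (y x + z x)) \<in> A" if y: "y \<in> A" and z: "z \<in> A" for y z
  proof -
   obtain v1 where v1: "v1 \<in> zero_trace p bm bp" "AE x in ?M. y x = ?W w x + ?W v1 x" and ym: "y \<in> borel_measurable ?M"
    using y by (auto simp: A_def)
   obtain v2 where v2: "v2 \<in> zero_trace p bm bp" "AE x in ?M. z x = ?W w x + ?W v2 x" and zm: "z \<in> borel_measurable ?M"
    using z by (auto simp: A_def)
   \<comment> \<open>The midpoint is written with the difference \<open>v2 - v1\<close> to match the
     form \<open>u + c * v\<close> in which linear combinations are available.\<close>
   let ?d = "%x. v2 x + (-1) * v1 x"
   have d: "?d \<in> zero_trace p bm bp" by (rule zero_trace_lincomb[OF p b v2(1) v1(1)])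
   have "(%x. v1 x + (1/2) * ?d x) \<in> zero_trace p bm bp" by (rule zero_trace_lincomb[OF p b v1(1) d])
   moreover have "AE x in ?M. (1/2) *\<^sub>R (y x + z x) = ?W w x + ?W (%x. v1 x + (1/2) * ?d x) x"
    using v1(2) v2(2) lin[OF zh[OF v1(1)] zh[OF d], of "1/2"] lin[OF zh[OF v2(1)] zh[OF v1(1)], of "-1"]
   proof eventually_elim
    case (elim x)
    have "(1/2) *\<^sub>R ((a + c) + (a + e)) = a + (c + (1/2) *\<^sub>R (e + (-1) *\<^sub>R c))" for a c e :: "(real^'n) \<times> real"
    proof -
     have "a = (1/2) *\<^sub>R a + (1/2) *\<^sub>R a" "c = (1/2) *\<^sub>R c + (1/2) *\<^sub>R c" by (simp_all add: scaleR_left_distrib[symmetric])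
     then show ?thesis by (simp add: algebra_simps)
    qed
    then show ?case unfolding elim .
   qed
   moreover have "(%x. (1/2) *\<^sub>R (y x + z x)) \<in> borel_measurable ?M" using ym zm by measurable
   ultimately show ?thesis by (auto simp: A_def)
  qed
  show "\<exists>h'\<in>A. AE x in ?M. h' x = h x"
   if zn: "\<And>n. z n \<in> A" and h: "h \<in> borel_measurable ?M" and lim: "(%n. Lpow ?M p (%x. z n x - h x)) \<longlonglongrightarrow> 0" for z h
  proof -
   have "\<forall>n. \<exists>v. v \<in> zero_trace p bm bp \<and> (AE x in ?M. z n x = ?W w x + ?W v x)" using zn by (auto simp: A_def)
   from choice[OF this] obtain v where v: "\<And>n. v n \<in> zero_trace p bm bp" "\<And>n. AE x in ?M. z n x = ?W w x + ?W (v n) x" by auto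
   \<comment> \<open>Subtracting the gradient of \<open>w\<close> brings the limit into the setting
     of zero traces.\<close>
   have "Lpow ?M p (%x. ?W (v n) x - (h x - ?W w x)) = Lpow ?M p (%x. z n x - h x)" for n
    by (rule Lpow_cong_AE) (use v(2)[of n] in eventually_elim, simp add: algebra_simps)
   then have "(%n. Lpow ?M p (%x. ?W (v n) x - (h x - ?W w x))) \<longlonglongrightarrow> 0" using lim by simp
   then obtain v0 where v0: "v0 \<in> zero_trace p bm bp" "AE x in ?M. ?W v0 x = h x - ?W w x"
    by (rule zero_trace_closed[OF p b v(1) borel_measurable_diff[OF h W(3)]])
   have "AE x in ?M. h x = ?W w x + ?W v0 x" using v0(2) by eventually_elim simp
   then have "h \<in> A" using h v0(1) by (auto simp: A_def)
   then show ?thesis by auto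
  qed
 qed blast
 obtain v0 where v0: "v0 \<in> zero_trace p bm bp" "AE x in ?M. z x = ?W w x + ?W v0 x" and zm: "z \<in> borel_measurable ?M"
  using z(1) by (auto simp: A_def)
 define u where "u x = w x + 1 * v0 x" for x
 have u: "u \<in> hom_sobolev p ?S" unfolding u_def by (rule hom_sobolev_lincomb(1)[OF slab_open p w(1) zh[OF v0(1)]])
 have uz: "AE x in ?M. ?W u x = z x" using v0(2) lin[OF w(1) zh[OF v0(1)], of 1] unfolding u_def by eventually_elim simp
 have tr: "has_trace p bm bp bm u fm" "has_trace p bm bp bp u fp"
  using has_trace_lincomb[OF p b w(1) zh[OF v0(1)] w(2), of "%_. 0" 1] has_trace_lincomb[OF p b w(1) zh[OF v0(1)] w(3), of "%_. 0" 1] v0(1)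
  by (simp_all add: u_def[abs_def] zero_trace_def)
 have "(\<integral>x. (p_flux p (?W u x) + g x) \<bullet> ?W v x \<partial>?M) = 0" if v: "v \<in> zero_trace p bm bp" for v
 proof -
  have "(\<integral>x. (p_flux p (?W u x) + g x) \<bullet> ?W v x \<partial>?M) = (\<integral>x. (p_flux p (z x) + g x) \<bullet> ?W v x \<partial>?M)"
  proof (rule integral_cong_AE)
   show "(%x. (p_flux p (?W u x) + g x) \<bullet> ?W v x) \<in> borel_measurable ?M"
    using hom_sobolevD(3)[OF slab_open p u] Z(1)[OF v] g(1)
    by (intro borel_measurable_inner borel_measurable_add p_flux_measurable[OF p pq])
   show "(%x. (p_flux p (z x) + g x) \<bullet> ?W v x) \<in> borel_measurable ?M"
    using zm Z(1)[OF v] g(1) by (intro borel_measurable_inner borel_measurable_add p_flux_measurable[OF p pq])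
   show "AE x in ?M. (p_flux p (?W u x) + g x) \<bullet> ?W v x = (p_flux p (z x) + g x) \<bullet> ?W v x" using uz by eventually_elim simp
  qed
  also have "\<dots> = 0" by (rule energy_minimiser_flux[OF p pq g zm Z(1)[OF v] A_fin[OF z(1)] Z(2)[OF v] z(2)[OF A_add[OF z(1) v]]])
  finally show ?thesis .
 qed
 then show ?thesis using that[of u] u tr by (simp add: dirichlet_solution_iff)
qed

text \<open>The bound concerns every solution, not only the minimiser, and every \<open>w\<close>
  with the same traces: the difference \<open>u - w\<close> is an admissible test function.\<close>

lemma dirichlet_estimate:
 fixes p q bm bp :: real
 assumes p: "p > 1" and pq: "1 / p + 1 / q = 1" and b: "bm < bp"
 obtains C where "C > 0" "\<And>(g :: (real^'n) \<times> real => (real^'n) \<times> real) fm fp u w.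
  g \<in> borel_measurable (lebesgue_on (slab bm bp)) ==> Lpow_on (slab bm bp) q g < \<infinity> ==>
  dirichlet_solution p bm bp g fm fp u ==>
  w \<in> hom_sobolev p (slab bm bp) ==> has_trace p bm bp bm w fm ==> has_trace p bm bp bp w fp ==>
  Lpow_on (slab bm bp) p (weak_grad (slab bm bp) u) \<le>
   ennreal C * Lpow_on (slab bm bp) q g + ennreal C * Lpow_on (slab bm bp) p (weak_grad (slab bm bp) w)"
proof -
 let ?S = "slab bm bp :: ((real^'n) \<times> real) set"
 let ?M = "lebesgue_on ?S" and ?W = "weak_grad ?S"
 obtain C where C: "C > 0" "\<And>(M :: ((real^'n) \<times> real) measure) (g :: (real^'n) \<times> real => (real^'n) \<times> real) z w.
  g \<in> borel_measurable M ==> z \<in> borel_measurable M ==> w \<in> borel_measurable M ==>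
  Lpow M q g < \<infinity> ==> Lpow M p z < \<infinity> ==> Lpow M p w < \<infinity> ==>
  (\<integral>x. (p_flux p (z x) + g x) \<bullet> (z x - w x) \<partial>M) = 0 ==>
  Lpow M p z \<le> ennreal C * Lpow M q g + ennreal C * Lpow M p w" using flux_estimate[OF p pq] by blast
 show ?thesis
 proof (rule that[OF C(1)])
  fix g :: "(real^'n) \<times> real => (real^'n) \<times> real" and fm fp u w
  assume g: "g \<in> borel_measurable ?M" "Lpow ?M q g < \<infinity>" and sol: "dirichlet_solution p bm bp g fm fp u"
   and w: "w \<in> hom_sobolev p ?S" "has_trace p bm bp bm w fm" "has_trace p bm bp bp w fp"
  have u: "u \<in> hom_sobolev p ?S" "has_trace p bm bp bm u fm" "has_trace p bm bp bp u fp"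
   and orth: "\<And>v. v \<in> zero_trace p bm bp ==> (\<integral>x. (p_flux p (?W u x) + g x) \<bullet> ?W v x \<partial>?M) = 0"
   using sol by (auto simp: dirichlet_solution_iff)
  note U = hom_sobolevD(3,4)[OF slab_open p u(1)] and W = hom_sobolevD(3,4)[OF slab_open p w(1)]
  let ?v = "%x. u x + (-1) * w x"
  have vh: "?v \<in> hom_sobolev p ?S" by (rule hom_sobolev_lincomb(1)[OF slab_open p u(1) w(1)])
  have "?v \<in> zero_trace p bm bp"
   using has_trace_lincomb[OF p b u(1) w(1) u(2) w(2), of "-1"] has_trace_lincomb[OF p b u(1) w(1) u(3) w(3), of "-1"] vh
   by (simp add: zero_trace_def)
  from orth[OF this] have "(\<integral>x. (p_flux p (?W u x) + g x) \<bullet> ?W ?v x \<partial>?M) = 0" .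
  moreover have "(\<integral>x. (p_flux p (?W u x) + g x) \<bullet> ?W ?v x \<partial>?M) = (\<integral>x. (p_flux p (?W u x) + g x) \<bullet> (?W u x - ?W w x) \<partial>?M)"
  proof (rule integral_cong_AE)
   show "(%x. (p_flux p (?W u x) + g x) \<bullet> ?W ?v x) \<in> borel_measurable ?M"
    using U(1) hom_sobolevD(3)[OF slab_open p vh] g(1) by (intro borel_measurable_inner borel_measurable_add p_flux_measurable[OF p pq])
   show "(%x. (p_flux p (?W u x) + g x) \<bullet> (?W u x - ?W w x)) \<in> borel_measurable ?M"
    using U(1) W(1) g(1) by (intro borel_measurable_inner borel_measurable_add borel_measurable_diff p_flux_measurable[OF p pq])
   show "AE x in ?M. (p_flux p (?W u x) + g x) \<bullet> ?W ?v x = (p_flux p (?W u x) + g x) \<bullet> (?W u x - ?W w x)"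
    using hom_sobolev_lincomb(2)[OF slab_open p u(1) w(1), of "-1"] by eventually_elim simp
  qed
  ultimately have "(\<integral>x. (p_flux p (?W u x) + g x) \<bullet> (?W u x - ?W w x) \<partial>?M) = 0" by simp
  from C(2)[OF g(1) U(1) W(1) g(2) U(2) W(2) this]
  show "Lpow ?M p (?W u) \<le> ennreal C * Lpow ?M q g + ennreal C * Lpow ?M p (?W w)" .
 qed
qed

text \<open>The classical gradient of the extension is also its weak gradient, by
  \<open>weak_grad_eq\<close>; the approximations \<open>\<Phi>\<close> then have the form that
  \<open>has_trace\<close> asks for, on both faces.\<close>

lemma extension_sobolev:
 fixes a p bm bp :: real
 assumes b: "bm < bp" and a: "0 < a" and p: "1 < p"
 obtains C where "C \<ge> 0"
  "\<And>fm fp :: real^'n => real. fm \<in> borel_measurable borel ==> fp \<in> borel_measurable borel ==>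
   L1loc_on UNIV fm ==> L1loc_on UNIV fp ==> gagliardo a p fm < \<infinity> ==> gagliardo a p fp < \<infinity> ==>
   Lpow lborel p (%x. fp x - fm x) < \<infinity> ==>
   \<exists>w. w \<in> hom_sobolev p (slab bm bp) \<and> has_trace p bm bp bm w fm \<and> has_trace p bm bp bp w fp \<and>
    Lpow_on (slab bm bp) p (weak_grad (slab bm bp) w) \<le>
     ennreal C * (Lpow lborel p (%x. fp x - fm x) + gagliardo a p fm + gagliardo a p fp)"
proof (rule extension[OF b a p, where 'a = "real^'n"], goal_cases)
 case (1 C)
 let ?S = "slab bm bp :: ((real^'n) \<times> real) set"
 let ?W = "weak_grad ?S"
 show ?case
 proof (rule that[OF 1(2)])
  fix fm fp :: "real^'n => real"
  assume f: "fm \<in> borel_measurable borel" "fp \<in> borel_measurable borel" "L1loc_on UNIV fm" "L1loc_on UNIV fp"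
   "gagliardo a p fm < \<infinity>" "gagliardo a p fp < \<infinity>" "Lpow lborel p (%x. fp x - fm x) < \<infinity>"
  let ?G = "Lpow lborel p (%x. fp x - fm x) + gagliardo a p fm + gagliardo a p fp" and ?C = "%R. lebesgue_on (ball 0 R \<times> {bm<..<bp}) :: ((real^'n) \<times> real) measure"
  from 1(3)[OF f] obtain w \<Phi> where fin: "\<And>R. Lpow_on (ball 0 R) p fm < \<infinity>" "\<And>R. Lpow_on (ball 0 R) p fp < \<infinity>"
   and w: "\<And>i. i \<in> Basis ==> has_weak_partial ?S i w (partial_deriv i w)" "continuous_on ?S (grad w)"
    "Lpow_on ?S p (grad w) \<le> ennreal C * ?G"
   and \<Phi>: "\<And>k::nat. Cinf (\<Phi> k)" "\<And>R. (%k. Lpow (?C R) p (%X. \<Phi> k X - w X)) \<longlonglongrightarrow> 0"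
    "\<And>R. (%k. Lpow (?C R) p (%X. grad (\<Phi> k) X - grad w X)) \<longlonglongrightarrow> 0"
    "\<And>R. (%k. Lpow_on (ball 0 R) p (%x. \<Phi> k (x, bm) - fm x)) \<longlonglongrightarrow> 0"
    "\<And>R. (%k. Lpow_on (ball 0 R) p (%x. \<Phi> k (x, bp) - fp x)) \<longlonglongrightarrow> 0" by (elim conjE exE) blast
  have h: "has_weak_partial ?S i w (%x. grad w x \<bullet> i)" if "i \<in> Basis" for i using w(1)[OF that] that by (simp add: grad_def)
  have AE: "AE x in lebesgue_on ?S. ?W w x = grad w x" by (rule weak_grad_eq[OF slab_open h])
  have m: "grad w \<in> borel_measurable (lebesgue_on ?S)"
   using w(2) by (rule continuous_imp_measurable_on_sets_lebesgue[OF _ slab_lebesgue])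
  have "ennreal C * ?G < \<infinity>"
   using f(5-7) by (simp add: ennreal_mult_less_top)
  with w(3) have "Lpow_on ?S p (grad w) < \<infinity>" by (rule le_less_trans)
  then have wh: "w \<in> hom_sobolev p ?S" by (intro hom_sobolevI[OF slab_open p, where W = "grad w"] h m)
  have AQ: "AE x in lebesgue_on (ball 0 R \<times> {bm<..<bp}). ?W w x = grad w x" for R
   by (rule AE_lebesgue_on_subset[OF AE cyl_subset cyl_lebesgue slab_lebesgue])
  have gr: "Lpow (?C R) p (%X. grad (\<Phi> k) X - ?W w X)
   = Lpow (?C R) p (%X. grad (\<Phi> k) X - grad w X)" for R k
   by (rule Lpow_cong_AE) (use AQ[of R] in eventually_elim, simp)
  have \<Phi>3: "(%k. Lpow (?C R) p (%X. grad (\<Phi> k) X - ?W w X)) \<longlonglongrightarrow> 0" for R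
   unfolding gr by (rule \<Phi>(3))
  have "has_trace p bm bp bm w fm" unfolding has_trace_iff
   by (intro allI impI conjI exI[of _ \<Phi>] borel_measurable_lebesgue_on f fin \<Phi>(1,2,4) \<Phi>3)
  moreover have "has_trace p bm bp bp w fp" unfolding has_trace_iff
   by (intro allI impI conjI exI[of _ \<Phi>] borel_measurable_lebesgue_on f fin \<Phi>(1,2,5) \<Phi>3)
  moreover have "Lpow_on ?S p (?W w) \<le> ennreal C * ?G"
   using w(3) Lpow_cong_AE[OF AE, of p] by simp
  ultimately show "\<exists>w. w \<in> hom_sobolev p ?S \<and> has_trace p bm bp bm w fm \<and> has_trace p bm bp bp w fp \<and>
    Lpow_on ?S p (?W w) \<le> ennreal C * ?G"
   using wh by blast
 qed
qed

subsection \<open>Regularity of traces\<close>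

lemma AE_lborel_translate:
 fixes x :: "'a::euclidean_space"
 assumes "AE y in lborel. P y"
 shows "AE h in lborel. P (x + h)"
proof -
 obtain N where N: "{y. \<not> P y} \<subseteq> N" "N \<in> null_sets lborel" using assms by (auto simp: eventually_ae_filter)
 have [measurable]: "N \<in> sets borel" using N(2) by auto
 have "(\<integral>\<^sup>+h. indicator N (x + h) \<partial>lborel) = (\<integral>\<^sup>+y. indicator N y \<partial>lborel)" by (rule nn_integral_lborel_translate) measurable
 also have "\<dots> = 0" using N(2) by auto
 finally have "AE h in lborel. indicator N (x + h) = (0 :: ennreal)" by (subst (asm) nn_integral_0_iff_AE) auto
 then show ?thesis by eventually_elim (use N(1) in "auto simp: indicator_def split: if_splits")
qed

definition gagliardo_at :: "real => real => ('a::euclidean_space => real) => 'a => ennreal" where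
 "gagliardo_at a p f x = (\<integral>\<^sup>+h. ennreal (\<bar>f (x + h) - f x\<bar> powr p / norm h powr (p + DIM('a) - 1)) * indicator (ball 0 a) h \<partial>lborel)"

lemma gagliardo_at_measurable [measurable]:
 assumes [measurable]: "f \<in> borel_measurable borel"
 shows "gagliardo_at a p f \<in> borel_measurable borel" unfolding gagliardo_at_def by measurable

text \<open>Fatou's lemma is applied to both integrals. Restricting \<open>x\<close> to the ball of
  radius \<open>R - a\<close> keeps \<open>x + h\<close> in the ball where convergence is
  known.\<close>

lemma gagliardo_at_Fatou:
 fixes f :: "'a::euclidean_space => real"
 assumes p: "p > 0" and m [measurable]: "\<And>k. \<phi> k \<in> borel_measurable borel"
  and conv: "AE y in lborel. y \<in> ball 0 R \<longrightarrow> (%k. \<phi> k y) \<longlonglongrightarrow> f y"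
 shows "(\<integral>\<^sup>+x. gagliardo_at a p f x * indicator (ball 0 (R - a)) x \<partial>lborel)
  \<le> liminf (%k. \<integral>\<^sup>+x. gagliardo_at a p (\<phi> k) x * indicator (ball 0 (R - a)) x \<partial>lborel)"
proof -
 have "(\<integral>\<^sup>+x. gagliardo_at a p f x * indicator (ball 0 (R - a)) x \<partial>lborel)
  \<le> (\<integral>\<^sup>+x. liminf (%k. gagliardo_at a p (\<phi> k) x * indicator (ball 0 (R - a)) x) \<partial>lborel)"
 proof (rule nn_integral_mono_AE, use conv in eventually_elim)
  case (elim x)
  show ?case
  proof (cases "x \<in> ball 0 (R - a)")
   case True
   let ?F = "%f h. ennreal (\<bar>f (x + h) - f x\<bar> powr p / norm h powr (p + DIM('a) - 1)) * indicator (ball 0 a) h"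
   have "gagliardo_at a p f x \<le> (\<integral>\<^sup>+h. liminf (%k. ?F (\<phi> k) h) \<partial>lborel)" unfolding gagliardo_at_def
   proof (rule nn_integral_mono_AE, use AE_lborel_translate[OF conv, of x] in eventually_elim)
    case (elim h)
    show ?case
    proof (cases "h \<in> ball 0 a")
     case h: True
     have "x \<in> ball 0 R" using True h norm_ge_zero[of h] unfolding mem_ball_0 by linarith
     moreover have "x + h \<in> ball 0 R" using True h norm_triangle_ineq[of x h] by simp
     ultimately have "(%k. \<phi> k (x + h)) \<longlonglongrightarrow> f (x + h)" "(%k. \<phi> k x) \<longlonglongrightarrow> f x"
      using elim \<open>x \<in> ball 0 R \<longrightarrow> (%k. \<phi> k x) \<longlonglongrightarrow> f x\<close> by auto
     then have "(%k. ennreal (\<bar>\<phi> k (x + h) - \<phi> k x\<bar> powr p / norm h powr (p + DIM('a) - 1)))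
      \<longlonglongrightarrow> ennreal (\<bar>f (x + h) - f x\<bar> powr p / norm h powr (p + DIM('a) - 1))"
     proof (cases "h = 0")
      case False
      assume lims: "(%k. \<phi> k (x + h)) \<longlonglongrightarrow> f (x + h)" "(%k. \<phi> k x) \<longlonglongrightarrow> f x"
      have "(%k. \<bar>\<phi> k (x + h) - \<phi> k x\<bar> powr p) \<longlonglongrightarrow> \<bar>f (x + h) - f x\<bar> powr p"
       using p by (intro tendsto_powr' tendsto_rabs tendsto_diff lims tendsto_const) auto
      then show ?thesis using False by (intro tendsto_ennrealI tendsto_divide tendsto_const) auto
     qed simp
     from lim_imp_Liminf[OF sequentially_bot this] h show ?thesis by simp
    qed simp
   qed
   also have "\<dots> \<le> liminf (%k. gagliardo_at a p (\<phi> k) x)" unfolding gagliardo_at_def by (rule nn_integral_liminf) measurable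
   finally show ?thesis using True by simp
  qed simp
 qed
 also have "\<dots> \<le> liminf (%k. \<integral>\<^sup>+x. gagliardo_at a p (\<phi> k) x * indicator (ball 0 (R - a)) x \<partial>lborel)"
  by (rule nn_integral_liminf) measurable
 finally show ?thesis .
qed

lemma gagliardo_exhaust:
 fixes f :: "'a::euclidean_space => real"
 assumes [measurable]: "f \<in> borel_measurable borel" and a: "a > 0"
  and le: "\<And>R. R > 0 ==> (\<integral>\<^sup>+x. gagliardo_at a p f x * indicator (ball 0 (R - a)) x \<partial>lborel) \<le> B"
 shows "gagliardo a p f \<le> B"
proof -
 let ?F = "%n x. gagliardo_at a p f x * indicator (ball (0::'a) (real n)) x"
 have "gagliardo a p f = (\<integral>\<^sup>+x. gagliardo_at a p f x \<partial>lborel)" by (simp add: gagliardo_def gagliardo_at_def)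
 also have "\<dots> = (\<integral>\<^sup>+x. (SUP n. ?F n x) \<partial>lborel)"
 proof (rule nn_integral_cong)
  fix x :: 'a
  obtain n where n: "norm x < real n" using reals_Archimedean2 by blast
  show "gagliardo_at a p f x = (SUP n. ?F n x)"
  proof (rule antisym)
   show "(SUP n. ?F n x) \<le> gagliardo_at a p f x" by (rule SUP_least) (simp add: indicator_def)
   show "gagliardo_at a p f x \<le> (SUP n. ?F n x)" by (rule SUP_upper2[of n]) (use n in auto)
  qed
 qed
 also have "\<dots> = (SUP n. \<integral>\<^sup>+x. ?F n x \<partial>lborel)"
 proof (rule nn_integral_monotone_convergence_SUP)
  show "incseq ?F" by (intro incseq_SucI le_funI mult_left_mono) (auto simp: indicator_def)
 qed measurable
 also have "\<dots> \<le> B"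
 proof (rule SUP_least)
  \<comment> \<open>The ball of radius \<open>n\<close> is obtained from
    \<open>R = n + a\<close>.\<close>
  fix n show "(\<integral>\<^sup>+x. ?F n x \<partial>lborel) \<le> B" using le[of "real n + a"] a by simp
 qed
 finally show ?thesis .
qed

context
 fixes p bm bp :: real
 assumes p: "p > 1" and b: "bm < bp"
begin

private lemma p0': "p > 0" using p by simp

text \<open>The bound for smooth functions passes to the trace along a subsequence converging almost
  everywhere on the face; its constant does not depend on the radius \<open>R\<close>.\<close>

lemma trace_gagliardo:
 fixes a t0 e :: real
 assumes a: "a > 0" and e: "e\<^sup>2 = 1" and st: "\<And>s. 0 < s ==> s < bp - bm ==> bm < t0 + e * s \<and> t0 + e * s < bp"
 obtains C where "C \<ge> 0" "\<And>(u :: (real^'n) \<times> real => real) f. u \<in> hom_sobolev p (slab bm bp) ==> has_trace p bm bp t0 u f ==>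
  f \<in> borel_measurable borel ==> gagliardo a p f \<le> ennreal C * Lpow_on (slab bm bp) p (weak_grad (slab bm bp) u)"
proof -
 obtain C where C: "C \<ge> 0" "\<And>(\<phi> :: (real^'n) \<times> real => real) R. Cinf \<phi> ==>
  (\<integral>\<^sup>+x. (\<integral>\<^sup>+h. ennreal (\<bar>\<phi> (x + h, t0) - \<phi> (x, t0)\<bar> powr p / norm h powr (p + DIM(real^'n) - 1)) * indicator (ball 0 a) h \<partial>lborel)
    * indicator (ball 0 (R - a)) x \<partial>lborel)
  \<le> ennreal C * Lpow_on (ball 0 R \<times> {bm<..<bp}) p (grad \<phi>)" using gagliardo_smooth[OF p a b e st] by blast
 show ?thesis
 proof (rule that)
  show "C * 2 powr p \<ge> 0" using C(1) by simp
  fix u :: "(real^'n) \<times> real => real" and f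
  assume u: "u \<in> hom_sobolev p (slab bm bp)" and t: "has_trace p bm bp t0 u f" and f: "f \<in> borel_measurable borel"
  let ?W = "weak_grad (slab bm bp) u"
  show "gagliardo a p f \<le> ennreal (C * 2 powr p) * Lpow_on (slab bm bp) p ?W"
  proof (rule gagliardo_exhaust[OF f a])
   fix R :: real assume R: "R > 0"
   let ?B = "lebesgue_on (ball (0::real^'n) R)" and ?Q = "lebesgue_on (ball (0::real^'n) R \<times> {bm<..<bp})"
   obtain \<phi> where \<phi>: "\<And>n::nat. Cinf (\<phi> n)"
    "(%n. Lpow ?Q p (%x. grad (\<phi> n) x - ?W x)) \<longlonglongrightarrow> 0" "(%n. Lpow ?B p (%y. \<phi> n (y, t0) - f y)) \<longlonglongrightarrow> 0"
    using t R unfolding has_trace_iff by blast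
   obtain r where r: "strict_mono r" "AE y in ?B. (%k. \<phi> (r k) (y, t0)) \<longlonglongrightarrow> f y" by (rule Lpow_AE_subseq[OF p0' _ _ \<phi>(3)])
     (auto intro: smooth_cyl_measurable[OF p b \<phi>(1)] borel_measurable_lebesgue_on f)
   have "AE y in lborel. y \<in> ball 0 R \<longrightarrow> (%k. \<phi> (r k) (y, t0)) \<longlonglongrightarrow> f y"
    using r(2) by (subst (asm) AE_restrict_space_iff) (use ball_lebesgue[of 0 R] in "auto simp: AE_completion_iff")
   from gagliardo_at_Fatou[OF p0' slice_measurable[OF \<phi>(1) p b] this]
   have "(\<integral>\<^sup>+x. gagliardo_at a p f x * indicator (ball 0 (R - a)) x \<partial>lborel)
    \<le> liminf (%k. \<integral>\<^sup>+x. gagliardo_at a p (%y. \<phi> (r k) (y, t0)) x * indicator (ball 0 (R - a)) x \<partial>lborel)" .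
   also have "\<dots> \<le> liminf (%k. ennreal (C * 2 powr p) * Lpow ?Q p (%x. grad (\<phi> (r k)) x - ?W x)
     + ennreal (C * 2 powr p) * Lpow_on (slab bm bp) p ?W)"
   proof (rule Liminf_mono, rule always_eventually, rule allI)
    fix k
    note m = sobolev_cyl_measurable(2)[OF p b u, of R] smooth_cyl_measurable(2)[OF p b \<phi>(1)]
    have "(\<integral>\<^sup>+x. gagliardo_at a p (%y. \<phi> (r k) (y, t0)) x * indicator (ball 0 (R - a)) x \<partial>lborel)
     \<le> ennreal C * Lpow ?Q p (%x. (grad (\<phi> (r k)) x - ?W x) + ?W x)"
     using C(2)[OF \<phi>(1), of "r k" R] by (simp add: gagliardo_at_def)
    also have "Lpow ?Q p (%x. (grad (\<phi> (r k)) x - ?W x) + ?W x)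
     \<le> ennreal (2 powr p) * (Lpow ?Q p (%x. grad (\<phi> (r k)) x - ?W x) + Lpow ?Q p ?W)"
     by (intro Lpow_add_le p0' borel_measurable_diff m)
    also have "Lpow ?Q p ?W \<le> Lpow_on (slab bm bp) p ?W"
     by (rule Lpow_subset[OF cyl_subset cyl_lebesgue slab_lebesgue])
    finally show "(\<integral>\<^sup>+x. gagliardo_at a p (%y. \<phi> (r k) (y, t0)) x * indicator (ball 0 (R - a)) x \<partial>lborel)
     \<le> ennreal (C * 2 powr p) * Lpow ?Q p (%x. grad (\<phi> (r k)) x - ?W x)
      + ennreal (C * 2 powr p) * Lpow_on (slab bm bp) p ?W"
     using C(1) by (simp add: ennreal_mult distrib_left mult.assoc add_mono mult_left_mono)
   qed
   also have "\<dots> = ennreal (C * 2 powr p) * Lpow_on (slab bm bp) p ?W"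
   proof (rule lim_imp_Liminf[OF sequentially_bot])
    have "(%k. ennreal (C * 2 powr p) * Lpow ?Q p (%x. grad (\<phi> (r k)) x - ?W x)) \<longlonglongrightarrow> 0"
     using LIMSEQ_subseq_LIMSEQ[OF \<phi>(2) r(1)] by (intro tendsto_cmult_zero_ennreal) (auto simp: o_def)
    from tendsto_add[OF this tendsto_const]
    show "(%k. ennreal (C * 2 powr p) * Lpow ?Q p (%x. grad (\<phi> (r k)) x - ?W x)
      + ennreal (C * 2 powr p) * Lpow_on (slab bm bp) p ?W) \<longlonglongrightarrow> ennreal (C * 2 powr p) * Lpow_on (slab bm bp) p ?W"
     by simp
   qed
   finally show "(\<integral>\<^sup>+x. gagliardo_at a p f x * indicator (ball 0 (R - a)) x \<partial>lborel) \<le> ennreal (C * 2 powr p) * Lpow_on (slab bm bp) p ?W" .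
  qed
 qed
qed

text \<open>The sequence of \<open>two_traces\<close> serves both faces at once, so the difference
  of the traces can be compared with vertical integrals of one gradient.\<close>

lemma trace_difference:
 fixes u :: "(real^'n) \<times> real => real"
 assumes u: "u \<in> hom_sobolev p (slab bm bp)" and tm: "has_trace p bm bp bm u fm" and tp: "has_trace p bm bp bp u fp"
  and f: "fm \<in> borel_measurable lebesgue" "fp \<in> borel_measurable lebesgue"
 shows "Lpow lebesgue p (%x. fp x - fm x) < \<infinity>"
proof -
 let ?W = "weak_grad (slab bm bp) u"
 let ?c = "ennreal (2 powr p)" and ?k = "ennreal ((bp - bm) powr (p - 1))"
 let ?w = "Lpow_on (slab bm bp) p ?W"
 have le: "Lpow_on (ball 0 R) p (%x. fp x - fm x) \<le> ?c * (?k * (?c * ?w))" if R: "R > 0" for R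
 proof -
  let ?B = "lebesgue_on (ball (0::real^'n) R)" and ?Q = "lebesgue_on (ball (0::real^'n) R \<times> {bm<..<bp})"
  obtain \<phi> where \<phi>: "\<And>n::nat. Cinf (\<phi> n)" "(%n. Lpow ?Q p (%x. grad (\<phi> n) x - ?W x)) \<longlonglongrightarrow> 0"
   "(%n. Lpow ?B p (%y. \<phi> n (y, bm) - fm y)) \<longlonglongrightarrow> 0" "(%n. Lpow ?B p (%y. \<phi> n (y, bp) - fp y)) \<longlonglongrightarrow> 0"
   and fB: "fm \<in> borel_measurable ?B" "fp \<in> borel_measurable ?B" by (rule two_traces[OF p b u _ tm tp R]) (use b in auto)
  define E where "E n = Lpow ?Q p (%x. grad (\<phi> n) x - ?W x)" for n
  define Tm where "Tm n = Lpow ?B p (%y. \<phi> n (y, bm) - fm y)" for n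
  define Tp where "Tp n = Lpow ?B p (%y. \<phi> n (y, bp) - fp y)" for n
  note m = sobolev_cyl_measurable(2)[OF p b u, of R] smooth_cyl_measurable[OF p b \<phi>(1)] fB
  have "Lpow ?B p (%x. fp x - fm x) \<le> ?c * (?k * (?c * E n) + ?c * (Tp n + Tm n)) + ?c * (?k * (?c * ?w))" for n
  proof -
   \<comment> \<open>The boundary values of \<open>\<phi> n\<close> are inserted on both
     faces.\<close>
   have "Lpow ?B p (%x. fp x - fm x)
    = Lpow ?B p (%x. (\<phi> n (x, bp) - \<phi> n (x, bm)) - ((\<phi> n (x, bp) - fp x) - (\<phi> n (x, bm) - fm x)))" by simp
   also have "\<dots> \<le> ?c * (Lpow ?B p (%x. \<phi> n (x, bp) - \<phi> n (x, bm)) + Lpow ?B p (%x. (\<phi> n (x, bp) - fp x) - (\<phi> n (x, bm) - fm x)))"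
    by (intro Lpow_diff_le p0' borel_measurable_diff m)
   also have "Lpow ?B p (%x. (\<phi> n (x, bp) - fp x) - (\<phi> n (x, bm) - fm x)) \<le> ?c * (Tp n + Tm n)"
    unfolding Tm_def Tp_def by (intro Lpow_diff_le p0' borel_measurable_diff m)
   also have "Lpow ?B p (%x. \<phi> n (x, bp) - \<phi> n (x, bm)) \<le> ?k * Lpow ?Q p (%x. (grad (\<phi> n) x - ?W x) + ?W x)"
    using slice_diff_le[OF \<phi>(1)[of n] p b, of bm bp R] b by simp
   also have "Lpow ?Q p (%x. (grad (\<phi> n) x - ?W x) + ?W x) \<le> ?c * (E n + Lpow ?Q p ?W)"
    unfolding E_def by (intro Lpow_add_le p0' borel_measurable_diff m)
   also have "Lpow ?Q p ?W \<le> ?w" by (rule Lpow_subset[OF cyl_subset cyl_lebesgue slab_lebesgue])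
   finally show ?thesis by (simp add: distrib_left add_ac add_mono mult_left_mono)
  qed
  moreover have "(%n. ?c * (?k * (?c * E n) + ?c * (Tp n + Tm n))) \<longlonglongrightarrow> 0"
   using \<phi>(2-4) unfolding E_def[symmetric] Tm_def[symmetric] Tp_def[symmetric]
   by (intro tendsto_cmult_zero_ennreal tendsto_add_zero_ennreal) auto
  ultimately show ?thesis by (rule ennreal_le_of_tendsto_0)
 qed
 have "Lpow_on UNIV p (%x. fp x - fm x) \<le> ?c * (?k * (?c * ?w))"
 proof (rule Lpow_exhaust_le[where A = "%n. ball 0 (real (Suc n))"])
  show "(%x. fp x - fm x) \<in> borel_measurable (lebesgue_on UNIV)" using f by simp
  show "(\<Union>n. ball 0 (real (Suc n))) = (UNIV :: (real^'n) set)"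
  proof (intro equalityI subsetI)
   fix x :: "real^'n"
   obtain n where "norm x < real n" using reals_Archimedean2 by blast
   then have "x \<in> ball 0 (real (Suc n))" by simp
   then show "x \<in> (\<Union>n. ball 0 (real (Suc n)))" by blast
  qed simp
  show "incseq (%n. ball (0::real^'n) (real (Suc n)))" by (intro incseq_SucI subset_ball) simp
 qed (use le in "auto intro: ball_lebesgue")
 also have "\<dots> < \<infinity>" using hom_sobolevD(4)[OF slab_open p u] by (simp add: ennreal_mult_less_top)
 finally show ?thesis by (simp add: lebesgue_on_UNIV_eq)
qed

end

subsection \<open>The Dirichlet problem\<close>

lemma borel_version:
 fixes f :: "'a::euclidean_space => real"
 assumes "L1loc_on UNIV f"
 obtains f' where "f' \<in> borel_measurable borel" "AE x in lborel. f x = f' x" "L1loc_on UNIV f'"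
proof -
 have f: "f \<in> borel_measurable lebesgue" using L1loc_measurable[OF open_UNIV assms] by (simp add: lebesgue_on_UNIV_eq)
 then obtain f' where f': "f' \<in> borel_measurable lborel" "AE x in lborel. f x = f' x"
  using completion_ex_borel_measurable_real by blast
 have m: "f' \<in> borel_measurable lebesgue" using f'(1) by (rule measurable_completion)
 have "L1loc_on UNIV f'" unfolding L1loc_on_def
 proof (intro allI impI)
  fix K :: "'a set" assume K: "compact K \<and> K \<subseteq> UNIV"
  have Km: "K \<in> sets lebesgue"
   by (intro sets_completionI_sets) (simp add: borel_closed[OF compact_imp_closed[OF conjunct1[OF K]]])
  have "integrable lebesgue (%x. indicator K x *\<^sub>R f x)" using assms K by (simp add: L1loc_on_def set_integrable_def)
  moreover have "AE x in lebesgue. indicator K x *\<^sub>R f x = indicator K x *\<^sub>R f' x"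
   using AE_completion[OF f'(2)] by eventually_elim simp
  ultimately show "f' absolutely_integrable_on K" unfolding set_integrable_def using f m Km
   by (subst (asm) integrable_cong_AE) (auto intro!: borel_measurable_scaleR borel_measurable_indicator)
 qed
 with f' show ?thesis by (intro that) auto
qed

text \<open>For almost every \<open>x\<close> the two functions agree at \<open>x\<close> and, by
  translation invariance of null sets, at \<open>x + h\<close> for almost every
  \<open>h\<close>.\<close>

lemma tilde_seminorm_eq:
 fixes f f' :: "real^'n => real"
 assumes AE: "AE x in lborel. f x = f' x"
 shows "tilde_seminorm a p f = ennreal_powr (gagliardo a p f') (1 / p)"
proof -
 \<comment> \<open>The dimension of the product space exceeds that of its first factor by 1.\<close>
 have e: "p + real DIM((real^'n) \<times> real) - 2 = p + real DIM(real^'n) - 1" by simp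
 have "(\<integral>\<^sup>+x. (\<integral>\<^sup>+h\<in>ball 0 a. ennreal (\<bar>f (x + h) - f x\<bar> powr p /
       norm h powr (p + real DIM((real^'n) \<times> real) - 2)) \<partial>lebesgue) \<partial>lebesgue) = gagliardo a p f'"
  unfolding gagliardo_def nn_integral_completion e
 proof (rule nn_integral_cong_AE, use AE in eventually_elim)
  case (elim x)
  show ?case by (rule nn_integral_cong_AE) (use AE_lborel_translate[OF AE, of x] elim in "auto elim: eventually_mono")
 qed
 then show ?thesis by (simp only: tilde_seminorm_def)
qed

lemma ennreal_powr_powr: "p > 0 ==> ennreal_powr (ennreal_powr x (1 / p)) p = x"
 by (cases x) (auto simp: ennreal_powr_def powr_powr)

lemma ennreal_powr_finite: "ennreal_powr x r < \<infinity> \<longleftrightarrow> x < \<infinity>" by (auto simp: ennreal_powr_def less_top)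

theorem theorem1p10:
  fixes a p q bm bp :: real
  assumes "bm < bp" and "0 < a" and "1 < p" and "1 / p + 1 / q = 1"
  shows "\<exists>c>0. \<forall>(g :: (real^'n) \<times> real \<Rightarrow> (real^'n) \<times> real)
      (fm :: real^'n \<Rightarrow> real) (fp :: real^'n \<Rightarrow> real).
    Lp_on q (strip bm bp) g \<and> L1loc_on UNIV fm \<and> L1loc_on UNIV fp \<longrightarrow>
      ((\<exists>u. dirichlet_solution p bm bp g fm fp u) \<longleftrightarrow>
         (\<integral>\<^sup>+x. ennreal (\<bar>fp x - fm x\<bar> powr p) \<partial>lebesgue) < \<infinity> \<and>
         tilde_seminorm a p fm < \<infinity> \<and> tilde_seminorm a p fp < \<infinity>) \<and>
      (\<forall>u. dirichlet_solution p bm bp g fm fp u \<longrightarrow>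
         (\<integral>\<^sup>+x\<in>strip bm bp. ennreal (norm (weak_grad (strip bm bp) u x) powr p) \<partial>lebesgue)
           \<le> ennreal c * (\<integral>\<^sup>+x\<in>strip bm bp. ennreal (norm (g x) powr q) \<partial>lebesgue)
             + ennreal c * (\<integral>\<^sup>+x. ennreal (\<bar>fp x - fm x\<bar> powr p) \<partial>lebesgue)
             + ennreal c * ennreal_powr (tilde_seminorm a p fm) p
             + ennreal c * ennreal_powr (tilde_seminorm a p fp) p)"
proof -
 note b = assms(1) and a = assms(2) and p = assms(3) and pq = assms(4)
 let ?M = "lebesgue_on (slab bm bp) :: ((real^'n) \<times> real) measure"
 let ?W = "weak_grad (slab bm bp) :: ((real^'n) \<times> real => real) => _"
 let ?H = "hom_sobolev p (slab bm bp) :: ((real^'n) \<times> real => real) set"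
 obtain Cx where Cx: "Cx \<ge> 0" and ext: "\<And>fm fp :: real^'n => real. fm \<in> borel_measurable borel ==> fp \<in> borel_measurable borel ==>
   L1loc_on UNIV fm ==> L1loc_on UNIV fp ==> gagliardo a p fm < \<infinity> ==> gagliardo a p fp < \<infinity> ==>
   Lpow lborel p (%x. fp x - fm x) < \<infinity> ==>
   \<exists>w. w \<in> ?H \<and> has_trace p bm bp bm w fm \<and> has_trace p bm bp bp w fp \<and>
    Lpow ?M p (?W w) \<le> ennreal Cx * (Lpow lborel p (%x. fp x - fm x) + gagliardo a p fm + gagliardo a p fp)"
  by (rule extension_sobolev[OF b a p]) blast
 obtain Cf where Cf: "Cf > 0" and est: "\<And>(g :: (real^'n) \<times> real => (real^'n) \<times> real) fm fp u w.
  g \<in> borel_measurable ?M ==> Lpow ?M q g < \<infinity> ==> dirichlet_solution p bm bp g fm fp u ==>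
  w \<in> ?H ==> has_trace p bm bp bm w fm ==> has_trace p bm bp bp w fp ==>
  Lpow ?M p (?W u) \<le> ennreal Cf * Lpow ?M q g + ennreal Cf * Lpow ?M p (?W w)" by (rule dirichlet_estimate[OF p pq b]) blast
 \<comment> \<open>The strip lies above its lower face and below its upper one, hence the inward
   directions 1 at \<open>bm\<close> and -1 at \<open>bp\<close>.\<close>
 obtain Km where Km: "\<And>(u :: (real^'n) \<times> real => real) f. u \<in> ?H ==> has_trace p bm bp bm u f ==>
  f \<in> borel_measurable borel ==> gagliardo a p f \<le> ennreal Km * Lpow ?M p (?W u)"
  by (rule trace_gagliardo[OF p b a, of 1 bm]) auto
 obtain Kp where Kp: "\<And>(u :: (real^'n) \<times> real => real) f. u \<in> ?H ==> has_trace p bm bp bp u f ==>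
  f \<in> borel_measurable borel ==> gagliardo a p f \<le> ennreal Kp * Lpow ?M p (?W u)"
  by (rule trace_gagliardo[OF p b a, of "-1" bp]) auto
 \<comment> \<open>The first summand serves the term with \<open>g\<close>, the product the terms
   with the data, which pass through the extension.\<close>
 define c where "c = Cf + Cf * Cx"
 have c: "c > 0" "Cf \<le> c" "Cf * Cx \<le> c" using Cf Cx by (auto simp: c_def add_pos_nonneg)
 show ?thesis
 proof (intro exI[of _ c] conjI c(1) allI impI)
  fix g :: "(real^'n) \<times> real => (real^'n) \<times> real" and fm fp :: "real^'n => real"
  assume hyp: "Lp_on q (strip bm bp) g \<and> L1loc_on UNIV fm \<and> L1loc_on UNIV fp"
  have g: "g \<in> borel_measurable ?M" "Lpow ?M q g < \<infinity>"
   using hyp by (auto simp: Lp_on_def strip_eq_slab Lpow_lebesgue_on[OF slab_lebesgue])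
  have fL: "fm \<in> borel_measurable lebesgue" "fp \<in> borel_measurable lebesgue"
   using hyp L1loc_measurable[OF open_UNIV] by (auto simp: lebesgue_on_UNIV_eq)
  obtain fm' where fm': "fm' \<in> borel_measurable borel" "AE x in lborel. fm x = fm' x" "L1loc_on UNIV fm'"
   using borel_version hyp by blast
  obtain fp' where fp': "fp' \<in> borel_measurable borel" "AE x in lborel. fp x = fp' x" "L1loc_on UNIV fp'"
   using borel_version hyp by blast
  have AEm: "AE x in lebesgue. fm x = fm' x" "AE x in lebesgue. fm' x = fm x"
   using AE_completion[OF fm'(2)] by (auto elim: eventually_mono)
  have AEp: "AE x in lebesgue. fp x = fp' x" "AE x in lebesgue. fp' x = fp x"
   using AE_completion[OF fp'(2)] by (auto elim: eventually_mono)
  have f'L: "fm' \<in> borel_measurable lebesgue" "fp' \<in> borel_measurable lebesgue"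
   using fm'(1) fp'(1) by (auto intro: measurable_completion)
  let ?D = "Lpow lborel p (%x. fp' x - fm' x)"
  have D: "Lpow lebesgue p (%x. fp x - fm x) = ?D"
  proof -
   have "Lpow lebesgue p (%x. fp x - fm x) = Lpow lebesgue p (%x. fp' x - fm' x)"
    by (rule Lpow_cong_AE) (use AEm(1) AEp(1) in eventually_elim, simp)
   then show ?thesis by (simp add: Lpow_def nn_integral_completion)
  qed
  have Dint: "(\<integral>\<^sup>+x. ennreal (\<bar>fp x - fm x\<bar> powr p) \<partial>lebesgue) = ?D" using D by (simp add: Lpow_def)
  have S: "tilde_seminorm a p fm < \<infinity> \<longleftrightarrow> gagliardo a p fm' < \<infinity>" "tilde_seminorm a p fp < \<infinity> \<longleftrightarrow> gagliardo a p fp' < \<infinity>"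
   by (simp_all only: tilde_seminorm_eq[OF fm'(2)] tilde_seminorm_eq[OF fp'(2)] ennreal_powr_finite)
  have Sp: "ennreal_powr (tilde_seminorm a p fm) p = gagliardo a p fm'" "ennreal_powr (tilde_seminorm a p fp) p = gagliardo a p fp'"
   using p by (simp_all add: tilde_seminorm_eq[OF fm'(2)] tilde_seminorm_eq[OF fp'(2)] ennreal_powr_powr)
  \<comment> \<open>The extension is built from the Borel versions; its traces are carried back to
    \<open>fm\<close> and \<open>fp\<close>, which agree with them almost everywhere.\<close>
  have lift: "\<exists>w. w \<in> ?H \<and> has_trace p bm bp bm w fm \<and> has_trace p bm bp bp w fp \<and>
    Lpow ?M p (?W w) \<le> ennreal Cx * (?D + gagliardo a p fm' + gagliardo a p fp')"
   if "?D < \<infinity>" "gagliardo a p fm' < \<infinity>" "gagliardo a p fp' < \<infinity>" using ext[OF fm'(1) fp'(1) fm'(3) fp'(3) that(2,3,1)]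
    has_trace_cong_AE[OF p b _ fL(1) AEm(2)] has_trace_cong_AE[OF p b _ fL(2) AEp(2)] by blast
  \<comment> \<open>Besides one half of the equivalence, this finiteness makes the extension
    available when the estimate for a given solution is proved.\<close>
  have nec: "?D < \<infinity> \<and> gagliardo a p fm' < \<infinity> \<and> gagliardo a p fp' < \<infinity>" if sol: "dirichlet_solution p bm bp g fm fp u" for u
  proof -
   have u: "u \<in> ?H" "has_trace p bm bp bm u fm" "has_trace p bm bp bp u fp" using sol by (auto simp: dirichlet_solution_iff)
   have fin: "ennreal K * Lpow ?M p (?W u) < \<infinity>" for K
    using hom_sobolevD(4)[OF slab_open p u(1)] by (simp add: ennreal_mult_less_top)
   have "gagliardo a p fm' < \<infinity>" by (rule le_less_trans[OF Km[OF u(1) has_trace_cong_AE[OF p b u(2) f'L(1) AEm(1)] fm'(1)] fin])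
   moreover have "gagliardo a p fp' < \<infinity>"
    by (rule le_less_trans[OF Kp[OF u(1) has_trace_cong_AE[OF p b u(3) f'L(2) AEp(1)] fp'(1)] fin])
   ultimately show ?thesis using trace_difference[OF p b u fL] D by simp
  qed
  show "(\<exists>u. dirichlet_solution p bm bp g fm fp u) \<longleftrightarrow>
     (\<integral>\<^sup>+x. ennreal (\<bar>fp x - fm x\<bar> powr p) \<partial>lebesgue) < \<infinity> \<and>
     tilde_seminorm a p fm < \<infinity> \<and> tilde_seminorm a p fp < \<infinity>" unfolding Dint S
  proof
   assume "\<exists>u. dirichlet_solution p bm bp g fm fp u"
   then show "?D < \<infinity> \<and> gagliardo a p fm' < \<infinity> \<and> gagliardo a p fp' < \<infinity>" using nec by blast
  next
   assume "?D < \<infinity> \<and> gagliardo a p fm' < \<infinity> \<and> gagliardo a p fp' < \<infinity>"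
   then obtain w where w: "w \<in> ?H" "has_trace p bm bp bm w fm" "has_trace p bm bp bp w fp" using lift by blast
   obtain u where "dirichlet_solution p bm bp g fm fp u" by (rule dirichlet_existence[OF p pq b g w])
   then show "\<exists>u. dirichlet_solution p bm bp g fm fp u" by blast
  qed
  fix u assume sol: "dirichlet_solution p bm bp g fm fp u"
  from nec[OF this] obtain w where w: "w \<in> ?H" "has_trace p bm bp bm w fm" "has_trace p bm bp bp w fp"
   and wle: "Lpow ?M p (?W w) \<le> ennreal Cx * (?D + gagliardo a p fm' + gagliardo a p fp')" using lift by blast
  have "Lpow ?M p (?W u) \<le> ennreal Cf * Lpow ?M q g + ennreal Cf * Lpow ?M p (?W w)" by (rule est[OF g sol w])
  also have "ennreal Cf * Lpow ?M p (?W w) \<le> ennreal Cf * (ennreal Cx * (?D + gagliardo a p fm' + gagliardo a p fp'))"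
   by (rule mult_left_mono[OF wle]) simp
  also have "\<dots> = ennreal (Cf * Cx) * (?D + gagliardo a p fm' + gagliardo a p fp')"
   using Cf Cx by (simp add: ennreal_mult mult.assoc)
  also have "\<dots> \<le> ennreal c * (?D + gagliardo a p fm' + gagliardo a p fp')" using c by (intro mult_right_mono ennreal_leI) auto
  also have "ennreal Cf * Lpow ?M q g \<le> ennreal c * Lpow ?M q g" using c by (intro mult_right_mono ennreal_leI) auto
  finally have "Lpow ?M p (?W u) \<le> ennreal c * Lpow ?M q g + ennreal c * (?D + gagliardo a p fm' + gagliardo a p fp')"
   by (auto intro: add_mono)
  then show "(\<integral>\<^sup>+x\<in>strip bm bp. ennreal (norm (weak_grad (strip bm bp) u x) powr p) \<partial>lebesgue)
      \<le> ennreal c * (\<integral>\<^sup>+x\<in>strip bm bp. ennreal (norm (g x) powr q) \<partial>lebesgue)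
       + ennreal c * (\<integral>\<^sup>+x. ennreal (\<bar>fp x - fm x\<bar> powr p) \<partial>lebesgue)
       + ennreal c * ennreal_powr (tilde_seminorm a p fm) p
       + ennreal c * ennreal_powr (tilde_seminorm a p fp) p"
   unfolding Dint Sp strip_eq_slab Lpow_lebesgue_on[OF slab_lebesgue, symmetric] by (simp add: distrib_left add.assoc)
 qed
qed

end
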